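(* Fix $\theta>0$. For each $n$ it is possible to construct a random vector $C^{(n)}=(c^{(n)}_1,c^{(n)}_2,\ldots)$ distributed as the cycle counts of an ESF$(\theta)$ permutation of $[n]$, together with a standard Brownian motion $W$, on the same probability space, in such a way that \[\mathbb{E}\left\{\sup_{0\le t\le 1}\left|W_n(t)-W(t^3)\right|\right\}=O\!\left(\frac{\log\log n}{\sqrt{\log n}}\right),\] where \[W_n(t)=\frac{\log\mathsf{invol}_{\lfloor n^t\rfloor}(C^{(n)})-\frac{\theta t^2}{2}\log^2 n}{\sqrt{\frac{\theta}{3}\log^3 n}}.\]
   Context: For a sequence $a=(a_1,a_2,\ldots)$ of nonnegative integers and $m\ge1$, define $\mathsf{B}_m(a)=\prod_{k=1}^m k^{a_k}$ and \[\mathsf{invol}_m(a)=\mathsf{B}_m(a)\prod_{k=1}^m\sum_{j=0}^{\lfloor a_k/2\rfloor}\frac{(a_k)_{2j}}{(2k)^j j!},\] where $(x)_r=x(x-1)\cdots(x-r+1)$. ESF$(\theta)$ is the Ewens measure on $\mathfrak{S}_n$, $\mathbb{P}(\sigma=\sigma_0)=\theta^{K(\sigma_0)}/\theta^{(n)}$ with $K$ the number of cycles and $\theta^{(n)}=\theta(\theta+1)\cdots(\theta+n-1)$; its cycle counts are $c_k$ = number of cycles of length $k$ (with $c_k=0$ for $k>n$). *)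

theory Defs
  imports "HOL-Probability.Probability" "HOL-Combinatorics.Combinatorics"
begin

definition falling :: "nat \<Rightarrow> nat \<Rightarrow> real" where
  "falling x r = (\<Prod>i<r. (real x - real i))"

definition B_m :: "nat \<Rightarrow> (nat \<Rightarrow> nat) \<Rightarrow> real" where
  "B_m m a = (\<Prod>k=1..m. real k ^ a k)"

definition invol :: "nat \<Rightarrow> (nat \<Rightarrow> nat) \<Rightarrow> real" where
  "invol m a = B_m m a *
     (\<Prod>k=1..m. \<Sum>j=0..a k div 2. falling (a k) (2*j) / ((2 * real k) ^ j * fact j))"

definition perm_cycles :: "nat \<Rightarrow> (nat \<Rightarrow> nat) \<Rightarrow> nat set set" where
  "perm_cycles n \<sigma> = (\<lambda>x. orbit \<sigma> x) ` {1..n}"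

definition num_cycles :: "nat \<Rightarrow> (nat \<Rightarrow> nat) \<Rightarrow> nat" where
  "num_cycles n \<sigma> = card (perm_cycles n \<sigma>)"

(* c_k = number of cycles of length k (0 for k > n, and for k = 0) *)
definition cycle_count :: "nat \<Rightarrow> (nat \<Rightarrow> nat) \<Rightarrow> nat \<Rightarrow> nat" where
  "cycle_count n \<sigma> k = card {c \<in> perm_cycles n \<sigma>. card c = k}"

definition esf_weight :: "real \<Rightarrow> nat \<Rightarrow> (nat \<Rightarrow> nat) \<Rightarrow> real" where
  "esf_weight \<theta> n \<sigma> = \<theta> ^ num_cycles n \<sigma> / pochhammer \<theta> n"

definition esf_cycle_counts :: "'a measure \<Rightarrow> real \<Rightarrow> nat \<Rightarrow> ('a \<Rightarrow> nat \<Rightarrow> nat) \<Rightarrow> bool" where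
  "esf_cycle_counts M \<theta> n C \<longleftrightarrow>
     C \<in> measurable M (count_space UNIV) \<and>
     (\<forall>v. measure M {\<omega> \<in> space M. C \<omega> = v} =
            (\<Sum>\<sigma> \<in> {\<sigma>. \<sigma> permutes {1..n} \<and> cycle_count n \<sigma> = v}. esf_weight \<theta> n \<sigma>))"

definition std_brownian_motion :: "'a measure \<Rightarrow> ('a \<Rightarrow> real \<Rightarrow> real) \<Rightarrow> bool" where
  "std_brownian_motion M W \<longleftrightarrow>
     (\<forall>t\<ge>0. (\<lambda>\<omega>. W \<omega> t) \<in> borel_measurable M) \<and>
     (AE \<omega> in M. W \<omega> 0 = 0) \<and>
     (AE \<omega> in M. continuous_on {0..} (W \<omega>)) \<and>
     (\<forall>s t. 0 \<le> s \<and> s < t \<longrightarrow>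
        distributed M lborel (\<lambda>\<omega>. W \<omega> t - W \<omega> s)
          (\<lambda>x. ennreal (normal_density 0 (sqrt (t - s)) x))) \<and>
     (\<forall>ts :: real list. sorted_wrt (<) ts \<and> (\<forall>t\<in>set ts. 0 \<le> t) \<longrightarrow>
        prob_space.indep_vars M (\<lambda>_. borel)
          (\<lambda>i \<omega>. W \<omega> (ts ! Suc i) - W \<omega> (ts ! i)) {..<length ts - 1})"

definition Wn :: "real \<Rightarrow> nat \<Rightarrow> (nat \<Rightarrow> nat) \<Rightarrow> real \<Rightarrow> real" where
  "Wn \<theta> n c t =
     (ln (invol (nat \<lfloor>real n powr t\<rfloor>) c) - \<theta> * t^2 / 2 * (ln (real n))^2)
       / sqrt (\<theta> / 3 * (ln (real n))^3)"

end

(* The cycle counts are coupled with independent Poisson variables Z_k of mean about theta/k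
   (Feller coupling stopped at a negative binomial time), at bounded expected L1 distance. The
   Z_k are the row sums of a Poisson process whose unit cells N_j are coupled with a Brownian
   motion by the dyadic quantile construction, the partial sums up to 2^r differing by O(r) in
   mean. The Z_k with k <= n^t fill about theta t log n unit cells, so summation by parts turns
   sum Z_k log k into sum (j / theta) N_j up to O(log n * log log n), and the normalised
   increments of W over the grid (j / (theta log n))^3 turn that sum into W(t^3). *)
theory Submission
  imports Defs
begin

section \<open>The quantile coupling of symmetric binomial and normal variables\<close>

text \<open>The rate is an error of order log n * log log n over a normalisation of order (log
  n)^(3/2). Only about theta * log n unit cells matter, and log log n is the logarithm of their
  number; so the strong approximation must be logarithmic in the number of cells. That precision
  comes from Tusnady's inequality at each node of a dyadic tree: the quantile coupling of a binomial
  count with a normal z errs by O(1 + z^2). The error of a partial sum collects along a single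
  root-to-leaf path, hence is controlled by a sum of R squared normals, and an exponential moment
  bounds its maximum over all 2^R paths by O(R) in mean. The depth is R = 2r although only 2^r cells
  are used: this keeps the share of the error at the root bounded. The clock t^3 appears because the
  weights j / theta have squares summing to about K^3 / (3 theta^2), which for K = theta t log n is
  theta t^3 log^3 n / 3. The involution factors cost only O(log n): their logarithm is Lipschitz in
  the cycle count with constant of order log n, and for the Poisson counts it is at most Z (Z - 1) /
  k. All pieces live on separate spaces, glued along discrete variables of equal law.\<close>

definition Phi :: "real => real" where
 "Phi x = measure std_normal_distribution {..x}"

lemma real_distribution_std_normal: "real_distribution std_normal_distribution"
 by (simp add: real_distribution_def real_distribution_axioms_def prob_space_normal_density)

lemma Phi_mono: "x <= y ==> Phi x <= Phi y"
proof -
 interpret real_distribution std_normal_distribution by (rule real_distribution_std_normal)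
 show "x <= y ==> Phi x <= Phi y" unfolding Phi_def by (rule finite_measure_mono) auto
qed

lemma Phi_diff:
 assumes "a <= b"
 shows "Phi b - Phi a = integral {a..b} std_normal_density"
proof -
 interpret real_distribution std_normal_distribution by (rule real_distribution_std_normal)
 have "Phi b = Phi a + measure std_normal_distribution {a<..b}"
  unfolding Phi_def using assms
  by (subst finite_measure_Union[symmetric]) (auto intro!: arg_cong[where f="measure _"])
 moreover have "measure std_normal_distribution {a<..b} = measure std_normal_distribution {a..b}"
 proof -
  have "emeasure std_normal_distribution {a} = 0"
   by (subst emeasure_density) (auto intro!: nn_integral_zero' AE_I'[of "{a}"])
  then have "measure std_normal_distribution {a} = 0" by (simp add: measure_def)
  moreover have "measure std_normal_distribution ({a} \<union> {a<..b})
    = measure std_normal_distribution {a} + measure std_normal_distribution {a<..b}"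
   by (rule finite_measure_Union) auto
  moreover have "{a} \<union> {a<..b} = {a..b}" using assms by auto
  ultimately show ?thesis by simp
 qed
 moreover have "measure std_normal_distribution {a..b} = integral {a..b} std_normal_density"
 proof -
  have i: "set_integrable lborel {a..b} std_normal_density"
   unfolding set_integrable_def
   by (rule integrable_mult_indicator) auto
  have "emeasure std_normal_distribution {a..b} = (\<integral>\<^sup>+x. ennreal (indicator {a..b} x * std_normal_density x) \<partial>lborel)"
   by (subst emeasure_density) (auto intro!: nn_integral_cong split: split_indicator)
  also have "\<dots> = ennreal (LINT x|lborel. indicator {a..b} x * std_normal_density x)"
   using i by (intro nn_integral_eq_integral) (auto simp: set_integrable_def)
  finally have "measure std_normal_distribution {a..b} = (LINT x:{a..b}|lborel. std_normal_density x)"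
   by (simp add: measure_def set_lebesgue_integral_def integral_nonneg_AE)
  also have "\<dots> = integral {a..b} std_normal_density"
   by (rule set_borel_integral_eq_integral(2)[OF i])
  finally show ?thesis .
 qed
 ultimately show ?thesis by simp
qed

lemma DERIV_Phi: "DERIV Phi x :> std_normal_density x"
proof -
 have "((\<lambda>u. integral {x-1..u} std_normal_density) has_real_derivative std_normal_density x)
  (at x within {x-1..x+1})"
  by (rule integral_has_real_derivative)
   (auto intro!: continuous_intros simp: normal_density_def)
 then have "((\<lambda>u. integral {x-1..u} std_normal_density) has_real_derivative std_normal_density x) (at x)"
  by (subst (asm) at_within_Icc_at) auto
 then have *: "((\<lambda>u. Phi (x-1) + integral {x-1..u} std_normal_density)
   has_real_derivative std_normal_density x) (at x)"
  by (auto intro!: derivative_eq_intros)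
 show ?thesis
  by (rule has_field_derivative_transform_within_open[OF *, of "{x-1<..<x+1}"])
   (auto simp: Phi_diff[of "x-1", symmetric])
qed

lemma isCont_Phi: "isCont Phi x"
 using DERIV_Phi by (rule DERIV_isCont)

lemma Phi_strict_mono: "x < y ==> Phi x < Phi y"
 by (rule DERIV_pos_imp_increasing) (use DERIV_Phi normal_density_pos in \<open>auto intro!: exI\<close>)

lemma std_normal_density_minus: "std_normal_density (- x) = std_normal_density x"
 by (simp add: normal_density_def)

lemma Phi_minus: "Phi (- x) = 1 - Phi x"
proof -
 interpret real_distribution std_normal_distribution by (rule real_distribution_std_normal)
 have d: "DERIV (\<lambda>x. Phi (-x) + Phi x) x :> 0" for x
  by (auto intro!: derivative_eq_intros DERIV_chain'[of uminus _ _ _ Phi] DERIV_Phi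
    simp: std_normal_density_minus)
 have c: "Phi (-x) + Phi x = Phi (-y) + Phi y" for x y
  by (metis DERIV_const_ratio_const2 DERIV_isconst_all d)
 have t: "((\<lambda>x. Phi x) \<longlongrightarrow> 1) at_top" "((\<lambda>x. Phi x) \<longlongrightarrow> 0) at_bot"
  using cdf_lim_at_top_prob cdf_lim_at_bot unfolding cdf_def Phi_def by auto
 have "((\<lambda>y. Phi (-y) + Phi y) \<longlongrightarrow> 0 + 1) at_top"
  by (intro tendsto_add t filterlim_compose[OF t(2)] filterlim_uminus_at_bot_at_top)
 moreover have "((\<lambda>y. Phi (-y) + Phi y) \<longlongrightarrow> Phi (-x) + Phi x) at_top"
  by (subst c[of _ x]) auto
 ultimately have "Phi (-x) + Phi x = 0 + 1" using tendsto_unique by (metis trivial_limit_at_top_linorder)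
 then show ?thesis by simp
qed

lemma Phi_0: "Phi 0 = 1/2" using Phi_minus[of 0] by simp

lemma Phi_bounds: "0 < Phi x" "Phi x < 1"
proof -
 interpret real_distribution std_normal_distribution by (rule real_distribution_std_normal)
 have "0 <= Phi (x - 1)" by (simp add: Phi_def)
 also have "\<dots> < Phi x" by (rule Phi_strict_mono) simp
 finally show "0 < Phi x" .
 have "Phi x < Phi (x + 1)" by (rule Phi_strict_mono) simp
 also have "\<dots> <= 1" by (simp add: Phi_def)
 finally show "Phi x < 1" .
qed

lemma Phi_onto:
 assumes "0 < u" "u < 1"
 obtains x where "Phi x = u"
proof -
 interpret real_distribution std_normal_distribution by (rule real_distribution_std_normal)
 have t: "((\<lambda>x. Phi x) \<longlongrightarrow> 1) at_top" "((\<lambda>x. Phi x) \<longlongrightarrow> 0) at_bot"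
  using cdf_lim_at_top_prob cdf_lim_at_bot unfolding cdf_def Phi_def by auto
 obtain b where b: "u < Phi b"
  using order_tendstoD(1)[OF t(1) assms(2)] by (auto simp: eventually_at_top_linorder)
 obtain a where a: "Phi a < u"
  using order_tendstoD(2)[OF t(2) assms(1)] by (auto simp: eventually_at_bot_linorder)
 have "a <= b" using a b Phi_mono[of b a] by (cases "a <= b") auto
 then obtain x where "Phi x = u"
  using IVT[of Phi a u b] a b isCont_Phi by force
 then show ?thesis by (rule that)
qed

lemma measure_Phi_le:
 assumes "0 <= u" "u <= 1"
 shows "measure std_normal_distribution {z. Phi z <= u} = u"
proof -
 interpret real_distribution std_normal_distribution by (rule real_distribution_std_normal)
 consider "u = 0" | "u = 1" | "0 < u" "u < 1" using assms by linarith
 then show ?thesis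
 proof cases
  case 1
  then have "{z. Phi z <= u} = {}" using Phi_bounds(1) by (auto simp: not_le)
  then show ?thesis using 1 by simp
 next
  case 2
  then have "{z. Phi z <= u} = UNIV" using Phi_bounds(2) less_imp_le by auto
  then show ?thesis using 2 prob_space by simp
 next
  case 3
  then obtain x where x: "Phi x = u" by (rule Phi_onto)
  have "Phi z <= Phi x \<longleftrightarrow> z <= x" for z
   using Phi_strict_mono[of x z] Phi_mono[of z x] by (cases "z <= x") auto
  then have "{z. Phi z <= u} = {..x}" using x by auto
  then show ?thesis using x by (simp add: Phi_def)
 qed
qed

text \<open>Up to x = 1 the number 1/2 separates the two sides. Beyond 1 the density is at most x
  exp(-x^2/2), so the difference of the two sides increases towards its limit 0 and is never
  positive.\<close>

lemma Phi_upper_tail: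
 assumes "0 <= x" shows "1 - Phi x <= exp (- x\<^sup>2 / 2)"
proof -
 have le: "std_normal_density y <= exp (- y\<^sup>2/2)" for y
 proof -
  have "1 / sqrt (2*pi) <= 1" using pi_ge_two by (simp add: real_le_rsqrt)
  then have "1 / sqrt (2*pi) * exp (- y\<^sup>2/2) <= 1 * exp (- y\<^sup>2/2)"
   by (intro mult_right_mono) auto
  then show ?thesis by (simp add: normal_density_def)
 qed
 have "1 - Phi x - exp (- x\<^sup>2 / 2) <= 0"
 proof (cases "x <= 1")
  case True
  have "1 - Phi x <= 1/2" using Phi_mono[of 0 x] Phi_0 assms by simp
  moreover have "1/2 <= exp (- x\<^sup>2 / 2)"
  proof -
   have "x\<^sup>2 <= 1" using True assms by (simp add: power_le_one)
   then have "1 - 1/2 <= 1 + (- x\<^sup>2/2)" by simp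
   also have "\<dots> <= exp (- x\<^sup>2 / 2)" by (rule exp_ge_add_one_self)
   finally show ?thesis by simp
  qed
  ultimately show ?thesis by simp
 next
  case False
  let ?g = "\<lambda>y. 1 - Phi y - exp (- y\<^sup>2 / 2)"
  have t: "(Phi \<longlongrightarrow> 1) at_top"
  proof -
   interpret real_distribution std_normal_distribution by (rule real_distribution_std_normal)
   show ?thesis using cdf_lim_at_top_prob unfolding cdf_def Phi_def by auto
  qed
  have "?g x <= ?g y" if "x <= y" for y
  proof (rule DERIV_nonneg_imp_nondecreasing[OF that], goal_cases)
   case (1 u)
   have "DERIV ?g u :> - std_normal_density u - (exp (- u\<^sup>2/2) * (- u))"
    by (auto intro!: derivative_eq_intros DERIV_Phi)
   moreover from 1 have "1 * exp (- u\<^sup>2/2) <= u * exp (- u\<^sup>2/2)"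
    using False 1 by (intro mult_right_mono) auto
   then have "std_normal_density u <= u * exp (- u\<^sup>2/2)" using le[of u] by linarith
   ultimately show ?case by (intro exI conjI) (assumption, simp add: mult.commute)
  qed
  moreover have "(?g \<longlongrightarrow> 1 - 1 - 0) at_top"
  proof (intro tendsto_diff t tendsto_const)
   show "((\<lambda>y::real. exp (- y\<^sup>2 / 2)) \<longlongrightarrow> 0) at_top" by real_asymp
  qed
  ultimately show ?thesis
   using tendsto_lowerbound[of ?g 0 at_top "?g x"] eventually_ge_at_top[of x]
   by (auto simp: eventually_mono)
 qed
 then show ?thesis by simp
qed

lemma Phi_le_cancel: "Phi x <= Phi y \<longleftrightarrow> x <= y"
 using Phi_strict_mono[of y x] Phi_mono[of x y] by (cases "x <= y") auto

text \<open>Cauchy's mean value theorem with both cells parametrised by the same s in (0, 1): the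
  ratio of two cell masses is the ratio of the scaled densities at matching points, and that ratio
  is explicit.\<close>

lemma Phi_cell_ratio:
 assumes "0 < d" "0 < d'"
 shows "\<exists>s. 0 < s \<and> s < 1 \<and> (Phi (a' + d') - Phi a') * (d * std_normal_density (a + d * s))
     = (Phi (a + d) - Phi a) * (d' * std_normal_density (a' + d' * s))"
proof -
 have d1: "DERIV (\<lambda>s. Phi (a + d * s)) s :> d * std_normal_density (a + d * s)" for a d s
 proof -
  have "DERIV (\<lambda>s. a + d * s) s :> d" by (auto intro!: derivative_eq_intros)
  from DERIV_chain'[OF this DERIV_Phi] show ?thesis by (simp add: mult.commute)
 qed
 have "\<exists>c>0. c < 1 \<and>
  (Phi (a' + d' * 1) - Phi (a' + d' * 0)) * (d * std_normal_density (a + d * c)) =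
  (Phi (a + d * 1) - Phi (a + d * 0)) * (d' * std_normal_density (a' + d' * c))"
  by (rule GMVT'[where f="\<lambda>s. Phi (a' + d' * s)" and g="\<lambda>s. Phi (a + d * s)"])
   (auto intro!: d1 DERIV_isCont[OF d1])
 then show ?thesis by auto
qed

lemma Phi_cell_ratio_ge:
 assumes "0 < h"
 shows "(Phi (a + h) - Phi a) * exp (- h * (a + h) - h\<^sup>2 / 2) <= Phi (a + 2 * h) - Phi (a + h)"
proof -
 obtain s where s: "0 < s" "s < 1" and e: "(Phi (a + h + h) - Phi (a + h)) * (h * std_normal_density (a + h * s))
     = (Phi (a + h) - Phi a) * (h * std_normal_density (a + h + h * s))"
  using Phi_cell_ratio[OF assms assms, of "a + h" a] by auto
 have "std_normal_density (a + h + h * s) = std_normal_density (a + h * s) * exp (- h * (a + h * s) - h\<^sup>2 / 2)"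
  by (simp add: normal_density_def exp_add[symmetric] field_simps power2_eq_square)
 then have "(Phi (a + h + h) - Phi (a + h)) * (h * std_normal_density (a + h * s))
   = ((Phi (a + h) - Phi a) * exp (- h * (a + h * s) - h\<^sup>2 / 2)) * (h * std_normal_density (a + h * s))"
  using e by simp
 moreover have "h * std_normal_density (a + h * s) > 0" using assms by (simp add: normal_density_pos)
 ultimately have "Phi (a + h + h) - Phi (a + h) = (Phi (a + h) - Phi a) * exp (- h * (a + h * s) - h\<^sup>2 / 2)"
  by (metis less_irrefl mult_cancel_right)
 moreover have "exp (- h * (a + h) - h\<^sup>2 / 2) <= exp (- h * (a + h * s) - h\<^sup>2 / 2)"
  using assms s by (simp add: mult_left_mono mult_left_le)
 moreover have "0 <= Phi (a + h) - Phi a" using assms by (simp add: Phi_mono)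
 ultimately show ?thesis by (simp add: mult_left_mono add.assoc)
qed

text \<open>The second cell may be wider, which costs the factor d' / d; moving right by at least d
  from a point beyond a lowers the density by the factor exp (- a * d).\<close>

lemma Phi_cell_ratio_le:
 assumes "0 < d" "0 < d'" "d <= d'" "0 <= a"
 shows "Phi (a + d + d') - Phi (a + d) <= (Phi (a + d) - Phi a) * (d' / d * exp (- a * d))"
proof -
 obtain s where s: "0 < s" "s < 1" and e: "(Phi (a + d + d') - Phi (a + d)) * (d * std_normal_density (a + d * s))
     = (Phi (a + d) - Phi a) * (d' * std_normal_density (a + d + d' * s))"
  using Phi_cell_ratio[OF assms(1,2), of "a + d" a] by auto
 have "std_normal_density (a + d + d' * s) <= std_normal_density (a + d * s) * exp (- a * d)"
 proof -
  have "(a + d * s)\<^sup>2 + 2 * a * d <= (a + d * s + d)\<^sup>2"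
   using assms s by (simp add: power2_eq_square algebra_simps)
  also have "\<dots> <= (a + d + d' * s)\<^sup>2"
   using assms s by (intro power_mono) (auto simp: mult_right_mono)
  finally have "- (a + d + d' * s)\<^sup>2 / 2 <= - (a + d * s)\<^sup>2 / 2 + (- a * d)" by simp
  then have "exp (- (a + d + d' * s)\<^sup>2 / 2) <= exp (- (a + d * s)\<^sup>2 / 2) * exp (- a * d)"
   by (subst exp_add[symmetric]) simp
  then show ?thesis unfolding normal_density_def by (simp add: divide_right_mono)
 qed
 then have "(Phi (a + d) - Phi a) * (d' * std_normal_density (a + d + d' * s))
  <= (Phi (a + d) - Phi a) * (d' * (std_normal_density (a + d * s) * exp (- a * d)))"
  using assms by (intro mult_left_mono) (auto simp: Phi_mono)
 then have "(Phi (a + d + d') - Phi (a + d)) * (d * std_normal_density (a + d * s))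
  <= ((Phi (a + d) - Phi a) * (d' / d * exp (- a * d))) * (d * std_normal_density (a + d * s))"
  using e assms by (simp add: mult_ac)
 moreover have "0 < d * std_normal_density (a + d * s)" using assms by (simp add: normal_density_pos)
 ultimately show ?thesis by (simp only: mult_le_cancel_right_pos)
qed

lemma Phi_cell_ge:
 assumes "0 <= a" "0 < h"
 shows "h * std_normal_density (a + h) <= Phi (a + h) - Phi a"
proof -
 obtain x where x: "a < x" "x < a + h" "Phi (a + h) - Phi a = h * std_normal_density x"
  using MVT2[of a "a + h" Phi std_normal_density] assms DERIV_Phi by auto
 have "std_normal_density (a + h) <= std_normal_density x"
  unfolding normal_density_def using x assms
  by (auto intro!: divide_right_mono power_mono)
 then show ?thesis using x assms by simp
qed

text \<open>Monotone likelihood ratio argument. If T exceeded G at k, some cell beyond k would carry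
  more mass under T than under G, because T is below G again at K. The ratio condition hands this
  excess down to every earlier cell, so the gap at k0 would be at least as large, against
  \<open>start\<close>.\<close>

lemma tail_le_if_ratio_le:
 fixes T G :: "nat => real"
 assumes q: "\<And>m. k0 <= m ==> G (Suc m) < G m"
  and ratio: "\<And>m. k0 <= m ==> (T (Suc m) - T (Suc (Suc m))) * (G m - G (Suc m))
     <= (T m - T (Suc m)) * (G (Suc m) - G (Suc (Suc m)))"
  and start: "T k0 <= G k0" and fin: "k <= K" "T K <= G K" and k: "k0 <= k"
 shows "T k <= G k"
proof (rule ccontr)
 assume "\<not> T k <= G k"
 then have neg: "G k < T k" by simp
 have "\<exists>i\<ge>k. G i - G (Suc i) < T i - T (Suc i)"
 proof (rule ccontr)
  assume "\<not> ?thesis"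
  then have *: "T i - G i <= T (Suc i) - G (Suc i)" if "i >= k" for i
   using that by (auto simp: not_less algebra_simps)
  have "T k - G k <= T K - G K"
   using fin(1) by (rule dec_induct) (use * in \<open>auto intro: order_trans\<close>)
  then show False using neg fin by simp
 qed
 then obtain i where i: "i >= k" "G i - G (Suc i) < T i - T (Suc i)" by auto
 have step: "G m - G (Suc m) < T m - T (Suc m)"
  if "k0 <= m" "G (Suc m) - G (Suc (Suc m)) < T (Suc m) - T (Suc (Suc m))" for m
 proof (rule ccontr)
  assume "\<not> ?thesis"
  then have "(T m - T (Suc m)) * (G (Suc m) - G (Suc (Suc m))) <= (G m - G (Suc m)) * (G (Suc m) - G (Suc (Suc m)))"
   using q[of "Suc m"] that by (intro mult_right_mono) auto
  then have "(T (Suc m) - T (Suc (Suc m))) * (G m - G (Suc m)) <= (G (Suc m) - G (Suc (Suc m))) * (G m - G (Suc m))"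
   using ratio[OF that(1)] by (simp add: mult.commute)
  then show False using q[OF that(1)] that(2) by simp
 qed
 have gt: "G m - G (Suc m) < T m - T (Suc m)" if "k0 <= m" "m <= i" for m
  using that(2,1) by (induction rule: inc_induct) (auto intro: step i)
 have "T k0 - G k0 >= T k - G k"
  using k
 proof (rule dec_induct)
  fix m assume "k0 <= m" "m < k" "T m - G m <= T k0 - G k0"
  then show "T (Suc m) - G (Suc m) <= T k0 - G k0" using gt[of m] i(1) by auto
 qed simp
 then show False using start neg by simp
qed

text \<open>Mirror image of \<open>tail_le_if_ratio_le\<close>. The ratio comparison is available
  only below k1, so the normal tail enters truncated, as G k - G k1; the truncation is removed later
  in \<open>bin_tail_lower\<close>.\<close>

lemma tail_ge_if_ratio_ge:
 fixes T G :: "nat => real"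
 assumes q: "\<And>m. m <= k1 ==> G (Suc m) < G m"
  and ratio: "\<And>m. m < k1 ==> (T (Suc m) - T (Suc (Suc m))) * (G m - G (Suc m))
     >= (T m - T (Suc m)) * (G (Suc m) - G (Suc (Suc m)))"
  and start: "G 0 - G k1 <= T 0" and fin: "0 <= T k1" and k: "k <= k1"
 shows "G k - G k1 <= T k"
proof (rule ccontr)
 assume "\<not> ?thesis"
 then have neg: "T k < G k - G k1" by simp
 have "\<exists>i\<ge>k. i < k1 \<and> T i - T (Suc i) < G i - G (Suc i)"
 proof (rule ccontr)
  assume "\<not> ?thesis"
  then have *: "T (Suc i) - G (Suc i) <= T i - G i" if "i >= k" "i < k1" for i
   using that by (auto simp: not_less algebra_simps)
  have "T k1 - G k1 <= T k - G k"
   using k by (rule dec_induct) (use * in \<open>auto intro: order_trans\<close>)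
  then show False using neg fin by simp
 qed
 then obtain i where i: "i >= k" "i < k1" "T i - T (Suc i) < G i - G (Suc i)" by auto
 have step: "T m - T (Suc m) < G m - G (Suc m)"
  if "m < k1" "T (Suc m) - T (Suc (Suc m)) < G (Suc m) - G (Suc (Suc m))" for m
 proof (rule ccontr)
  assume "\<not> ?thesis"
  then have "(G m - G (Suc m)) * (G (Suc m) - G (Suc (Suc m))) <= (T m - T (Suc m)) * (G (Suc m) - G (Suc (Suc m)))"
   using q[of "Suc m"] that by (intro mult_right_mono) auto
  then have "(G (Suc m) - G (Suc (Suc m))) * (G m - G (Suc m)) <= (T (Suc m) - T (Suc (Suc m))) * (G m - G (Suc m))"
   using ratio[OF that(1)] by (simp add: mult.commute)
  then show False using q[of m] that by simp
 qed
 have lt: "T m - T (Suc m) < G m - G (Suc m)" if "m <= i" for m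
  using that by (induction rule: inc_induct) (use i(2) in \<open>auto intro: step i\<close>)
 have "T 0 - G 0 <= T k - G k"
 proof -
  have "T 0 - G 0 <= T m - G m" if "m <= k" for m
   using that
  proof (induction m)
   case (Suc m)
   then show ?case using lt[of m] i(1) by auto
  qed simp
  then show ?thesis by simp
 qed
 then show False using start neg by simp
qed

section \<open>Tails of the symmetric binomial law compared with normal tails\<close>

definition bin_half :: "nat => nat => real" where
 "bin_half n j = real (n choose j) / 2 ^ n"

definition bin_tail :: "nat => nat => real" where
 "bin_tail n k = (\<Sum>j=k..n. bin_half n j)"

lemma bin_half_nonneg: "0 <= bin_half n j" by (simp add: bin_half_def)

lemma bin_half_Suc: "bin_half n (Suc j) * (real j + 1) = bin_half n j * (real n - real j)"
proof (cases "j <= n")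
 case True
 have "Suc j * (n choose Suc j) = (n - j) * (n choose j)"
  by (metis binomial_absorb_comp binomial_absorption)
 then have "real (Suc j * (n choose Suc j)) = real ((n - j) * (n choose j))" by simp
 then show ?thesis using True by (simp add: bin_half_def field_simps of_nat_diff)
qed (auto simp: bin_half_def binomial_eq_0)

lemma bin_tail_Suc: "bin_tail n k = bin_half n k + bin_tail n (Suc k)"
proof (cases "k <= n")
 case True
 then show ?thesis unfolding bin_tail_def by (simp add: sum.atLeast_Suc_atMost)
qed (simp add: bin_tail_def bin_half_def)

lemma bin_tail_0: "bin_tail n 0 = 1"
proof -
 have "(\<Sum>j=0..n. real (n choose j)) = 2 ^ n"
  using choose_row_sum[of n] by (metis atMost_atLeast0 of_nat_numeral of_nat_power of_nat_sum)
 then show ?thesis by (simp add: bin_tail_def bin_half_def sum_divide_distrib[symmetric])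
qed

lemma bin_tail_antimono: "k <= l ==> bin_tail n l <= bin_tail n k"
 unfolding bin_tail_def by (rule sum_mono2) (auto simp: bin_half_nonneg)

lemma bin_tail_nonneg: "0 <= bin_tail n k"
 unfolding bin_tail_def by (rule sum_nonneg) (auto simp: bin_half_nonneg)

lemma bin_tail_le_1: "bin_tail n k <= 1"
 using bin_tail_antimono[of 0 k n] bin_tail_0 by simp

lemma bin_tail_gt: "n < k ==> bin_tail n k = 0"
 by (simp add: bin_tail_def)

lemma bin_tail_sym:
 assumes "k <= Suc n" shows "bin_tail n k + bin_tail n (Suc n - k) = 1"
proof -
 have "bin_tail n (Suc n - k) = (\<Sum>j\<in>{..<k}. bin_half n j)"
  unfolding bin_tail_def
  by (rule sum.reindex_bij_witness[of _ "\<lambda>j. n - j" "\<lambda>j. n - j"])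
   (use assms in \<open>auto simp: bin_half_def binomial_symmetric[symmetric]\<close>)
 moreover have "{..<k} \<union> {k..n} = {0..n}" "{..<k} \<inter> {k..n} = {}" using assms by auto
 then have "(\<Sum>j\<in>{..<k}. bin_half n j) + bin_tail n k = bin_tail n 0"
  unfolding bin_tail_def by (metis finite_atLeastAtMost finite_lessThan sum.union_disjoint)
 ultimately show ?thesis using bin_tail_0 by simp
qed

lemma bin_tail_median:
 "1/2 <= bin_tail n ((n + 1) div 2)" "bin_tail n (Suc ((n + 1) div 2)) <= 1/2"
proof -
 let ?j = "(n+1) div 2"
 have "bin_tail n ?j + bin_tail n (Suc n - ?j) = 1" by (rule bin_tail_sym) auto
 moreover have "bin_tail n (Suc n - ?j) <= bin_tail n ?j" by (rule bin_tail_antimono) auto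
 ultimately show "1/2 <= bin_tail n ?j" by simp
 show "bin_tail n (Suc ?j) <= 1/2"
 proof (cases "n = 0")
  case False
  then have "bin_tail n (Suc ?j) + bin_tail n (Suc n - Suc ?j) = 1" by (intro bin_tail_sym) auto
  moreover have "bin_tail n (Suc ?j) <= bin_tail n (Suc n - Suc ?j)" by (rule bin_tail_antimono) auto
  ultimately show ?thesis by simp
 qed (simp add: bin_tail_def bin_half_def)
qed

text \<open>This is artanh a >= a, because (1 - a) / (1 + a) = exp (- 2 artanh a) for a < 1; for
  larger a the left side is not positive.\<close>

lemma ratio_le_exp:
 fixes a :: real assumes "0 <= a"
 shows "(1 - a) / (1 + a) <= exp (- 2 * a)"
proof (cases "a < 1")
 case True
 have "(1 - a) * exp a <= (1 + a) * exp (- a)"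
 proof -
  let ?f = "\<lambda>a::real. (1 + a) * exp (- a) - (1 - a) * exp a"
  have "?f 0 <= ?f a"
  proof (rule DERIV_nonneg_imp_nondecreasing[OF assms], goal_cases)
   case (1 x)
   have "DERIV ?f x :> x * (exp x - exp (- x))"
    by (auto intro!: derivative_eq_intros simp: algebra_simps)
   moreover have "0 <= x * (exp x - exp (- x))" using 1 by simp
   ultimately show ?case by blast
  qed
  then show ?thesis by simp
 qed
 then have "(1 - a) * exp a * exp (- a) <= (1 + a) * exp (- a) * exp (- a)" by (rule mult_right_mono) simp
 then have "1 - a <= (1 + a) * exp (- 2 * a)" by (simp add: mult.assoc exp_minus_inverse exp_add[symmetric])
 then show ?thesis using assms by (simp add: divide_le_eq mult.commute)
next
 case False
 then have "(1 - a) / (1 + a) <= 0" by (simp add: divide_nonpos_pos)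
 then show ?thesis by (smt (verit) exp_gt_zero)
qed

text \<open>The converse estimate artanh a <= a + a^2. Its quadratic loss is the reason for the
  widening cells in \<open>bin_tail_lower_aux\<close>.\<close>

lemma ratio_ge_exp:
 fixes a :: real assumes "0 <= a" "a <= 1/2"
 shows "exp (- 2 * a - 2 * a\<^sup>2) <= (1 - a) / (1 + a)"
proof -
 have "exp (- a - 2 * a\<^sup>2) <= 1 - a"
  using ln_one_minus_pos_lower_bound[OF assms] assms by (simp add: ln_ge_iff)
 moreover have "exp (- a) <= 1 / (1 + a)"
  using exp_ge_add_one_self[of a] assms by (simp add: exp_minus field_simps)
 ultimately have "exp (- a - 2 * a\<^sup>2) * exp (- a) <= (1 - a) * (1 / (1 + a))"
  using assms by (intro mult_mono) auto
 then show ?thesis by (simp add: exp_add[symmetric] algebra_simps)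
qed

lemma bin_tail_diff: "bin_tail n k - bin_tail n (Suc k) = bin_half n k"
 using bin_tail_Suc[of n k] by simp

text \<open>One binomial step is 2 / sqrt n standard deviations, so the binomial cells are compared
  with normal cells of that width. The binomial ratio is (1 - c) / (1 + c) with c about 2m / n.
  Shifting the normal cells by 2 lowers their exponent to (4m - 2) / n, which is below 2c, and makes
  the comparison start at the median, where both tails are compared with 1/2.\<close>

lemma bin_tail_upper:
 assumes n: "1 <= n" and k: "2 <= k"
 shows "bin_tail n ((n + 1) div 2 + k) <= 1 - Phi (2 / sqrt n * (real k - 2))"
proof -
 define h where "h = 2 / sqrt n"
 define T where "T = (\<lambda>m. bin_tail n ((n + 1) div 2 + m))"
 define G where "G = (\<lambda>m. 1 - Phi (h * (real m - 2)))"
 have h: "h > 0" "h * h = 4 / n" using n by (auto simp: h_def)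
 have Td: "T m - T (Suc m) = bin_half n ((n + 1) div 2 + m)" for m
  by (simp add: T_def bin_tail_diff)
 have "T k <= G k"
 proof (rule tail_le_if_ratio_le[where T=T and G=G and k=k and k0=2 and K="n + k"])
  show "G (Suc m) < G m" for m
   using h by (auto simp: G_def intro!: Phi_strict_mono)
  show "T 2 <= G 2"
   using bin_tail_median(2)[of n] bin_tail_antimono[of "Suc ((n + 1) div 2)" "(n + 1) div 2 + 2" n]
   by (simp add: T_def G_def Phi_0)
  show "T (n + k) <= G (n + k)"
   using k Phi_bounds(2)[of "h * (real (n + k) - 2)"] by (simp add: T_def G_def bin_tail_gt less_imp_le)
  fix m :: nat assume m: "2 <= m"
  define j where "j = (n + 1) div 2 + m"
  define a where "a = h * (real m - 2)"
  have p: "bin_half n (Suc j) = bin_half n j * ((real n - real j) / (real j + 1))"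
   using bin_half_Suc[of n j] by (simp add: field_simps)
  have e1: "h * real m - h * 2 = a" "h * (real (Suc m) - 2) = a + h" "h * (real (Suc (Suc m)) - 2) = a + 2 * h"
   by (auto simp: a_def algebra_simps)
  have q: "(G m - G (Suc m)) * exp (- h * (a + h) - h\<^sup>2 / 2) <= G (Suc m) - G (Suc (Suc m))"
   using Phi_cell_ratio_ge[OF h(1), of a] unfolding G_def e1 a_def[symmetric] by simp
  have q0: "0 <= G m - G (Suc m)" unfolding G_def using h by (auto intro!: Phi_mono)
  show "(T (Suc m) - T (Suc (Suc m))) * (G m - G (Suc m)) <= (T m - T (Suc m)) * (G (Suc m) - G (Suc (Suc m)))"
  proof (cases "j <= n")
   case False
   then have "bin_half n (Suc j) = 0" "bin_half n j = 0" by (auto simp: bin_half_def)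
   then show ?thesis unfolding Td by (simp add: j_def)
  next
   case True
   have "(real n - real j) / (real j + 1) <= exp (- h * (a + h) - h\<^sup>2 / 2)"
   proof -
    define c where "c = (2 * real m + 1) / (real n + 1)"
    have jm: "real j >= real n / 2 + real m"
     unfolding j_def by linarith
    have "(real n - real j) / (real j + 1) <= (real n / 2 - real m) / (real n / 2 + real m + 1)"
     using jm True by (intro frac_le) auto
    also have "\<dots> = (1 - c) / (1 + c)"
    proof -
     have "1 - c = (real n - 2 * real m) / (real n + 1)" "1 + c = (real n + 2 * real m + 2) / (real n + 1)"
      by (auto simp: c_def field_simps)
     then have "(1 - c) / (1 + c) = (real n - 2 * real m) / (real n + 2 * real m + 2)" by simp
     also have "\<dots> = (2 * (real n / 2 - real m)) / (2 * (real n / 2 + real m + 1))" by simp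
     also have "\<dots> = (real n / 2 - real m) / (real n / 2 + real m + 1)" by (rule mult_divide_mult_cancel_left) simp
     finally show ?thesis by simp
    qed
    also have "\<dots> <= exp (- 2 * c)" by (rule ratio_le_exp) (simp add: c_def)
    also have "\<dots> <= exp (- h * (a + h) - h\<^sup>2 / 2)"
    proof -
     have "h * (a + h) + h\<^sup>2 / 2 = (h * h) * (real m - 1) + (h * h) / 2"
      by (simp add: a_def power2_eq_square algebra_simps)
     also have "\<dots> = (4 * real m - 2) / n" unfolding h using n by (simp add: field_simps)
     also have "\<dots> <= 2 * c"
     proof -
      have "real m <= n / 2" using jm True by simp
      then have "(4 * real m - 2) * (real n + 1) <= (4 * real m + 2) * real n" by (simp add: algebra_simps)
      then show ?thesis using n by (simp add: c_def field_simps)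
     qed
     finally show ?thesis by simp
    qed
    finally show ?thesis .
   qed
   then have "bin_half n (Suc j) <= bin_half n j * exp (- h * (a + h) - h\<^sup>2 / 2)"
    unfolding p by (intro mult_left_mono) (auto simp: bin_half_nonneg)
   then have "bin_half n (Suc j) * (G m - G (Suc m)) <= bin_half n j * exp (- h * (a + h) - h\<^sup>2 / 2) * (G m - G (Suc m))"
    using q0 by (rule mult_right_mono)
   also have "\<dots> <= bin_half n j * (G (Suc m) - G (Suc (Suc m)))"
    using mult_left_mono[OF q bin_half_nonneg[of n j]] by (simp add: mult_ac)
   finally show ?thesis unfolding Td by (simp add: j_def)
  qed
 qed (use k in auto)
 then show ?thesis by (simp add: T_def G_def h_def)
qed

text \<open>The term m^2 / n in \<open>\<beta>\<close> makes the normal cells widen with m, which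
  adds about 8 m^2 / n^2 to the exponent of the normal ratio and so covers the loss 2 c^2 of
  \<open>ratio_ge_exp\<close>. The shift by 3 absorbs the remaining terms of order 1 / n, including
  the ratio d' / d of consecutive widths. The restriction to n div 8 keeps c within the range of
  that lemma.\<close>

lemma bin_tail_lower_aux:
 fixes n :: nat
 defines "\<beta> \<equiv> \<lambda>m::nat. 2 / sqrt n * (real m + 3 + (real m)\<^sup>2 / n)"
 assumes n: "2 <= n" and k: "k <= n div 8"
 shows "Phi (\<beta> (n div 8)) - Phi (\<beta> k) <= bin_tail n ((n + 1) div 2 + k)"
proof -
 define h where "h = 2 / sqrt n"
 define T where "T = (\<lambda>m. bin_tail n ((n + 1) div 2 + m))"
 define G where "G = (\<lambda>m. 1 - Phi (\<beta> m))"
 have h: "h > 0" "h * h = 4 / n" using n by (auto simp: h_def)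
 have bh: "\<beta> m = h * (real m + 3 + (real m)\<^sup>2 / n)" for m by (simp add: \<beta>_def h_def)
 have Td: "T m - T (Suc m) = bin_half n ((n + 1) div 2 + m)" for m
  by (simp add: T_def bin_tail_diff)
 have bS: "\<beta> (Suc m) = \<beta> m + h * (1 + (2 * real m + 1) / n)" for m
  using n by (simp add: bh field_simps power2_eq_square)
 have "G k - G (n div 8) <= T k"
 proof (rule tail_ge_if_ratio_ge[where T=T and G=G])
  show "G (Suc m) < G m" for m
   unfolding G_def bS using h n by (auto intro!: Phi_strict_mono mult_pos_pos add_pos_nonneg)
  have "1/2 <= Phi (\<beta> 0)" using Phi_mono[of 0 "\<beta> 0"] Phi_0 h by (simp add: bh)
  then show "G 0 - G (n div 8) <= T 0"
   using bin_tail_median(1)[of n] Phi_bounds(2)[of "\<beta> (n div 8)"] by (simp add: T_def G_def)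
  show "0 <= T (n div 8)" by (simp add: T_def bin_tail_nonneg)
  fix m assume m: "m < n div 8"
  then have "8 * (m + 1) <= n" by presburger
  then have "real (8 * (m + 1)) <= real n" by (simp only: of_nat_le_iff)
  then have m8: "8 * (real m + 1) <= real n" by simp
  define j where "j = (n + 1) div 2 + m"
  define d where "d = h * (1 + (2 * real m + 1) / n)"
  define d' where "d' = h * (1 + (2 * real m + 3) / n)"
  have d: "0 < d" "0 < d'" "d <= d'" "0 <= \<beta> m"
   using h n by (auto simp: d_def d'_def bh divide_right_mono intro!: mult_pos_pos add_pos_nonneg mult_left_mono mult_nonneg_nonneg)
  have b: "\<beta> (Suc m) = \<beta> m + d" "\<beta> (Suc (Suc m)) = \<beta> m + d + d'"
   using bS[of m] bS[of "Suc m"] by (auto simp: d_def d'_def algebra_simps)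
  have p: "bin_half n (Suc j) = bin_half n j * ((real n - real j) / (real j + 1))"
   using bin_half_Suc[of n j] by (simp add: field_simps)
  have q: "G (Suc m) - G (Suc (Suc m)) <= (G m - G (Suc m)) * (d' / d * exp (- \<beta> m * d))"
   using Phi_cell_ratio_le[OF d] unfolding G_def b by simp
  have q0: "0 <= G m - G (Suc m)" unfolding G_def b using d by (auto intro!: Phi_mono)
  have key: "d' / d * exp (- \<beta> m * d) <= (real n - real j) / (real j + 1)"
  proof -
   define c where "c = (2 * real m + 2) / (real n + 1)"
   have c: "0 <= c" "c <= 1/2" using m8 by (auto simp: c_def field_simps)
   have "2 * ((n + 1) div 2) <= n + 1" by simp
   then have "real (2 * ((n + 1) div 2)) <= real (n + 1)" by (simp only: of_nat_le_iff)
   then have jm: "real j <= (real n + 1) / 2 + real m"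
    unfolding j_def by simp
   have e: "1 + (2 * real m + 1) / n > 0" by (intro add_pos_nonneg) auto
   have "d' / d = (1 + (2 * real m + 3) / n) / (1 + (2 * real m + 1) / n)"
    using h by (simp add: d_def d'_def)
   also have "1 + (2 * real m + 3) / n = (1 + (2 * real m + 1) / n) + 2 / n"
    by (simp add: add_divide_distrib)
   also have "\<dots> / (1 + (2 * real m + 1) / n) = 1 + (2 / n) / (1 + (2 * real m + 1) / n)"
    using e by (subst add_divide_distrib) simp
   also have "\<dots> <= 1 + 2 / n"
    using divide_left_mono[of 1 "1 + (2 * real m + 1) / n" "2 / n"] n by (simp add: add_pos_nonneg)
   also have "\<dots> <= exp (2 / n)" by (rule exp_ge_add_one_self)
   finally have dd: "d' / d <= exp (2 / n)" .
   have "d' / d * exp (- \<beta> m * d) <= exp (2 / n) * exp (- \<beta> m * d)"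
    using dd by (rule mult_right_mono) simp
   also have "\<dots> = exp (2 / n - \<beta> m * d)" by (simp add: exp_add[symmetric])
   also have "\<dots> <= exp (- 2 * c - 2 * c\<^sup>2)"
   proof -
    have "\<beta> m * d = (h * h) * ((real m + 3 + (real m)\<^sup>2 / n) * (1 + (2 * real m + 1) / n))"
     by (simp add: bh d_def mult_ac)
    also have "\<dots> >= (4 / n) * ((real m + 3) + real m * (2 * real m) / n)"
    proof -
     have "(real m + 3) + real m * (2 * real m) / n <= (real m + 3) * (1 + (2 * real m + 1) / n)"
      using n by (simp add: field_simps)
     also have "\<dots> <= (real m + 3 + (real m)\<^sup>2 / n) * (1 + (2 * real m + 1) / n)"
      by (intro mult_right_mono) auto
     finally show ?thesis unfolding h by (intro mult_left_mono) auto
    qed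
    also have "(4 / n) * ((real m + 3) + real m * (2 * real m) / n) = (4 * real m + 12) / n + 8 * (real m)\<^sup>2 / n\<^sup>2"
     using n by (simp add: power2_eq_square field_simps)
    finally have 1: "\<beta> m * d >= (4 * real m + 12) / n + 8 * (real m)\<^sup>2 / n\<^sup>2" .
    have c1: "c <= (2 * real m + 2) / n" unfolding c_def using n by (intro divide_left_mono) auto
    have "2 * c + 2 * c\<^sup>2 <= 2 * ((2 * real m + 2) / n) + 2 * ((2 * real m + 2) / n)\<^sup>2"
     using c1 c by (intro add_mono mult_left_mono power_mono) auto
    also have "\<dots> = (4 * real m + 4) / n + 8 * (real m)\<^sup>2 / n\<^sup>2 + (16 * real m + 8) / n\<^sup>2"
     by (simp add: power2_eq_square divide_simps) (simp add: algebra_simps)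
    also have "(16 * real m + 8) / n\<^sup>2 <= 6 / n"
    proof -
     have "16 * real m + 8 <= 6 * n" using m8 n by simp
     then have "(16 * real m + 8) / n\<^sup>2 <= (6 * n) / n\<^sup>2" by (rule divide_right_mono) simp
     then show ?thesis using n by (simp add: power2_eq_square)
    qed
    finally have "2 * c + 2 * c\<^sup>2 + 2 / n <= (4 * real m + 12) / n + 8 * (real m)\<^sup>2 / n\<^sup>2"
     by (simp add: add_divide_distrib)
    then show ?thesis using 1 by simp
   qed
   also have "\<dots> <= (1 - c) / (1 + c)" by (rule ratio_ge_exp[OF c])
   also have "\<dots> = ((real n - 1) / 2 - real m) / ((real n + 1) / 2 + real m + 1)"
   proof -
    have "1 - c = (real n - 1 - 2 * real m) / (real n + 1)" "1 + c = (real n + 3 + 2 * real m) / (real n + 1)"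
     by (auto simp: c_def field_simps)
    then have "(1 - c) / (1 + c) = (real n - 1 - 2 * real m) / (real n + 3 + 2 * real m)" by simp
    also have "\<dots> = (2 * ((real n - 1) / 2 - real m)) / (2 * ((real n + 1) / 2 + real m + 1))"
     by (rule arg_cong2[where f="(/)"]) (simp_all add: field_simps)
    also have "\<dots> = ((real n - 1) / 2 - real m) / ((real n + 1) / 2 + real m + 1)"
     by (rule mult_divide_mult_cancel_left) simp
    finally show ?thesis .
   qed
   also have "\<dots> <= (real n - real j) / (real j + 1)"
   proof -
    have "real j <= real n" "(real n - 1) / 2 - real m <= real n - real j"
     using jm m8 by (simp_all add: field_simps del: of_nat_le_iff)
    then show ?thesis using jm by (intro frac_le) auto
   qed
   finally show ?thesis .
  qed
  have "bin_half n j * (G (Suc m) - G (Suc (Suc m))) <= bin_half n j * ((G m - G (Suc m)) * (d' / d * exp (- \<beta> m * d)))"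
   using q bin_half_nonneg by (rule mult_left_mono)
  also have "\<dots> <= bin_half n j * ((G m - G (Suc m)) * ((real n - real j) / (real j + 1)))"
   using key q0 bin_half_nonneg by (intro mult_left_mono) auto
  also have "\<dots> = bin_half n (Suc j) * (G m - G (Suc m))" unfolding p by simp
  finally show "(T m - T (Suc m)) * (G (Suc m) - G (Suc (Suc m)))
   <= (T (Suc m) - T (Suc (Suc m))) * (G m - G (Suc m))"
   unfolding Td by (simp add: j_def)
 qed (use k in auto)
 then show ?thesis by (simp add: T_def G_def)
qed

text \<open>One further unit in the shift (4 instead of 3) pays for the truncation: the normal tail
  beyond sqrt n / 4 is at most exp (- n / 32), while for k <= n / 32 the single cell next to
  \<open>\<beta> k\<close> has a larger mass once n is large. The constant 33 / 1024 is 1 / 32 + 1 /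
  1024, from k + k^2 / n with k <= n / 32.\<close>

lemma bin_tail_lower:
 "\<exists>n0\<ge>2. \<forall>n\<ge>n0. \<forall>k. k <= n div 32 \<longrightarrow>
  1 - Phi (2 / sqrt n * (real k + 4 + (real k)\<^sup>2 / n)) <= bin_tail n ((n + 1) div 2 + k)"
proof -
 have "\<forall>\<^sub>F n in sequentially. sqrt (real n) <= 2/3 * exp (real n / 40 - 1)"
  by real_asymp
 then have "\<forall>\<^sub>F n in sequentially. exp (- real n / 32) <= 2 / sqrt n * (1/3 * exp (- (2 * (33 / 1024 * real n + 4)\<^sup>2 / n)))"
  using eventually_ge_at_top[of "64::nat"]
 proof eventually_elim
  case (elim n)
  then have n: "real n >= 64" by simp
  have "(33 / 1024 * real n + 4)\<^sup>2 <= 2 * (33 / 1024 * real n)\<^sup>2 + 2 * 4\<^sup>2"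
   using zero_le_power2[of "33 / 1024 * real n - 4"] by (simp add: power2_eq_square algebra_simps)
  then have "2 * (33 / 1024 * real n + 4)\<^sup>2 / n <= 2 * (2 * (33 / 1024 * real n)\<^sup>2 + 2 * 4\<^sup>2) / n"
   using n by (intro divide_right_mono mult_left_mono) auto
  also have "\<dots> = 4 * (33 / 1024)\<^sup>2 * n + 64 / n"
   using n by (simp add: power2_eq_square field_simps)
  also have "\<dots> <= n / 200 + 1"
   using n by (intro add_mono) (simp_all add: power2_eq_square)
  finally have "2 * (33 / 1024 * real n + 4)\<^sup>2 / n <= n / 32 - n / 40 + 1" using n by simp
  then have "exp (- (n / 32 - n / 40 + 1)) <= exp (- (2 * (33 / 1024 * real n + 4)\<^sup>2 / n))" by simp
  have "sqrt n * exp (- real n / 32) <= 2 / 3 * exp (real n / 40 - 1) * exp (- real n / 32)"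
   using elim(1) by (rule mult_right_mono) simp
  also have "\<dots> = 2 / 3 * exp (- (n / 32 - n / 40 + 1))"
   by (simp add: exp_add[symmetric] mult.assoc)
  also have "\<dots> <= 2 / 3 * exp (- (2 * (33 / 1024 * real n + 4)\<^sup>2 / n))"
   using \<open>exp (- (n / 32 - n / 40 + 1)) <= _\<close> by (rule mult_left_mono) simp
  finally have "exp (- real n / 32) <= 2 / 3 * exp (- (2 * (33 / 1024 * real n + 4)\<^sup>2 / n)) / sqrt n"
   using n by (subst pos_le_divide_eq) (auto simp: mult.commute)
  then show ?case by (simp add: mult.commute)
 qed
 then have "\<forall>\<^sub>F n in sequentially. exp (- (sqrt (real n) / 4)\<^sup>2 / 2) <= 2 / sqrt n * (1/3 * exp (- (2 / sqrt n * (33 / 1024 * real n + 4))\<^sup>2 / 2))"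
 proof (rule eventually_mono)
  fix n :: nat
  have e: "- (2 / sqrt (real n) * A)\<^sup>2 / 2 = - (2 * A\<^sup>2 / n)" for A :: real
   by (simp add: power_mult_distrib power_divide)
  have e2: "- (sqrt (real n) / 4)\<^sup>2 / 2 = - real n / 32" by (simp add: power_divide)
  assume "exp (- real n / 32) <= 2 / sqrt n * (1/3 * exp (- (2 * (33 / 1024 * real n + 4)\<^sup>2 / n)))"
  then show "exp (- (sqrt (real n) / 4)\<^sup>2 / 2) <= 2 / sqrt n * (1/3 * exp (- (2 / sqrt n * (33 / 1024 * real n + 4))\<^sup>2 / 2))"
   unfolding e e2 .
 qed
 then obtain n1 where n1: "\<And>n. n >= n1 ==> exp (- (sqrt (real n) / 4)\<^sup>2 / 2) <= 2 / sqrt n * (1/3 * exp (- (2 / sqrt n * (33 / 1024 * real n + 4))\<^sup>2 / 2))"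
  by (auto simp: eventually_sequentially)
 show ?thesis
 proof (intro exI[of _ "max 2 n1"] conjI allI impI)
  fix n k :: nat assume "max 2 n1 <= n" and k: "k <= n div 32"
  then have n: "2 <= n" "n1 <= n" by auto
  define h where "h = 2 / sqrt n"
  have h: "h > 0" using n by (simp add: h_def)
  have k32: "32 * real k <= n" using k by linarith
  define \<beta> where "\<beta> = (\<lambda>m::nat. 2 / sqrt n * (real m + 3 + (real m)\<^sup>2 / n))"
  have k8: "k <= n div 8" using k by linarith
  have low: "Phi (\<beta> (n div 8)) - Phi (\<beta> k) <= bin_tail n ((n + 1) div 2 + k)"
   unfolding \<beta>_def by (rule bin_tail_lower_aux[OF n(1) k8])
  have b0: "0 <= \<beta> k" using n by (simp add: \<beta>_def)
  have bk: "2 / sqrt n * (real k + 4 + (real k)\<^sup>2 / n) = \<beta> k + h" by (simp add: \<beta>_def h_def algebra_simps)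
  have bk': "h * (real k + 4 + (real k)\<^sup>2 / n) = \<beta> k + h" using bk by (simp add: h_def)
  have "1 - Phi (\<beta> (n div 8)) <= 1 - Phi (sqrt n / 4)"
  proof -
   have "real n / 8 <= real (n div 8) + 3" by linarith
   also have "\<dots> <= real (n div 8) + 3 + (real (n div 8))\<^sup>2 / n" by simp
   finally have "2 / sqrt n * (real n / 8) <= \<beta> (n div 8)" unfolding \<beta>_def by (intro mult_left_mono) auto
   moreover have "2 / sqrt n * (real n / 8) = sqrt n / 4"
    by (simp add: real_div_sqrt)
   ultimately show ?thesis by (simp add: Phi_mono)
  qed
  also have "\<dots> <= exp (- (sqrt n / 4)\<^sup>2 / 2)" by (rule Phi_upper_tail) simp
  also have "\<dots> <= h * (1/3 * exp (- (h * (33 / 1024 * real n + 4))\<^sup>2 / 2))"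
   using n1[OF n(2)] unfolding h_def .
  also have "\<dots> <= h * std_normal_density (\<beta> k + h)"
  proof (rule mult_left_mono)
   have "(real k)\<^sup>2 / n <= n / 1024"
   proof -
    have "(32 * real k)\<^sup>2 <= (real n)\<^sup>2" using k32 by (intro power_mono) auto
    then show ?thesis using n by (simp add: field_simps power2_eq_square)
   qed
   then have "real k + 4 + (real k)\<^sup>2 / n <= 33 / 1024 * real n + 4" using k32 by simp
   then have "2 / sqrt n * (real k + 4 + (real k)\<^sup>2 / n) <= 2 / sqrt n * (33 / 1024 * real n + 4)"
    by (intro mult_left_mono) auto
   then have "\<beta> k + h <= h * (33 / 1024 * real n + 4)"
    unfolding h_def[symmetric] bk' .
   then have "(\<beta> k + h)\<^sup>2 <= (h * (33 / 1024 * real n + 4))\<^sup>2"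
    using b0 h by (intro power_mono) auto
   moreover have "1/3 <= 1 / sqrt (2 * pi)"
   proof -
    have "sqrt (2 * pi) <= sqrt 9" using pi_less_4 by (intro real_sqrt_le_mono) simp
    then show ?thesis by (simp add: field_simps)
   qed
   ultimately show "1/3 * exp (- (h * (33 / 1024 * real n + 4))\<^sup>2 / 2) <= std_normal_density (\<beta> k + h)"
    unfolding normal_density_def by (intro mult_mono) auto
  qed (use h in auto)
  also have "\<dots> <= Phi (\<beta> k + h) - Phi (\<beta> k)" by (rule Phi_cell_ge[OF b0 h])
  finally show "1 - Phi (2 / sqrt n * (real k + 4 + (real k)\<^sup>2 / n)) <= bin_tail n ((n + 1) div 2 + k)"
   using low unfolding bk by simp
 qed auto
qed

text \<open>Inverting the tail bounds gives the deviation near the centre, where m <= n / 32.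
  Further out sqrt n <= 32 z, so that sqrt n * z is itself O(z^2). Finitely many small n are
  absorbed into the constant.\<close>

lemma quantile_half_pos:
 "\<exists>C\<ge>1. \<forall>n\<ge>1. \<forall>j\<le>n. \<forall>z\<ge>0. bin_tail n (Suc j) <= 1 - Phi z \<longrightarrow> 1 - Phi z <= bin_tail n j \<longrightarrow>
  \<bar>2 * real j - real n - sqrt n * z\<bar> <= C * (1 + z\<^sup>2)"
proof -
 obtain n0 where n0: "n0 >= 2" "\<And>n k. n >= n0 ==> k <= n div 32 ==>
  1 - Phi (2 / sqrt n * (real k + 4 + (real k)\<^sup>2 / n)) <= bin_tail n ((n + 1) div 2 + k)"
  using bin_tail_lower by blast
 define N where "N = max n0 320"
 show ?thesis
 proof (intro exI[of _ "2 * real N + 100"] conjI allI impI)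
  show "1 <= 2 * real N + 100" by simp
  fix n j :: nat and z :: real
  assume n: "1 <= n" and j: "j <= n" and z: "0 <= z"
   and lo: "bin_tail n (Suc j) <= 1 - Phi z" and hi: "1 - Phi z <= bin_tail n j"
  define j0 where "j0 = (n + 1) div 2"
  have j0: "real n <= 2 * real j0" "2 * real j0 <= real n + 1" unfolding j0_def by linarith+
  have z2: "z <= 1 + z\<^sup>2" using zero_le_power2[of "z - 1"] z by (simp add: power2_eq_square algebra_simps)
  have sq: "sqrt n > 0" using n by simp
  have up: "2 * real j - real n <= sqrt n * z + 5"
  proof (cases "j >= j0 + 2")
   case True
   have "1 - Phi z <= 1 - Phi (2 / sqrt n * (real (j - j0) - 2))"
   proof -
    have "bin_tail n j <= 1 - Phi (2 / sqrt n * (real (j - j0) - 2))"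
     using bin_tail_upper[OF n, of "j - j0"] True unfolding j0_def[symmetric] by simp
    then show ?thesis using hi by linarith
   qed
   then have "2 / sqrt n * (real (j - j0) - 2) <= z" by (simp add: Phi_le_cancel)
   then have "2 * (real (j - j0) - 2) <= sqrt n * z" using sq by (simp add: field_simps)
   then show ?thesis using True j0 by (simp add: of_nat_diff)
  next
   case False
   then have "real j <= real j0 + 1" by simp
   moreover have "0 <= sqrt n * z" using z by simp
   ultimately show ?thesis using j0 by simp
  qed
  have ge: "j0 <= Suc j"
  proof (rule ccontr)
   assume "\<not> j0 <= Suc j"
   then have le: "Suc j <= j0 - 1" and "j0 >= 1" by auto
   have "bin_half n (j0 - 1) > 0" unfolding bin_half_def j0_def by (auto simp: zero_less_binomial)
   then have "bin_tail n (j0 - 1) > 1/2"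
    using bin_tail_Suc[of n "j0 - 1"] bin_tail_median(1)[of n] \<open>j0 >= 1\<close> unfolding j0_def[symmetric] by simp
   moreover have "bin_tail n (j0 - 1) <= bin_tail n (Suc j)" using le by (rule bin_tail_antimono)
   moreover have "1 - Phi z <= 1/2" using Phi_mono[OF z] Phi_0 by simp
   ultimately show False using lo by simp
  qed
  define m where "m = Suc j - j0"
  have m: "Suc j = j0 + m" "real m = real j + 1 - real j0" using ge by (auto simp: m_def)
  have low2: "real n - 2 * real j <= 2" using j0 ge by simp
  have m2: "2 * real m <= sqrt n * z + 7" using up j0 m by simp
  have "\<bar>2 * real j - real n - sqrt n * z\<bar> <= 2 * real N * (1 + z\<^sup>2) + 100 * (1 + z\<^sup>2)"
  proof (cases "n < N")
   case True
   have "sqrt n * z <= n * (1 + z\<^sup>2)"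
   proof (rule mult_mono)
    have "sqrt n <= sqrt (real n * real n)" using n by (intro real_sqrt_le_mono) auto
    then show "sqrt n <= n" by simp
   qed (use z z2 in auto)
   moreover have "\<bar>2 * real j - real n\<bar> <= n" using j by simp
   moreover have "real n * 1 <= real n * (1 + z\<^sup>2)" by (rule mult_left_mono) auto
   moreover have "0 <= sqrt n * z" using z by simp
   ultimately have "\<bar>2 * real j - real n - sqrt n * z\<bar> <= 2 * (real n * (1 + z\<^sup>2))" by linarith
   also have "\<dots> <= 2 * (real N * (1 + z\<^sup>2))" using True by (intro mult_left_mono mult_right_mono) auto
   also have "\<dots> <= 2 * real N * (1 + z\<^sup>2) + 100 * (1 + z\<^sup>2)" by simp
   finally show ?thesis .
  next
   case False
   then have nN: "n >= n0" "n >= 320" by (auto simp: N_def)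
   have Nz: "0 <= 2 * real N * (1 + z\<^sup>2)" by simp
   have up': "2 * real j - real n - sqrt n * z <= 100 * (1 + z\<^sup>2)" proof -
    have "5 <= 100 * (1 + z\<^sup>2)" by simp
    then show ?thesis using up by linarith
   qed
   have "sqrt n * z - (2 * real j - real n) <= 100 * (1 + z\<^sup>2)"
    if "m <= n div 32"
   proof -
    have "1 - Phi (2 / sqrt n * (real m + 4 + (real m)\<^sup>2 / n)) <= 1 - Phi z"
     using n0(2)[OF nN(1) that] lo m(1) unfolding j0_def by simp
    then have "z <= 2 / sqrt n * (real m + 4 + (real m)\<^sup>2 / n)" by (simp add: Phi_le_cancel)
    then have "sqrt n * z <= sqrt n * (2 / sqrt n * (real m + 4 + (real m)\<^sup>2 / n))"
     using sq by (intro mult_left_mono) auto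
    then have 1: "sqrt n * z <= 2 * real m + 8 + 2 * (real m)\<^sup>2 / n" using sq by (simp add: algebra_simps)
    have "(2 * real m)\<^sup>2 <= (sqrt n * z + 7)\<^sup>2" using m2 by (intro power_mono) auto
    also have "\<dots> <= 2 * (sqrt n * z)\<^sup>2 + 2 * 7\<^sup>2"
     using zero_le_power2[of "sqrt n * z - 7"] by (simp add: power2_eq_square algebra_simps)
    finally have "2 * (real m)\<^sup>2 / n <= (2 * (n * z\<^sup>2) / 2 + 49) / n"
     using n by (simp add: power_mult_distrib divide_right_mono)
    also have "\<dots> <= z\<^sup>2 + 49" using n by (simp add: field_simps)
    finally have "sqrt n * z - (2 * real j - real n) <= 59 + z\<^sup>2" using 1 m(2) j0 by linarith
    also have "\<dots> <= 100 * (1 + z\<^sup>2)" by simp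
    finally show ?thesis .
   qed
   moreover have "sqrt n * z - (2 * real j - real n) <= 100 * (1 + z\<^sup>2)"
    if "\<not> m <= n div 32"
   proof -
    have "real n <= 32 * real m" using that by linarith
    then have "real n / 32 <= sqrt n * z" using m2 nN(2) by linarith
    then have "sqrt n * sqrt n <= sqrt n * (32 * z)" by simp
    then have "sqrt n <= 32 * z" using sq by (simp only: mult_le_cancel_left_pos)
    then have "sqrt n * z <= 32 * z * z" using z by (rule mult_right_mono)
    then have "sqrt n * z - (2 * real j - real n) <= 2 + 32 * z\<^sup>2" using low2 by (simp add: power2_eq_square)
    also have "\<dots> <= 100 * (1 + z\<^sup>2)" by simp
    finally show ?thesis .
   qed
   ultimately have "sqrt n * z - (2 * real j - real n) <= 100 * (1 + z\<^sup>2)" by blast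
   then show ?thesis using up' Nz by linarith
  qed
  then show "\<bar>2 * real j - real n - sqrt n * z\<bar> <= (2 * real N + 100) * (1 + z\<^sup>2)" by (simp add: algebra_simps)
 qed
qed

lemma quantile_half:
 "\<exists>C\<ge>1. \<forall>n. \<forall>j\<le>n. \<forall>z. bin_tail n (Suc j) <= 1 - Phi z \<longrightarrow> 1 - Phi z <= bin_tail n j \<longrightarrow>
  \<bar>2 * real j - real n - sqrt n * z\<bar> <= C * (1 + z\<^sup>2)"
proof -
 obtain C where C: "C >= 1" "\<And>n j z. n >= 1 ==> j <= n ==> z >= 0 ==> bin_tail n (Suc j) <= 1 - Phi z ==> 1 - Phi z <= bin_tail n j ==>
  \<bar>2 * real j - real n - sqrt n * z\<bar> <= C * (1 + z\<^sup>2)"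
  using quantile_half_pos by blast
 show ?thesis
 proof (intro exI[of _ C] conjI allI impI)
  fix n j :: nat and z :: real
  assume j: "j <= n" and lo: "bin_tail n (Suc j) <= 1 - Phi z" and hi: "1 - Phi z <= bin_tail n j"
  consider "n = 0" | "n >= 1" "z >= 0" | "n >= 1" "z < 0" by linarith
  then show "\<bar>2 * real j - real n - sqrt n * z\<bar> <= C * (1 + z\<^sup>2)"
  proof cases
   case 1
   then show ?thesis using j C(1) by (auto intro: mult_nonneg_nonneg)
  next
   case 2
   then show ?thesis using C(2) j lo hi by blast
  next
   case 3
   have "bin_tail n (Suc (n - j)) = 1 - bin_tail n j"
    using bin_tail_sym[of j n] j by (simp add: Suc_diff_le)
   moreover have "bin_tail n (n - j) = 1 - bin_tail n (Suc j)"
    using bin_tail_sym[of "Suc j" n] j by simp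
   ultimately have "\<bar>2 * real (n - j) - real n - sqrt n * (- z)\<bar> <= C * (1 + (- z)\<^sup>2)"
    using 3 lo hi by (intro C(2)) (auto simp: Phi_minus)
   then show ?thesis using j by (simp add: of_nat_diff)
  qed
 qed (rule C(1))
qed

text \<open>The binomial quantile at the level of a standard normal \<open>z\<close>: a deterministic function of \<open>z\<close> with the binomial law, staying within \<open>O(1 + z^2)\<close> of \<open>(n + sqrt n * z) / 2\<close> (Tusnady).\<close>
definition half_split :: "nat => real => nat" where
 "half_split n z = card {j \<in> {1..n}. 1 - bin_tail n j < Phi z}"

lemma half_split_le: "half_split n z <= n"
proof -
 have "half_split n z <= card {1..n}" unfolding half_split_def by (rule card_mono) auto
 then show ?thesis by simp
qed

text \<open>Binomial tails decrease, so the set counted by \<open>half_split\<close> is an initial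
  segment {1..j} and its cardinality is the quantile function. Counting avoids an explicit
  inverse.\<close>

lemma half_split_less_iff:
 assumes "j <= n" shows "half_split n z <= j \<longleftrightarrow> Phi z <= 1 - bin_tail n (Suc j)"
proof
 assume *: "Phi z <= 1 - bin_tail n (Suc j)"
 have "{k \<in> {1..n}. 1 - bin_tail n k < Phi z} \<subseteq> {1..j}"
 proof safe
  fix k assume k: "k \<in> {1..n}" "1 - bin_tail n k < Phi z"
  have "\<not> Suc j <= k" using bin_tail_antimono[of "Suc j" k n] k * by auto
  then show "k \<in> {1..j}" using k by auto
 qed
 then have "half_split n z <= card {1..j}" unfolding half_split_def by (intro card_mono) auto
 then show "half_split n z <= j" by simp
next
 assume *: "half_split n z <= j"
 show "Phi z <= 1 - bin_tail n (Suc j)"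
 proof (rule ccontr)
  assume neg: "\<not> ?thesis"
  then have "j ~= n" using Phi_bounds(2)[of z] by (auto simp: bin_tail_gt)
  then have "{1..Suc j} \<subseteq> {k \<in> {1..n}. 1 - bin_tail n k < Phi z}"
  proof safe
   fix k assume k: "k \<in> {1..Suc j}"
   show "1 - bin_tail n k < Phi z" using bin_tail_antimono[of k "Suc j" n] k neg by auto
   show "k \<in> {1..n}" using k assms \<open>j ~= n\<close> by auto
  qed
  then have "card {1..Suc j} <= half_split n z" unfolding half_split_def by (intro card_mono) auto
  then show False using * by simp
 qed
qed

lemma half_split_bound:
 obtains C where "C >= 1" "\<And>n z. \<bar>2 * real (half_split n z) - real n - sqrt n * z\<bar> <= C * (1 + z\<^sup>2)"
proof -
 obtain C where C: "C >= 1" "\<And>n j z. j <= n ==> bin_tail n (Suc j) <= 1 - Phi z ==> 1 - Phi z <= bin_tail n j ==>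
  \<bar>2 * real j - real n - sqrt n * z\<bar> <= C * (1 + z\<^sup>2)"
  using quantile_half by blast
 have "\<bar>2 * real (half_split n z) - real n - sqrt n * z\<bar> <= C * (1 + z\<^sup>2)" for n z
 proof (rule C(2)[OF half_split_le])
  show "bin_tail n (Suc (half_split n z)) <= 1 - Phi z"
   using half_split_less_iff[OF half_split_le, of n z z] by simp
  show "1 - Phi z <= bin_tail n (half_split n z)"
  proof (cases "half_split n z")
   case 0
   then show ?thesis using bin_tail_0 Phi_bounds(1)[of z] by simp
  next
   case (Suc j)
   then have "j <= n" "\<not> half_split n z <= j" using half_split_le[of n z] by auto
   then show ?thesis using half_split_less_iff[of j n z] Suc by simp
  qed
 qed
 then show ?thesis using C(1) that by blast
qed

lemma half_split_measurable[measurable]: "half_split n \<in> measurable borel (count_space UNIV)"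
proof -
 have [measurable]: "Phi \<in> borel_measurable borel"
  by (rule borel_measurable_mono) (auto simp: mono_def Phi_mono)
 have "{z. half_split n z = j} \<in> sets borel" for j
 proof -
  have le: "{z. half_split n z <= j} \<in> sets borel" for j
  proof (cases "j <= n")
   case True
   then show ?thesis by (simp add: half_split_less_iff)
  next
   case False
   then have "{z. half_split n z <= j} = UNIV" using half_split_le[of n] le_trans nat_le_linear by blast
   then show ?thesis by simp
  qed
  show ?thesis
  proof (cases j)
   case 0
   then show ?thesis using le[of 0] by simp
  next
   case (Suc k)
   then have "{z. half_split n z = j} = {z. half_split n z <= j} - {z. half_split n z <= k}" by auto
   then show ?thesis using le by auto
  qed
 qed
 then show ?thesis by (intro measurable_count_space_eq2_countable[THEN iffD2]) (auto simp: vimage_def)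
qed

lemma measure_half_split:
 "measure std_normal_distribution {z. half_split n z = j} = bin_half n j"
proof -
 interpret real_distribution std_normal_distribution by (rule real_distribution_std_normal)
 have S: "{z. half_split n z \<in> A} \<in> sets std_normal_distribution" for A
  using measurable_sets[OF half_split_measurable[of n], of A] by (simp add: vimage_def)
 have le: "prob {z. half_split n z <= j} = 1 - bin_tail n (Suc j)" if "j <= n" for j
  unfolding half_split_less_iff[OF that]
  by (rule measure_Phi_le) (auto simp: bin_tail_le_1 bin_tail_nonneg)
 consider "j > n" | "j = 0" | k where "j = Suc k" "j <= n" by (metis leI not0_implies_Suc)
 then show ?thesis
 proof cases
  case 1
  then have "{z. half_split n z = j} = {}" using half_split_le[of n] by (auto simp: not_le[symmetric])
  then show ?thesis using 1 by (simp add: bin_half_def)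
 next
  case 2
  then show ?thesis using le[of 0] bin_tail_Suc[of n 0] bin_tail_0[of n] by simp
 next
  case 3
  have "prob ({z. half_split n z <= j} - {z. half_split n z <= k}) = prob {z. half_split n z <= j} - prob {z. half_split n z <= k}"
   using S[of "{..j}"] S[of "{..k}"] 3 by (intro finite_measure_Diff) auto
  moreover have "{z. half_split n z <= j} - {z. half_split n z <= k} = {z. half_split n z = j}" using 3 by auto
  ultimately show ?thesis using le[of j] le[of k] 3 bin_tail_Suc[of n j] by simp
 qed
qed

section \<open>Families of independent standard normal variables\<close>

abbreviation NN :: "real measure" where "NN \<equiv> std_normal_distribution"

lemma prob_space_NN: "prob_space NN"
 by (simp add: prob_space_normal_density)

text \<open>The joint density depends only on x^2 + y^2. The rotation is carried out by two affine
  substitutions in one variable, with Fubini in between: first x = - y + sqrt 2 * u, then y = (u -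
  v) / sqrt 2; their Jacobians sqrt 2 and 1 / sqrt 2 cancel.\<close>

lemma normal_rotation:
 fixes A B :: "real set"
 assumes [measurable]: "A \<in> sets borel" "B \<in> sets borel"
 shows "emeasure (NN \<Otimes>\<^sub>M NN) {p. (fst p + snd p) / sqrt 2 \<in> A \<and> (fst p - snd p) / sqrt 2 \<in> B}
  = emeasure NN A * emeasure NN B"
proof -
 interpret N: prob_space NN by (rule prob_space_NN)
 let ?\<phi> = "\<lambda>x. ennreal (std_normal_density x)"
 define F where "F = (\<lambda>x y. ?\<phi> x * ?\<phi> y * indicator A ((x + y) / sqrt 2) * indicator B ((x - y) / sqrt 2))"
 have [measurable]: "case_prod F \<in> borel_measurable (borel \<Otimes>\<^sub>M borel)"
  unfolding F_def by measurable
 let ?S = "{p. (fst p + snd p) / sqrt 2 \<in> A \<and> (fst p - snd p) / sqrt 2 \<in> B}"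
 have S: "?S \<in> sets (NN \<Otimes>\<^sub>M NN)"
 proof -
  have "{p \<in> space (borel \<Otimes>\<^sub>M borel). (fst p + snd p) / sqrt 2 \<in> A \<and> (fst p - snd p) / sqrt 2 \<in> B} \<in> sets (borel \<Otimes>\<^sub>M borel)"
   by measurable
  then show ?thesis by (simp add: space_pair_measure cong: sets_pair_measure_cong)
 qed
 have "emeasure (NN \<Otimes>\<^sub>M NN) ?S = (\<integral>\<^sup>+x. \<integral>\<^sup>+y. indicator ?S (x, y) \<partial>NN \<partial>NN)"
  using S by (rule N.emeasure_pair_measure)
 also have "\<dots> = (\<integral>\<^sup>+x. \<integral>\<^sup>+y. indicator A ((x + y) / sqrt 2) * indicator B ((x - y) / sqrt 2) \<partial>NN \<partial>NN)"
  by (intro nn_integral_cong) (auto split: split_indicator)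
 also have "\<dots> = (\<integral>\<^sup>+x. \<integral>\<^sup>+y. F x y \<partial>lborel \<partial>lborel)"
  unfolding F_def by (simp add: nn_integral_density nn_integral_cmult[symmetric] mult.assoc)
 also have "\<dots> = (\<integral>\<^sup>+y. \<integral>\<^sup>+x. F x y \<partial>lborel \<partial>lborel)"
  using lborel_pair.Fubini'[of F] by simp
 also have "\<dots> = (\<integral>\<^sup>+y. \<integral>\<^sup>+u. ennreal (sqrt 2) * F (- y + sqrt 2 * u) y \<partial>lborel \<partial>lborel)"
 proof (rule nn_integral_cong)
  fix y :: real
  have "(\<integral>\<^sup>+x. F x y \<partial>lborel) = ennreal \<bar>sqrt 2\<bar> * (\<integral>\<^sup>+u. F (- y + sqrt 2 * u) y \<partial>lborel)"
   by (rule nn_integral_real_affine) auto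
  then show "(\<integral>\<^sup>+x. F x y \<partial>lborel) = (\<integral>\<^sup>+u. ennreal (sqrt 2) * F (- y + sqrt 2 * u) y \<partial>lborel)"
   by (simp add: nn_integral_cmult)
 qed
 also have "\<dots> = (\<integral>\<^sup>+u. \<integral>\<^sup>+y. ennreal (sqrt 2) * F (- y + sqrt 2 * u) y \<partial>lborel \<partial>lborel)"
  by (rule lborel_pair.Fubini') simp
 also have "\<dots> = (\<integral>\<^sup>+u. \<integral>\<^sup>+v. ?\<phi> u * ?\<phi> v * indicator A u * indicator B v \<partial>lborel \<partial>lborel)"
 proof (rule nn_integral_cong)
  fix u :: real
  have "(\<integral>\<^sup>+y. ennreal (sqrt 2) * F (- y + sqrt 2 * u) y \<partial>lborel)
   = ennreal \<bar>- 1 / sqrt 2\<bar> * (\<integral>\<^sup>+v. ennreal (sqrt 2) * F (- (u / sqrt 2 + (- 1 / sqrt 2) * v) + sqrt 2 * u) (u / sqrt 2 + (- 1 / sqrt 2) * v) \<partial>lborel)"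
   by (rule nn_integral_real_affine) auto
  also have "\<dots> = (\<integral>\<^sup>+v. (ennreal (1 / sqrt 2) * ennreal (sqrt 2)) * F (- (u / sqrt 2 + (- 1 / sqrt 2) * v) + sqrt 2 * u) (u / sqrt 2 + (- 1 / sqrt 2) * v) \<partial>lborel)"
   by (simp add: nn_integral_cmult mult.assoc)
  also have "ennreal (1 / sqrt 2) * ennreal (sqrt 2) = 1"
   by (simp add: ennreal_mult'[symmetric])
  also have "(\<integral>\<^sup>+v. 1 * F (- (u / sqrt 2 + (- 1 / sqrt 2) * v) + sqrt 2 * u) (u / sqrt 2 + (- 1 / sqrt 2) * v) \<partial>lborel)
   = (\<integral>\<^sup>+v. ?\<phi> u * ?\<phi> v * indicator A u * indicator B v \<partial>lborel)"
  proof (rule nn_integral_cong)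
   fix v :: real
   have s2: "sqrt 2 * u - u / sqrt 2 = u / sqrt 2"
    by (simp add: field_simps)
   have x: "- ((u - v) / sqrt 2) + sqrt 2 * u = (u + v) / sqrt 2"
    using s2 by (simp add: add_divide_distrib diff_divide_distrib)
   have y: "u / sqrt 2 + (- 1 / sqrt 2) * v = (u - v) / sqrt 2" by (simp add: diff_divide_distrib)
   have "std_normal_density ((u + v) / sqrt 2) * std_normal_density ((u - v) / sqrt 2) = std_normal_density u * std_normal_density v"
   proof -
    have "- ((u + v) / sqrt 2)\<^sup>2 / 2 + - ((u - v) / sqrt 2)\<^sup>2 / 2 = - u\<^sup>2 / 2 + - v\<^sup>2 / 2"
     by (simp add: power_divide power2_eq_square field_simps)
    then show ?thesis unfolding normal_density_def by (simp add: exp_add[symmetric] algebra_simps)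
   qed
   then have "?\<phi> ((u + v) / sqrt 2) * ?\<phi> ((u - v) / sqrt 2) = ?\<phi> u * ?\<phi> v"
    by (simp add: ennreal_mult'[symmetric])
   moreover have "((u + v) / sqrt 2 + (u - v) / sqrt 2) / sqrt 2 = u" "((u + v) / sqrt 2 - (u - v) / sqrt 2) / sqrt 2 = v"
    by (simp_all add: field_simps)
   ultimately show "1 * F (- (u / sqrt 2 + (- 1 / sqrt 2) * v) + sqrt 2 * u) (u / sqrt 2 + (- 1 / sqrt 2) * v) = ?\<phi> u * ?\<phi> v * indicator A u * indicator B v"
    unfolding x y F_def by simp
  qed
  finally show "(\<integral>\<^sup>+y. ennreal (sqrt 2) * F (- y + sqrt 2 * u) y \<partial>lborel) = (\<integral>\<^sup>+v. ?\<phi> u * ?\<phi> v * indicator A u * indicator B v \<partial>lborel)" .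
 qed
 also have "\<dots> = (\<integral>\<^sup>+u. (?\<phi> u * indicator A u) * (\<integral>\<^sup>+v. ?\<phi> v * indicator B v \<partial>lborel) \<partial>lborel)"
  by (intro nn_integral_cong, subst nn_integral_cmult[symmetric]) (auto intro!: nn_integral_cong simp: mult_ac)
 also have "\<dots> = (\<integral>\<^sup>+u. ?\<phi> u * indicator A u \<partial>lborel) * (\<integral>\<^sup>+v. ?\<phi> v * indicator B v \<partial>lborel)"
  by (rule nn_integral_multc) auto
 also have "\<dots> = emeasure NN A * emeasure NN B" by (simp add: emeasure_density)
 finally show ?thesis .
qed

text \<open>Stated through rectangle probabilities over finite index sets, so that joint law and
  independence are one property for arbitrary, also infinite, S, and survive reindexing and
  rotations without passing through product measures.\<close>

definition iid_normal :: "'a measure => ('i => 'a => real) => 'i set => bool" where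
 "iid_normal M X S \<longleftrightarrow> (\<forall>i\<in>S. X i \<in> borel_measurable M) \<and>
  (\<forall>T A. finite T \<longrightarrow> T \<subseteq> S \<longrightarrow> (\<forall>i. A i \<in> sets borel) \<longrightarrow>
    measure M {\<omega> \<in> space M. \<forall>i\<in>T. X i \<omega> \<in> A i} = (\<Prod>i\<in>T. measure NN (A i)))"

lemma iid_normal_measurable: "iid_normal M X S ==> i \<in> S ==> X i \<in> borel_measurable M"
 by (simp add: iid_normal_def)

lemma iid_normalD:
 assumes "iid_normal M X S" "finite T" "T \<subseteq> S" "\<And>i. i \<in> T ==> A i \<in> sets borel"
 shows "measure M {\<omega> \<in> space M. \<forall>i\<in>T. X i \<omega> \<in> A i} = (\<Prod>i\<in>T. measure NN (A i))"
proof -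
 let ?A = "\<lambda>i. if i \<in> T then A i else {}"
 have "measure M {\<omega> \<in> space M. \<forall>i\<in>T. X i \<omega> \<in> ?A i} = (\<Prod>i\<in>T. measure NN (?A i))"
  using assms(1)[unfolded iid_normal_def, THEN conjunct2, rule_format, of T ?A] assms(2-4) by auto
 moreover have "{\<omega> \<in> space M. \<forall>i\<in>T. X i \<omega> \<in> ?A i} = {\<omega> \<in> space M. \<forall>i\<in>T. X i \<omega> \<in> A i}" by auto
 ultimately show ?thesis by simp
qed

text \<open>The product formula on a larger finite set implies it on a smaller one by taking the
  surplus sets to be everything. Hence it may be checked on sets T' adapted to a block
  structure.\<close>

lemma iid_normal_cofinalI:
 assumes "\<And>i. i \<in> S ==> X i \<in> borel_measurable M"
  and "\<And>T. finite T ==> T \<subseteq> S ==> \<exists>T'. finite T' \<and> T \<subseteq> T' \<and> T' \<subseteq> S \<and>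
   (\<forall>A. (\<forall>i. A i \<in> sets borel) \<longrightarrow> measure M {\<omega> \<in> space M. \<forall>i\<in>T'. X i \<omega> \<in> A i} = (\<Prod>i\<in>T'. measure NN (A i)))"
 shows "iid_normal M X S"
 unfolding iid_normal_def
proof (intro conjI ballI allI impI)
 fix T :: "'a set" and A :: "'a => real set" assume T: "finite T" "T \<subseteq> S" and A: "\<forall>i. A i \<in> sets borel"
 obtain T' where T': "finite T'" "T \<subseteq> T'" "T' \<subseteq> S"
  "\<And>A. (\<forall>i. A i \<in> sets borel) ==> measure M {\<omega> \<in> space M. \<forall>i\<in>T'. X i \<omega> \<in> A i} = (\<Prod>i\<in>T'. measure NN (A i))"
  using assms(2)[OF T] by blast
 interpret N: prob_space NN by (rule prob_space_NN)
 let ?A = "\<lambda>i. if i \<in> T then A i else UNIV"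
 have "measure M {\<omega> \<in> space M. \<forall>i\<in>T'. X i \<omega> \<in> ?A i} = (\<Prod>i\<in>T'. measure NN (?A i))"
  by (rule T'(4)) (use A in auto)
 also have "\<dots> = (\<Prod>i\<in>T. measure NN (?A i))"
  using N.prob_space by (intro prod.mono_neutral_right T') auto
 also have "{\<omega> \<in> space M. \<forall>i\<in>T'. X i \<omega> \<in> ?A i} = {\<omega> \<in> space M. \<forall>i\<in>T. X i \<omega> \<in> A i}"
  using T'(2) by auto
 finally show "measure M {\<omega> \<in> space M. \<forall>i\<in>T. X i \<omega> \<in> A i} = (\<Prod>i\<in>T. measure NN (A i))" by simp
qed (use assms in auto)

lemma iid_normal_reindex:
 assumes "iid_normal M X S" "inj_on g S'" "g ` S' \<subseteq> S"
 shows "iid_normal M (\<lambda>s. X (g s)) S'"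
proof (rule iid_normal_cofinalI)
 fix T assume T: "finite T" "T \<subseteq> S'"
 have inj: "inj_on g T" using assms(2) T(2) by (rule inj_on_subset)
 show "\<exists>T'. finite T' \<and> T \<subseteq> T' \<and> T' \<subseteq> S' \<and>
   (\<forall>A. (\<forall>i. A i \<in> sets borel) \<longrightarrow> measure M {\<omega> \<in> space M. \<forall>i\<in>T'. X (g i) \<omega> \<in> A i} = (\<Prod>i\<in>T'. measure NN (A i)))"
 proof (intro exI[of _ T] conjI allI impI T order_refl)
  fix A :: "'c => real set" assume A: "\<forall>i. A i \<in> sets borel"
  have "measure M {\<omega> \<in> space M. \<forall>i\<in>g ` T. X i \<omega> \<in> A (the_inv_into T g i)} = (\<Prod>i\<in>g ` T. measure NN (A (the_inv_into T g i)))"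
   by (rule iid_normalD[OF assms(1)]) (use T assms(3) A in auto)
  then show "measure M {\<omega> \<in> space M. \<forall>i\<in>T. X (g i) \<omega> \<in> A i} = (\<Prod>i\<in>T. measure NN (A i))"
   by (simp add: prod.reindex[OF inj] the_inv_into_f_f[OF inj] cong: prod.cong)
 qed
qed (use assms in \<open>auto intro: iid_normal_measurable\<close>)

lemma (in prob_space) iid_normal_distr:
 assumes "iid_normal M X S" "i \<in> S"
 shows "distr M borel (X i) = NN"
proof (rule measure_eqI)
 fix A assume A: "A \<in> sets (distr M borel (X i))"
 note [measurable] = iid_normal_measurable[OF assms]
 interpret N: prob_space NN by (rule prob_space_NN)
 have "measure M {\<omega> \<in> space M. X i \<omega> \<in> A} = measure NN A"
  using iid_normalD[OF assms(1), of "{i}" "\<lambda>_. A"] assms(2) A by simp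
 moreover have "X i -` A \<inter> space M = {\<omega> \<in> space M. X i \<omega> \<in> A}" by auto
 ultimately show "emeasure (distr M borel (X i)) A = emeasure NN A"
  using A by (simp add: emeasure_distr emeasure_eq_measure N.emeasure_eq_measure)
qed simp

lemma (in prob_space) iid_normal_indep_vars:
 assumes "iid_normal M X S"
 shows "indep_vars (\<lambda>_. borel) X S"
 unfolding indep_vars_def2
proof (intro conjI ballI)
 show "indep_sets (\<lambda>i. {X i -` A \<inter> space M |A. A \<in> sets borel}) S"
 proof (rule indep_setsI)
  fix A and J assume J: "J ~= {}" "J \<subseteq> S" "finite J" and "\<forall>j\<in>J. A j \<in> {X j -` A \<inter> space M |A. A \<in> sets borel}"
  then obtain B where B: "\<And>j. j \<in> J ==> A j = X j -` B j \<inter> space M" "\<And>j. j \<in> J ==> B j \<in> sets borel"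
   by simp metis
  have "prob (\<Inter>j\<in>J. A j) = prob {\<omega> \<in> space M. \<forall>j\<in>J. X j \<omega> \<in> B j}"
   using B(1) J(1) by (intro arg_cong[where f=prob]) auto
  also have "\<dots> = (\<Prod>i\<in>J. measure NN (B i))" by (rule iid_normalD[OF assms]) (use J B in auto)
  also have "\<dots> = (\<Prod>j\<in>J. prob (A j))"
  proof (rule prod.cong)
   fix j assume j: "j \<in> J"
   have "prob (A j) = prob {\<omega> \<in> space M. \<forall>i\<in>{j}. X i \<omega> \<in> B i}"
    using B(1)[OF j] by (intro arg_cong[where f=prob]) auto
   then show "measure NN (B j) = prob (A j)"
    using iid_normalD[OF assms, of "{j}" B] j J B(2) by auto
  qed simp
  finally show "prob (\<Inter>j\<in>J. A j) = (\<Prod>j\<in>J. prob (A j))" .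
 qed (use assms in \<open>auto intro!: measurable_sets iid_normal_measurable\<close>)
qed (use assms in \<open>auto intro: iid_normal_measurable\<close>)

lemma (in prob_space) iid_normalI:
 fixes X :: "'i => 'a => real"
 assumes "indep_vars (\<lambda>_. borel) X S" "\<And>i. i \<in> S ==> distr M borel (X i) = NN"
 shows "iid_normal M X S"
proof (rule iid_normal_cofinalI)
 show rv: "X i \<in> borel_measurable M" if "i \<in> S" for i
  using assms(1) that by (auto simp: indep_vars_def)
 fix T assume T: "finite T" "T \<subseteq> S"
 show "\<exists>T'. finite T' \<and> T \<subseteq> T' \<and> T' \<subseteq> S \<and>
   (\<forall>A. (\<forall>i. A i \<in> sets borel) \<longrightarrow> measure M {\<omega> \<in> space M. \<forall>i\<in>T'. X i \<omega> \<in> A i} = (\<Prod>i\<in>T'. measure NN (A i)))"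
 proof (intro exI[of _ T] conjI allI impI T order_refl)
  fix A :: "'i => real set" assume A: "\<forall>i. A i \<in> sets borel"
  show "prob {\<omega> \<in> space M. \<forall>i\<in>T. X i \<omega> \<in> A i} = (\<Prod>i\<in>T. measure NN (A i))"
  proof (cases "T = {}")
   case False
   have "prob (\<Inter>i\<in>T. X i -` A i \<inter> space M) = (\<Prod>i\<in>T. prob (X i -` A i \<inter> space M))"
    using T A False by (intro indep_varsD[OF assms(1)]) auto
   also have "(\<Inter>i\<in>T. X i -` A i \<inter> space M) = {\<omega> \<in> space M. \<forall>i\<in>T. X i \<omega> \<in> A i}" using False by auto
   also have "(\<Prod>i\<in>T. prob (X i -` A i \<inter> space M)) = (\<Prod>i\<in>T. measure NN (A i))"
   proof (rule prod.cong)
    fix i assume "i \<in> T"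
    then show "prob (X i -` A i \<inter> space M) = measure NN (A i)"
     using T A rv[of i] assms(2)[of i] measure_distr[of "X i" M borel "A i"] by auto
   qed simp
   finally show ?thesis .
  qed (simp add: prob_space)
 qed
qed

lemma (in prob_space) iid_normal_pair:
 assumes Y: "iid_normal M Y S" and s: "s \<in> S" "t \<in> S" "s ~= t"
  and [measurable]: "A \<in> sets borel" "B \<in> sets borel"
 shows "prob {\<omega> \<in> space M. (Y s \<omega> + Y t \<omega>) / sqrt 2 \<in> A \<and> (Y s \<omega> - Y t \<omega>) / sqrt 2 \<in> B}
  = measure NN A * measure NN B"
proof -
 interpret N: prob_space NN by (rule prob_space_NN)
 interpret NP: pair_prob_space NN NN by unfold_locales
 note [measurable] = iid_normal_measurable[OF Y s(1)] iid_normal_measurable[OF Y s(2)]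
 let ?E = "{p. (fst p + snd p) / sqrt 2 \<in> A \<and> (fst p - snd p) / sqrt 2 \<in> B}"
 have ind: "indep_var borel (Y s) borel (Y t)"
 proof -
  have i: "indep_vars (\<lambda>_. borel) Y S" by (rule iid_normal_indep_vars[OF Y])
  have "indep_var borel ((\<lambda>f. f s) \<circ> (\<lambda>\<omega>. restrict (\<lambda>i. Y i \<omega>) {s})) borel ((\<lambda>f. f t) \<circ> (\<lambda>\<omega>. restrict (\<lambda>i. Y i \<omega>) {t}))"
   using s by (intro indep_var_compose[OF indep_var_restrict[OF i]]) auto
  then show ?thesis by (simp add: comp_def)
 qed
 have "distr M (borel \<Otimes>\<^sub>M borel) (\<lambda>\<omega>. (Y s \<omega>, Y t \<omega>)) = distr M borel (Y s) \<Otimes>\<^sub>M distr M borel (Y t)"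
  using ind unfolding indep_var_distribution_eq by simp
 then have D: "distr M (borel \<Otimes>\<^sub>M borel) (\<lambda>\<omega>. (Y s \<omega>, Y t \<omega>)) = NN \<Otimes>\<^sub>M NN"
  using iid_normal_distr[OF Y] s by simp
 have E: "?E \<in> sets (borel \<Otimes>\<^sub>M borel)"
 proof -
  have "{p \<in> space (borel \<Otimes>\<^sub>M borel). (fst p + snd p) / sqrt 2 \<in> A \<and> (fst p - snd p) / sqrt 2 \<in> B} \<in> sets (borel \<Otimes>\<^sub>M borel)"
   by measurable
  then show ?thesis by (simp add: space_pair_measure)
 qed
 have "prob {\<omega> \<in> space M. (Y s \<omega> + Y t \<omega>) / sqrt 2 \<in> A \<and> (Y s \<omega> - Y t \<omega>) / sqrt 2 \<in> B}
  = measure (distr M (borel \<Otimes>\<^sub>M borel) (\<lambda>\<omega>. (Y s \<omega>, Y t \<omega>))) ?E"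
  using E by (subst measure_distr) (auto intro!: arg_cong[where f=prob])
 also have "\<dots> = measure NN A * measure NN B"
  unfolding D measure_def normal_rotation[OF assms(5,6)] by (simp add: enn2real_mult)
 finally show ?thesis .
qed

text \<open>Rotating disjoint pairs by 45 degrees keeps a family iid standard normal: the blocks {s,
  f s} and the remaining singletons are independent, and within a pair
  \<open>normal_rotation\<close> applies. This is the only source of new iid families in the Levy
  and Haar transforms below.\<close>

lemma (in prob_space) iid_normal_rotate:
 fixes Y V :: "'i => 'a => real"
 assumes Y: "iid_normal M Y S" and P: "P \<subseteq> S" "inj_on f P" "f ` P \<inter> P = {}" "f ` P \<subseteq> S"
  and V1: "\<And>s \<omega>. s \<in> P ==> V s \<omega> = (Y s \<omega> + Y (f s) \<omega>) / sqrt 2"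
  and V2: "\<And>s \<omega>. s \<in> P ==> V (f s) \<omega> = (Y s \<omega> - Y (f s) \<omega>) / sqrt 2"
  and V3: "\<And>s \<omega>. s \<in> S ==> s \<notin> P ==> s \<notin> f ` P ==> V s \<omega> = Y s \<omega>"
 shows "iid_normal M V S"
proof (rule iid_normal_cofinalI)
 have rvY: "Y i \<in> borel_measurable M" if "i \<in> S" for i
  using Y that by (rule iid_normal_measurable)
 show rv: "V i \<in> borel_measurable M" if "i \<in> S" for i
 proof -
  consider "i \<in> P" | s where "s \<in> P" "i = f s" | "i \<notin> P" "i \<notin> f ` P" by auto
  then show ?thesis
  proof cases
   case 1
   then have "V i = (\<lambda>\<omega>. (Y i \<omega> + Y (f i) \<omega>) / sqrt 2)" using V1 by auto
   moreover have "Y i \<in> borel_measurable M" "Y (f i) \<in> borel_measurable M" using 1 P by (auto intro!: rvY)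
   ultimately show ?thesis by simp
  next
   case 2
   then have "V i = (\<lambda>\<omega>. (Y s \<omega> - Y (f s) \<omega>) / sqrt 2)" using V2 by auto
   moreover have "Y s \<in> borel_measurable M" "Y (f s) \<in> borel_measurable M" using 2 P by (auto intro!: rvY)
   ultimately show ?thesis by simp
  next
   case 3
   then have "V i = Y i" using V3 that by auto
   then show ?thesis using rvY that by simp
  qed
 qed
 fix T assume T: "finite T" "T \<subseteq> S"
 \<comment> \<open>\<open>L\<close> has one representative per block and \<open>K\<close> maps it to
   its block; a given finite T is then enlarged to the union T' of the blocks that it meets.\<close>
 define L where "L = P \<union> (S - P - f ` P)"
 define K where "K = (\<lambda>s. if s \<in> P then {s, f s} else {s})"
 have KS: "K s \<subseteq> S" if "s \<in> L" for s using that P by (auto simp: K_def L_def)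
 have Kdisj: "disjoint_family_on K L"
  using P by (auto simp: disjoint_family_on_def K_def L_def inj_on_eq_iff)
 have Kcover: "\<exists>s\<in>L. i \<in> K s" if "i \<in> S" for i
  using that by (auto simp: K_def L_def)
 then obtain r where r: "\<And>i. i \<in> S ==> r i \<in> L \<and> i \<in> K (r i)" by metis
 define L0 where "L0 = r ` T"
 define T' where "T' = (\<Union>s\<in>L0. K s)"
 have L0: "finite L0" "L0 \<subseteq> L" using T r by (auto simp: L0_def)
 have finK: "finite (K s)" for s by (simp add: K_def)
 then have T': "finite T'" "T' \<subseteq> S"
  using L0 KS by (auto simp: T'_def)
 have T'2: "T \<subseteq> T'"
  using T(2) r by (fastforce simp: T'_def L0_def)
 show "\<exists>T'. finite T' \<and> T \<subseteq> T' \<and> T' \<subseteq> S \<and>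
   (\<forall>A. (\<forall>i. A i \<in> sets borel) \<longrightarrow> prob {\<omega> \<in> space M. \<forall>i\<in>T'. V i \<omega> \<in> A i} = (\<Prod>i\<in>T'. measure NN (A i)))"
 proof (intro exI[of _ T'] conjI allI impI T' T'2)
  fix A :: "'i => real set" assume A: "\<forall>i. A i \<in> sets borel"
  have [measurable]: "A i \<in> sets borel" for i using A by simp
  define E where "E = (\<lambda>s. if s \<in> P then {y \<in> space (Pi\<^sub>M (K s) (\<lambda>_. borel)). (y s + y (f s)) / sqrt 2 \<in> A s \<and> (y s - y (f s)) / sqrt 2 \<in> A (f s)}
    else {y \<in> space (Pi\<^sub>M (K s) (\<lambda>_. borel)). (y s :: real) \<in> A s})"
  have Em: "E s \<in> sets (Pi\<^sub>M (K s) (\<lambda>_. borel))" for s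
  proof (cases "s \<in> P")
   case True
   then have [measurable]: "(\<lambda>y. y s :: real) \<in> borel_measurable (Pi\<^sub>M (K s) (\<lambda>_. borel))" "(\<lambda>y. y (f s) :: real) \<in> borel_measurable (Pi\<^sub>M (K s) (\<lambda>_. borel))"
    by (auto simp: K_def intro!: measurable_component_singleton)
   show ?thesis using True by (simp add: E_def)
  next
   case False
   then have [measurable]: "(\<lambda>y. y s :: real) \<in> borel_measurable (Pi\<^sub>M (K s) (\<lambda>_. borel))"
    by (auto simp: K_def intro!: measurable_component_singleton)
   show ?thesis using False by (simp add: E_def)
  qed
  define Z where "Z = (\<lambda>s \<omega>. restrict (\<lambda>i. Y i \<omega>) (K s))"
  have ind: "indep_vars (\<lambda>s. Pi\<^sub>M (K s) (\<lambda>_. borel)) Z L"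
   unfolding Z_def by (rule indep_vars_restrict[OF iid_normal_indep_vars[OF Y] KS Kdisj])
  have Zsp: "Z s \<omega> \<in> space (Pi\<^sub>M (K s) (\<lambda>_. borel))" for s \<omega>
   by (auto simp: Z_def space_PiM)
  have ZE: "Z s \<omega> \<in> E s \<longleftrightarrow> (\<forall>i\<in>K s. V i \<omega> \<in> A i)" if "s \<in> L" for s \<omega>
  proof (cases "s \<in> P")
   case True
   then show ?thesis using Zsp[of s \<omega>] by (auto simp: E_def Z_def K_def V1 V2)
  next
   case False
   then have "V s \<omega> = Y s \<omega>" using that by (intro V3) (auto simp: L_def)
   then show ?thesis using Zsp[of s \<omega>] False by (auto simp: E_def Z_def K_def)
  qed
  have single: "prob {\<omega> \<in> space M. Z s \<omega> \<in> E s} = (\<Prod>i\<in>K s. measure NN (A i))" if s: "s \<in> L" for s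
  proof (cases "s \<in> P")
   case True
   then have ne: "s ~= f s" and sS: "s \<in> S" "f s \<in> S" using P by auto
   have "{\<omega> \<in> space M. Z s \<omega> \<in> E s} = {\<omega> \<in> space M. (Y s \<omega> + Y (f s) \<omega>) / sqrt 2 \<in> A s \<and> (Y s \<omega> - Y (f s) \<omega>) / sqrt 2 \<in> A (f s)}"
    using True ZE[OF s] V1 V2 by (auto simp: K_def)
   then show ?thesis using iid_normal_pair[OF Y, of s "f s" "A s" "A (f s)"] True sS ne
    by (simp add: K_def)
  next
   case False
   then have "V s \<omega> = Y s \<omega>" for \<omega> using that by (intro V3) (auto simp: L_def)
   then have "{\<omega> \<in> space M. Z s \<omega> \<in> E s} = {\<omega> \<in> space M. \<forall>i\<in>{s}. Y i \<omega> \<in> A i}"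
    using False ZE[OF s] by (auto simp: K_def)
   then show ?thesis using iid_normalD[OF Y, of "{s}" A] False s by (auto simp: K_def L_def)
  qed
  show "prob {\<omega> \<in> space M. \<forall>i\<in>T'. V i \<omega> \<in> A i} = (\<Prod>i\<in>T'. measure NN (A i))"
  proof (cases "T = {}")
   case True
   then show ?thesis by (simp add: T'_def L0_def prob_space)
  next
   case False
   then have "L0 ~= {}" by (simp add: L0_def)
   have "prob (\<Inter>s\<in>L0. Z s -` E s \<inter> space M) = (\<Prod>s\<in>L0. prob (Z s -` E s \<inter> space M))"
    using L0 \<open>L0 ~= {}\<close> Em by (intro indep_varsD[OF ind]) auto
   also have "\<dots> = (\<Prod>s\<in>L0. \<Prod>i\<in>K s. measure NN (A i))"
   proof (rule prod.cong)
    fix s assume "s \<in> L0"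
    moreover have "Z s -` E s \<inter> space M = {\<omega> \<in> space M. Z s \<omega> \<in> E s}" by auto
    ultimately show "prob (Z s -` E s \<inter> space M) = (\<Prod>i\<in>K s. measure NN (A i))" using single L0 by auto
   qed simp
   also have "\<dots> = (\<Prod>i\<in>T'. measure NN (A i))"
   proof -
    have "\<forall>i\<in>L0. \<forall>j\<in>L0. i ~= j \<longrightarrow> K i \<inter> K j = {}"
     using Kdisj L0(2) unfolding disjoint_family_on_def by blast
    then show ?thesis unfolding T'_def using L0(1) finK
     by (intro prod.UNION_disjoint[symmetric]) auto
   qed
   also have "(\<Inter>s\<in>L0. Z s -` E s \<inter> space M) = {\<omega> \<in> space M. \<forall>i\<in>T'. V i \<omega> \<in> A i}"
    using ZE L0 \<open>L0 ~= {}\<close> by (auto simp: T'_def)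
   finally show ?thesis .
  qed
 qed
qed

lemma iid_normal_PiM: "iid_normal (Pi\<^sub>M UNIV (\<lambda>_. NN)) (\<lambda>i \<omega>. \<omega> i) UNIV"
proof (rule iid_normal_cofinalI)
 interpret product_prob_space "\<lambda>_. NN" UNIV
  by (rule product_prob_spaceI) (rule prob_space_NN)
 have s: "sets (Pi\<^sub>M UNIV (\<lambda>_::'a. NN)) = sets (Pi\<^sub>M UNIV (\<lambda>_. borel))"
  by (rule sets_PiM_cong) auto
 show "(\<lambda>\<omega>. \<omega> i) \<in> borel_measurable (Pi\<^sub>M UNIV (\<lambda>_::'a. NN))" for i
  using measurable_component_singleton[of i UNIV "\<lambda>_. NN"] by (simp cong: measurable_cong_sets)
 fix T :: "'a set" assume T: "finite T" "T \<subseteq> UNIV"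
 show "\<exists>T'. finite T' \<and> T \<subseteq> T' \<and> T' \<subseteq> UNIV \<and>
   (\<forall>A. (\<forall>i. A i \<in> sets borel) \<longrightarrow> measure (Pi\<^sub>M UNIV (\<lambda>_. NN)) {\<omega> \<in> space (Pi\<^sub>M UNIV (\<lambda>_. NN)). \<forall>i\<in>T'. \<omega> i \<in> A i} = (\<Prod>i\<in>T'. measure NN (A i)))"
 proof (intro exI[of _ T] conjI allI impI T order_refl)
  fix A :: "'a => real set" assume A: "\<forall>i. A i \<in> sets borel"
  have "measure (Pi\<^sub>M UNIV (\<lambda>_. NN)) (emb UNIV T (Pi\<^sub>E T A)) = (\<Prod>i\<in>T. measure NN (A i))"
   using T A by (intro measure_PiM_emb) auto
  moreover have "emb UNIV T (Pi\<^sub>E T A) = {\<omega> \<in> space (Pi\<^sub>M UNIV (\<lambda>_. NN)). \<forall>i\<in>T. \<omega> i \<in> A i}"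
   by (auto simp: prod_emb_def space_PiM PiE_iff)
  ultimately show "measure (Pi\<^sub>M UNIV (\<lambda>_. NN)) {\<omega> \<in> space (Pi\<^sub>M UNIV (\<lambda>_. NN)). \<forall>i\<in>T. \<omega> i \<in> A i} = (\<Prod>i\<in>T. measure NN (A i))"
   by simp
 qed
qed

section \<open>Limits in distribution\<close>

text \<open>A continuous ramp from 1 to 0 on [a, a + 1/k]: it decreases to the indicator of a half
  line as k grows, so continuous test functions determine distribution functions.\<close>

definition cut :: "nat => real => real => real" where
 "cut k a x = max 0 (min 1 (1 - real k * (x - a)))"

lemma cut_bounds: "0 <= cut k a x" "cut k a x <= 1" by (auto simp: cut_def)

lemma cut_continuous: "continuous_on UNIV (cut k a)"
 unfolding cut_def by (intro continuous_intros)

lemma cut_measurable[measurable]: "cut k a \<in> borel_measurable borel"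
 by (rule borel_measurable_continuous_onI[OF cut_continuous])

lemma cut_tendsto: "(\<lambda>k. cut k a x) \<longlonglongrightarrow> indicator {..a} x"
proof (cases "x <= a")
 case True
 then have "cut k a x = 1" for k
  by (auto simp: cut_def mult_nonneg_nonpos)
 then show ?thesis using True by simp
next
 case False
 obtain N :: nat where N: "1 / (x - a) < N" using reals_Archimedean2 by blast
 have "cut k a x = 0" if "k >= N" for k
 proof -
  have "1 / (x - a) <= real k" using N that by linarith
  then have "1 <= real k * (x - a)" using False by (simp add: field_simps)
  then show ?thesis by (simp add: cut_def)
 qed
 then have "\<forall>\<^sub>F k in sequentially. cut k a x = 0" by (auto simp: eventually_sequentially)
 then show ?thesis using False by (simp add: tendsto_eventually)
qed

lemma ex_cut:
 assumes "A \<in> insert UNIV (range (\<lambda>a::real. {..a}))"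
 obtains h :: "nat => real => real" where "\<And>k. continuous_on UNIV (h k)" "\<And>k x. 0 <= h k x" "\<And>k x. h k x <= 1"
  "\<And>x. (\<lambda>k. h k x) \<longlonglongrightarrow> indicator A x"
proof (cases "A = UNIV")
 case True
 show ?thesis by (rule that[of "\<lambda>_ _. 1"]) (auto simp: True)
next
 case False
 then obtain a where "A = {..a}" using assms by auto
 then show ?thesis using that[of "\<lambda>k. cut k a"] cut_bounds cut_continuous cut_tendsto by auto
qed

text \<open>Dominated convergence is applied twice: along i for a fixed continuous ramp, then along
  the slope k to reach the distribution function. No continuity point is needed, since all Y i have
  the same law D.\<close>

lemma (in prob_space) distr_limit_eq:
 fixes Y :: "nat => 'a => real"
 assumes [measurable]: "\<And>i. Y i \<in> borel_measurable M" "Z \<in> borel_measurable M"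
  and D: "\<And>i. distr M borel (Y i) = D" and lim: "AE \<omega> in M. (\<lambda>i. Y i \<omega>) \<longlonglongrightarrow> Z \<omega>"
 shows "distr M borel Z = D"
proof -
 have rdD: "real_distribution D" unfolding D[of 0, symmetric] by (rule real_distribution_distr) simp
 have rdZ: "real_distribution (distr M borel Z)" by (rule real_distribution_distr) simp
 interpret D: real_distribution D by (rule rdD)
 have sD: "sets D = sets borel" by simp
 have cutD[measurable]: "cut k a \<in> borel_measurable D" for k a
  using cut_measurable by (simp cong: measurable_cong_sets)
 have eq: "expectation (\<lambda>\<omega>. cut k a (Z \<omega>)) = (\<integral>x. cut k a x \<partial>D)" for k a
 proof -
  have "(\<lambda>i. expectation (\<lambda>\<omega>. cut k a (Y i \<omega>))) \<longlonglongrightarrow> expectation (\<lambda>\<omega>. cut k a (Z \<omega>))"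
  proof (rule integral_dominated_convergence[where w="\<lambda>_. 1"])
   show "AE \<omega> in M. (\<lambda>i. cut k a (Y i \<omega>)) \<longlonglongrightarrow> cut k a (Z \<omega>)"
    using lim by eventually_elim (auto intro: continuous_on_tendsto_compose[OF cut_continuous])
  qed (auto simp: cut_bounds)
  moreover have "expectation (\<lambda>\<omega>. cut k a (Y i \<omega>)) = (\<integral>x. cut k a x \<partial>D)" for i
   unfolding D[of i, symmetric] by (rule integral_distr[symmetric]) auto
  ultimately show ?thesis by (simp add: LIMSEQ_const_iff)
 qed
 have "cdf (distr M borel Z) a = cdf D a" for a
 proof -
  have "(\<lambda>k. expectation (\<lambda>\<omega>. cut k a (Z \<omega>))) \<longlonglongrightarrow> expectation (\<lambda>\<omega>. indicat_real {..a} (Z \<omega>))"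
   by (rule integral_dominated_convergence[where w="\<lambda>_. 1"]) (auto simp: cut_bounds cut_tendsto)
  moreover have "(\<lambda>k. (\<integral>x. cut k a x \<partial>D)) \<longlonglongrightarrow> (\<integral>x. indicat_real {..a} x \<partial>D)"
   by (rule integral_dominated_convergence[where w="\<lambda>_. 1"]) (auto simp: cut_bounds cut_tendsto)
  ultimately have "expectation (\<lambda>\<omega>. indicat_real {..a} (Z \<omega>)) = (\<integral>x. indicat_real {..a} x \<partial>D)"
   unfolding eq by (rule LIMSEQ_unique)
  moreover have "expectation (\<lambda>\<omega>. indicat_real {..a} (Z \<omega>)) = measure (distr M borel Z) {..a}"
  proof -
   have "expectation (\<lambda>\<omega>. indicat_real {..a} (Z \<omega>) :: real) = (\<integral>x. indicat_real {..a} x \<partial>distr M borel Z)"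
    by (rule integral_distr[symmetric]) auto
   then show ?thesis by simp
  qed
  ultimately show ?thesis by (simp add: cdf_def)
 qed
 then show ?thesis by (intro cdf_unique rdD rdZ ext)
qed

text \<open>Products of expectations of continuous test functions pass to almost sure limits;
  sharpening the test functions to indicators then gives the product rule on half lines together
  with the whole line, an intersection-stable generator of the Borel sets.\<close>

lemma (in prob_space) indep_vars_limit:
 fixes Y :: "nat => 'i => 'a => real"
 assumes I: "finite I" and ind: "\<And>i. indep_vars (\<lambda>_. borel) (Y i) I"
  and Z: "\<And>l. l \<in> I ==> Z l \<in> borel_measurable M"
  and lim: "\<And>l. l \<in> I ==> AE \<omega> in M. (\<lambda>i. Y i l \<omega>) \<longlonglongrightarrow> Z l \<omega>"
 shows "indep_vars (\<lambda>_. borel) Z I"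
proof (cases "I = {}")
 case True
 then show ?thesis by (simp add: indep_vars_def2 indep_sets_def)
next
 case False
 define E :: "real set set" where "E = insert UNIV (range (\<lambda>a::real. {..a}))"
 have Y: "Y i l \<in> borel_measurable M" if "l \<in> I" for i l using ind[of i] that by (auto simp: indep_vars_def)
 have sE: "sets borel = sigma_sets UNIV E"
 proof -
  have "sets (borel :: real measure) = sigma_sets UNIV (range (\<lambda>a::real. {..a}))"
   by (subst borel_eq_atMost) simp
  also have "\<dots> = sigma_sets UNIV E"
  proof (rule sigma_sets_eqI)
   fix a assume "a \<in> E"
   then show "a \<in> sigma_sets UNIV (range (\<lambda>a::real. {..a}))"
    unfolding E_def by (auto intro: sigma_sets_top)
  qed (auto simp: E_def)
  finally show ?thesis .
 qed
 show ?thesis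
 proof (subst indep_vars_finite[where E="\<lambda>_. E"])
  show "Int_stable E"
  proof (rule Int_stableI)
   fix a b assume "a \<in> E" "b \<in> E"
   moreover have "{..x} \<inter> {..y} = {..min x y :: real}" for x y by auto
   ultimately show "a \<inter> b \<in> E" unfolding E_def by auto
  qed
  show "\<forall>A\<in>(\<Pi> i\<in>I. E). prob (\<Inter>j\<in>I. Z j -` A j \<inter> space M) = (\<Prod>j\<in>I. prob (Z j -` A j \<inter> space M))"
  proof
   fix A assume A: "A \<in> (\<Pi> i\<in>I. E)"
   have "\<exists>h. (\<forall>k. continuous_on UNIV (h k)) \<and> (\<forall>k x. 0 <= h k x) \<and> (\<forall>k x. h k x <= 1) \<and>
    (\<forall>x. (\<lambda>k. h k x) \<longlonglongrightarrow> (indicat_real (A l) x :: real))" if "l \<in> I" for l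
   proof -
    have "A l \<in> insert UNIV (range (\<lambda>a::real. {..a}))" using A that by (auto simp: E_def)
    from ex_cut[OF this] show ?thesis by metis
   qed
   then obtain h where h: "\<And>l k. l \<in> I ==> continuous_on UNIV (h l k)" "\<And>l k x. l \<in> I ==> 0 <= h l k x"
    "\<And>l k x. l \<in> I ==> h l k x <= 1" "\<And>l x. l \<in> I ==> (\<lambda>k. h l k x) \<longlonglongrightarrow> (indicat_real (A l) x :: real)"
    by metis
   have hm: "h l k \<in> borel_measurable borel" if "l \<in> I" for l k
    by (rule borel_measurable_continuous_onI[OF h(1)[OF that]])
   have Am: "A l \<in> sets borel" if "l \<in> I" for l
   proof -
    have "A l \<in> insert UNIV (range (\<lambda>a::real. {..a}))" using A that by (auto simp: E_def)
    then show ?thesis by auto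
   qed
   have hY: "(\<lambda>\<omega>. h l k (Y i l \<omega>)) \<in> borel_measurable M" if "l \<in> I" for l k i
    using measurable_compose[OF Y[OF that] hm[OF that]] .
   have hZ: "(\<lambda>\<omega>. h l k (Z l \<omega>)) \<in> borel_measurable M" if "l \<in> I" for l k
    using measurable_compose[OF Z[OF that] hm[OF that]] .
   have prod_bd: "norm (\<Prod>l\<in>I. f l) <= 1" if "\<And>l. l \<in> I ==> 0 <= f l" "\<And>l. l \<in> I ==> f l <= 1" for f :: "'i => real"
   proof -
    have "0 <= prod f I" "prod f I <= 1" by (auto intro!: prod_nonneg prod_le_1 that)
    then show ?thesis by simp
   qed
   have eqk: "expectation (\<lambda>\<omega>. \<Prod>l\<in>I. h l k (Z l \<omega>)) = (\<Prod>l\<in>I. expectation (\<lambda>\<omega>. h l k (Z l \<omega>)))" for k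
   proof -
    have e1: "expectation (\<lambda>\<omega>. \<Prod>l\<in>I. h l k (Y i l \<omega>)) = (\<Prod>l\<in>I. expectation (\<lambda>\<omega>. h l k (Y i l \<omega>)))" for i
    proof (rule indep_vars_lebesgue_integral[OF I])
     show "indep_vars (\<lambda>_. borel) (\<lambda>l \<omega>. h l k (Y i l \<omega>)) I"
      by (rule indep_vars_compose2[OF ind[of i] hm])
     show "integrable M (\<lambda>\<omega>. h l k (Y i l \<omega>))" if "l \<in> I" for l
      by (rule integrable_const_bound[where B=1]) (use h hY that in auto)
    qed
    have c1: "(\<lambda>i. expectation (\<lambda>\<omega>. \<Prod>l\<in>I. h l k (Y i l \<omega>))) \<longlonglongrightarrow> expectation (\<lambda>\<omega>. \<Prod>l\<in>I. h l k (Z l \<omega>))"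
    proof (rule integral_dominated_convergence[where w="\<lambda>_. 1"])
     have "AE \<omega> in M. \<forall>l\<in>I. (\<lambda>i. Y i l \<omega>) \<longlonglongrightarrow> Z l \<omega>"
      using lim by (intro AE_finite_allI I) auto
     then show "AE \<omega> in M. (\<lambda>i. \<Prod>l\<in>I. h l k (Y i l \<omega>)) \<longlonglongrightarrow> (\<Prod>l\<in>I. h l k (Z l \<omega>))"
      by eventually_elim (auto intro!: tendsto_prod continuous_on_tendsto_compose[OF h(1)])
     show "AE \<omega> in M. norm (\<Prod>l\<in>I. h l k (Y i l \<omega>)) <= 1" for i
      by (intro AE_I2 prod_bd h)
    qed (use hY hZ in auto)
    have c2: "(\<lambda>i. \<Prod>l\<in>I. expectation (\<lambda>\<omega>. h l k (Y i l \<omega>))) \<longlonglongrightarrow> (\<Prod>l\<in>I. expectation (\<lambda>\<omega>. h l k (Z l \<omega>)))"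
    proof (rule tendsto_prod)
     fix l assume l: "l \<in> I"
     show "(\<lambda>i. expectation (\<lambda>\<omega>. h l k (Y i l \<omega>))) \<longlonglongrightarrow> expectation (\<lambda>\<omega>. h l k (Z l \<omega>))"
     proof (rule integral_dominated_convergence[where w="\<lambda>_. 1"])
      show "AE \<omega> in M. (\<lambda>i. h l k (Y i l \<omega>)) \<longlonglongrightarrow> h l k (Z l \<omega>)"
       using lim[OF l] by eventually_elim (auto intro!: continuous_on_tendsto_compose[OF h(1)] l)
     qed (use hY hZ h l in auto)
    qed
    show ?thesis by (rule LIMSEQ_unique[OF c1[unfolded e1] c2])
   qed
   have "(\<lambda>k. expectation (\<lambda>\<omega>. \<Prod>l\<in>I. h l k (Z l \<omega>))) \<longlonglongrightarrow> expectation (\<lambda>\<omega>. \<Prod>l\<in>I. indicat_real (A l) (Z l \<omega>))"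
   proof (rule integral_dominated_convergence[where w="\<lambda>_. 1"])
    show "(\<lambda>\<omega>. \<Prod>l\<in>I. indicat_real (A l) (Z l \<omega>) :: real) \<in> borel_measurable M"
    proof (rule borel_measurable_prod)
     fix l assume l: "l \<in> I"
     note [measurable] = Z[OF l] Am[OF l]
     show "(\<lambda>\<omega>. indicat_real (A l) (Z l \<omega>) :: real) \<in> borel_measurable M" by measurable
    qed
    show "AE \<omega> in M. (\<lambda>k. \<Prod>l\<in>I. h l k (Z l \<omega>)) \<longlonglongrightarrow> (\<Prod>l\<in>I. indicat_real (A l) (Z l \<omega>))"
     by (intro AE_I2 tendsto_prod h)
    show "AE \<omega> in M. norm (\<Prod>l\<in>I. h l k (Z l \<omega>)) <= 1" for k
     by (intro AE_I2 prod_bd h)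
   qed (use hZ in auto)
   moreover have "(\<lambda>k. \<Prod>l\<in>I. expectation (\<lambda>\<omega>. h l k (Z l \<omega>))) \<longlonglongrightarrow> (\<Prod>l\<in>I. expectation (\<lambda>\<omega>. indicat_real (A l) (Z l \<omega>)))"
   proof (rule tendsto_prod)
    fix l assume l: "l \<in> I"
    note [measurable] = Z[OF l] Am[OF l]
    show "(\<lambda>k. expectation (\<lambda>\<omega>. h l k (Z l \<omega>))) \<longlonglongrightarrow> expectation (\<lambda>\<omega>. indicat_real (A l) (Z l \<omega>))"
     by (rule integral_dominated_convergence[where w="\<lambda>_. 1"]) (use hZ h l in auto)
   qed
   ultimately have "expectation (\<lambda>\<omega>. \<Prod>l\<in>I. indicat_real (A l) (Z l \<omega>)) = (\<Prod>l\<in>I. expectation (\<lambda>\<omega>. indicat_real (A l) (Z l \<omega>)))"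
    unfolding eqk by (rule LIMSEQ_unique)
   moreover have "expectation (\<lambda>\<omega>. indicat_real (A l) (Z l \<omega>)) = prob (Z l -` A l \<inter> space M)" if "l \<in> I" for l
   proof -
    have "expectation (\<lambda>\<omega>. indicat_real (A l) (Z l \<omega>) :: real) = expectation (indicator (Z l -` A l \<inter> space M))"
     by (rule Bochner_Integration.integral_cong) (auto split: split_indicator)
    then show ?thesis using measurable_sets[OF Z[OF that] Am[OF that]] by simp
   qed
   moreover have "expectation (\<lambda>\<omega>. \<Prod>l\<in>I. indicat_real (A l) (Z l \<omega>)) = prob (\<Inter>j\<in>I. Z j -` A j \<inter> space M)"
   proof -
    have "(\<Inter>j\<in>I. Z j -` A j \<inter> space M) \<in> events"
     using measurable_sets[OF Z Am] I False by (intro sets.finite_INT) auto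
    moreover have "(\<Prod>l\<in>I. indicat_real (A l) (Z l \<omega>) :: real) = indicator (\<Inter>j\<in>I. Z j -` A j \<inter> space M) \<omega>" if "\<omega> \<in> space M" for \<omega>
     using I that by (induction I rule: finite_induct) (auto split: split_indicator)
    ultimately show ?thesis by (simp cong: Bochner_Integration.integral_cong)
   qed
   ultimately show "prob (\<Inter>j\<in>I. Z j -` A j \<inter> space M) = (\<Prod>j\<in>I. prob (Z j -` A j \<inter> space M))" by simp
  qed
 qed (use I False Z sE in \<open>auto simp: E_def\<close>)
qed

lemma nn_integral_exp_NN: "(\<integral>\<^sup>+x. ennreal (exp \<bar>x\<bar>) \<partial>NN) <= 4"
proof -
 have s: "(\<integral>\<^sup>+x. ennreal (exp (c * x)) \<partial>NN) = ennreal (exp (1/2))" if "c = 1 \<or> c = -1" for c :: real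
 proof -
  have "(\<integral>\<^sup>+x. ennreal (exp (c * x)) \<partial>NN) = (\<integral>\<^sup>+x. ennreal (std_normal_density x) * ennreal (exp (c * x)) \<partial>lborel)"
   by (simp add: nn_integral_density)
  also have "\<dots> = (\<integral>\<^sup>+x. ennreal (exp (1/2)) * ennreal (normal_density c 1 x) \<partial>lborel)"
  proof (rule nn_integral_cong)
   fix x
   have "std_normal_density x * exp (c * x) = exp (1/2) * normal_density c 1 x"
    unfolding normal_density_def using that
    by (auto simp: exp_add[symmetric] power2_eq_square field_simps)
   then show "ennreal (std_normal_density x) * ennreal (exp (c * x)) = ennreal (exp (1/2)) * ennreal (normal_density c 1 x)"
    by (simp add: ennreal_mult'[symmetric] del: ennreal_half)
  qed
  also have "\<dots> = ennreal (exp (1/2)) * (\<integral>\<^sup>+x. ennreal (normal_density c 1 x) \<partial>lborel)"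
   by (rule nn_integral_cmult) auto
  also have "(\<integral>\<^sup>+x. ennreal (normal_density c 1 x) \<partial>lborel) = 1"
   by (subst nn_integral_eq_integral) auto
  finally show ?thesis by simp
 qed
 have "(\<integral>\<^sup>+x. ennreal (exp \<bar>x\<bar>) \<partial>NN) <= (\<integral>\<^sup>+x. ennreal (exp (1 * x)) + ennreal (exp (-1 * x)) \<partial>NN)"
  by (intro nn_integral_mono) (auto simp: ennreal_plus[symmetric] abs_if simp del: ennreal_plus intro!: ennreal_leI)
 also have "\<dots> = (\<integral>\<^sup>+x. ennreal (exp (1 * x)) \<partial>NN) + (\<integral>\<^sup>+x. ennreal (exp (-1 * x)) \<partial>NN)"
  by (rule nn_integral_add) auto
 also have "\<dots> = ennreal (exp (1/2) + exp (1/2))" using s[of 1] s[of "-1"] by (simp add: ennreal_plus[symmetric] del: ennreal_plus)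
 also have "\<dots> <= ennreal 4"
 proof (rule ennreal_leI)
  have "exp (1/2::real) * exp (1/2) <= 2 * 2" using exp_le by (simp add: exp_add[symmetric])
  then have "exp (1/2::real) <= 2" using mult_strict_mono[of 2 "exp (1/2::real)" 2 "exp (1/2::real)"] by force
  then show "exp (1/2) + exp (1/2) <= (4::real)" by simp
 qed
 finally show ?thesis by simp
qed

section \<open>Brownian motion with a modulus of continuity\<close>

fun lev :: "(nat \<times> nat => real) => nat => nat \<times> nat => real" where
 "lev z 0 p = z p"
| "lev z (Suc i) p =
  (if fst p = 0 then
    (if even (snd p) then (lev z i (0, snd p div 2) + lev z i (1, snd p div 2)) / sqrt 2
    else (lev z i (0, snd p div 2) - lev z i (1, snd p div 2)) / sqrt 2)
   else lev z i (Suc (fst p), snd p))"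

text \<open>A refinement is a rotation of the pairs formed by rows 0 and 1, followed by the
  injective relabelling \<open>g\<close>, which interleaves the two rotated rows as even and odd
  cells.\<close>

lemma (in prob_space) iid_lev:
 assumes "iid_normal M \<zeta> UNIV"
 shows "iid_normal M (\<lambda>p \<omega>. lev (\<lambda>q. \<zeta> q \<omega>) i p) UNIV"
proof (induction i)
 case 0
 then show ?case using assms by simp
next
 case (Suc i)
 define Y where "Y = (\<lambda>p \<omega>. lev (\<lambda>q. \<zeta> q \<omega>) i p)"
 define V where "V = (\<lambda>p \<omega>. if fst p = 0 then (Y (0, snd p) \<omega> + Y (1, snd p) \<omega>) / sqrt 2
  else if fst p = 1 then (Y (0, snd p) \<omega> - Y (1, snd p) \<omega>) / sqrt 2 else Y p \<omega>)"
 define g where "g = (\<lambda>p::nat \<times> nat. if fst p = 0 then (if even (snd p) then (0, snd p div 2) else (1, snd p div 2)) else (Suc (fst p), snd p))"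
 have "iid_normal M V UNIV"
 proof (rule iid_normal_rotate[where Y=Y and P="{p. fst p = 0}" and f="\<lambda>p. (1, snd p)"])
  show "iid_normal M Y UNIV" unfolding Y_def by (rule Suc)
 qed (auto simp: V_def inj_on_def image_iff prod_eq_iff)
 then have "iid_normal M (\<lambda>p. V (g p)) UNIV"
 proof (rule iid_normal_reindex)
  show "inj g"
  proof (rule injI)
   fix x y assume "g x = g y"
   then show "x = y"
    by (cases x; cases y) (auto simp: g_def split: if_splits elim!: evenE oddE)
  qed
 qed simp
 moreover have "(\<lambda>p. V (g p)) = (\<lambda>p \<omega>. lev (\<lambda>q. \<zeta> q \<omega>) (Suc i) p)"
  by (intro ext) (auto simp: V_def g_def Y_def)
 ultimately show ?case by (simp only:)
qed

definition BMsp :: "(nat \<times> nat => real) measure" where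
 "BMsp = Pi\<^sub>M UNIV (\<lambda>_. NN)"

lemma prob_space_BMsp: "prob_space BMsp"
 unfolding BMsp_def by (rule prob_space_PiM) (rule prob_space_NN)

interpretation BM: prob_space BMsp by (rule prob_space_BMsp)

lemma iid_lev_BM: "iid_normal BMsp (\<lambda>p z. lev z i p) UNIV"
 using BM.iid_lev[of "\<lambda>p z. z p" i] iid_normal_PiM by (simp add: BMsp_def)

lemma lev_measurable[measurable]: "(\<lambda>z. lev z i p) \<in> borel_measurable BMsp"
 using iid_normal_measurable[OF iid_lev_BM] by simp

definition grid :: "(nat \<times> nat => real) => nat => nat => real" where
 "grid z i k = (\<Sum>j<k. lev z i (0, j)) / sqrt 2 ^ i"

lemma grid_measurable[measurable]: "(\<lambda>z. grid z i k) \<in> borel_measurable BMsp"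
 unfolding grid_def by measurable

lemma grid_double: "grid z (Suc i) (2 * k) = grid z i k"
proof -
 have "(\<Sum>j<2 * k. lev z (Suc i) (0, j)) = sqrt 2 * (\<Sum>j<k. lev z i (0, j))"
  by (induction k) (auto simp: field_simps)
 then show ?thesis by (simp add: grid_def del: lev.simps)
qed

lemma grid_Suc: "grid z i (Suc k) = grid z i k + lev z i (0, k) / sqrt 2 ^ i"
 by (simp add: grid_def add_divide_distrib)

text \<open>A majorant of the largest increment at level i on [0, A): with N cells, x <= ln N + exp
  x / N for every x, and exp x is at most the sum over all cells. The mean of this expression is
  immediate, unlike that of a maximum.\<close>

definition dd :: "nat => nat => (nat \<times> nat => real) => real" where
 "dd A i z = (ln (real (A * 2 ^ i)) + (\<Sum>k<A * 2 ^ i. exp \<bar>lev z i (0, k)\<bar>) / real (A * 2 ^ i)) / sqrt 2 ^ i"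

lemma dd_measurable[measurable]: "dd A i \<in> borel_measurable BMsp"
 unfolding dd_def by measurable

lemma lev_le_dd:
 assumes "k < A * 2 ^ i" shows "\<bar>lev z i (0, k)\<bar> / sqrt 2 ^ i <= dd A i z"
proof -
 let ?N = "real (A * 2 ^ i)" and ?x = "\<bar>lev z i (0, k)\<bar>"
 have "0 < A * 2 ^ i" using assms by (rule le_less_trans[OF le0])
 then have N: "?N > 0" by (simp only: of_nat_0_less_iff)
 have "?x - ln ?N <= exp (?x - ln ?N)" using exp_ge_add_one_self[of "?x - ln ?N"] by linarith
 also have "\<dots> = exp ?x / ?N" using N by (simp add: exp_diff)
 also have "\<dots> <= (\<Sum>k<A * 2 ^ i. exp \<bar>lev z i (0, k)\<bar>) / ?N"
  using assms N by (intro divide_right_mono member_le_sum) auto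
 finally have "?x <= ln ?N + (\<Sum>k<A * 2 ^ i. exp \<bar>lev z i (0, k)\<bar>) / ?N" by simp
 then show ?thesis unfolding dd_def by (rule divide_right_mono) simp
qed

lemma one_le_mult_power2: "1 <= A ==> 1 <= real (A * 2 ^ i)"
proof -
 assume "1 <= A"
 then have "1 <= A * 2 ^ i" by simp
 then have "real 1 <= real (A * 2 ^ i)" by (simp only: of_nat_le_iff)
 then show ?thesis by (simp only: of_nat_1)
qed

lemma dd_nonneg: "1 <= A ==> 0 <= dd A i z"
 using one_le_mult_power2[of A i] unfolding dd_def
 by (intro divide_nonneg_nonneg add_nonneg_nonneg sum_nonneg ln_ge_zero) auto

lemma nn_integral_dd:
 assumes A: "1 <= A"
 shows "(\<integral>\<^sup>+z. ennreal (dd A i z) \<partial>BMsp) <= ennreal ((ln (real A) + 4 + real i) / sqrt 2 ^ i)"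
proof -
 let ?N = "real (A * 2 ^ i)"
 have N: "?N >= 1" using A by (rule one_le_mult_power2)
 have e: "(\<integral>\<^sup>+z. ennreal (exp \<bar>lev z i (0, k)\<bar>) \<partial>BMsp) <= 4" for k
 proof -
  have "(\<integral>\<^sup>+z. ennreal (exp \<bar>lev z i (0, k)\<bar>) \<partial>BMsp) = (\<integral>\<^sup>+x. ennreal (exp \<bar>x\<bar>) \<partial>distr BMsp borel (\<lambda>z. lev z i (0, k)))"
   by (subst nn_integral_distr) auto
  also have "distr BMsp borel (\<lambda>z. lev z i (0, k)) = NN"
   by (rule BM.iid_normal_distr[OF iid_lev_BM]) simp
  finally show ?thesis using nn_integral_exp_NN by simp
 qed
 have "(\<integral>\<^sup>+z. ennreal (dd A i z) \<partial>BMsp) = (\<integral>\<^sup>+z. ennreal (ln ?N / sqrt 2 ^ i) + ennreal (1 / (?N * sqrt 2 ^ i)) * (\<Sum>k<A * 2 ^ i. ennreal (exp \<bar>lev z i (0, k)\<bar>)) \<partial>BMsp)"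
 proof (rule nn_integral_cong)
  fix z
  have "dd A i z = ln ?N / sqrt 2 ^ i + 1 / (?N * sqrt 2 ^ i) * (\<Sum>k<A * 2 ^ i. exp \<bar>lev z i (0, k)\<bar>)"
   by (simp add: dd_def add_divide_distrib)
  also have "ennreal \<dots> = ennreal (ln ?N / sqrt 2 ^ i) + ennreal (1 / (?N * sqrt 2 ^ i) * (\<Sum>k<A * 2 ^ i. exp \<bar>lev z i (0, k)\<bar>))"
   using N by (intro ennreal_plus mult_nonneg_nonneg divide_nonneg_nonneg sum_nonneg ln_ge_zero) auto
  also have "ennreal (1 / (?N * sqrt 2 ^ i) * (\<Sum>k<A * 2 ^ i. exp \<bar>lev z i (0, k)\<bar>))
   = ennreal (1 / (?N * sqrt 2 ^ i)) * ennreal (\<Sum>k<A * 2 ^ i. exp \<bar>lev z i (0, k)\<bar>)"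
   using N by (intro ennreal_mult sum_nonneg) auto
  also have "ennreal (\<Sum>k<A * 2 ^ i. exp \<bar>lev z i (0, k)\<bar>) = (\<Sum>k<A * 2 ^ i. ennreal (exp \<bar>lev z i (0, k)\<bar>))"
   by (rule sum_ennreal[symmetric]) simp
  finally show "ennreal (dd A i z) = ennreal (ln ?N / sqrt 2 ^ i) + ennreal (1 / (?N * sqrt 2 ^ i)) * (\<Sum>k<A * 2 ^ i. ennreal (exp \<bar>lev z i (0, k)\<bar>))" .
 qed
 also have "\<dots> = ennreal (ln ?N / sqrt 2 ^ i) + ennreal (1 / (?N * sqrt 2 ^ i)) * (\<Sum>k<A * 2 ^ i. (\<integral>\<^sup>+z. ennreal (exp \<bar>lev z i (0, k)\<bar>) \<partial>BMsp))"
  by (subst nn_integral_add) (auto simp: nn_integral_cmult nn_integral_sum BM.emeasure_space_1 simp del: sum_ennreal)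
 also have "\<dots> <= ennreal (ln ?N / sqrt 2 ^ i) + ennreal (1 / (?N * sqrt 2 ^ i)) * (\<Sum>k<A * 2 ^ i. ennreal 4)"
  using e by (intro add_left_mono mult_left_mono sum_mono) auto
 also have "\<dots> = ennreal ((ln ?N + 4) / sqrt 2 ^ i)"
 proof -
  have "(\<Sum>k<A * 2 ^ i. ennreal 4) = ennreal (?N * 4)" by (simp add: ennreal_of_nat_eq_real_of_nat ennreal_mult'')
  then show ?thesis using N
   by (simp add: ennreal_plus[symmetric] ennreal_mult''[symmetric] ln_ge_zero add_divide_distrib del: ennreal_plus of_nat_mult of_nat_power)
 qed
 also have "\<dots> <= ennreal ((ln (real A) + 4 + real i) / sqrt 2 ^ i)"
 proof (intro ennreal_leI divide_right_mono)
  have "ln ?N = ln (real A) + real i * ln 2" using A by (simp add: ln_mult ln_realpow)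
  also have "\<dots> <= ln (real A) + real i * 1" using ln_le_minus_one[of "2::real"] by (intro add_left_mono mult_left_mono) auto
  finally show "ln ?N + 4 <= ln (real A) + 4 + real i" by simp
 qed simp
 finally show ?thesis .
qed

definition idx :: "real => nat => nat" where
 "idx t i = nat \<lfloor>t * 2 ^ i\<rfloor>"

lemma idx_mono: "s <= t ==> idx s i <= idx t i"
 unfolding idx_def by (intro nat_mono floor_mono mult_right_mono) auto

lemma idx_bounds:
 assumes "0 <= t" shows "real (idx t i) <= t * 2 ^ i" "t * 2 ^ i < real (idx t i) + 1"
 using assms by (auto simp: idx_def of_nat_nat)

lemma idx_less:
 assumes "0 <= t" "t < real A" shows "idx t i < A * 2 ^ i"
proof -
 have "real (idx t i) <= t * 2 ^ i" using idx_bounds assms by blast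
 also have "\<dots> < real A * 2 ^ i" using assms by simp
 finally have "real (idx t i) < real (A * 2 ^ i)" by simp
 then show ?thesis by (simp only: of_nat_less_iff)
qed

lemma idx_Suc:
 assumes "0 <= t" shows "idx t (Suc i) = 2 * idx t i \<or> idx t (Suc i) = Suc (2 * idx t i)"
proof -
 have "real (idx t (Suc i)) < real (2 * idx t i + 2)" "real (2 * idx t i) < real (idx t (Suc i) + 1)"
  using idx_bounds[OF assms, of i] idx_bounds[OF assms, of "Suc i"] by (auto simp: algebra_simps)
 then have "idx t (Suc i) < 2 * idx t i + 2" "2 * idx t i < idx t (Suc i) + 1" by (simp_all only: of_nat_less_iff)
 then show ?thesis by linarith
qed

lemma grid_step:
 assumes "0 <= t" "t < real A"
 shows "\<bar>grid z (Suc i) (idx t (Suc i)) - grid z i (idx t i)\<bar> <= dd A (Suc i) z"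
proof -
 have A: "1 <= A" using assms by linarith
 have less: "idx t (Suc i) < A * 2 ^ Suc i" by (rule idx_less[OF assms])
 from idx_Suc[OF assms(1), of i] show ?thesis
 proof
  assume "idx t (Suc i) = 2 * idx t i"
  then show ?thesis using dd_nonneg[OF A] by (simp add: grid_double del: lev.simps)
 next
  assume e: "idx t (Suc i) = Suc (2 * idx t i)"
  have "\<bar>lev z (Suc i) (0, 2 * idx t i)\<bar> / sqrt 2 ^ Suc i <= dd A (Suc i) z"
   by (rule lev_le_dd) (use less e in auto)
  then show ?thesis unfolding e grid_Suc grid_double by (simp del: lev.simps)
 qed
qed

lemma grid_near:
 assumes "0 <= s" "s <= t" "t < real A" "t - s <= 1 / 2 ^ i"
 shows "\<bar>grid z i (idx t i) - grid z i (idx s i)\<bar> <= dd A i z"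
proof -
 have A: "1 <= A" using assms by linarith
 have "t * 2 ^ i <= s * 2 ^ i + 1"
  using mult_right_mono[OF assms(4), of "2 ^ i"] by (simp add: algebra_simps)
 then have "real (idx t i) < real (idx s i + 2)"
  using idx_bounds[of t i] idx_bounds[of s i] assms by simp
 then have "idx t i < idx s i + 2" by (simp only: of_nat_less_iff)
 then have "idx t i = idx s i \<or> idx t i = Suc (idx s i)" using idx_mono[OF assms(2), of i] by linarith
 then show ?thesis
 proof
  assume e: "idx t i = Suc (idx s i)"
  have "idx t i < A * 2 ^ i" using assms by (intro idx_less) auto
  then have "\<bar>lev z i (0, idx s i)\<bar> / sqrt 2 ^ i <= dd A i z"
   by (intro lev_le_dd) (use e in auto)
  then show ?thesis unfolding e grid_Suc by simp
 qed (use dd_nonneg[OF A] in simp)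
qed

text \<open>Where the level errors are summable for every horizon A, the dyadic approximations
  converge uniformly on bounded intervals. Elsewhere, on a null set, \<open>bmW\<close> is defined
  to be the zero path, so continuity and \<open>bmW_osc\<close> hold for every z and not only almost
  surely.\<close>

definition good :: "(nat \<times> nat => real) => bool" where
 "good z \<longleftrightarrow> (\<forall>A\<ge>1. (\<Sum>i. ennreal (dd A i z)) ~= \<top>)"

lemma good_measurable[measurable]: "Measurable.pred BMsp good"
 unfolding good_def by measurable

lemma good_summable: "good z ==> 1 <= A ==> summable (\<lambda>i. dd A i z)"
 unfolding good_def by (intro summable_suminf_not_top) (auto simp: dd_nonneg)

definition bmW :: "(nat \<times> nat => real) => real => real" where
 "bmW z t = (if good z then lim (\<lambda>i. grid z i (idx t i)) else 0)"

lemma bmW_measurable[measurable]: "(\<lambda>z. bmW z t) \<in> borel_measurable BMsp"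
 unfolding bmW_def by measurable

lemma limit_of_summable_steps:
 fixes a b :: "nat => real"
 assumes step: "\<And>n. \<bar>a (Suc n) - a n\<bar> <= b (Suc n)" and b: "summable b"
 shows "a \<longlonglongrightarrow> lim a" "\<bar>lim a - a i\<bar> <= (\<Sum>m. b (Suc i + m))"
proof -
 have sb: "summable (\<lambda>m. b (Suc i + m))" for i
  using summable_ignore_initial_segment[OF b, of "Suc i"] by (simp add: add.commute)
 have sd: "summable (\<lambda>m. norm (a (Suc (i + m)) - a (i + m)))" for i
  by (rule summable_comparison_test[OF _ sb[of i]]) (use step in auto)
 have part: "(\<Sum>m<n. a (Suc (i + m)) - a (i + m)) = a (i + n) - a i" for i n
  by (induction n) auto
 have lim: "(\<lambda>n. a (i + n) - a i) \<longlonglongrightarrow> (\<Sum>m. a (Suc (i + m)) - a (i + m))" for i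
  using summable_LIMSEQ[OF summable_norm_cancel[OF sd[of i]]] unfolding part .
 have "(\<lambda>n. a (0 + n) - a 0 + a 0) \<longlonglongrightarrow> (\<Sum>m. a (Suc (0 + m)) - a (0 + m)) + a 0"
  by (rule tendsto_add[OF lim[of 0] tendsto_const])
 then have "convergent a" by (auto simp: convergent_def)
 then show c: "a \<longlonglongrightarrow> lim a" by (simp add: convergent_LIMSEQ_iff)
 then have "(\<lambda>n. a (n + i)) \<longlonglongrightarrow> lim a" by (rule LIMSEQ_ignore_initial_segment)
 then have "(\<lambda>n. a (i + n) - a i) \<longlonglongrightarrow> lim a - a i" by (intro tendsto_diff) (auto simp: add.commute)
 then have "lim a - a i = (\<Sum>m. a (Suc (i + m)) - a (i + m))" using lim by (rule LIMSEQ_unique)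
 also have "\<bar>\<dots>\<bar> <= (\<Sum>m. \<bar>a (Suc (i + m)) - a (i + m)\<bar>)" using summable_norm[OF sd[of i]] by simp
 also have "\<dots> <= (\<Sum>m. b (Suc i + m))" by (rule suminf_le) (use step sd sb[of i] in auto)
 finally show "\<bar>lim a - a i\<bar> <= (\<Sum>m. b (Suc i + m))" by simp
qed

lemma bmW_limit:
 assumes "good z" "0 <= t" "t < real A"
 shows "(\<lambda>i. grid z i (idx t i)) \<longlonglongrightarrow> bmW z t" "\<bar>bmW z t - grid z i (idx t i)\<bar> <= (\<Sum>m. dd A (Suc i + m) z)"
proof -
 have A: "1 <= A" using assms by linarith
 note * = limit_of_summable_steps[of "\<lambda>i. grid z i (idx t i)" "\<lambda>i. dd A i z", OF grid_step[OF assms(2,3)] good_summable[OF assms(1) A]]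
 show "(\<lambda>i. grid z i (idx t i)) \<longlonglongrightarrow> bmW z t" using *(1) assms(1) by (simp add: bmW_def)
 show "\<bar>bmW z t - grid z i (idx t i)\<bar> <= (\<Sum>m. dd A (Suc i + m) z)" using *(2)[of i] assms(1) by (simp add: bmW_def)
qed

text \<open>Chaining bound for the modulus of continuity at scale 2^-i on [0, A). The factor 2 comes
  from descending to the dyadic grid at both time points; the two grid points at level i are equal
  or adjacent.\<close>

definition osc :: "nat => nat => (nat \<times> nat => real) => real" where
 "osc A i z = (if good z then 2 * (\<Sum>m. dd A (i + m) z) else 0)"

lemma osc_measurable[measurable]: "osc A i \<in> borel_measurable BMsp"
 unfolding osc_def by measurable

lemma bmW_osc:
 assumes "0 <= s" "0 <= t" "s < real A" "t < real A" "\<bar>t - s\<bar> <= 1 / 2 ^ i"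
 shows "\<bar>bmW z t - bmW z s\<bar> <= osc A i z"
proof -
 have *: "\<bar>bmW z t - bmW z s\<bar> <= osc A i z"
  if "0 <= s" "s <= t" "t < real A" "t - s <= 1 / 2 ^ i" for s t
 proof (cases "good z")
  case True
  have A: "1 <= A" using that by linarith
  have sA: "s < real A" using that by linarith
  have sm: "summable (\<lambda>m. dd A (i + m) z)"
   using summable_ignore_initial_segment[OF good_summable[OF True A], of i] by (simp add: add.commute)
  have "(\<Sum>m. dd A (i + m) z) = dd A i z + (\<Sum>m. dd A (Suc i + m) z)"
   using suminf_split_head[OF sm] by simp
  moreover have "\<bar>bmW z t - bmW z s\<bar> <= dd A i z + 2 * (\<Sum>m. dd A (Suc i + m) z)"
   using bmW_limit(2)[OF True that(1) sA, of i] bmW_limit(2)[OF True order_trans[OF that(1,2)] that(3), of i]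
    grid_near[OF that, of z] by linarith
  ultimately show ?thesis using True dd_nonneg[OF A, of i z] by (simp add: osc_def)
 qed (simp add: bmW_def osc_def)
 show ?thesis
 proof (cases "s <= t")
  case True
  then show ?thesis using * assms by auto
 next
  case False
  then show ?thesis using *[of t s] assms by (simp add: abs_minus_commute)
 qed
qed

text \<open>The numerator is linear in the level, and i + m is absorbed by (i + 1) * (m + 1). What
  remains is the series of (m + 1) q^m with q = 1 / sqrt 2, whose sum is 1 / (1 - q)^2.\<close>

lemma nn_integral_sum_dd:
 assumes A: "1 <= A"
 shows "(\<integral>\<^sup>+z. (\<Sum>m. ennreal (dd A (i + m) z)) \<partial>BMsp)
  <= ennreal ((ln (real A) + 4) / (1 - 1 / sqrt 2)\<^sup>2 * (real i + 1) / sqrt 2 ^ i)"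
proof -
 define c where "c = (ln (real A) + 4) * (real i + 1) / sqrt 2 ^ i"
 have lnA: "0 <= ln (real A)" using A by simp
 have c: "0 <= c" unfolding c_def using lnA by simp
 have sums: "(\<lambda>m. c * (real (Suc m) * (1 / sqrt 2) ^ m)) sums (c * (1 / (1 - 1 / sqrt 2)\<^sup>2))"
  by (intro sums_mult geometric_deriv_sums) simp
 have "(\<integral>\<^sup>+z. (\<Sum>m. ennreal (dd A (i + m) z)) \<partial>BMsp) = (\<Sum>m. \<integral>\<^sup>+z. ennreal (dd A (i + m) z) \<partial>BMsp)"
  by (rule nn_integral_suminf) auto
 also have "\<dots> <= (\<Sum>m. ennreal (c * (real (Suc m) * (1 / sqrt 2) ^ m)))"
 proof (rule suminf_le)
  fix m
  have "ln (real A) + 4 + real (i + m) <= (ln (real A) + 4) * ((real i + 1) * real (Suc m))"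
  proof -
   have "real (i + m) <= (ln (real A) + 4) * real (i + m)" using mult_right_mono[of 1 "ln (real A) + 4" "real (i + m)"] lnA by simp
   then have "ln (real A) + 4 + real (i + m) <= (ln (real A) + 4) * (real i + 1 + real m)"
    by (simp add: algebra_simps)
   also have "\<dots> <= (ln (real A) + 4) * ((real i + 1) * real (Suc m))"
    using lnA by (intro mult_left_mono) (auto simp: algebra_simps)
   finally show ?thesis .
  qed
  then have "(ln (real A) + 4 + real (i + m)) / sqrt 2 ^ (i + m) <= (ln (real A) + 4) * ((real i + 1) * real (Suc m)) / sqrt 2 ^ (i + m)"
   by (rule divide_right_mono) simp
  also have "\<dots> = c * (real (Suc m) * (1 / sqrt 2) ^ m)"
   by (simp add: c_def power_add power_divide)
  finally show "(\<integral>\<^sup>+z. ennreal (dd A (i + m) z) \<partial>BMsp) <= ennreal (c * (real (Suc m) * (1 / sqrt 2) ^ m))"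
   using nn_integral_dd[OF A, of "i + m"] by (auto intro: order_trans ennreal_leI)
 qed auto
 also have "\<dots> = ennreal (c * (1 / (1 - 1 / sqrt 2)\<^sup>2))"
  using sums c by (subst suminf_ennreal2) (auto simp: sums_iff)
 finally show ?thesis by (simp add: c_def mult_ac)
qed

lemma AE_good: "AE z in BMsp. good z"
proof -
 have "AE z in BMsp. (\<Sum>i. ennreal (dd A i z)) ~= \<infinity>" if "1 <= A" for A
 proof (rule nn_integral_PInf_AE)
  have "(\<integral>\<^sup>+z. (\<Sum>m. ennreal (dd A m z)) \<partial>BMsp) < \<top>"
   using nn_integral_sum_dd[OF that, of 0] by (simp add: le_less_trans ennreal_less_top)
  then show "(\<integral>\<^sup>+z. (\<Sum>m. ennreal (dd A m z)) \<partial>BMsp) ~= \<infinity>" by simp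
 qed measurable
 then have "AE z in BMsp. 1 <= A \<longrightarrow> (\<Sum>i. ennreal (dd A i z)) ~= \<top>" for A by (cases "1 <= A") auto
 then show ?thesis unfolding good_def by (simp add: AE_all_countable)
qed

lemma nn_integral_osc:
 assumes A: "1 <= A"
 shows "(\<integral>\<^sup>+z. ennreal (osc A i z) \<partial>BMsp) <= ennreal (2 * (ln (real A) + 4) / (1 - 1 / sqrt 2)\<^sup>2 * (real i + 1) / sqrt 2 ^ i)"
proof -
 have "(\<integral>\<^sup>+z. ennreal (osc A i z) \<partial>BMsp) <= (\<integral>\<^sup>+z. 2 * (\<Sum>m. ennreal (dd A (i + m) z)) \<partial>BMsp)"
 proof (rule nn_integral_mono)
  fix z
  show "ennreal (osc A i z) <= 2 * (\<Sum>m. ennreal (dd A (i + m) z))"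
  proof (cases "good z")
   case True
   have "summable (\<lambda>m. dd A (i + m) z)"
    using summable_ignore_initial_segment[OF good_summable[OF True A], of i] by (simp add: add.commute)
   then have "(\<Sum>m. ennreal (dd A (i + m) z)) = ennreal (\<Sum>m. dd A (i + m) z)"
    by (intro suminf_ennreal2) (auto simp: dd_nonneg[OF A])
   moreover have "0 <= (\<Sum>m. dd A (i + m) z)" by (intro suminf_nonneg \<open>summable _\<close>) (auto simp: dd_nonneg[OF A])
   ultimately show ?thesis using True by (simp add: osc_def ennreal_mult')
  qed (simp add: osc_def)
 qed
 also have "\<dots> = 2 * (\<integral>\<^sup>+z. (\<Sum>m. ennreal (dd A (i + m) z)) \<partial>BMsp)"
  by (rule nn_integral_cmult) measurable
 also have "\<dots> <= 2 * ennreal ((ln (real A) + 4) / (1 - 1 / sqrt 2)\<^sup>2 * (real i + 1) / sqrt 2 ^ i)"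
  by (intro mult_left_mono nn_integral_sum_dd A) simp
 also have "\<dots> = ennreal (2 * ((ln (real A) + 4) / (1 - 1 / sqrt 2)\<^sup>2 * (real i + 1) / sqrt 2 ^ i))"
  by (subst ennreal_mult') auto
 also have "2 * ((ln (real A) + 4) / (1 - 1 / sqrt 2)\<^sup>2 * (real i + 1) / sqrt 2 ^ i)
   = 2 * (ln (real A) + 4) / (1 - 1 / sqrt 2)\<^sup>2 * (real i + 1) / sqrt 2 ^ i"
  by (simp only: times_divide_eq_right times_divide_eq_left mult.assoc)
 finally show ?thesis .
qed

lemma bmW_0: "bmW z 0 = 0"
 by (simp add: bmW_def idx_def grid_def)

lemma bmW_continuous: "continuous_on {0..} (bmW z)"
proof (cases "good z")
 case True
 show ?thesis
  unfolding continuous_on_iff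
 proof (intro ballI allI impI)
  fix t e :: real assume t: "t \<in> {0..}" and e: "0 < e"
  obtain A :: nat where A: "t + 1 < real A" using reals_Archimedean2 by blast
  have A1: "1 <= A" using A t by auto
  have "0 < e / 2" using e by simp
  from suminf_exist_split[OF this good_summable[OF True A1]] obtain i where
   "norm (\<Sum>m. dd A (m + i) z) < e / 2" by auto
  then have osc: "osc A i z < e" using True by (simp add: osc_def add.commute)
  show "\<exists>d>0. \<forall>s\<in>{0..}. dist s t < d \<longrightarrow> dist (bmW z s) (bmW z t) < e"
  proof (intro exI[of _ "1 / 2 ^ i"] conjI ballI impI)
   fix s :: real assume s: "s \<in> {0..}" "dist s t < 1 / 2 ^ i"
   have i1: "1 / 2 ^ i <= (1::real)" by simp
   have "s < real A" using s(2) A i1 unfolding dist_real_def by linarith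
   then have "\<bar>bmW z s - bmW z t\<bar> <= osc A i z"
    using s t A by (intro bmW_osc) (auto simp: dist_real_def)
   then show "dist (bmW z s) (bmW z t) < e" using osc by (simp add: dist_real_def)
  qed simp
 qed
qed (simp add: bmW_def)

lemma bmW_lim_AE:
 assumes "0 <= t" shows "AE z in BMsp. (\<lambda>i. grid z i (idx t i)) \<longlonglongrightarrow> bmW z t"
proof -
 obtain A :: nat where tA: "t < real A" using reals_Archimedean2 by blast
 show ?thesis using AE_good by eventually_elim (use bmW_limit(1) assms tA in blast)
qed

lemma idx_tendsto:
 assumes "0 <= t" shows "(\<lambda>i. real (idx t i) / 2 ^ i) \<longlonglongrightarrow> t"
proof (rule real_tendsto_sandwich)
 show "\<forall>\<^sub>F i in sequentially. t - (1/2) ^ i <= real (idx t i) / 2 ^ i"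
 proof (rule always_eventually, rule allI)
  fix i
  have "t * 2 ^ i - 1 <= real (idx t i)" using idx_bounds(2)[OF assms, of i] by simp
  then have "(t * 2 ^ i - 1) / 2 ^ i <= real (idx t i) / 2 ^ i" by (rule divide_right_mono) simp
  then show "t - (1/2) ^ i <= real (idx t i) / 2 ^ i" by (simp add: diff_divide_distrib power_divide)
 qed
 show "\<forall>\<^sub>F i in sequentially. real (idx t i) / 2 ^ i <= t"
  using idx_bounds(1)[OF assms] by (intro always_eventually) (auto simp: field_simps)
 have "(\<lambda>i. t - (1/2::real) ^ i) \<longlonglongrightarrow> t - 0" by (intro tendsto_diff tendsto_const LIMSEQ_power_zero) simp
 then show "(\<lambda>i. t - (1/2::real) ^ i) \<longlonglongrightarrow> t" by simp
qed simp

lemma grid_diff: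
 assumes "a <= b" shows "grid z i b - grid z i a = (\<Sum>j=a..<b. lev z i (0, j)) / sqrt 2 ^ i"
proof -
 have "{..<b} = {..<a} \<union> {a..<b}" "{..<a} \<inter> {a..<b} = {}" using assms by auto
 then have "(\<Sum>j<b. lev z i (0, j)) = (\<Sum>j<a. lev z i (0, j)) + (\<Sum>j=a..<b. lev z i (0, j))"
  by (simp add: sum.union_disjoint)
 then show ?thesis by (simp add: grid_def add_divide_distrib)
qed

lemma (in prob_space) distributed_NN_iff:
 "distributed M lborel X std_normal_density \<longleftrightarrow> X \<in> borel_measurable M \<and> distr M borel X = NN"
proof -
 have "distr M lborel X = distr M borel X" by (rule distr_cong) auto
 then show ?thesis by (auto simp: distributed_def)
qed

lemma (in prob_space) distr_normalized_sum:
 assumes X: "iid_normal M X S" and I: "finite I" "I ~= {}" "I \<subseteq> S"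
 shows "distr M borel (\<lambda>\<omega>. (\<Sum>j\<in>I. X j \<omega>) / sqrt (real (card I))) = NN"
proof -
 have c: "0 < card I" using I by (simp add: card_gt_0_iff)
 have "distributed M lborel (\<lambda>x. \<Sum>i\<in>I. X i x) (normal_density (\<Sum>i\<in>I. 0) (sqrt (\<Sum>i\<in>I. 1\<^sup>2)))"
 proof (rule sum_indep_normal[OF I(1,2)])
  show "indep_vars (\<lambda>i. borel) X I" using iid_normal_indep_vars[OF X] I(3) by (rule indep_vars_subset)
  show "distributed M lborel (X i) (normal_density 0 1)" if "i \<in> I" for i
   using that I(3) iid_normal_measurable[OF X, of i] iid_normal_distr[OF X, of i] by (auto simp: distributed_NN_iff)
 qed auto
 then have "distributed M lborel (\<lambda>x. \<Sum>i\<in>I. X i x) (normal_density 0 (sqrt (real (card I))))" by simp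
 then have "distributed M lborel (\<lambda>x. ((\<Sum>i\<in>I. X i x) - 0) / sqrt (real (card I))) std_normal_density"
  using c by (subst (asm) normal_standard_normal_convert) auto
 then show ?thesis by (simp add: distributed_NN_iff)
qed

text \<open>Increments of \<open>bmW\<close> are almost sure limits of sums of level-i increments
  over disjoint index ranges; both the normal law and independence pass to the limit.\<close>

theorem std_brownian_motion_bmW: "std_brownian_motion BMsp bmW"
 unfolding std_brownian_motion_def
proof (intro conjI allI impI)
 show "(\<lambda>\<omega>. bmW \<omega> t) \<in> borel_measurable BMsp" for t by measurable
 show "AE \<omega> in BMsp. bmW \<omega> 0 = 0" by (simp add: bmW_0)
 show "AE \<omega> in BMsp. continuous_on {0..} (bmW \<omega>)" by (simp add: bmW_continuous)
next
 fix s t :: real assume st: "0 <= s \<and> s < t"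
 then have s0: "0 <= s" and t0: "0 <= t" by auto
 define n where "n = (\<lambda>i. idx t i - idx s i)"
 have le: "idx s i <= idx t i" for i using st by (intro idx_mono) auto
 have rn: "real (n i) = real (idx t i) - real (idx s i)" for i using le[of i] by (simp add: n_def of_nat_diff)
 have nlim: "(\<lambda>i. real (n i) / 2 ^ i) \<longlonglongrightarrow> t - s"
  unfolding rn diff_divide_distrib using st by (intro tendsto_diff idx_tendsto) auto
 have "\<forall>\<^sub>F i in sequentially. 0 < real (n i) / 2 ^ i"
  using order_tendstoD(1)[OF nlim] st by auto
 then obtain i0 where i0: "\<And>i. i >= i0 ==> 0 < n i"
  by (auto simp: eventually_sequentially zero_less_divide_iff)
 \<comment> \<open>Dividing by the actual number of cells, not by t - s, makes every
   \<open>Y i\<close> exactly standard normal, as \<open>distr_limit_eq\<close> requires. The offset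
   \<open>i0\<close> keeps the range of cells nonempty.\<close>
 define Y where "Y = (\<lambda>i z. (\<Sum>j=idx s (i + i0)..<idx t (i + i0). lev z (i + i0) (0, j)) / sqrt (real (card {idx s (i + i0)..<idx t (i + i0)})))"
 have "distr BMsp borel (\<lambda>z. (bmW z t - bmW z s) / sqrt (t - s)) = NN"
 proof (rule BM.distr_limit_eq)
  show "distr BMsp borel (Y i) = NN" for i
  proof -
   have iid: "iid_normal BMsp (\<lambda>j z. lev z (i + i0) (0, j)) UNIV"
    by (rule iid_normal_reindex[OF iid_lev_BM]) (auto simp: inj_on_def)
   show ?thesis unfolding Y_def
    by (rule BM.distr_normalized_sum[OF iid]) (use i0[of "i + i0"] in \<open>auto simp: n_def\<close>)
  qed
  show "Y i \<in> borel_measurable BMsp" for i unfolding Y_def by measurable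
  show "AE z in BMsp. (\<lambda>i. Y i z) \<longlonglongrightarrow> (bmW z t - bmW z s) / sqrt (t - s)"
   using bmW_lim_AE[OF s0] bmW_lim_AE[OF t0]
  proof eventually_elim
   case (elim z)
   have e: "Y i z = (grid z (i + i0) (idx t (i + i0)) - grid z (i + i0) (idx s (i + i0))) / sqrt (real (n (i + i0)) / 2 ^ (i + i0))" for i
    unfolding Y_def grid_diff[OF le] by (simp add: n_def real_sqrt_divide real_sqrt_power)
   have "(\<lambda>i. (grid z i (idx t i) - grid z i (idx s i)) / sqrt (real (n i) / 2 ^ i)) \<longlonglongrightarrow> (bmW z t - bmW z s) / sqrt (t - s)"
    using st by (intro tendsto_divide tendsto_diff elim tendsto_real_sqrt nlim) auto
   then show ?case unfolding e by (rule LIMSEQ_ignore_initial_segment)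
  qed
 qed measurable
 then have "distributed BMsp lborel (\<lambda>z. (bmW z t - bmW z s - 0) / sqrt (t - s)) std_normal_density"
  by (simp add: BM.distributed_NN_iff)
 then show "distributed BMsp lborel (\<lambda>\<omega>. bmW \<omega> t - bmW \<omega> s) (\<lambda>x. ennreal (normal_density 0 (sqrt (t - s)) x))"
  using st by (subst BM.normal_standard_normal_convert) auto
next
 fix ts :: "real list" assume ts: "sorted_wrt (<) ts \<and> (\<forall>t\<in>set ts. 0 <= t)"
 define I where "I = {..<length ts - 1}"
 have nn: "0 <= ts ! l" if "l < length ts" for l using ts that by auto
 have incr: "ts ! k <= ts ! l" if "k <= l" "l < length ts" for k l
  using ts that by (cases "k = l") (auto simp: sorted_wrt_iff_nth_less less_imp_le)
 show "BM.indep_vars (\<lambda>_. borel) (\<lambda>i \<omega>. bmW \<omega> (ts ! Suc i) - bmW \<omega> (ts ! i)) {..<length ts - 1}"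
  unfolding I_def[symmetric]
 proof (rule BM.indep_vars_limit[where Y="\<lambda>i l z. grid z i (idx (ts ! Suc l) i) - grid z i (idx (ts ! l) i)"])
  fix i
  define K where "K = (\<lambda>l. {idx (ts ! l) i..<idx (ts ! Suc l) i})"
  have iid: "iid_normal BMsp (\<lambda>j z. lev z i (0, j)) UNIV"
   by (rule iid_normal_reindex[OF iid_lev_BM]) (auto simp: inj_on_def)
  have "disjoint_family_on K I"
   unfolding disjoint_family_on_def
  proof (intro ballI impI)
   have *: "K k \<inter> K l = {}" if "k < l" "l \<in> I" for k l
   proof -
    have "idx (ts ! Suc k) i <= idx (ts ! l) i" using that by (intro idx_mono incr) (auto simp: I_def)
    then show ?thesis by (auto simp: K_def)
   qed
   fix k l assume "k \<in> I" "l \<in> I" "k ~= l"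
   then show "K k \<inter> K l = {}" using *[of k l] *[of l k] by (cases "k < l") auto
  qed
  then have "BM.indep_vars (\<lambda>l. Pi\<^sub>M (K l) (\<lambda>_. borel)) (\<lambda>l z. restrict (\<lambda>j. lev z i (0, j)) (K l)) I"
   by (intro BM.indep_vars_restrict[OF BM.iid_normal_indep_vars[OF iid]]) auto
  then have "BM.indep_vars (\<lambda>_. borel) (\<lambda>l z. (\<lambda>f. (\<Sum>j\<in>K l. f j) / sqrt 2 ^ i) (restrict (\<lambda>j. lev z i (0, j)) (K l))) I"
   by (rule BM.indep_vars_compose2) (auto intro!: borel_measurable_divide borel_measurable_sum)
  moreover have "grid z i (idx (ts ! Suc l) i) - grid z i (idx (ts ! l) i) = (\<lambda>f. (\<Sum>j\<in>K l. f j) / sqrt 2 ^ i) (restrict (\<lambda>j. lev z i (0, j)) (K l))"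
   if "l \<in> I" for l z
   using that by (subst grid_diff) (auto simp: K_def I_def intro!: idx_mono incr)
  ultimately show "BM.indep_vars (\<lambda>_. borel) (\<lambda>l z. grid z i (idx (ts ! Suc l) i) - grid z i (idx (ts ! l) i)) I"
   by (subst BM.indep_vars_cong[OF refl _ refl]) auto
 next
  fix l assume l: "l \<in> I"
  then have "0 <= ts ! l" "0 <= ts ! Suc l" by (auto simp: I_def intro!: nn)
  from bmW_lim_AE[OF this(1)] bmW_lim_AE[OF this(2)]
  show "AE z in BMsp. (\<lambda>i. grid z i (idx (ts ! Suc l) i) - grid z i (idx (ts ! l) i)) \<longlonglongrightarrow> bmW z (ts ! Suc l) - bmW z (ts ! l)"
   by eventually_elim (rule tendsto_diff)
 qed (auto simp: I_def)
qed

section \<open>Dyadic coupling of Poisson counts with normal sums\<close>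

text \<open>An in-place orthonormal Haar transform. After i rounds, position k * 2^i holds the
  normalised sum of the k-th block of length 2^i; the difference formed in round i + 1 is stored at
  the odd multiple of 2^i. Working in place makes each round a pairwise rotation.\<close>

fun haar :: "(nat => real) => nat => nat => real" where
 "haar g 0 p = g p"
| "haar g (Suc i) p =
  (if 2 ^ Suc i dvd p then (haar g i p + haar g i (p + 2 ^ i)) / sqrt 2
   else if 2 ^ i dvd p then (haar g i (p - 2 ^ i) - haar g i p) / sqrt 2
   else haar g i p)"

lemma (in prob_space) iid_haar:
 assumes "iid_normal M g UNIV"
 shows "iid_normal M (\<lambda>p \<omega>. haar (\<lambda>q. g q \<omega>) i p) UNIV"
proof (induction i)
 case 0
 then show ?case using assms by simp
next
 case (Suc i)
 show ?case
 proof (rule iid_normal_rotate[OF Suc, where P="{p::nat. 2 ^ Suc i dvd p}" and f="\<lambda>p. p + 2 ^ i"])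
  have no: "\<not> 2 ^ Suc i dvd p + 2 ^ i" if "2 ^ Suc i dvd p" for p :: nat
  proof
   assume "2 ^ Suc i dvd p + 2 ^ i"
   then have "(2::nat) ^ Suc i dvd 2 ^ i" using that by (simp add: dvd_add_right_iff)
   then show False by (auto dest: dvd_imp_le)
  qed
  have yes: "2 ^ i dvd p" if "2 ^ Suc i dvd p" for p :: nat
   using that by (rule power_le_dvd) simp
  show "(\<lambda>p. p + 2 ^ i) ` {p::nat. 2 ^ Suc i dvd p} \<inter> {p. 2 ^ Suc i dvd p} = {}" using no by auto
  fix s \<omega> assume s: "s \<in> {p. (2::nat) ^ Suc i dvd p}"
  then show "haar (\<lambda>q. g q \<omega>) (Suc i) (s + 2 ^ i) = (haar (\<lambda>q. g q \<omega>) i s - haar (\<lambda>q. g q \<omega>) i (s + 2 ^ i)) / sqrt 2"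
   using no[of s] yes[of s] by simp
 next
  fix s \<omega> assume s: "s \<notin> {p. (2::nat) ^ Suc i dvd p}" "s \<notin> (\<lambda>p. p + 2 ^ i) ` {p. 2 ^ Suc i dvd p}"
  have "\<not> 2 ^ i dvd s"
  proof
   assume "2 ^ i dvd s"
   then obtain m where m: "s = 2 ^ i * m" by (rule dvdE)
   show False
   proof (cases "even m")
    case True
    then show False using s(1) m by (auto elim!: evenE)
   next
    case False
    then obtain b where "m = 2 * b + 1" by (rule oddE)
    then have "s = 2 ^ Suc i * b + 2 ^ i" using m by (simp add: algebra_simps)
    then show False using s(2) by auto
   qed
  qed
  then show "haar (\<lambda>q. g q \<omega>) (Suc i) s = haar (\<lambda>q. g q \<omega>) i s" using s(1) by simp
 qed auto
qed

definition hsum :: "(nat => real) => nat => nat => real" where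
 "hsum g i k = haar g i (k * 2 ^ i)"

definition hdiff :: "(nat => real) => nat => nat => real" where
 "hdiff g i k = haar g (Suc i) ((2 * k + 1) * 2 ^ i)"

lemma hsum_Suc: "hsum g (Suc i) k = (hsum g i (2 * k) + hsum g i (2 * k + 1)) / sqrt 2"
 by (simp add: hsum_def algebra_simps)

lemma hdiff_eq: "hdiff g i k = (hsum g i (2 * k) - hsum g i (2 * k + 1)) / sqrt 2"
proof -
 have "\<not> 2 ^ Suc i dvd (2 * k + 1) * 2 ^ i"
 proof
  assume "2 ^ Suc i dvd (2 * k + 1) * 2 ^ i"
  then have "2 * 2 ^ i dvd (2 * k + 1) * 2 ^ i" by simp
  then have "2 dvd 2 * k + 1" using dvd_times_right_cancel_iff[of "2 ^ i" 2 "2 * k + 1"] by simp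
  then show False by simp
 qed
 then show ?thesis by (simp add: hdiff_def hsum_def algebra_simps)
qed

lemma hsum_children:
 "hsum g i (2 * k) = (hsum g (Suc i) k + hdiff g i k) / sqrt 2"
 "hsum g i (2 * k + 1) = (hsum g (Suc i) k - hdiff g i k) / sqrt 2"
 unfolding hsum_Suc hdiff_eq by (simp_all add: field_simps)

text \<open>A round R + 1 changes only multiples of 2^R. A difference stored at an odd multiple of
  2^i with i < R is thus never touched again, and all differences up to R can be read off one
  family.\<close>

lemma hdiff_stable:
 assumes "Suc i <= R" shows "haar g R ((2 * k + 1) * 2 ^ i) = hdiff g i k"
 using assms
proof (induction R rule: dec_induct)
 case (step R)
 have n: "\<not> 2 ^ R dvd (2 * k + 1) * 2 ^ i"
 proof
  assume "2 ^ R dvd (2 * k + 1) * 2 ^ i"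
  then have "2 ^ Suc i dvd (2 * k + 1) * 2 ^ i" using step(1) by (rule power_le_dvd)
  then have "2 * 2 ^ i dvd (2 * k + 1) * 2 ^ i" by simp
  then have "2 dvd 2 * k + 1" using dvd_times_right_cancel_iff[of "2 ^ i" 2 "2 * k + 1"] by simp
  then show False by simp
 qed
 then have "\<not> 2 ^ Suc R dvd (2 * k + 1) * 2 ^ i" using power_le_dvd[of 2 "Suc R" _ R] by auto
 then show ?case using n step by simp
qed (simp add: hdiff_def)

lemma iid_normal_cong:
 assumes "iid_normal M X S" "\<And>i \<omega>. i \<in> S ==> X i \<omega> = Y i \<omega>"
 shows "iid_normal M Y S"
proof -
 have e: "X i = Y i" if "i \<in> S" for i using assms(2)[OF that] by auto
 show ?thesis
 proof (rule iid_normal_cofinalI)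
  show "Y i \<in> borel_measurable M" if "i \<in> S" for i
   using iid_normal_measurable[OF assms(1) that] e[OF that] by simp
  fix T assume T: "finite T" "T \<subseteq> S"
  have "{\<omega> \<in> space M. \<forall>i\<in>T. X i \<omega> \<in> A i} = {\<omega> \<in> space M. \<forall>i\<in>T. Y i \<omega> \<in> A i}" for A
  proof -
   have "X i = Y i" if "i \<in> T" for i using e T(2) that by blast
   then show ?thesis by (simp cong: ball_cong)
  qed
  then show "\<exists>T'. finite T' \<and> T \<subseteq> T' \<and> T' \<subseteq> S \<and>
   (\<forall>A. (\<forall>i. A i \<in> sets borel) \<longrightarrow> measure M {\<omega> \<in> space M. \<forall>i\<in>T'. Y i \<omega> \<in> A i} = (\<Prod>i\<in>T'. measure NN (A i)))"
   using iid_normalD[OF assms(1) T] T by (intro exI[of _ T]) auto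
 qed
qed

text \<open>Haar differences renumbered from the root: in a binary tree with 2^R leaves, (d, k) is
  the k-th node at depth d, whose block has length 2^(R - d).\<close>

definition noise :: "(nat => real) => nat => nat \<times> nat => real" where
 "noise g R p = hdiff g (R - Suc (fst p)) (snd p)"

text \<open>All these differences are entries of the single transform \<open>haar g R\<close>, at
  positions (odd number) * 2^i; distinct nodes give distinct positions because the odd part and the
  power of 2 are determined by the position.\<close>

lemma (in prob_space) iid_noise:
 assumes "iid_normal M g UNIV"
 shows "iid_normal M (\<lambda>p \<omega>. noise (\<lambda>q. g q \<omega>) R p) {p. fst p < R}"
proof -
 let ?h = "\<lambda>p. (2 * snd p + 1) * 2 ^ (R - Suc (fst p)) :: nat"
 have "inj_on ?h {p. fst p < R}"
 proof (rule inj_onI)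
  fix x y :: "nat \<times> nat" assume x: "x \<in> {p. fst p < R}" and y: "y \<in> {p. fst p < R}" and e: "?h x = ?h y"
  have aux: "i = j \<and> a = b" if h: "(2 * a + 1) * 2 ^ i = (2 * b + 1) * 2 ^ j" "i <= j" for a b i j :: nat
  proof -
   obtain d where d: "j = i + d" using h(2) le_Suc_ex by blast
   have "(2 * a + 1) * 2 ^ i = ((2 * b + 1) * 2 ^ d) * 2 ^ i"
    using h(1) unfolding d power_add by (simp only: mult_ac)
   then have e: "2 * a + 1 = (2 * b + 1) * 2 ^ d"
    by (metis mult_right_cancel power_not_zero zero_neq_numeral)
   have "d = 0"
   proof (rule ccontr)
    assume "d ~= 0"
    then have "even ((2 * b + 1) * 2 ^ d)" by simp
    then show False unfolding e[symmetric] by simp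
   qed
   then show ?thesis using d e by simp
  qed
  have "R - Suc (fst x) = R - Suc (fst y) \<and> snd x = snd y"
   using aux[OF e] aux[OF e[symmetric]] by (cases "R - Suc (fst x) <= R - Suc (fst y)") auto
  then show "x = y" using x y by (auto simp: prod_eq_iff)
 qed
 then have "iid_normal M (\<lambda>p \<omega>. haar (\<lambda>q. g q \<omega>) R (?h p)) {p. fst p < R}"
  by (intro iid_normal_reindex[OF iid_haar[OF assms]]) auto
 moreover have "haar g R (?h p) = noise g R p" if "fst p < R" for g p
  unfolding noise_def using that by (intro hdiff_stable) auto
 ultimately show ?thesis by (rule iid_normal_cong) simp
qed

text \<open>A total x is divided down the tree: the count of a node is split binomially between its
  children, with the quantile transform driven by the Haar difference of the same node. Counts and
  normal sums thereby use the same source of randomness at every node.\<close>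

fun cnt :: "(nat \<times> nat => real) => nat => nat => nat => nat" where
 "cnt z x 0 k = x"
| "cnt z x (Suc d) k =
  (if even k then half_split (cnt z x d (k div 2)) (z (d, k div 2))
   else cnt z x d (k div 2) - half_split (cnt z x d (k div 2)) (z (d, k div 2)))"

lemma cnt_children:
 "cnt z x (Suc d) (2 * k) = half_split (cnt z x d k) (z (d, k))"
 "cnt z x (Suc d) (2 * k + 1) = cnt z x d k - half_split (cnt z x d k) (z (d, k))"
 by auto

lemma cnt_children_sum: "cnt z x (Suc d) (2 * k) + cnt z x (Suc d) (2 * k + 1) = cnt z x d k"
 unfolding cnt_children using half_split_le by simp

lemma sum_double: "(\<Sum>k<2 * n. f k) = (\<Sum>k<n. f (2 * k) + f (2 * k + 1 :: nat))"
 for f :: "nat => 'a :: comm_monoid_add"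
 by (induction n) (auto simp: add.assoc)

lemma prod_double: "(\<Prod>k<2 * n. f k) = (\<Prod>k<n. f (2 * k) * f (2 * k + 1 :: nat))"
 for f :: "nat => 'a :: comm_monoid_mult"
 by (induction n) (auto simp: mult.assoc)

lemma cnt_sum: "(\<Sum>k<2 ^ d. cnt z x d k) = x"
proof (induction d)
 case (Suc d)
 have "(\<Sum>k<2 ^ Suc d. cnt z x (Suc d) k) = (\<Sum>k<2 * 2 ^ d. cnt z x (Suc d) k)" by simp
 also have "\<dots> = (\<Sum>k<2 ^ d. cnt z x d k)" unfolding sum_double cnt_children_sum ..
 finally show ?case using Suc by simp
qed simp

lemma ball_double: "(\<forall>k<2 * n. P k) \<longleftrightarrow> (\<forall>k<n. P (2 * k) \<and> P (2 * k + 1 :: nat))"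
proof safe
 fix k assume *: "\<forall>k<n. P (2 * k) \<and> P (2 * k + 1)" and k: "k < 2 * n"
 show "P k"
 proof (cases "even k")
  case True
  then show ?thesis using * k by (auto elim!: evenE)
 next
  case False
  then show ?thesis using * k by (auto elim!: oddE)
 qed
qed auto

text \<open>The leaf counts determine the counts at all inner nodes, so fixing them is a rectangle
  event in the noise with one binomial condition per inner node. The product of the binomial
  probabilities telescopes to the multinomial one.\<close>

lemma cnt_event:
 fixes v :: "nat => nat"
 assumes "(\<Sum>k<2 ^ d. v k) = x"
 shows "\<exists>A. (\<forall>p. A p \<in> sets borel) \<and>
  (\<forall>z. (\<forall>k<2 ^ d. cnt z x d k = v k) \<longleftrightarrow> (\<forall>p\<in>Sigma {..<d} (\<lambda>e. {..<2 ^ e}). z p \<in> A p)) \<and>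
  (\<Prod>p\<in>Sigma {..<d} (\<lambda>e. {..<2 ^ e}). measure NN (A p)) = fact x / (\<Prod>k<2 ^ d. fact (v k)) / 2 ^ (d * x)"
 using assms
proof (induction d arbitrary: v)
 case 0
 then show ?case by (intro exI[of _ "\<lambda>_. {}"]) auto
next
 case (Suc d)
 define s where "s = (\<lambda>k. v (2 * k) + v (2 * k + 1))"
 have s: "(\<Sum>k<2 ^ d. s k) = x"
  using Suc.prems sum_double[of v "2 ^ d"] by (simp add: s_def)
 obtain A where A: "\<And>p. A p \<in> sets borel"
  "\<And>z. (\<forall>k<2 ^ d. cnt z x d k = s k) \<longleftrightarrow> (\<forall>p\<in>Sigma {..<d} (\<lambda>e. {..<2 ^ e}). z p \<in> A p)"
  "(\<Prod>p\<in>Sigma {..<d} (\<lambda>e. {..<2 ^ e}). measure NN (A p)) = fact x / (\<Prod>k<2 ^ d. fact (s k)) / 2 ^ (d * x)"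
  using Suc.IH[OF s] by blast
 define B where "B = (\<lambda>p. if fst p = d then {y. half_split (s (snd p)) y = v (2 * snd p)} else A p)"
 have Sig: "Sigma {..<Suc d} (\<lambda>e. {..<2 ^ e}) = Sigma {..<d} (\<lambda>e. {..<2 ^ e}) \<union> {d} \<times> {..<2 ^ d :: nat}"
  by (auto simp: less_Suc_eq)
 show ?case
 proof (intro exI[of _ B] conjI allI)
  show "B p \<in> sets borel" for p
   using A(1) measurable_sets[OF half_split_measurable, of "{v (2 * snd p)}" "s (snd p)"]
   by (auto simp: B_def vimage_def)
  fix z
  have "(\<forall>k<2 ^ Suc d. cnt z x (Suc d) k = v k) \<longleftrightarrow> (\<forall>k<2 ^ d. cnt z x (Suc d) (2 * k) = v (2 * k) \<and> cnt z x (Suc d) (2 * k + 1) = v (2 * k + 1))"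
   using ball_double[of "2 ^ d" "\<lambda>k. cnt z x (Suc d) k = v k"] by simp
  also have "\<dots> \<longleftrightarrow> (\<forall>k<2 ^ d. cnt z x d k = s k \<and> half_split (s k) (z (d, k)) = v (2 * k))"
  proof -
   have "cnt z x (Suc d) (2 * k) = v (2 * k) \<and> cnt z x (Suc d) (2 * k + 1) = v (2 * k + 1) \<longleftrightarrow>
    cnt z x d k = s k \<and> half_split (s k) (z (d, k)) = v (2 * k)" for k
    using cnt_children_sum[of z x d k] cnt_children(1)[of z x d k] by (auto simp: s_def simp del: cnt.simps)
   then show ?thesis by simp
  qed
  also have "\<dots> \<longleftrightarrow> (\<forall>p\<in>Sigma {..<d} (\<lambda>e. {..<2 ^ e}). z p \<in> A p) \<and> (\<forall>k<2 ^ d. half_split (s k) (z (d, k)) = v (2 * k))"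
   using A(2)[of z] by auto
  also have "\<dots> \<longleftrightarrow> (\<forall>p\<in>Sigma {..<Suc d} (\<lambda>e. {..<2 ^ e}). z p \<in> B p)"
  proof -
   have "(\<forall>p\<in>Sigma {..<Suc d} (\<lambda>e. {..<2 ^ e}). z p \<in> B p) \<longleftrightarrow>
    (\<forall>p\<in>Sigma {..<d} (\<lambda>e. {..<2 ^ e}). z p \<in> B p) \<and> (\<forall>p\<in>{d} \<times> {..<2 ^ d}. z p \<in> B p)"
    unfolding Sig ball_Un ..
   also have "(\<forall>p\<in>Sigma {..<d} (\<lambda>e. {..<2 ^ e}). z p \<in> B p) \<longleftrightarrow> (\<forall>p\<in>Sigma {..<d} (\<lambda>e. {..<2 ^ e}). z p \<in> A p)"
    by (rule ball_cong) (auto simp: B_def)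
   also have "(\<forall>p\<in>{d} \<times> {..<2 ^ d}. z p \<in> B p) \<longleftrightarrow> (\<forall>k<2 ^ d. half_split (s k) (z (d, k)) = v (2 * k))"
    by (auto simp: B_def)
   finally show ?thesis by simp
  qed
  finally show "(\<forall>k<2 ^ Suc d. cnt z x (Suc d) k = v k) \<longleftrightarrow> (\<forall>p\<in>Sigma {..<Suc d} (\<lambda>e. {..<2 ^ e}). z p \<in> B p)" .
 next
  have "(\<Prod>p\<in>Sigma {..<Suc d} (\<lambda>e. {..<2 ^ e}). measure NN (B p))
   = (\<Prod>p\<in>Sigma {..<d} (\<lambda>e. {..<2 ^ e}). measure NN (B p)) * (\<Prod>p\<in>{d} \<times> {..<2 ^ d}. measure NN (B p))"
   unfolding Sig by (rule prod.union_disjoint) auto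
  also have "(\<Prod>p\<in>Sigma {..<d} (\<lambda>e. {..<2 ^ e}). measure NN (B p)) = (\<Prod>p\<in>Sigma {..<d} (\<lambda>e. {..<2 ^ e}). measure NN (A p))"
   by (rule prod.cong) (auto simp: B_def)
  also have "(\<Prod>p\<in>{d} \<times> {..<2 ^ d :: nat}. measure NN (B p)) = (\<Prod>k<2 ^ d. measure NN (B (d, k)))"
   by (rule prod.reindex_bij_witness[of _ "\<lambda>k. (d, k)" snd]) auto
  also have "\<dots> = (\<Prod>k<2 ^ d. fact (s k) / (fact (v (2 * k)) * fact (v (2 * k + 1))) / 2 ^ s k)"
  proof (rule prod.cong)
   fix k
   show "measure NN (B (d, k)) = fact (s k) / (fact (v (2 * k)) * fact (v (2 * k + 1))) / 2 ^ s k"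
    by (simp add: B_def measure_half_split bin_half_def s_def binomial_fact)
  qed simp
  also have "\<dots> = (\<Prod>k<2 ^ d. fact (s k)) / (\<Prod>k<2 ^ d. fact (v (2 * k)) * fact (v (2 * k + 1))) / 2 ^ (\<Sum>k<2 ^ d. s k)"
   by (simp add: prod_dividef power_sum prod.distrib)
  also have "(\<Prod>k<2 ^ d. fact (v (2 * k)) * fact (v (2 * k + 1)) :: real) = (\<Prod>k<2 ^ Suc d. fact (v k))"
   using prod_double[of "\<lambda>k. fact (v k) :: real" "2 ^ d"] by simp
  finally show "(\<Prod>p\<in>Sigma {..<Suc d} (\<lambda>e. {..<2 ^ e}). measure NN (B p)) = fact x / (\<Prod>k<2 ^ Suc d. fact (v k)) / 2 ^ (Suc d * x)"
   unfolding A(3) s by (simp add: power_add prod_zero_iff field_simps)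
 qed
qed

section \<open>Propagation of coupling errors through the tree\<close>

lemma abs_combine: "a = x + y ==> \<bar>y\<bar> <= d ==> \<bar>x\<bar> <= c ==> \<bar>a\<bar> <= c + d"
 for a c d x y :: real
 by linarith

lemma abs_combine2: "\<bar>a - b\<bar> <= c + d ==> \<bar>b\<bar> <= e ==> \<bar>a\<bar> <= e + d + c"
 for a b c d e :: real
 by linarith

text \<open>The local error at a node adds to the partial sums a tent supported inside that node, of
  height half that error; only the nodes on the path to leaf k matter. The induction needs the
  stronger form with c, for points interpolated between neighbouring partial sums: the midpoint of a
  parent becomes a grid point one level deeper.\<close>

lemma tree_interpolation:
 fixes e \<delta> :: "nat => nat => real"
 assumes ev: "\<And>d k. d < R ==> e (Suc d) (2 * k) = (e d k + \<delta> d k) / 2"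
  and od: "\<And>d k. d < R ==> e (Suc d) (2 * k + 1) = (e d k - \<delta> d k) / 2"
 defines "P \<equiv> \<lambda>d k. (\<Sum>j<k. e d j) - real k / 2 ^ d * e 0 0"
 assumes "d <= R" "k < 2 ^ d" "0 <= c" "c <= 1"
 shows "\<bar>(1 - c) * P d k + c * P d (Suc k)\<bar> <= (\<Sum>i<d. \<bar>\<delta> i (k div 2 ^ (d - i))\<bar>) / 2"
 using assms(4-7)
proof (induction d arbitrary: k c)
 case 0
 then show ?case by (simp add: P_def)
next
 case (Suc d)
 define k' where "k' = k div 2"
 have k': "k' < 2 ^ d" using Suc.prems by (auto simp: k'_def)
 define p q D where "p = P d k'" "q = P d (Suc k')" "D = \<delta> d k'"
 have dR: "d < R" "d <= R" using Suc.prems by auto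
 have S2: "(\<Sum>j<2 * j'. e (Suc d) j) = (\<Sum>j<j'. e d j)" for j'
  unfolding sum_double ev[OF dR(1)] od[OF dR(1)] by (simp add: field_simps)
 have P_even: "P (Suc d) (2 * j) = P d j" for j
  unfolding P_def S2 by simp
 have P_mid: "P (Suc d) (2 * k' + 1) = (p + q) / 2 + D / 2"
 proof -
  have s1: "(\<Sum>j<2 * k' + 1. e (Suc d) j) = (\<Sum>j<k'. e d j) + (e d k' + D) / 2"
   using S2[of k'] ev[OF dR(1), of k'] by (simp add: p_q_D_def)
  have f1: "real (2 * k' + 1) / 2 ^ Suc d = (real k' / 2 ^ d + real (Suc k') / 2 ^ d) / 2"
   by (simp add: field_simps)
  have s2: "(\<Sum>j<Suc k'. e d j) = (\<Sum>j<k'. e d j) + e d k'" by simp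
  have "P (Suc d) (2 * k' + 1) = ((\<Sum>j<k'. e d j) + (e d k' + D) / 2) - (real k' / 2 ^ d + real (Suc k') / 2 ^ d) / 2 * e 0 0"
   unfolding P_def s1 f1 ..
  moreover have "p = (\<Sum>j<k'. e d j) - real k' / 2 ^ d * e 0 0" "q = ((\<Sum>j<k'. e d j) + e d k') - real (Suc k') / 2 ^ d * e 0 0"
   unfolding p_q_D_def P_def s2 by (rule refl)+
  moreover have "(S + (E + F) / 2) - (a + b) / 2 * c = ((S - a * c) + ((S + E) - b * c)) / 2 + F / 2" for S E F a b c :: real
   by (simp add: field_simps)
  ultimately show ?thesis by (simp only:)
 qed
 have sums: "(\<Sum>i<Suc d. \<bar>\<delta> i (k div 2 ^ (Suc d - i))\<bar>) = (\<Sum>i<d. \<bar>\<delta> i (k' div 2 ^ (d - i))\<bar>) + \<bar>D\<bar>"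
 proof -
  have "k div 2 ^ (Suc d - i) = k' div 2 ^ (d - i)" if "i < d" for i
   using that by (simp add: k'_def Suc_diff_le div_mult2_eq)
  then have "(\<Sum>i<d. \<bar>\<delta> i (k div 2 ^ (Suc d - i))\<bar>) = (\<Sum>i<d. \<bar>\<delta> i (k' div 2 ^ (d - i))\<bar>)"
   by (intro sum.cong) auto
  then show ?thesis by (simp add: k'_def p_q_D_def)
 qed
 have IH: "\<bar>(1 - b) * p + b * q\<bar> <= (\<Sum>i<d. \<bar>\<delta> i (k' div 2 ^ (d - i))\<bar>) / 2" if "0 <= b" "b <= 1" for b
  using Suc.IH[OF dR(2) k' that] by (simp add: p_q_D_def)
 show ?case
 proof (cases "even k")
  case True
  then have k: "k = 2 * k'" by (simp add: k'_def)
  have "(1 - c) * P (Suc d) k + c * P (Suc d) (Suc k) = ((1 - c / 2) * p + (c / 2) * q) + c * D / 2"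
   unfolding k P_even using P_mid by (simp add: p_q_D_def field_simps)
  moreover have "\<bar>c * D / 2\<bar> <= \<bar>D\<bar> / 2" using Suc.prems by (simp add: abs_mult mult_left_le_one_le)
  moreover have "\<bar>(1 - c / 2) * p + (c / 2) * q\<bar> <= (\<Sum>i<d. \<bar>\<delta> i (k' div 2 ^ (d - i))\<bar>) / 2"
   using Suc.prems by (intro IH) auto
  ultimately show ?thesis unfolding sums add_divide_distrib by (rule abs_combine)
 next
  case False
  then have k: "k = 2 * k' + 1" by (simp add: k'_def)
  have Sk: "Suc k = 2 * Suc k'" using k by simp
  have "(1 - c) * P (Suc d) k + c * P (Suc d) (Suc k) = ((1 - (1 + c) / 2) * p + ((1 + c) / 2) * q) + (1 - c) * D / 2"
   unfolding Sk P_even unfolding k P_mid by (simp add: p_q_D_def field_simps)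
  moreover have "\<bar>(1 - c) * D / 2\<bar> <= \<bar>D\<bar> / 2" using Suc.prems by (simp add: abs_mult mult_left_le_one_le)
  moreover have "\<bar>(1 - (1 + c) / 2) * p + ((1 + c) / 2) * q\<bar> <= (\<Sum>i<d. \<bar>\<delta> i (k' div 2 ^ (d - i))\<bar>) / 2"
   using Suc.prems by (intro IH) auto
  ultimately show ?thesis unfolding sums add_divide_distrib by (rule abs_combine)
 qed
qed

text \<open>Induction with 4 * r m kept on the left as a potential; 4 = 1 / (1 - 3/4).\<close>

lemma contraction_sum:
 fixes r c :: "nat => real"
 assumes "\<And>i. i < n ==> r (Suc i) <= 3 / 4 * r i + c i" "\<And>i. 0 <= r i"
 shows "(\<Sum>i<n. r i) <= 4 * r 0 + 4 * (\<Sum>i<n. c i)"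
proof -
 have "(\<Sum>i<m. r i) + 4 * r m <= 4 * r 0 + 4 * (\<Sum>i<m. c i)" if "m <= n" for m
  using that
 proof (induction m)
  case (Suc m)
  then show ?case using assms(1)[of m] by (simp add: algebra_simps)
 qed simp
 from this[of n] show ?thesis using assms(2)[of n] by simp
qed

text \<open>The quantile bound is centred with sqrt x for the random count x, while the normal tree
  uses the mean m; replacing one by the other costs (sqrt x - sqrt m) * z. Square roots stabilise
  the variance, so this gap can be tracked: a child inherits the gap divided by sqrt 2 plus a fresh
  error b, and (a / sqrt 2 + b)^2 <= 3/4 a^2 + 3 b^2 contracts.\<close>

lemma half_split_node_bounds:
 obtains C where "C >= 1"
  "\<And>x z m. 0 <= m ==> \<bar>2 * real (half_split x z) - real x - sqrt m * z\<bar> <= C * (1 + z\<^sup>2) + ((sqrt x - sqrt m)\<^sup>2 + z\<^sup>2) / 2"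
  "\<And>x z m c. 0 <= m ==> c = half_split x z \<or> c = x - half_split x z ==>
   (sqrt c - sqrt (m / 2))\<^sup>2 <= 3 / 4 * (sqrt x - sqrt m)\<^sup>2 + 6 * (C + 1)\<^sup>2 * (1 + z\<^sup>2)"
proof -
 obtain C where C: "C >= 1" "\<And>n z. \<bar>2 * real (half_split n z) - real n - sqrt n * z\<bar> <= C * (1 + z\<^sup>2)"
  using half_split_bound by blast
 show ?thesis
 proof (rule that[OF C(1)])
  fix x :: nat and z m :: real assume m: "0 <= m"
  have "2 * real (half_split x z) - real x - sqrt m * z = (2 * real (half_split x z) - real x - sqrt x * z) + (sqrt x - sqrt m) * z"
   by (simp add: algebra_simps)
  moreover have "\<bar>(sqrt x - sqrt m) * z\<bar> <= ((sqrt x - sqrt m)\<^sup>2 + z\<^sup>2) / 2"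
   using sum_squares_bound[of "\<bar>sqrt x - sqrt m\<bar>" "\<bar>z\<bar>"] by (simp add: abs_mult)
  ultimately show "\<bar>2 * real (half_split x z) - real x - sqrt m * z\<bar> <= C * (1 + z\<^sup>2) + ((sqrt x - sqrt m)\<^sup>2 + z\<^sup>2) / 2"
   using C(2)[of x z] by linarith
  fix c assume c: "c = half_split x z \<or> c = x - half_split x z"
  have cx: "\<bar>2 * real c - real x\<bar> = \<bar>2 * real (half_split x z) - real x\<bar>" "c <= x"
   using c half_split_le[of x z] by (auto simp: of_nat_diff)
  define A where "A = (C + 1) * (1 + \<bar>z\<bar>)"
  have A0: "0 <= A" using C(1) by (simp add: A_def)
  \<comment> \<open>For z up to sqrt x the quantile bound is divided by a multiple of sqrt x; for
    larger z the trivial bound x on the deviation suffices.\<close>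
  have key: "\<bar>sqrt c - sqrt (x / 2)\<bar> <= A"
  proof (cases "x = 0")
   case True
   then show ?thesis using cx A0 by simp
  next
   case False
   then have x: "1 <= sqrt x" by simp
   have D: "\<bar>2 * real c - real x\<bar> <= sqrt x * A"
   proof (cases "\<bar>z\<bar> <= sqrt x")
    case True
    have "z\<^sup>2 <= sqrt x * \<bar>z\<bar>" using mult_right_mono[OF True, of "\<bar>z\<bar>"] by (simp add: power2_eq_square)
    then have "1 + z\<^sup>2 <= sqrt x + sqrt x * \<bar>z\<bar>" using x by linarith
    then have "1 + z\<^sup>2 <= sqrt x * (1 + \<bar>z\<bar>)" by (simp add: distrib_left)
    then have "C * (1 + z\<^sup>2) <= C * (sqrt x * (1 + \<bar>z\<bar>))" using C(1) by (intro mult_left_mono) auto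
    moreover have "\<bar>2 * real (half_split x z) - real x\<bar> <= C * (1 + z\<^sup>2) + \<bar>sqrt x * z\<bar>"
     using C(2)[of x z] by linarith
    ultimately have "\<bar>2 * real c - real x\<bar> <= C * (sqrt x * (1 + \<bar>z\<bar>)) + sqrt x * \<bar>z\<bar>"
     using cx by (simp add: abs_mult)
    also have "\<dots> <= sqrt x * A" by (simp add: A_def algebra_simps)
    finally show ?thesis .
   next
    case False
    have "\<bar>2 * real c - real x\<bar> <= real x" using cx(2) by auto
    also have "\<dots> = sqrt x * sqrt x" by simp
    also have "\<dots> <= sqrt x * A"
    proof (rule mult_left_mono)
     have "sqrt x <= 1 * (1 + \<bar>z\<bar>)" using False by simp
     also have "\<dots> <= A" unfolding A_def using C(1) by (intro mult_right_mono) auto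
     finally show "sqrt x <= A" .
    qed simp
    finally show ?thesis .
   qed
   have s: "sqrt x <= 2 * sqrt (x / 2)"
   proof -
    have "2 * sqrt (x / 2) = sqrt 4 * sqrt (x / 2)" by simp
    also have "\<dots> = sqrt (4 * (x / 2))" by (simp only: real_sqrt_mult)
    also have "\<dots> >= sqrt x" by (intro real_sqrt_le_mono) simp
    finally show ?thesis by simp
   qed
   have pos: "0 < sqrt c + sqrt (x / 2)" using False by (intro add_nonneg_pos) auto
   have "(sqrt c - sqrt (x / 2)) * (sqrt c + sqrt (x / 2)) = real c - real x / 2"
    by (simp add: algebra_simps)
   then have "\<bar>sqrt c - sqrt (x / 2)\<bar> * (sqrt c + sqrt (x / 2)) = \<bar>2 * real c - real x\<bar> / 2"
   proof -
    assume e: "(sqrt c - sqrt (x / 2)) * (sqrt c + sqrt (x / 2)) = real c - real x / 2"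
    have "\<bar>sqrt c - sqrt (x / 2)\<bar> * (sqrt c + sqrt (x / 2)) = \<bar>(sqrt c - sqrt (x / 2)) * (sqrt c + sqrt (x / 2))\<bar>"
     using pos by (simp add: abs_mult)
    also have "\<dots> = \<bar>(2 * real c - real x) / 2\<bar>" unfolding e by (simp add: diff_divide_distrib)
    finally show ?thesis by simp
   qed
   also have "\<dots> <= sqrt x * A / 2" using D by simp
   also have "\<dots> <= (2 * sqrt (x / 2)) * A / 2" using s A0 by (intro divide_right_mono mult_right_mono) auto
   also have "\<dots> <= A * (sqrt c + sqrt (x / 2))" using A0 by (simp add: algebra_simps)
   finally show ?thesis using pos by (simp only: mult_le_cancel_right_pos)
  qed
  define a where "a = sqrt x - sqrt m"
  define b where "b = sqrt c - sqrt (x / 2)"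
  have "sqrt c - sqrt (m / 2) = a / sqrt 2 + b"
   by (simp add: a_def b_def real_sqrt_divide diff_divide_distrib)
  then have "(sqrt c - sqrt (m / 2))\<^sup>2 = a\<^sup>2 / 2 + 2 * (a / sqrt 2) * b + b\<^sup>2"
   by (simp add: power2_sum power_divide)
  also have "2 * (a / sqrt 2) * b <= a\<^sup>2 / 4 + 2 * b\<^sup>2"
  proof -
   have "0 <= (a / 2 - sqrt 2 * b)\<^sup>2" by simp
   also have "\<dots> = a\<^sup>2 / 4 - sqrt 2 * a * b + 2 * b\<^sup>2"
    by (simp add: power2_diff power_divide power_mult_distrib)
   also have "sqrt 2 * a * b = 2 * (a / sqrt 2) * b"
    by (simp add: field_simps)
   finally show ?thesis by simp
  qed
  finally have "(sqrt c - sqrt (m / 2))\<^sup>2 <= 3 / 4 * a\<^sup>2 + 3 * b\<^sup>2" by simp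
  also have "b\<^sup>2 <= 2 * (C + 1)\<^sup>2 * (1 + z\<^sup>2)"
  proof -
   have "b\<^sup>2 <= A\<^sup>2" using key A0 unfolding b_def by (subst abs_le_square_iff[symmetric]) auto
   also have "\<dots> = (C + 1)\<^sup>2 * (1 + \<bar>z\<bar>)\<^sup>2" by (simp add: A_def power_mult_distrib)
   also have "\<dots> <= (C + 1)\<^sup>2 * (2 * (1 + z\<^sup>2))"
   proof (rule mult_left_mono)
    show "(1 + \<bar>z\<bar>)\<^sup>2 <= 2 * (1 + z\<^sup>2)"
     using zero_le_power2[of "1 - \<bar>z\<bar>"] by (simp add: power2_diff power2_sum)
   qed simp
   finally show ?thesis by (simp only: mult.assoc mult.left_commute)
  qed
  finally show "(sqrt c - sqrt (m / 2))\<^sup>2 <= 3 / 4 * (sqrt x - sqrt m)\<^sup>2 + 6 * (C + 1)\<^sup>2 * (1 + z\<^sup>2)"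
   by (simp add: a_def mult.assoc)
 qed
qed

text \<open>Three contributions: the error at the root, distributed linearly over the leaves; the
  initial gap of square roots; and the squared noise along the path to leaf k, which dominates the
  local errors together with the accumulated gaps.\<close>

lemma tree_bound:
 obtains K where "K >= 1" "\<And>g R x k. k < 2 ^ R ==>
  \<bar>(\<Sum>j<k. real (cnt (noise g R) x R j) - 1) - (\<Sum>j<k. g j)\<bar>
   <= real k / 2 ^ R * (\<bar>real x - 2 ^ R\<bar> + sqrt (2 ^ R) * \<bar>hsum g R 0\<bar>) + (sqrt x - sqrt (2 ^ R))\<^sup>2
    + K * (\<Sum>d<R. 1 + (noise g R (d, k div 2 ^ (R - d)))\<^sup>2)"
proof -
 obtain C where C: "C >= 1"
  "\<And>x z m. 0 <= m ==> \<bar>2 * real (half_split x z) - real x - sqrt m * z\<bar> <= C * (1 + z\<^sup>2) + ((sqrt x - sqrt m)\<^sup>2 + z\<^sup>2) / 2"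
  "\<And>x z m c. 0 <= m ==> c = half_split x z \<or> c = x - half_split x z ==>
   (sqrt c - sqrt (m / 2))\<^sup>2 <= 3 / 4 * (sqrt x - sqrt m)\<^sup>2 + 6 * (C + 1)\<^sup>2 * (1 + z\<^sup>2)"
  using half_split_node_bounds by blast
 define K where "K = C + 1 + 6 * (C + 1)\<^sup>2"
 show ?thesis
 proof (rule that[of K])
  show "K >= 1" using C(1) by (simp add: K_def)
  fix g :: "nat => real" and R x k :: nat assume k: "k < 2 ^ R"
  define z where "z = noise g R"
  define m where "m = (\<lambda>d::nat. 2 ^ R / 2 ^ d :: real)"
  have m: "0 < m d" "m (Suc d) = m d / 2" for d by (auto simp: m_def)
  \<comment> \<open>\<open>e\<close> is the error at a node: its count minus its mean, minus the
    unnormalised normal sum over its leaves. Since \<open>hsum\<close> splits with the same noise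
    that splits the count, the children of a node carry (e + \<open>\<delta>\<close>) / 2 and (e -
    \<open>\<delta>\<close>) / 2, where \<open>\<delta>\<close> is the quantile error.\<close>
  define e where "e = (\<lambda>d k. real (cnt z x d k) - m d - sqrt (m d) * hsum g (R - d) k)"
  define \<delta> where "\<delta> = (\<lambda>d k. 2 * real (half_split (cnt z x d k) (z (d, k))) - real (cnt z x d k) - sqrt (m d) * z (d, k))"
  have hs: "hsum g (R - Suc d) (2 * k) = (hsum g (R - d) k + z (d, k)) / sqrt 2"
    "hsum g (R - Suc d) (2 * k + 1) = (hsum g (R - d) k - z (d, k)) / sqrt 2" if "d < R" for d k
   using hsum_children[of g "R - Suc d" k] that by (simp_all add: z_def noise_def Suc_diff_Suc)
  have sq: "sqrt (m (Suc d)) * (y / sqrt 2) = sqrt (m d) * y / 2" for d y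
   unfolding m by (simp add: real_sqrt_divide)
  have ev: "e (Suc d) (2 * k) = (e d k + \<delta> d k) / 2" if "d < R" for d k
   unfolding e_def \<delta>_def hs[OF that] sq cnt_children by (simp add: m field_simps del: cnt.simps)
  have od: "e (Suc d) (2 * k + 1) = (e d k - \<delta> d k) / 2" if "d < R" for d k
   unfolding e_def \<delta>_def hs[OF that] sq cnt_children
   by (simp add: m field_simps of_nat_diff half_split_le del: cnt.simps)
  have I: "\<bar>(1 - 0) * ((\<Sum>j<k. e R j) - real k / 2 ^ R * e 0 0) + 0 * ((\<Sum>j<Suc k. e R j) - real (Suc k) / 2 ^ R * e 0 0)\<bar>
    <= (\<Sum>i<R. \<bar>\<delta> i (k div 2 ^ (R - i))\<bar>) / 2"
   by (rule tree_interpolation[where e=e and \<delta>=\<delta> and R=R and d=R and k=k and c=0]) (use k ev od in auto)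
  define \<rho> where "\<rho> = (\<lambda>d. (sqrt (cnt z x d (k div 2 ^ (R - d))) - sqrt (m d))\<^sup>2)"
  define w where "w = (\<lambda>d. 1 + (z (d, k div 2 ^ (R - d)))\<^sup>2)"
  have \<rho>: "(\<Sum>d<R. \<rho> d) <= 4 * \<rho> 0 + 4 * (\<Sum>d<R. 6 * (C + 1)\<^sup>2 * w d)"
  proof (rule contraction_sum)
   fix d assume d: "d < R"
   have dv: "k div 2 ^ (R - d) = (k div 2 ^ (R - Suc d)) div 2"
   proof -
    have "R - d = Suc (R - Suc d)" using d by simp
    then show ?thesis by (simp only: power_Suc2 div_mult2_eq)
   qed
   have "cnt z x (Suc d) (k div 2 ^ (R - Suc d)) = half_split (cnt z x d (k div 2 ^ (R - d))) (z (d, k div 2 ^ (R - d))) \<or>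
    cnt z x (Suc d) (k div 2 ^ (R - Suc d)) = cnt z x d (k div 2 ^ (R - d)) - half_split (cnt z x d (k div 2 ^ (R - d))) (z (d, k div 2 ^ (R - d)))"
    unfolding dv by simp
   then show "\<rho> (Suc d) <= 3 / 4 * \<rho> d + 6 * (C + 1)\<^sup>2 * w d"
    unfolding \<rho>_def w_def m(2) by (intro C(3)) (use m(1)[of d] in auto)
  qed (simp add: \<rho>_def)
  have "(\<Sum>i<R. \<bar>\<delta> i (k div 2 ^ (R - i))\<bar>) <= (\<Sum>i<R. (C + 1) * w i + \<rho> i / 2)"
  proof (rule sum_mono)
   fix d
   have lin: "x <= c + (r + q) / 2 ==> w = 1 + q ==> 0 <= q ==> x <= c + w + r / 2" for x c w r q :: real
    unfolding add_divide_distrib by linarith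
   have "\<bar>\<delta> d (k div 2 ^ (R - d))\<bar> <= C * w d + (\<rho> d + (z (d, k div 2 ^ (R - d)))\<^sup>2) / 2"
    unfolding \<delta>_def \<rho>_def w_def by (rule C(2)) (use m(1)[of d] in auto)
   then have "\<bar>\<delta> d (k div 2 ^ (R - d))\<bar> <= C * w d + w d + \<rho> d / 2"
    by (rule lin) (simp_all add: w_def)
   then show "\<bar>\<delta> d (k div 2 ^ (R - d))\<bar> <= (C + 1) * w d + \<rho> d / 2"
    by (simp add: distrib_right)
  qed
  also have "\<dots> = (C + 1) * (\<Sum>i<R. w i) + (\<Sum>i<R. \<rho> i) / 2"
   by (simp add: sum.distrib sum_distrib_left sum_divide_distrib)
  also have "\<dots> <= (C + 1) * (\<Sum>i<R. w i) + (4 * \<rho> 0 + 4 * (\<Sum>d<R. 6 * (C + 1)\<^sup>2 * w d)) / 2"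
   using \<rho> by simp
  also have "(\<Sum>d<R. 6 * (C + 1)\<^sup>2 * w d) = 6 * (C + 1)\<^sup>2 * (\<Sum>d<R. w d)"
   by (simp add: sum_distrib_left)
  also have "(C + 1) * (\<Sum>i<R. w i) + (4 * \<rho> 0 + 4 * (6 * (C + 1)\<^sup>2 * (\<Sum>d<R. w d))) / 2 = (C + 1 + 12 * (C + 1)\<^sup>2) * (\<Sum>i<R. w i) + 2 * \<rho> 0"
   by (simp add: distrib_right add_divide_distrib)
  also have "\<dots> <= (2 * K) * (\<Sum>i<R. w i) + 2 * \<rho> 0"
   using C(1) by (intro add_right_mono mult_right_mono sum_nonneg) (auto simp: K_def w_def)
  finally have "(\<Sum>i<R. \<bar>\<delta> i (k div 2 ^ (R - i))\<bar>) / 2 <= K * (\<Sum>i<R. w i) + \<rho> 0" by simp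
  then have 1: "\<bar>(\<Sum>j<k. e R j) - real k / 2 ^ R * e 0 0\<bar> <= K * (\<Sum>i<R. w i) + \<rho> 0" using I by simp
  have eR: "(\<Sum>j<k. e R j) = (\<Sum>j<k. real (cnt z x R j) - 1) - (\<Sum>j<k. g j)"
   by (simp add: e_def m_def hsum_def sum_subtractf)
  have e0: "\<bar>real k / 2 ^ R * e 0 0\<bar> <= real k / 2 ^ R * (\<bar>real x - 2 ^ R\<bar> + sqrt (2 ^ R) * \<bar>hsum g R 0\<bar>)"
  proof -
   have "\<bar>e 0 0\<bar> <= \<bar>real x - 2 ^ R\<bar> + \<bar>sqrt (2 ^ R) * hsum g R 0\<bar>"
    unfolding e_def m_def by simp
   also have "\<bar>sqrt (2 ^ R) * hsum g R 0\<bar> = sqrt (2 ^ R) * \<bar>hsum g R 0\<bar>" by (simp add: abs_mult)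
   finally have "real k / 2 ^ R * \<bar>e 0 0\<bar> <= real k / 2 ^ R * (\<bar>real x - 2 ^ R\<bar> + sqrt (2 ^ R) * \<bar>hsum g R 0\<bar>)"
    by (rule mult_left_mono) simp
   then show ?thesis by (simp add: abs_mult)
  qed
  have r0: "\<rho> 0 = (sqrt x - sqrt (2 ^ R))\<^sup>2" by (simp add: \<rho>_def m_def)
  show "\<bar>(\<Sum>j<k. real (cnt (noise g R) x R j) - 1) - (\<Sum>j<k. g j)\<bar>
   <= real k / 2 ^ R * (\<bar>real x - 2 ^ R\<bar> + sqrt (2 ^ R) * \<bar>hsum g R 0\<bar>) + (sqrt x - sqrt (2 ^ R))\<^sup>2
    + K * (\<Sum>d<R. 1 + (noise g R (d, k div 2 ^ (R - d)))\<^sup>2)"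
   unfolding z_def[symmetric] w_def[symmetric] r0[symmetric] eR[symmetric] by (rule abs_combine2[OF 1 e0])
 qed
qed

lemma nn_integral_exp_square_NN: "(\<integral>\<^sup>+x. ennreal (exp (x\<^sup>2 / 4)) \<partial>NN) = ennreal (sqrt 2)"
proof -
 have "(\<integral>\<^sup>+x. ennreal (exp (x\<^sup>2 / 4)) \<partial>NN) = (\<integral>\<^sup>+x. ennreal (std_normal_density x) * ennreal (exp (x\<^sup>2 / 4)) \<partial>lborel)"
  by (simp add: nn_integral_density)
 also have "\<dots> = (\<integral>\<^sup>+x. ennreal (sqrt 2) * ennreal (normal_density 0 (sqrt 2) x) \<partial>lborel)"
 proof (rule nn_integral_cong)
  fix x :: real
  have "std_normal_density x * exp (x\<^sup>2 / 4) = sqrt 2 * normal_density 0 (sqrt 2) x"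
   unfolding normal_density_def by (simp add: exp_add[symmetric] real_sqrt_mult) (simp add: field_simps)
  then show "ennreal (std_normal_density x) * ennreal (exp (x\<^sup>2 / 4)) = ennreal (sqrt 2) * ennreal (normal_density 0 (sqrt 2) x)"
   by (simp add: ennreal_mult'[symmetric])
 qed
 also have "\<dots> = ennreal (sqrt 2) * (\<integral>\<^sup>+x. ennreal (normal_density 0 (sqrt 2) x) \<partial>lborel)"
  by (rule nn_integral_cmult) auto
 also have "(\<integral>\<^sup>+x. ennreal (normal_density 0 (sqrt 2) x) \<partial>lborel) = 1"
  by (subst nn_integral_eq_integral) auto
 finally show ?thesis by simp
qed

text \<open>The device of \<open>dd\<close> for path sums: a sum of exponentials over the 2^R leaves
  replaces the maximum. As E exp (Z^2 / 4) = sqrt 2, the unweighted sum has mean (2 sqrt 2)^R, and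
  the weight exp (- 2 R) brings this below 1.\<close>

definition path_exp :: "(nat => real) => nat => real" where
 "path_exp g R = exp (- 2 * real R) * (\<Sum>k<2 ^ R. exp ((\<Sum>d<R. (noise g R (d, k div 2 ^ (R - d)))\<^sup>2) / 4))"

lemma path_sum_le:
 assumes "k < 2 ^ R"
 shows "(\<Sum>d<R. (noise g R (d, k div 2 ^ (R - d)))\<^sup>2) <= 8 * real R + 4 * path_exp g R"
proof -
 define Q where "Q = (\<lambda>k. (\<Sum>d<R. (noise g R (d, k div 2 ^ (R - d)))\<^sup>2) / 4)"
 have "Q k - 2 * real R <= exp (Q k - 2 * real R)" using exp_ge_add_one_self[of "Q k - 2 * real R"] by linarith
 also have "\<dots> = exp (- 2 * real R) * exp (Q k)" by (simp add: exp_add[symmetric])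
 also have "\<dots> <= exp (- 2 * real R) * (\<Sum>k<2 ^ R. exp (Q k))"
  using assms by (intro mult_left_mono member_le_sum) auto
 also have "\<dots> = path_exp g R" by (simp add: path_exp_def Q_def)
 finally show ?thesis by (simp add: Q_def)
qed

lemma (in prob_space) nn_integral_path_exp:
 assumes g: "iid_normal M g UNIV"
 shows "(\<integral>\<^sup>+\<omega>. ennreal (path_exp (\<lambda>j. g j \<omega>) R) \<partial>M) <= 1"
proof -
 define z where "z = (\<lambda>p \<omega>. noise (\<lambda>j. g j \<omega>) R p)"
 have iz: "iid_normal M z {p. fst p < R}" unfolding z_def by (rule iid_noise[OF g])
 have path: "(\<integral>\<^sup>+\<omega>. ennreal (exp ((\<Sum>d<R. (z (d, k div 2 ^ (R - d)) \<omega>)\<^sup>2) / 4)) \<partial>M) = ennreal (sqrt 2 ^ R)" for k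
 proof -
  define y where "y = (\<lambda>d. z (d, k div 2 ^ (R - d)))"
  have iy: "iid_normal M y {..<R}"
   unfolding y_def by (rule iid_normal_reindex[OF iz]) (auto simp: inj_on_def)
  have ind: "indep_vars (\<lambda>_. borel) (\<lambda>d \<omega>. ennreal (exp ((y d \<omega>)\<^sup>2 / 4))) {..<R}"
   by (rule indep_vars_compose2[OF iid_normal_indep_vars[OF iy]]) measurable
  have "(\<integral>\<^sup>+\<omega>. ennreal (exp ((\<Sum>d<R. (y d \<omega>)\<^sup>2) / 4)) \<partial>M) = (\<integral>\<^sup>+\<omega>. (\<Prod>d<R. ennreal (exp ((y d \<omega>)\<^sup>2 / 4))) \<partial>M)"
   by (simp add: sum_divide_distrib exp_sum prod_ennreal)
  also have "\<dots> = (\<Prod>d<R. \<integral>\<^sup>+\<omega>. ennreal (exp ((y d \<omega>)\<^sup>2 / 4)) \<partial>M)"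
   by (rule indep_vars_nn_integral[OF _ ind]) auto
  also have "\<dots> = (\<Prod>d<R. ennreal (sqrt 2))"
  proof (rule prod.cong)
   fix d assume d: "d \<in> {..<R}"
   have "(\<integral>\<^sup>+\<omega>. ennreal (exp ((y d \<omega>)\<^sup>2 / 4)) \<partial>M) = (\<integral>\<^sup>+x. ennreal (exp (x\<^sup>2 / 4)) \<partial>distr M borel (y d))"
    using iid_normal_measurable[OF iy d] by (subst nn_integral_distr) auto
   then show "(\<integral>\<^sup>+\<omega>. ennreal (exp ((y d \<omega>)\<^sup>2 / 4)) \<partial>M) = ennreal (sqrt 2)"
    using iid_normal_distr[OF iy d] nn_integral_exp_square_NN by simp
  qed simp
  finally show ?thesis by (simp add: y_def ennreal_power)
 qed
 have zm: "z p \<in> borel_measurable M" if "fst p < R" for p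
  using iid_normal_measurable[OF iz, of p] that by simp
 have "(\<integral>\<^sup>+\<omega>. ennreal (path_exp (\<lambda>j. g j \<omega>) R) \<partial>M) =
  (\<integral>\<^sup>+\<omega>. ennreal (exp (- 2 * real R)) * (\<Sum>k<2 ^ R. ennreal (exp ((\<Sum>d<R. (z (d, k div 2 ^ (R - d)) \<omega>)\<^sup>2) / 4))) \<partial>M)"
  by (rule nn_integral_cong) (simp add: path_exp_def z_def ennreal_mult' sum_nonneg)
 also have "\<dots> = ennreal (exp (- 2 * real R)) * (\<integral>\<^sup>+\<omega>. (\<Sum>k<2 ^ R. ennreal (exp ((\<Sum>d<R. (z (d, k div 2 ^ (R - d)) \<omega>)\<^sup>2) / 4))) \<partial>M)"
  using zm by (intro nn_integral_cmult borel_measurable_sum) auto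
 also have "\<dots> = ennreal (exp (- 2 * real R)) * (\<Sum>k<2 ^ R. (\<integral>\<^sup>+\<omega>. ennreal (exp ((\<Sum>d<R. (z (d, k div 2 ^ (R - d)) \<omega>)\<^sup>2) / 4)) \<partial>M))"
  using zm by (subst nn_integral_sum) auto
 also have "\<dots> = ennreal (exp (- 2 * real R)) * (\<Sum>k<2 ^ R :: nat. ennreal (sqrt 2 ^ R))"
  unfolding path ..
 also have "\<dots> = ennreal (exp (- 2 * real R) * (2 ^ R * sqrt 2 ^ R))"
 proof -
  have "(\<Sum>k<2 ^ R :: nat. ennreal (sqrt 2 ^ R)) = ennreal (\<Sum>k<2 ^ R :: nat. sqrt 2 ^ R)"
   by (rule sum_ennreal) simp
  then show ?thesis by (simp add: ennreal_mult')
 qed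
 also have "\<dots> <= ennreal 1"
 proof (rule ennreal_leI)
  have "2 * sqrt 2 <= exp (2::real)"
  proof -
   have "2 * sqrt 2 <= (3::real)"
    by (rule power2_le_imp_le) (auto simp: power_mult_distrib)
   also have "\<dots> <= exp 2" using exp_ge_add_one_self[of "2::real"] by simp
   finally show ?thesis .
  qed
  then have "(2 * sqrt 2) ^ R <= exp 2 ^ R" by (intro power_mono) auto
  then have "2 ^ R * sqrt 2 ^ R <= exp (2 * real R)" by (simp add: power_mult_distrib exp_of_nat_mult[symmetric] mult.commute)
  then have "exp (- 2 * real R) * (2 ^ R * sqrt 2 ^ R) <= exp (- 2 * real R) * exp (2 * real R)" by (intro mult_left_mono) auto
  then show "exp (- 2 * real R) * (2 ^ R * sqrt 2 ^ R) <= 1" by (simp add: exp_add[symmetric])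
 qed
 finally show ?thesis by simp
qed

section \<open>Gluing probability spaces\<close>

text \<open>Each ingredient is built on a space of its own and pulled back along measure preserving
  maps to larger spaces, where its law, its almost sure properties and its integrals
  persist.\<close>

definition mpres :: "'a measure => 'b measure => ('a => 'b) => bool" where
 "mpres M' M h \<longleftrightarrow> h \<in> measurable M' M \<and> distr M' M h = M"

lemma mpres_measurable: "mpres M' M h ==> h \<in> measurable M' M"
 by (simp add: mpres_def)

lemma mpres_comp: "mpres M'' M' g ==> mpres M' M h ==> mpres M'' M (\<lambda>x. h (g x))"
 using distr_distr[of h M' M g M''] measurable_compose[of g M'' M' h M] by (simp add: mpres_def comp_def)

lemma mpres_emeasure:
 assumes "mpres M' M h" "A \<in> sets M"
 shows "emeasure M' (h -` A \<inter> space M') = emeasure M A"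
 using assms emeasure_distr[of h M' M A] by (simp add: mpres_def)

lemma mpres_measure:
 assumes "mpres M' M h" "A \<in> sets M"
 shows "measure M' (h -` A \<inter> space M') = measure M A"
 using mpres_emeasure[OF assms] by (simp add: measure_def)

lemma mpres_nn_integral:
 assumes "mpres M' M h" "f \<in> borel_measurable M"
 shows "(\<integral>\<^sup>+x. f (h x) \<partial>M') = (\<integral>\<^sup>+x. f x \<partial>M)"
 using assms nn_integral_distr[of h M' M f] by (simp add: mpres_def)

lemma mpres_AE: "mpres M' M h ==> AE x in M. P x ==> AE x in M'. P (h x)"
 unfolding mpres_def by (metis AE_distrD)

lemma mpres_space: "mpres M' M h ==> x \<in> space M' ==> h x \<in> space M"
 by (auto simp: mpres_def dest: measurable_space)

lemma mpres_indep_vars: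
 assumes h: "mpres M' M h" and M: "prob_space M" "prob_space M'"
  and X: "prob_space.indep_vars M N X I"
 shows "prob_space.indep_vars M' N (\<lambda>i x. X i (h x)) I"
proof -
 interpret M: prob_space M by fact
 interpret M': prob_space M' by fact
 have X': "\<forall>i\<in>I. X i \<in> measurable M (N i)" "M.indep_sets (\<lambda>i. {X i -` A \<inter> space M |A. A \<in> sets (N i)}) I"
  using X unfolding M.indep_vars_def2 by auto
 have hs: "h x \<in> space M" if "x \<in> space M'" for x using mpres_space[OF h that] .
 show ?thesis
  unfolding M'.indep_vars_def2
 proof (intro conjI ballI)
  show m: "(\<lambda>x. X i (h x)) \<in> measurable M' (N i)" if "i \<in> I" for i
   using measurable_compose[OF mpres_measurable[OF h]] X'(1) that by blast
  show "M'.indep_sets (\<lambda>i. {(\<lambda>x. X i (h x)) -` A \<inter> space M' |A. A \<in> sets (N i)}) I"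
  proof (rule M'.indep_setsI)
   show "{(\<lambda>x. X i (h x)) -` A \<inter> space M' |A. A \<in> sets (N i)} \<subseteq> sets M'" if "i \<in> I" for i
    using measurable_sets[OF m[OF that]] by auto
   fix A J assume J: "J ~= {}" "J \<subseteq> I" "finite J" and "\<forall>j\<in>J. A j \<in> {(\<lambda>x. X j (h x)) -` A \<inter> space M' |A. A \<in> sets (N j)}"
   then obtain B where B: "\<And>j. j \<in> J ==> A j = (\<lambda>x. X j (h x)) -` B j \<inter> space M'" "\<And>j. j \<in> J ==> B j \<in> sets (N j)"
    by simp metis
   define C where "C = (\<lambda>j. X j -` B j \<inter> space M)"
   have Cs: "C j \<in> sets M" if "j \<in> J" for j
    unfolding C_def using measurable_sets X'(1) J(2) B(2) that by blast
   have AC: "A j = h -` C j \<inter> space M'" if "j \<in> J" for j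
    using B(1)[OF that] hs by (auto simp: C_def)
   have "M'.prob (\<Inter>j\<in>J. A j) = M'.prob (h -` (\<Inter>j\<in>J. C j) \<inter> space M')"
    using AC J(1) by (intro arg_cong[where f=M'.prob]) auto
   also have "\<dots> = M.prob (\<Inter>j\<in>J. C j)"
    using Cs J by (intro mpres_measure[OF h] sets.finite_INT) auto
   also have "\<dots> = (\<Prod>j\<in>J. M.prob (C j))"
    by (rule M.indep_setsD[OF X'(2) J(2,1,3)]) (use B(2) in \<open>auto simp: C_def\<close>)
   also have "\<dots> = (\<Prod>j\<in>J. M'.prob (A j))"
    using mpres_measure[OF h Cs] AC by (intro prod.cong) auto
   finally show "M'.prob (\<Inter>j\<in>J. A j) = (\<Prod>j\<in>J. M'.prob (A j))" .
  qed
 qed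
qed

lemma mpres_std_brownian_motion:
 assumes h: "mpres M' M h" and M: "prob_space M" "prob_space M'" and W: "std_brownian_motion M W"
 shows "std_brownian_motion M' (\<lambda>x. W (h x))"
 unfolding std_brownian_motion_def
proof (intro conjI allI impI)
 note hm = mpres_measurable[OF h]
 have rv: "(\<lambda>\<omega>. W \<omega> t) \<in> borel_measurable M" if "0 <= t" for t
  using W that by (auto simp: std_brownian_motion_def)
 show "(\<lambda>\<omega>. W (h \<omega>) t) \<in> borel_measurable M'" if "0 <= t" for t
  using measurable_compose[OF hm rv[OF that]] .
 show "AE \<omega> in M'. W (h \<omega>) 0 = 0"
  using W by (intro mpres_AE[OF h]) (auto simp: std_brownian_motion_def)
 show "AE \<omega> in M'. continuous_on {0..} (W (h \<omega>))"
  using W by (intro mpres_AE[OF h]) (auto simp: std_brownian_motion_def)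
 show "distributed M' lborel (\<lambda>\<omega>. W (h \<omega>) t - W (h \<omega>) s) (\<lambda>x. ennreal (normal_density 0 (sqrt (t - s)) x))"
  if st: "0 <= s \<and> s < t" for s t
 proof -
  have D: "distributed M lborel (\<lambda>\<omega>. W \<omega> t - W \<omega> s) (\<lambda>x. ennreal (normal_density 0 (sqrt (t - s)) x))"
   using W st by (auto simp: std_brownian_motion_def)
  have m: "(\<lambda>\<omega>. W \<omega> t - W \<omega> s) \<in> measurable M lborel" using D by (simp add: distributed_def)
  have "distr M' lborel (\<lambda>\<omega>. W (h \<omega>) t - W (h \<omega>) s) = distr (distr M' M h) lborel (\<lambda>\<omega>. W \<omega> t - W \<omega> s)"
   using distr_distr[OF m hm] by (simp add: comp_def)
  also have "distr M' M h = M" using h by (simp add: mpres_def)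
  finally show ?thesis using D measurable_compose[OF hm m] by (simp add: distributed_def)
 qed
 show "prob_space.indep_vars M' (\<lambda>_. borel) (\<lambda>i \<omega>. W (h \<omega>) (ts ! Suc i) - W (h \<omega>) (ts ! i)) {..<length ts - 1}"
  if "sorted_wrt (<) ts \<and> (\<forall>t\<in>set ts. 0 <= t)" for ts
 proof -
  have "prob_space.indep_vars M (\<lambda>_. borel) (\<lambda>i \<omega>. W \<omega> (ts ! Suc i) - W \<omega> (ts ! i)) {..<length ts - 1}"
   using W that by (auto simp: std_brownian_motion_def)
  from mpres_indep_vars[OF h M this] show ?thesis by simp
 qed
qed

text \<open>The coupling that makes the two spaces conditionally independent given the common value:
  the product measure is reweighted by 1 / p(v) on the event that both variables equal v. Countably
  many values make those of probability 0 jointly negligible, which gives the correct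
  marginals.\<close>

lemma glue:
 fixes X1 :: "'a => 'c :: countable" and X2 :: "'b => 'c"
 assumes M: "prob_space M1" "prob_space M2"
  and X1: "X1 \<in> measurable M1 (count_space UNIV)" and X2: "X2 \<in> measurable M2 (count_space UNIV)"
  and law: "\<And>v. measure M1 {\<omega> \<in> space M1. X1 \<omega> = v} = measure M2 {\<omega> \<in> space M2. X2 \<omega> = v}"
 obtains M :: "('a \<times> 'b) measure" where "prob_space M" "mpres M M1 fst" "mpres M M2 snd"
  "AE \<omega> in M. X1 (fst \<omega>) = X2 (snd \<omega>)"
proof -
 interpret M1: prob_space M1 by fact
 interpret M2: prob_space M2 by fact
 interpret P: pair_prob_space M1 M2 ..
 note [measurable] = X1 X2
 define p where "p v = measure M1 {\<omega> \<in> space M1. X1 \<omega> = v}" for v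
 have p1: "emeasure M1 {\<omega> \<in> space M1. X1 \<omega> = v} = ennreal (p v)" for v
  by (simp add: p_def M1.emeasure_eq_measure)
 have p2: "emeasure M2 {\<omega> \<in> space M2. X2 \<omega> = v} = ennreal (p v)" for v
  by (simp add: p_def law M2.emeasure_eq_measure)
 have p0: "0 <= p v" for v by (simp add: p_def)
 define f where "f = (\<lambda>\<omega>. if X1 (fst \<omega>) = X2 (snd \<omega>) then ennreal (1 / p (X1 (fst \<omega>))) else 0)"
 have [measurable]: "f \<in> borel_measurable (M1 \<Otimes>\<^sub>M M2)"
  unfolding f_def by measurable
 define M where "M = density (M1 \<Otimes>\<^sub>M M2) f"
 have inv: "ennreal (1 / p v) * ennreal (p v) = 1" if "p v ~= 0" for v
  using that p0[of v] by (simp add: ennreal_mult'[symmetric])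
 have i1: "(\<integral>\<^sup>+y. f (x, y) \<partial>M2) = 1" if "p (X1 x) ~= 0" for x
 proof -
  have "(\<integral>\<^sup>+y. f (x, y) \<partial>M2) = (\<integral>\<^sup>+y. ennreal (1 / p (X1 x)) * indicator {\<omega> \<in> space M2. X2 \<omega> = X1 x} y \<partial>M2)"
   by (intro nn_integral_cong) (auto simp: f_def split: split_indicator)
  also have "\<dots> = ennreal (1 / p (X1 x)) * ennreal (p (X1 x))"
   by (subst nn_integral_cmult_indicator) (auto simp: p2)
  finally show ?thesis using inv[OF that] by simp
 qed
 have i2: "(\<integral>\<^sup>+x. f (x, y) \<partial>M1) = 1" if "p (X2 y) ~= 0" for y
 proof -
  have "(\<integral>\<^sup>+x. f (x, y) \<partial>M1) = (\<integral>\<^sup>+x. ennreal (1 / p (X2 y)) * indicator {\<omega> \<in> space M1. X1 \<omega> = X2 y} x \<partial>M1)"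
   by (intro nn_integral_cong) (auto simp: f_def split: split_indicator)
  also have "\<dots> = ennreal (1 / p (X2 y)) * ennreal (p (X2 y))"
   by (subst nn_integral_cmult_indicator) (auto simp: p1)
  finally show ?thesis using inv[OF that] by simp
 qed
 have ae1: "AE x in M1. p (X1 x) ~= 0"
 proof -
  have "AE x in M1. X1 x = v \<longrightarrow> p v ~= 0" for v
  proof (cases "p v = 0")
   case True
   then have "AE x in M1. \<not> (X1 x = v)" using p1[of v] by (intro AE_I[of _ _ "{\<omega> \<in> space M1. X1 \<omega> = v}"]) auto
   then show ?thesis by (rule eventually_mono) simp
  qed auto
  then have "AE x in M1. \<forall>v. X1 x = v \<longrightarrow> p v ~= 0" by (subst AE_all_countable) auto
  then show ?thesis by auto
 qed
 have ae2: "AE x in M2. p (X2 x) ~= 0"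
 proof -
  have "AE x in M2. X2 x = v \<longrightarrow> p v ~= 0" for v
  proof (cases "p v = 0")
   case True
   then have "AE x in M2. \<not> (X2 x = v)" using p2[of v] by (intro AE_I[of _ _ "{\<omega> \<in> space M2. X2 \<omega> = v}"]) auto
   then show ?thesis by (rule eventually_mono) simp
  qed auto
  then have "AE x in M2. \<forall>v. X2 x = v \<longrightarrow> p v ~= 0" by (subst AE_all_countable) auto
  then show ?thesis by auto
 qed
 have mf: "fst \<in> measurable M M1" "snd \<in> measurable M M2" by (auto simp: M_def)
 have d1: "distr M M1 fst = M1"
 proof (rule measure_eqI)
  fix A assume "A \<in> sets (distr M M1 fst)"
  then have A[measurable]: "A \<in> sets M1" by simp
  have "emeasure (distr M M1 fst) A = emeasure M (fst -` A \<inter> space M)"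
   by (rule emeasure_distr[OF mf(1)]) simp
  also have "\<dots> = (\<integral>\<^sup>+\<omega>. f \<omega> * indicator (fst -` A \<inter> space M) \<omega> \<partial>(M1 \<Otimes>\<^sub>M M2))"
   unfolding M_def by (subst emeasure_density) (auto simp: measurable_sets)
  also have "\<dots> = (\<integral>\<^sup>+\<omega>. f \<omega> * indicator A (fst \<omega>) \<partial>(M1 \<Otimes>\<^sub>M M2))"
   by (intro nn_integral_cong) (auto simp: M_def split: split_indicator)
  also have "\<dots> = (\<integral>\<^sup>+x. \<integral>\<^sup>+y. f (x, y) * indicator A x \<partial>M2 \<partial>M1)"
   by (subst M2.nn_integral_fst[symmetric]) auto
  also have "\<dots> = (\<integral>\<^sup>+x. indicator A x \<partial>M1)"
  proof (rule nn_integral_cong_AE)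
   show "AE x in M1. (\<integral>\<^sup>+y. f (x, y) * indicator A x \<partial>M2) = indicator A x"
    using ae1 AE_space
   proof eventually_elim
    case (elim x)
    have "(\<lambda>y. f (x, y)) \<in> borel_measurable M2" using elim(2) by measurable
    then show ?case using i1[OF elim(1)] by (simp add: nn_integral_multc)
   qed
  qed
  finally show "emeasure (distr M M1 fst) A = emeasure M1 A" by simp
 qed simp
 have d2: "distr M M2 snd = M2"
 proof (rule measure_eqI)
  fix A assume "A \<in> sets (distr M M2 snd)"
  then have A[measurable]: "A \<in> sets M2" by simp
  have "emeasure (distr M M2 snd) A = emeasure M (snd -` A \<inter> space M)"
   by (rule emeasure_distr[OF mf(2)]) simp
  also have "\<dots> = (\<integral>\<^sup>+\<omega>. f \<omega> * indicator (snd -` A \<inter> space M) \<omega> \<partial>(M1 \<Otimes>\<^sub>M M2))"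
   unfolding M_def by (subst emeasure_density) (auto simp: measurable_sets)
  also have "\<dots> = (\<integral>\<^sup>+\<omega>. f \<omega> * indicator A (snd \<omega>) \<partial>(M1 \<Otimes>\<^sub>M M2))"
   by (intro nn_integral_cong) (auto simp: M_def split: split_indicator)
  also have "\<dots> = (\<integral>\<^sup>+y. \<integral>\<^sup>+x. f (x, y) * indicator A y \<partial>M1 \<partial>M2)"
   by (subst P.nn_integral_snd[symmetric]) (auto simp: case_prod_beta')
  also have "\<dots> = (\<integral>\<^sup>+y. indicator A y \<partial>M2)"
  proof (rule nn_integral_cong_AE)
   show "AE y in M2. (\<integral>\<^sup>+x. f (x, y) * indicator A y \<partial>M1) = indicator A y"
    using ae2 AE_space
   proof eventually_elim
    case (elim y)
    have "(\<lambda>x. f (x, y)) \<in> borel_measurable M1" using elim(2) by measurable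
    then show ?case using i2[OF elim(1)] by (simp add: nn_integral_multc)
   qed
  qed
  finally show "emeasure (distr M M2 snd) A = emeasure M2 A" by simp
 qed simp
 have pM: "prob_space M"
  using mf(1) d1 M1.prob_space_axioms by (metis prob_space_distrD)
 have ae: "AE \<omega> in M. X1 (fst \<omega>) = X2 (snd \<omega>)"
  unfolding M_def by (subst AE_density) (auto simp: f_def)
 show ?thesis by (rule that[OF pM _ _ ae]) (use mf d1 d2 in \<open>auto simp: mpres_def\<close>)
qed

text \<open>Serves the final requirement that the underlying measure lives on the reals: the space
  is carried over by an injection, and its inverse is measure preserving.\<close>

lemma embed_into:
 fixes f :: "'a => 'b" and M :: "'a measure"
 assumes "inj f" "prob_space M"
 obtains M' :: "'b measure" and h where "prob_space M'" "mpres M' M h"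
proof -
 define M' where "M' = embed_measure M f"
 have pM': "prob_space M'" unfolding M'_def
  by (subst embed_measure_eq_distr[OF assms(1)]) (intro prob_space.prob_space_distr assms measurable_embed_measure2)
 have hm: "inv f \<in> measurable M' M"
 proof (rule measurableI)
  show "inv f x \<in> space M" if "x \<in> space M'" for x
   using that assms(1) by (auto simp: M'_def space_embed_measure)
  fix A assume A: "A \<in> sets M"
  have "inv f -` A \<inter> space M' = f ` A"
   using assms(1) sets.sets_into_space[OF A] by (auto simp: M'_def space_embed_measure)
  then show "inv f -` A \<inter> space M' \<in> sets M'" using A by (simp add: M'_def in_sets_embed_measure)
 qed
 have "distr M' M (inv f) = M"
 proof -
  have "distr M' M (inv f) = distr (distr M (embed_measure M f) f) M (inv f)"
   unfolding M'_def by (subst embed_measure_eq_distr[OF assms(1), symmetric]) simp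
  also have "\<dots> = distr M M (inv f \<circ> f)"
   using hm unfolding M'_def by (intro distr_distr measurable_embed_measure2 assms(1))
  also have "inv f \<circ> f = (\<lambda>x. x)" using assms(1) by (simp add: fun_eq_iff)
  also have "distr M M (\<lambda>x. x) = M" by (rule distr_id)
  finally show ?thesis .
 qed
 then show ?thesis using that pM' hm by (auto simp: mpres_def)
qed

section \<open>Poisson laws, with rate 0 as a point mass at 0, and their moments\<close>

definition pois :: "real => nat pmf" where
 "pois \<mu> = (if 0 < \<mu> then poisson_pmf \<mu> else return_pmf 0)"

lemma pmf_pois: "0 <= \<mu> ==> pmf (pois \<mu>) k = \<mu> ^ k / fact k * exp (- \<mu>)"
 by (cases "0 < \<mu>") (auto simp: pois_def indicator_def power_0_left)

lemma nn_integral_pmf_nat: "(\<integral>\<^sup>+k. f k \<partial>measure_pmf p) = (\<Sum>k. ennreal (pmf p k) * f k)" for p :: "nat pmf"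
 by (subst nn_integral_measure_pmf) (simp add: nn_integral_count_space_nat)

lemma nn_integral_pois_1: "0 <= \<mu> ==> (\<integral>\<^sup>+k. ennreal (real k) \<partial>pois \<mu>) = ennreal \<mu>"
proof -
 assume \<mu>: "0 <= \<mu>"
 have "(\<lambda>k. \<mu> ^ k / fact k) sums exp \<mu>" using exp_converges[of \<mu>] by (simp add: field_simps)
 then have "(\<lambda>k. (\<mu> * exp (-\<mu>)) * (\<mu> ^ k / fact k)) sums ((\<mu> * exp (-\<mu>)) * exp \<mu>)" by (rule sums_mult)
 then have "(\<lambda>k. pmf (pois \<mu>) (Suc k) * real (Suc k)) sums \<mu>"
  using \<mu> by (simp add: pmf_pois exp_minus field_simps del: of_nat_Suc)
 then have s: "(\<lambda>k. pmf (pois \<mu>) k * real k) sums \<mu>" by (subst (asm) sums_Suc_iff) simp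
 have "(\<integral>\<^sup>+k. ennreal (real k) \<partial>pois \<mu>) = (\<Sum>k. ennreal (pmf (pois \<mu>) k * real k))"
  unfolding nn_integral_pmf_nat by (simp add: ennreal_mult')
 also have "\<dots> = ennreal \<mu>"
  using s by (subst suminf_ennreal2) (auto simp: sums_iff)
 finally show ?thesis .
qed

lemma nn_integral_pois_2: "0 <= \<mu> ==> (\<integral>\<^sup>+k. ennreal (real k * (real k - 1)) \<partial>pois \<mu>) = ennreal (\<mu>\<^sup>2)"
proof -
 assume \<mu>: "0 <= \<mu>"
 have "(\<lambda>k. \<mu> ^ k / fact k) sums exp \<mu>" using exp_converges[of \<mu>] by (simp add: field_simps)
 then have S: "(\<lambda>k. (\<mu>\<^sup>2 * exp (-\<mu>)) * (\<mu> ^ k / fact k)) sums ((\<mu>\<^sup>2 * exp (-\<mu>)) * exp \<mu>)" by (rule sums_mult)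
 have T: "(\<mu>\<^sup>2 * exp (-\<mu>)) * (\<mu> ^ k / fact k) = pmf (pois \<mu>) (Suc (Suc k)) * (real (Suc (Suc k)) * (real (Suc (Suc k)) - 1))" for k
 proof -
  define c where "c = real (Suc (Suc k)) * (real (Suc (Suc k)) - 1)"
  have f: "fact (Suc (Suc k)) = c * fact k" by (simp add: c_def algebra_simps)
  have "c ~= 0" by (simp add: c_def)
  then show ?thesis unfolding pmf_pois[OF \<mu>] f c_def[symmetric]
   by (simp add: power2_eq_square field_simps)
 qed
 have E: "(\<mu>\<^sup>2 * exp (-\<mu>)) * exp \<mu> = \<mu>\<^sup>2" by (simp add: mult.assoc exp_add[symmetric])
 have "(\<lambda>k. pmf (pois \<mu>) (Suc (Suc k)) * (real (Suc (Suc k)) * (real (Suc (Suc k)) - 1))) sums (\<mu>\<^sup>2)"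
  using S unfolding T E .
 then have "(\<lambda>k. pmf (pois \<mu>) (Suc k) * (real (Suc k) * (real (Suc k) - 1))) sums (\<mu>\<^sup>2)"
  by (subst (asm) sums_Suc_iff) simp
 then have s: "(\<lambda>k. pmf (pois \<mu>) k * (real k * (real k - 1))) sums (\<mu>\<^sup>2)"
  by (subst (asm) sums_Suc_iff) simp
 have nn: "0 <= real k * (real k - 1)" for k by (cases k) auto
 have "(\<integral>\<^sup>+k. ennreal (real k * (real k - 1)) \<partial>pois \<mu>) = (\<Sum>k. ennreal (pmf (pois \<mu>) k * (real k * (real k - 1))))"
  unfolding nn_integral_pmf_nat by (simp add: ennreal_mult')
 also have "\<dots> = ennreal (\<mu>\<^sup>2)"
  using s nn by (subst suminf_ennreal2) (auto simp: sums_iff)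
 finally show ?thesis .
qed

lemma nn_integral_pois_var:
 assumes "0 <= \<mu>" shows "(\<integral>\<^sup>+k. ennreal ((real k - \<mu>)\<^sup>2) \<partial>pois \<mu>) = ennreal \<mu>"
proof -
 have nn: "0 <= real k * (real k - 1)" for k by (cases k) auto
 have i1: "integrable (pois \<mu>) (\<lambda>k. real k)"
  by (rule integrableI_nonneg) (auto simp: nn_integral_pois_1[OF assms])
 have i2: "integrable (pois \<mu>) (\<lambda>k. real k * (real k - 1))"
  by (rule integrableI_nonneg) (auto simp: nn_integral_pois_2[OF assms] nn)
 have e1: "(\<integral>k. real k \<partial>pois \<mu>) = \<mu>"
  using nn_integral_eq_integral[OF i1] nn_integral_pois_1[OF assms] assms by (simp add: integral_nonneg_AE)
 have e2: "(\<integral>k. real k * (real k - 1) \<partial>pois \<mu>) = \<mu>\<^sup>2"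
  using nn_integral_eq_integral[OF i2] nn_integral_pois_2[OF assms] nn by (simp add: integral_nonneg_AE)
 have eq: "(real k - \<mu>)\<^sup>2 = real k * (real k - 1) + (1 - 2 * \<mu>) * real k + \<mu>\<^sup>2" for k
  by (simp add: power2_eq_square algebra_simps)
 have i: "integrable (pois \<mu>) (\<lambda>k. (real k - \<mu>)\<^sup>2)"
  unfolding eq using i1 i2 by auto
 have "(\<integral>k. (real k - \<mu>)\<^sup>2 \<partial>pois \<mu>) = \<mu>\<^sup>2 + (1 - 2 * \<mu>) * \<mu> + \<mu>\<^sup>2"
  unfolding eq using i1 i2 e1 e2 by (simp add: measure_pmf.prob_space)
 also have "\<dots> = \<mu>" by (simp add: power2_eq_square algebra_simps)
 finally show ?thesis using nn_integral_eq_integral[OF i] by simp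
qed

section \<open>Poisson counts coupled with a Brownian path\<close>

definition incr :: "(nat => real) => (real => real) => nat => real" where
 "incr v w j = (w (v (Suc j)) - w (v j)) / sqrt (v (Suc j) - v j)"

lemma iid_increments:
 assumes M: "prob_space M" and W: "std_brownian_motion M W" and v: "strict_mono v" "0 <= v 0"
 shows "iid_normal M (\<lambda>j \<omega>. incr v (W \<omega>) j) UNIV"
proof (rule iid_normal_cofinalI)
 interpret prob_space M by (rule M)
 have v0: "0 <= v j" for j
  using v(2) strict_mono_less_eq[OF v(1), of 0 j] by simp
 have vS: "v j < v (Suc j)" for j using v(1) by (simp add: strict_mono_Suc_iff)
 have rvW: "(\<lambda>\<omega>. W \<omega> (v j)) \<in> borel_measurable M" for j
  using W v0 by (auto simp: std_brownian_motion_def)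
 show rv: "(\<lambda>\<omega>. incr v (W \<omega>) j) \<in> borel_measurable M" for j
  unfolding incr_def using rvW by simp
 have distr: "distr M borel (\<lambda>\<omega>. incr v (W \<omega>) j) = NN" for j
 proof -
  have "distributed M lborel (\<lambda>\<omega>. W \<omega> (v (Suc j)) - W \<omega> (v j)) (\<lambda>x. ennreal (normal_density 0 (sqrt (v (Suc j) - v j)) x))"
   using W v0[of j] vS[of j] by (auto simp: std_brownian_motion_def)
  then have "distributed M lborel (\<lambda>\<omega>. ((W \<omega> (v (Suc j)) - W \<omega> (v j)) - 0) / sqrt (v (Suc j) - v j)) std_normal_density"
   using vS[of j] by (subst (asm) normal_standard_normal_convert) auto
  then show ?thesis unfolding distributed_NN_iff incr_def by simp
 qed
 fix T :: "nat set" assume T: "finite T"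
 then obtain m where m: "T \<subseteq> {..<m}" using finite_nat_bounded by blast
 define ts where "ts = map v [0..<Suc m]"
 have ts: "length ts = Suc m" "\<And>i. i <= m ==> ts ! i = v i" by (auto simp: ts_def simp del: upt_Suc)
 have "sorted_wrt (<) ts" unfolding sorted_wrt_iff_nth_less ts(1)
  using ts(2) v(1) by (auto simp: strict_mono_def)
 moreover have "\<forall>t\<in>set ts. 0 <= t" using v0 by (auto simp: ts_def)
 ultimately have "indep_vars (\<lambda>_. borel) (\<lambda>i \<omega>. W \<omega> (ts ! Suc i) - W \<omega> (ts ! i)) {..<length ts - 1}"
  using W by (auto simp: std_brownian_motion_def)
 then have ind: "indep_vars (\<lambda>_. borel) (\<lambda>i \<omega>. W \<omega> (ts ! Suc i) - W \<omega> (ts ! i)) {..<m}"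
  by (simp add: ts(1))
 have "indep_vars (\<lambda>_. borel) (\<lambda>i \<omega>. (W \<omega> (ts ! Suc i) - W \<omega> (ts ! i)) / sqrt (v (Suc i) - v i)) {..<m}"
  using indep_vars_compose2[OF ind, of "\<lambda>i y. y / sqrt (v (Suc i) - v i)" "\<lambda>_. borel"] by simp
 moreover have "(W \<omega> (ts ! Suc i) - W \<omega> (ts ! i)) / sqrt (v (Suc i) - v i) = incr v (W \<omega>) i" if "i \<in> {..<m}" for i \<omega>
  using that by (simp add: incr_def ts)
 ultimately have "indep_vars (\<lambda>_. borel) (\<lambda>j \<omega>. incr v (W \<omega>) j) {..<m}"
  by (subst (asm) indep_vars_cong[OF refl _ refl]) auto
 then have iid: "iid_normal M (\<lambda>j \<omega>. incr v (W \<omega>) j) {..<m}"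
  using distr by (rule iid_normalI)
 show "\<exists>T'. finite T' \<and> T \<subseteq> T' \<and> T' \<subseteq> UNIV \<and>
   (\<forall>A. (\<forall>i. A i \<in> sets borel) \<longrightarrow> prob {\<omega> \<in> space M. \<forall>i\<in>T'. incr v (W \<omega>) i \<in> A i} = (\<Prod>i\<in>T'. measure NN (A i)))"
  using m iid_normalD[OF iid] by (intro exI[of _ "{..<m}"]) auto
qed

definition unit_pois_law :: "nat => nat list => real" where
 "unit_pois_law m w = (if length w = m then (\<Prod>k<m. exp (-1) / fact (w ! k)) else 0)"

text \<open>A Poisson total of mean 2^R, independent of the Brownian path. Split multinomially over
  2^R leaves it yields independent Poisson variables of mean 1, while all splitting noise comes from
  the path.\<close>

definition S1 :: "nat => (nat \<times> (nat \<times> nat => real)) measure" where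
 "S1 R = measure_pmf (pois (2 ^ R)) \<Otimes>\<^sub>M BMsp"

lemma prob_space_S1: "prob_space (S1 R)"
 unfolding S1_def by (intro prob_space_pair prob_space_BMsp measure_pmf.prob_space_axioms)

lemma mpres_S1: "mpres (S1 R) (measure_pmf (pois (2 ^ R))) fst" "mpres (S1 R) BMsp snd"
proof -
 interpret P: pair_prob_space "measure_pmf (pois (2 ^ R))" BMsp ..
 show "mpres (S1 R) (measure_pmf (pois (2 ^ R))) fst"
  unfolding S1_def mpres_def using BM.distr_pair_fst[of "measure_pmf (pois (2 ^ R))"] measure_pmf.prob_space_axioms by auto
 have "distr (measure_pmf (pois (2 ^ R)) \<Otimes>\<^sub>M BMsp) BMsp snd = BMsp"
 proof (rule measure_eqI)
  fix A assume "A \<in> sets (distr (measure_pmf (pois (2 ^ R)) \<Otimes>\<^sub>M BMsp) BMsp snd)"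
  then have A: "A \<in> sets BMsp" by simp
  have "snd -` A \<inter> space (measure_pmf (pois (2 ^ R)) \<Otimes>\<^sub>M BMsp) = UNIV \<times> A"
   using sets.sets_into_space[OF A] by (auto simp: space_pair_measure)
  then show "emeasure (distr (measure_pmf (pois (2 ^ R)) \<Otimes>\<^sub>M BMsp) BMsp snd) A = emeasure BMsp A"
   using A measure_pmf.emeasure_space_1 by (simp add: emeasure_distr BM.emeasure_pair_measure_Times)
 qed simp
 then show "mpres (S1 R) BMsp snd" unfolding S1_def mpres_def by auto
qed

definition S1W :: "nat \<times> (nat \<times> nat => real) => real => real" where
 "S1W \<omega> = bmW (snd \<omega>)"

definition S1N :: "(nat => real) => nat => nat \<times> (nat \<times> nat => real) => nat list" where
 "S1N v R \<omega> = map (cnt (noise (incr v (S1W \<omega>)) R) (fst \<omega>) R) [0..<2 ^ R]"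

lemma brownian_S1: "std_brownian_motion (S1 R) S1W"
 unfolding S1W_def
 by (rule mpres_std_brownian_motion[OF mpres_S1(2) prob_space_BMsp prob_space_S1 std_brownian_motion_bmW])

lemma S1N_nth: "k < 2 ^ R ==> S1N v R \<omega> ! k = cnt (noise (incr v (S1W \<omega>)) R) (fst \<omega>) R k"
 by (simp add: S1N_def)

text \<open>The list w determines the total x, so the event is a product {x} times a noise event;
  the Poisson weight of x times the multinomial probability is the product of unit Poisson
  weights.\<close>

lemma S1N_law:
 assumes v: "strict_mono v" "0 <= v 0"
 shows "{\<omega> \<in> space (S1 R). S1N v R \<omega> = w} \<in> sets (S1 R)"
  and "measure (S1 R) {\<omega> \<in> space (S1 R). S1N v R \<omega> = w} = unit_pois_law (2 ^ R) w"
proof -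
 have "{\<omega> \<in> space (S1 R). S1N v R \<omega> = w} \<in> sets (S1 R) \<and> measure (S1 R) {\<omega> \<in> space (S1 R). S1N v R \<omega> = w} = unit_pois_law (2 ^ R) w"
 proof (cases "length w = 2 ^ R")
  case False
  then have e: "{\<omega> \<in> space (S1 R). S1N v R \<omega> = w} = {}" by (auto simp: S1N_def)
  show ?thesis unfolding e using False by (simp add: unit_pois_law_def)
 next
  case True
  define x where "x = (\<Sum>k<2 ^ R. w ! k)"
  define S where "S = Sigma {..<R} (\<lambda>e. {..<2 ^ e :: nat})"
  obtain A where A: "\<And>p. A p \<in> sets borel"
   "\<And>z. (\<forall>k<2 ^ R. cnt z x R k = w ! k) \<longleftrightarrow> (\<forall>p\<in>S. z p \<in> A p)"
   "(\<Prod>p\<in>S. measure NN (A p)) = fact x / (\<Prod>k<2 ^ R. fact (w ! k)) / 2 ^ (R * x)"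
   using cnt_event[where d=R and v="\<lambda>k. w ! k" and x=x] unfolding S_def x_def by blast
  define E where "E = {z \<in> space BMsp. \<forall>p\<in>S. noise (incr v (bmW z)) R p \<in> A p}"
  have iid: "iid_normal BMsp (\<lambda>p z. noise (incr v (bmW z)) R p) {p. fst p < R}"
   using BM.iid_noise[OF iid_increments[OF prob_space_BMsp std_brownian_motion_bmW v]] by simp
  have S: "finite S" "S \<subseteq> {p. fst p < R}" by (auto simp: S_def)
  have Em: "E \<in> sets BMsp"
  proof -
   have "{z \<in> space BMsp. noise (incr v (bmW z)) R p \<in> A p} \<in> sets BMsp" if "p \<in> S" for p
    using measurable_sets[OF iid_normal_measurable[OF iid, of p] A(1)[of p]] S(2) that
    by (auto simp: vimage_def Int_def conj_commute)
   then show ?thesis unfolding E_def by (intro sets.sets_Collect_finite_All S) auto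
  qed
  have mE: "measure BMsp E = fact x / (\<Prod>k<2 ^ R. fact (w ! k)) / 2 ^ (R * x)"
   unfolding E_def using iid_normalD[OF iid S(1,2), of A] A(1,3) by simp
  have ev: "{\<omega> \<in> space (S1 R). S1N v R \<omega> = w} = {x} \<times> E"
  proof (intro equalityI subsetI)
   fix \<omega> assume \<omega>: "\<omega> \<in> {\<omega> \<in> space (S1 R). S1N v R \<omega> = w}"
   obtain y z where yz: "\<omega> = (y, z)" by (cases \<omega>)
   have c: "cnt (noise (incr v (bmW z)) R) y R k = w ! k" if "k < 2 ^ R" for k
    using \<omega> S1N_nth[OF that, of v \<omega>] yz by (auto simp: S1W_def)
   then have "y = x" using cnt_sum[of "noise (incr v (bmW z)) R" y R] by (simp add: x_def)
   then show "\<omega> \<in> {x} \<times> E" using c A(2)[of "noise (incr v (bmW z)) R"] \<omega> yz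
    by (auto simp: E_def S1_def space_pair_measure)
  next
   fix \<omega> assume "\<omega> \<in> {x} \<times> E"
   then obtain z where z: "\<omega> = (x, z)" "z \<in> E" by auto
   then have "\<forall>k<2 ^ R. cnt (noise (incr v (bmW z)) R) x R k = w ! k"
    using A(2)[of "noise (incr v (bmW z)) R"] by (auto simp: E_def)
   then have "S1N v R \<omega> = w" using True z(1) by (auto simp: S1N_def S1W_def intro!: nth_equalityI)
   then show "\<omega> \<in> {\<omega> \<in> space (S1 R). S1N v R \<omega> = w}" using z by (auto simp: E_def S1_def space_pair_measure)
  qed
  have "measure (S1 R) ({x} \<times> E) = pmf (pois (2 ^ R)) x * measure BMsp E"
  proof -
   have "emeasure (S1 R) ({x} \<times> E) = emeasure (measure_pmf (pois (2 ^ R))) {x} * emeasure BMsp E"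
    unfolding S1_def by (rule BM.emeasure_pair_measure_Times) (use Em in auto)
   then show ?thesis by (simp add: measure_def enn2real_mult emeasure_pmf_single)
  qed
  also have "\<dots> = (\<Prod>k<2 ^ R. exp (-1) / fact (w ! k))"
  proof -
   have "pmf (pois (2 ^ R)) x = (2 ^ R) ^ x / fact x * exp (- (2 ^ R))" by (simp add: pmf_pois)
   moreover have "(2 ^ R) ^ x = (2::real) ^ (R * x)" by (simp add: power_mult)
   moreover have "exp (- (2 ^ R)) = (\<Prod>k<2 ^ R :: nat. exp (-1 :: real))"
    by (simp add: exp_of_nat_mult[symmetric])
   ultimately show ?thesis unfolding mE by (simp add: prod_dividef)
  qed
  finally show ?thesis using True ev Em unfolding S1_def unit_pois_law_def
   by (auto intro!: pair_measureI)
 qed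
 then show "{\<omega> \<in> space (S1 R). S1N v R \<omega> = w} \<in> sets (S1 R)"
  and "measure (S1 R) {\<omega> \<in> space (S1 R). S1N v R \<omega> = w} = unit_pois_law (2 ^ R) w" by auto
qed

lemma S1N_measurable:
 assumes "strict_mono v" "0 <= v 0"
 shows "S1N v R \<in> measurable (S1 R) (count_space UNIV)"
proof (subst measurable_count_space_eq2_countable, intro conjI ballI)
 fix w
 have "S1N v R -` {w} \<inter> space (S1 R) = {\<omega> \<in> space (S1 R). S1N v R \<omega> = w}" by auto
 then show "S1N v R -` {w} \<inter> space (S1 R) \<in> sets (S1 R)" using S1N_law(1)[OF assms] by simp
qed simp

text \<open>Only the first 2^r of the 2^(2r) leaves are used. The total and the root sum fluctuate
  by about 2^r, and a partial sum with k <= 2^r takes the share k / 2^(2r) <= 2^-r of that, which is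
  O(1). The path noise contributes O(r). The last clause bounds single counts, for the one block
  that a prefix cuts in two.\<close>

lemma S1_coupling:
 obtains K where "K >= 1" "\<And>v r. strict_mono v ==> 0 <= v 0 ==> 1 <= r ==>
  \<exists>D. D \<in> borel_measurable (S1 (2 * r)) \<and> (\<integral>\<^sup>+\<omega>. ennreal (D \<omega>) \<partial>S1 (2 * r)) <= ennreal (K * real r) \<and>
   (\<forall>\<omega>. 0 <= D \<omega> \<and> (\<forall>k\<le>2 ^ r. \<bar>(\<Sum>j<k. real (S1N v (2 * r) \<omega> ! j) - 1) - (\<Sum>j<k. incr v (S1W \<omega>) j)\<bar> <= D \<omega>)
     \<and> (\<forall>j<2 ^ r. real (S1N v (2 * r) \<omega> ! j) <= D \<omega>))"
proof -
 obtain K where K: "K >= 1" "\<And>g R x k. k < 2 ^ R ==>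
  \<bar>(\<Sum>j<k. real (cnt (noise g R) x R j) - 1) - (\<Sum>j<k. g j)\<bar>
   <= real k / 2 ^ R * (\<bar>real x - 2 ^ R\<bar> + sqrt (2 ^ R) * \<bar>hsum g R 0\<bar>) + (sqrt x - sqrt (2 ^ R))\<^sup>2
    + K * (\<Sum>d<R. 1 + (noise g R (d, k div 2 ^ (R - d)))\<^sup>2)"
  using tree_bound by blast
 show ?thesis
 proof (rule that[of "100 * K"])
  show "100 * K >= 1" using K(1) by simp
  fix v :: "nat => real" and r :: nat assume v: "strict_mono v" "0 <= v 0" and r: "1 <= r"
  define R where "R = 2 * r"
  define T where "T = (2::real) ^ R"
  have T3: "T = 2 ^ r * 2 ^ r" unfolding T_def R_def mult_2 power_add ..
  then have T: "T > 0" "sqrt T = 2 ^ r" "T = 2 ^ r * 2 ^ r" by simp_all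
  define g where "g = (\<lambda>j \<omega>. incr v (S1W \<omega>) j)"
  interpret S: prob_space "S1 R" by (rule prob_space_S1)
  have iid: "iid_normal (S1 R) g UNIV"
   unfolding g_def by (rule iid_increments[OF prob_space_S1 brownian_S1 v])
  note gm[measurable] = iid_normal_measurable[OF iid UNIV_I]
  define h where "h = (\<lambda>\<omega>. haar (\<lambda>j. g j \<omega>) R 0)"
  have iidh: "iid_normal (S1 R) (\<lambda>p \<omega>. haar (\<lambda>j. g j \<omega>) R p) UNIV" by (rule S.iid_haar[OF iid])
  have hm[measurable]: "h \<in> borel_measurable (S1 R)" unfolding h_def using iid_normal_measurable[OF iidh] by simp
  have pm[measurable]: "(\<lambda>\<omega>. path_exp (\<lambda>j. g j \<omega>) R) \<in> borel_measurable (S1 R)"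
  proof -
   have n: "(\<lambda>\<omega>. noise (\<lambda>j. g j \<omega>) R p) \<in> borel_measurable (S1 R)" if "fst p < R" for p
    using iid_normal_measurable[OF S.iid_noise[OF iid, of R]] that by simp
   show ?thesis unfolding path_exp_def
    by (intro borel_measurable_times borel_measurable_sum measurable_compose[OF _ borel_measurable_exp]
      borel_measurable_divide borel_measurable_power n) auto
  qed
  have fm[measurable]: "(\<lambda>\<omega>. f (fst \<omega>) :: real) \<in> borel_measurable (S1 R)" for f :: "nat => real"
   using measurable_compose[OF mpres_measurable[OF mpres_S1(1)[of R]], of f borel] by simp
  \<comment> \<open>\<open>V\<close> has mean 1 by the Poisson variance; it dominates both the
    linear share of the root deviation and the squared gap of square roots. \<open>X\<close> plays
    for single increments the role that \<open>path_exp\<close> plays for paths.\<close>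
  define V :: "nat \<times> (nat \<times> nat => real) => real" where "V = (\<lambda>\<omega>. (real (fst \<omega>) - T)\<^sup>2 / T)"
  define X where "X = (\<lambda>\<omega>. (\<Sum>j<2 ^ r. exp \<bar>g j \<omega>\<bar>) / 2 ^ r)"
  define D0 where "D0 = (\<lambda>\<omega>. 1 + 2 * V \<omega> + exp \<bar>h \<omega>\<bar> + K * (9 * real R + 4 * path_exp (\<lambda>j. g j \<omega>) R))"
  define D where "D = (\<lambda>\<omega>. 2 * D0 \<omega> + 1 + real r + X \<omega>)"
  have pe0: "0 <= path_exp (\<lambda>j. g j \<omega>) R" for \<omega> by (simp add: path_exp_def sum_nonneg)
  have V0: "0 <= V \<omega>" for \<omega> using T by (simp add: V_def)
  have X0: "0 <= X \<omega>" for \<omega> by (simp add: X_def sum_nonneg)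
  have D00: "0 <= D0 \<omega>" for \<omega> using V0[of \<omega>] pe0[of \<omega>] K(1) by (simp add: D0_def)
  have main: "\<bar>(\<Sum>j<k. real (S1N v R \<omega> ! j) - 1) - (\<Sum>j<k. g j \<omega>)\<bar> <= D0 \<omega>" if k: "k <= 2 ^ r" for k \<omega>
  proof -
   have kR: "k < 2 ^ R"
   proof -
    have "(2::nat) ^ r < 2 ^ R" using r by (intro power_strict_increasing) (auto simp: R_def)
    with k show ?thesis by (rule le_less_trans)
   qed
   define x where "x = fst \<omega>"
   have sN: "(\<Sum>j<k. real (S1N v R \<omega> ! j) - 1) = (\<Sum>j<k. real (cnt (noise (\<lambda>j. g j \<omega>) R) x R j) - 1)"
    using kR by (intro sum.cong) (auto simp: S1N_nth g_def x_def)
   have A1: "real k / 2 ^ R * (\<bar>real x - 2 ^ R\<bar> + sqrt (2 ^ R) * \<bar>hsum (\<lambda>j. g j \<omega>) R 0\<bar>) <= 1 + V \<omega> + exp \<bar>h \<omega>\<bar>"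
   proof -
    have kT: "real k / 2 ^ R <= 1 / 2 ^ r"
    proof -
     have "real k <= 2 ^ r" using k by (metis of_nat_le_iff of_nat_numeral of_nat_power)
     then have "real k / T <= 2 ^ r / T" using T(1) by (intro divide_right_mono) auto
     also have "\<dots> = 1 / 2 ^ r" unfolding T(3) by simp
     finally show ?thesis by (simp add: T_def)
    qed
    have "real k / 2 ^ R * (\<bar>real x - 2 ^ R\<bar> + sqrt (2 ^ R) * \<bar>hsum (\<lambda>j. g j \<omega>) R 0\<bar>)
      <= 1 / 2 ^ r * (\<bar>real x - T\<bar> + 2 ^ r * \<bar>h \<omega>\<bar>)"
     using kT T(2) by (intro mult_mono) (auto simp: T_def h_def hsum_def)
    also have "\<dots> = \<bar>real x - T\<bar> / 2 ^ r + \<bar>h \<omega>\<bar>" by (simp add: field_simps)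
    also have "\<bar>real x - T\<bar> / 2 ^ r <= 1 + V \<omega>"
    proof -
     have "V \<omega> = (\<bar>real x - T\<bar> / 2 ^ r)\<^sup>2" unfolding V_def x_def T(3) by (simp add: power2_eq_square)
     moreover have "y <= 1 + y\<^sup>2" for y :: real using zero_le_power2[of "y - 1/2"]
      by (simp add: power2_eq_square algebra_simps)
     ultimately show ?thesis by simp
    qed
    also have "\<bar>h \<omega>\<bar> <= exp \<bar>h \<omega>\<bar>" using exp_ge_add_one_self[of "\<bar>h \<omega>\<bar>"] by linarith
    finally show ?thesis by simp
   qed
   have A2: "(sqrt x - sqrt (2 ^ R))\<^sup>2 <= V \<omega>"
   proof -
    have "\<bar>sqrt x - sqrt T\<bar> * sqrt T <= \<bar>sqrt x - sqrt T\<bar> * (sqrt x + sqrt T)"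
     by (intro mult_left_mono) auto
    also have "\<dots> = \<bar>(sqrt x - sqrt T) * (sqrt x + sqrt T)\<bar>" by (simp add: abs_mult T_def)
    also have "(sqrt x - sqrt T) * (sqrt x + sqrt T) = real x - T"
     using T(1) by (simp add: algebra_simps)
    finally have "(\<bar>sqrt x - sqrt T\<bar> * sqrt T)\<^sup>2 <= \<bar>real x - T\<bar>\<^sup>2" using T(1) by (intro power_mono) auto
    then have "(sqrt x - sqrt T)\<^sup>2 * T <= (real x - T)\<^sup>2" using T(1) by (simp add: power_mult_distrib)
    then have "(sqrt x - sqrt T)\<^sup>2 <= (real x - T)\<^sup>2 / T" using T(1) by (simp add: pos_le_divide_eq)
    then show ?thesis by (simp add: V_def x_def T_def)
   qed
   have A3: "K * (\<Sum>d<R. 1 + (noise (\<lambda>j. g j \<omega>) R (d, k div 2 ^ (R - d)))\<^sup>2) <= K * (9 * real R + 4 * path_exp (\<lambda>j. g j \<omega>) R)"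
    using K(1) path_sum_le[OF kR, of "\<lambda>j. g j \<omega>"] by (intro mult_left_mono) (auto simp: sum.distrib)
   have lin: "a <= p + q + s ==> p <= 1 + V' + e ==> q <= V' ==> s <= s' ==> a <= 1 + 2 * V' + e + s'" for a p q s s' V' e :: real
    by linarith
   show ?thesis unfolding sN D0_def by (rule lin[OF K(2)[OF kR] A1 A2 A3])
  qed
  have single: "real (S1N v R \<omega> ! j) <= D \<omega>" if j: "j < 2 ^ r" for j \<omega>
  proof -
   \<comment> \<open>Subtracting r before exponentiating divides by exp r, which exceeds the number
     2^r of increments, so the average \<open>X\<close> bounds each of them.\<close>
   have gX: "\<bar>g j \<omega>\<bar> <= real r + X \<omega>"
   proof -
    have "\<bar>g j \<omega>\<bar> - real r <= exp (\<bar>g j \<omega>\<bar> - real r)" using exp_ge_add_one_self[of "\<bar>g j \<omega>\<bar> - real r"] by linarith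
    also have "\<dots> = exp \<bar>g j \<omega>\<bar> / exp (real r)" by (simp add: exp_diff)
    also have "\<dots> <= exp \<bar>g j \<omega>\<bar> / 2 ^ r"
    proof (rule divide_left_mono)
     have "(2::real) ^ r <= exp 1 ^ r" using exp_ge_add_one_self[of "1::real"] by (intro power_mono) auto
     then show "(2::real) ^ r <= exp (real r)" by (simp add: exp_of_nat_mult[symmetric])
    qed auto
    also have "\<dots> <= X \<omega>" unfolding X_def using j by (intro divide_right_mono member_le_sum) auto
    finally show ?thesis by simp
   qed
   define P where "P = (\<lambda>k. (\<Sum>i<k. real (S1N v R \<omega> ! i) - 1) - (\<Sum>i<k. g i \<omega>))"
   have "real (S1N v R \<omega> ! j) = P (Suc j) - P j + 1 + g j \<omega>" by (simp add: P_def)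
   moreover have "\<bar>P k\<bar> <= D0 \<omega>" if "k <= 2 ^ r" for k unfolding P_def by (rule main[OF that])
   then have "\<bar>P (Suc j)\<bar> <= D0 \<omega>" "\<bar>P j\<bar> <= D0 \<omega>" using j by auto
   ultimately show ?thesis unfolding D_def using gX by linarith
  qed
  have gexp: "(\<integral>\<^sup>+\<omega>. ennreal (exp \<bar>Y \<omega>\<bar>) \<partial>S1 R) <= ennreal 4" if "Y \<in> borel_measurable (S1 R)" "distr (S1 R) borel Y = NN" for Y
  proof -
   have "(\<integral>\<^sup>+\<omega>. ennreal (exp \<bar>Y \<omega>\<bar>) \<partial>S1 R) = (\<integral>\<^sup>+x. ennreal (exp \<bar>x\<bar>) \<partial>distr (S1 R) borel Y)"
    using that(1) by (subst nn_integral_distr) auto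
   then show ?thesis using that(2) nn_integral_exp_NN by simp
  qed
  have EV: "(\<integral>\<^sup>+\<omega>. ennreal (V \<omega>) \<partial>S1 R) <= ennreal 1"
  proof -
   have "(\<integral>\<^sup>+\<omega>. ennreal (V \<omega>) \<partial>S1 R) = (\<integral>\<^sup>+x. ennreal ((real x - T)\<^sup>2 / T) \<partial>measure_pmf (pois (2 ^ R)))"
    unfolding V_def by (rule mpres_nn_integral[OF mpres_S1(1)]) simp
   also have "\<dots> = (\<integral>\<^sup>+x. ennreal (1 / T) * ennreal ((real x - T)\<^sup>2) \<partial>measure_pmf (pois T))"
    unfolding T_def[symmetric] using T(1) by (intro nn_integral_cong) (auto simp: ennreal_mult'[symmetric])
   also have "\<dots> = ennreal (1 / T) * ennreal T"
    using T(1) by (subst nn_integral_cmult) (auto simp: nn_integral_pois_var)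
   also have "\<dots> = ennreal 1" using T(1) by (simp add: ennreal_mult'[symmetric])
   finally show ?thesis by simp
  qed
  have EX: "(\<integral>\<^sup>+\<omega>. ennreal (X \<omega>) \<partial>S1 R) <= ennreal 4"
  proof -
   have "(\<integral>\<^sup>+\<omega>. ennreal (X \<omega>) \<partial>S1 R) = (\<integral>\<^sup>+\<omega>. ennreal (1 / 2 ^ r) * (\<Sum>j<2 ^ r. ennreal (exp \<bar>g j \<omega>\<bar>)) \<partial>S1 R)"
   proof (rule nn_integral_cong)
    fix \<omega>
    have "X \<omega> = 1 / 2 ^ r * (\<Sum>j<2 ^ r. exp \<bar>g j \<omega>\<bar>)" by (simp add: X_def)
    also have "ennreal \<dots> = ennreal (1 / 2 ^ r) * ennreal (\<Sum>j<2 ^ r. exp \<bar>g j \<omega>\<bar>)" by (rule ennreal_mult) (auto intro: sum_nonneg)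
    also have "ennreal (\<Sum>j<2 ^ r. exp \<bar>g j \<omega>\<bar>) = (\<Sum>j<2 ^ r. ennreal (exp \<bar>g j \<omega>\<bar>))" by (rule sum_ennreal[symmetric]) simp
    finally show "ennreal (X \<omega>) = ennreal (1 / 2 ^ r) * (\<Sum>j<2 ^ r. ennreal (exp \<bar>g j \<omega>\<bar>))" .
   qed
   also have "\<dots> = ennreal (1 / 2 ^ r) * (\<Sum>j<2 ^ r. \<integral>\<^sup>+\<omega>. ennreal (exp \<bar>g j \<omega>\<bar>) \<partial>S1 R)"
    by (subst nn_integral_cmult) (auto simp: nn_integral_sum simp del: sum_ennreal)
   also have "\<dots> <= ennreal (1 / 2 ^ r) * (\<Sum>j<2 ^ r :: nat. ennreal 4)"
    using S.iid_normal_distr[OF iid] by (intro mult_left_mono sum_mono gexp gm) auto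
   also have "(\<Sum>j<2 ^ r :: nat. ennreal 4) = ennreal (\<Sum>j<2 ^ r :: nat. 4)" by (rule sum_ennreal) simp
   also have "ennreal (1 / 2 ^ r) * \<dots> = ennreal 4" by (subst ennreal_mult[symmetric]) auto
   finally show ?thesis .
  qed
  have Eh: "(\<integral>\<^sup>+\<omega>. ennreal (exp \<bar>h \<omega>\<bar>) \<partial>S1 R) <= ennreal 4"
   by (rule gexp[OF hm]) (simp add: h_def S.iid_normal_distr[OF iidh])
  have EP: "(\<integral>\<^sup>+\<omega>. ennreal (path_exp (\<lambda>j. g j \<omega>) R) \<partial>S1 R) <= ennreal 1"
   using S.nn_integral_path_exp[OF iid, of R] by simp
  have "(\<integral>\<^sup>+\<omega>. ennreal (D \<omega>) \<partial>S1 R) = (\<integral>\<^sup>+\<omega>. ennreal (3 + real r + 18 * K * real R) + (ennreal 4 * ennreal (V \<omega>) + (ennreal 2 * ennreal (exp \<bar>h \<omega>\<bar>) + (ennreal (8 * K) * ennreal (path_exp (\<lambda>j. g j \<omega>) R) + ennreal (X \<omega>)))) \<partial>S1 R)"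
  proof (rule nn_integral_cong)
   fix \<omega>
   have "D \<omega> = (3 + real r + 18 * K * real R) + (4 * V \<omega> + (2 * exp \<bar>h \<omega>\<bar> + (8 * K * path_exp (\<lambda>j. g j \<omega>) R + X \<omega>)))"
    by (simp add: D_def D0_def algebra_simps)
   then show "ennreal (D \<omega>) = ennreal (3 + real r + 18 * K * real R) + (ennreal 4 * ennreal (V \<omega>) + (ennreal 2 * ennreal (exp \<bar>h \<omega>\<bar>) + (ennreal (8 * K) * ennreal (path_exp (\<lambda>j. g j \<omega>) R) + ennreal (X \<omega>))))"
    using K(1) V0[of \<omega>] X0[of \<omega>] pe0[of \<omega>]
    by (simp only: ennreal_plus[symmetric] ennreal_mult[symmetric] zero_le_numeral mult_nonneg_nonneg add_nonneg_nonneg exp_ge_zero of_nat_0_le_iff order_trans[OF zero_le_one])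
  qed
  also have "\<dots> = ennreal (3 + real r + 18 * K * real R) + (ennreal 4 * (\<integral>\<^sup>+\<omega>. ennreal (V \<omega>) \<partial>S1 R) + (ennreal 2 * (\<integral>\<^sup>+\<omega>. ennreal (exp \<bar>h \<omega>\<bar>) \<partial>S1 R) + (ennreal (8 * K) * (\<integral>\<^sup>+\<omega>. ennreal (path_exp (\<lambda>j. g j \<omega>) R) \<partial>S1 R) + (\<integral>\<^sup>+\<omega>. ennreal (X \<omega>) \<partial>S1 R))))"
  proof -
   have Vm: "V \<in> borel_measurable (S1 R)" unfolding V_def by (rule fm)
   have Xm: "X \<in> borel_measurable (S1 R)" unfolding X_def by measurable
   note [measurable] = Vm Xm
   show ?thesis by (simp add: nn_integral_add nn_integral_cmult S.emeasure_space_1)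
  qed
  also have "\<dots> <= ennreal (3 + real r + 18 * K * real R) + (ennreal 4 * ennreal 1 + (ennreal 2 * ennreal 4 + (ennreal (8 * K) * ennreal 1 + ennreal 4)))"
   by (intro add_left_mono add_mono mult_left_mono EV Eh EP EX) auto
  also have "\<dots> = ennreal (3 + real r + 18 * K * real R + (4 * 1 + (2 * 4 + (8 * K * 1 + 4))))"
   using K(1)
   by (simp only: ennreal_plus[symmetric] ennreal_mult[symmetric] zero_le_numeral zero_le_one mult_nonneg_nonneg add_nonneg_nonneg of_nat_0_le_iff order_trans[OF zero_le_one])
  also have "\<dots> <= ennreal (100 * K * real r)"
  proof (rule ennreal_leI)
   have k1: "real r <= K * real r" "K <= K * real r"
    using K(1) r mult_right_mono[of 1 K "real r"] mult_left_mono[of 1 "real r" K] by auto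
   moreover have "1 <= K * real r" using k1(2) K(1) by linarith
   moreover have "18 * K * real R = 36 * (K * real r)" "100 * K * real r = 100 * (K * real r)" by (simp_all add: R_def)
   ultimately show "3 + real r + 18 * K * real R + (4 * 1 + (2 * 4 + (8 * K * 1 + 4))) <= 100 * K * real r"
    by linarith
  qed
  finally have ED: "(\<integral>\<^sup>+\<omega>. ennreal (D \<omega>) \<partial>S1 R) <= ennreal (100 * K * real r)" .
  have Dm: "D \<in> borel_measurable (S1 R)"
  proof -
   have Vm: "V \<in> borel_measurable (S1 R)" unfolding V_def by (rule fm)
   have Xm: "X \<in> borel_measurable (S1 R)" unfolding X_def by measurable
   note [measurable] = Vm Xm
   show ?thesis unfolding D_def D0_def by measurable
  qed
  show "\<exists>D. D \<in> borel_measurable (S1 (2 * r)) \<and> (\<integral>\<^sup>+\<omega>. ennreal (D \<omega>) \<partial>S1 (2 * r)) <= ennreal (100 * K * real r) \<and>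
   (\<forall>\<omega>. 0 <= D \<omega> \<and> (\<forall>k\<le>2 ^ r. \<bar>(\<Sum>j<k. real (S1N v (2 * r) \<omega> ! j) - 1) - (\<Sum>j<k. incr v (S1W \<omega>) j)\<bar> <= D \<omega>)
     \<and> (\<forall>j<2 ^ r. real (S1N v (2 * r) \<omega> ! j) <= D \<omega>))"
  proof (intro exI[of _ D] conjI allI impI)
   show "D \<in> borel_measurable (S1 (2 * r))" using Dm by (simp add: R_def)
   show "(\<integral>\<^sup>+\<omega>. ennreal (D \<omega>) \<partial>S1 (2 * r)) <= ennreal (100 * K * real r)" using ED by (simp add: R_def)
   show "0 <= D \<omega>" for \<omega> using D00[of \<omega>] X0[of \<omega>] by (simp add: D_def)
   show "\<bar>(\<Sum>j<k. real (S1N v (2 * r) \<omega> ! j) - 1) - (\<Sum>j<k. incr v (S1W \<omega>) j)\<bar> <= D \<omega>" if "k <= 2 ^ r" for \<omega> k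
    using main[OF that, of \<omega>] D00[of \<omega>] X0[of \<omega>] by (simp add: D_def R_def g_def)
   show "real (S1N v (2 * r) \<omega> ! j) <= D \<omega>" if "j < 2 ^ r" for \<omega> j
    using single[OF that, of \<omega>] by (simp add: R_def)
  qed
 qed
qed

section \<open>Two partitions of a Poisson process\<close>

lemma pois_add:
 assumes "0 <= a" "0 <= b"
 shows "map_pmf (\<lambda>(x, y). x + y) (pair_pmf (pois a) (pois b)) = pois (a + b)"
proof (rule pmf_eqI)
 fix n :: nat
 have "pmf (map_pmf (\<lambda>(x, y). x + y) (pair_pmf (pois a) (pois b))) n
   = measure (pair_pmf (pois a) (pois b)) ((\<lambda>i. (i, n - i)) ` {..n})"
  unfolding pmf_map by (rule arg_cong[where f="measure _"]) (auto simp: image_iff)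
 also have "\<dots> = (\<Sum>p\<in>(\<lambda>i. (i, n - i)) ` {..n}. pmf (pair_pmf (pois a) (pois b)) p)"
  by (rule measure_measure_pmf_finite) simp
 also have "\<dots> = (\<Sum>i\<le>n. pmf (pair_pmf (pois a) (pois b)) (i, n - i))"
  by (subst sum.reindex) (auto simp: inj_on_def)
 also have "\<dots> = (\<Sum>i\<le>n. real (n choose i) * a ^ i * b ^ (n - i)) * (exp (- (a + b)) / fact n)"
  unfolding sum_distrib_right
 proof (rule sum.cong)
  fix i assume i: "i \<in> {..n}"
  have "exp (- (a + b)) = exp (- a) * exp (- b)" by (simp add: exp_add[symmetric])
  then show "pmf (pair_pmf (pois a) (pois b)) (i, n - i) = real (n choose i) * a ^ i * b ^ (n - i) * (exp (- (a + b)) / fact n)"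
   using i assms by (simp add: pmf_pair pmf_pois binomial_fact)
 qed simp
 also have "\<dots> = pmf (pois (a + b)) n"
  using assms binomial_ring[of a b n] by (simp add: pmf_pois atLeast0AtMost)
 finally show "pmf (map_pmf (\<lambda>(x, y). x + y) (pair_pmf (pois a) (pois b))) n = pmf (pois (a + b)) n" .
qed

lemma map_pair_pmf': "map_pmf (\<lambda>(x, y). (f x, g y)) (pair_pmf p q) = pair_pmf (map_pmf f p) (map_pmf g q)"
 by (simp add: map_pair)

lemma pois_sum:
 assumes "finite A" "\<And>i. i \<in> A ==> 0 <= \<mu> i"
 shows "map_pmf (\<lambda>f. \<Sum>i\<in>A. f i) (Pi_pmf A 0 (\<lambda>i. pois (\<mu> i))) = pois (\<Sum>i\<in>A. \<mu> i)"
 using assms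
proof (induction A rule: finite_induct)
 case empty
 then show ?case by (simp add: pois_def)
next
 case (insert x A)
 have "map_pmf (\<lambda>f. \<Sum>i\<in>insert x A. f i) (Pi_pmf (insert x A) 0 (\<lambda>i. pois (\<mu> i)))
   = map_pmf (\<lambda>(y, f). y + (\<Sum>i\<in>A. f i)) (pair_pmf (pois (\<mu> x)) (Pi_pmf A 0 (\<lambda>i. pois (\<mu> i))))"
  unfolding Pi_pmf_insert[OF insert(1,2)] pmf.map_comp
 proof (rule map_pmf_cong[OF refl])
  fix p :: "nat \<times> ('a => nat)"
  show "((\<lambda>f. sum f (insert x A)) \<circ> (\<lambda>(y, f). f(x := y))) p = (case p of (y, f) => y + sum f A)"
   using insert(1,2) by (auto simp: split_beta intro!: sum.cong)
 qed
 also have "\<dots> = map_pmf (\<lambda>(x, y). x + y) (map_pmf (\<lambda>(y, f). (y, \<Sum>i\<in>A. f i)) (pair_pmf (pois (\<mu> x)) (Pi_pmf A 0 (\<lambda>i. pois (\<mu> i)))))"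
  by (simp add: pmf.map_comp comp_def case_prod_unfold)
 also have "\<dots> = map_pmf (\<lambda>(x, y). x + y) (pair_pmf (pois (\<mu> x)) (pois (\<Sum>i\<in>A. \<mu> i)))"
  unfolding map_pair_pmf'[of "\<lambda>y. y"] using insert by simp
 also have "\<dots> = pois (\<Sum>i\<in>insert x A. \<mu> i)"
  using insert by (subst pois_add) (auto intro: sum_nonneg)
 finally show ?case .
qed

lemma pois_group_sums:
 fixes \<mu> :: "'i => real" and K :: "'l => 'i set"
 assumes "finite L" "\<And>l. l \<in> L ==> finite (K l)" "\<And>k l. k \<in> L ==> l \<in> L ==> k ~= l ==> K k \<inter> K l = {}"
  "\<And>i. 0 <= \<mu> i"
 shows "map_pmf (\<lambda>f l. if l \<in> L then \<Sum>i\<in>K l. f i else 0) (Pi_pmf (\<Union>l\<in>L. K l) 0 (\<lambda>i. pois (\<mu> i)))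
  = Pi_pmf L 0 (\<lambda>l. pois (\<Sum>i\<in>K l. \<mu> i))"
 using assms
proof (induction L rule: finite_induct)
 case empty
 then show ?case by simp
next
 case (insert x L)
 let ?U = "\<Union>l\<in>L. K l"
 have disj: "K x \<inter> ?U = {}" using insert.prems(2)[of x] insert.hyps(2) by blast
 have fin: "finite (K x)" "finite ?U" using insert.prems(1) insert.hyps(1) by auto
 have U: "(\<Union>l\<in>insert x L. K l) = K x \<union> ?U" by simp
 have "map_pmf (\<lambda>f l. if l \<in> insert x L then \<Sum>i\<in>K l. f i else 0) (Pi_pmf (K x \<union> ?U) 0 (\<lambda>i. pois (\<mu> i)))
  = map_pmf (\<lambda>(f, g). (\<lambda>l. if l \<in> L then \<Sum>i\<in>K l. g i else 0)(x := \<Sum>i\<in>K x. f i))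
   (pair_pmf (Pi_pmf (K x) 0 (\<lambda>i. pois (\<mu> i))) (Pi_pmf ?U 0 (\<lambda>i. pois (\<mu> i))))"
  unfolding Pi_pmf_union[OF fin disj] pmf.map_comp
 proof (rule map_pmf_cong[OF refl], rule ext)
  fix p :: "('i => nat) \<times> ('i => nat)" and l
  obtain f g where p: "p = (f, g)" by (cases p)
  have 1: "(\<Sum>i\<in>K x. if i \<in> K x then f i else g i) = (\<Sum>i\<in>K x. f i)" by (rule sum.cong) auto
  have 2: "(\<Sum>i\<in>K l. if i \<in> K x then f i else g i) = (\<Sum>i\<in>K l. g i)" if "l \<in> L"
   using disj that by (intro sum.cong) auto
  show "((\<lambda>f l. if l \<in> insert x L then \<Sum>i\<in>K l. f i else 0) \<circ> (\<lambda>(f, g) xa. if xa \<in> K x then f xa else g xa)) p l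
   = (case p of (f, g) => (\<lambda>l. if l \<in> L then \<Sum>i\<in>K l. g i else 0)(x := \<Sum>i\<in>K x. f i)) l"
   using 1 2 insert.hyps(2) by (auto simp: p)
 qed
 also have "\<dots> = map_pmf (\<lambda>(y, h). h(x := y)) (map_pmf (\<lambda>(f, g). (\<Sum>i\<in>K x. f i, \<lambda>l. if l \<in> L then \<Sum>i\<in>K l. g i else 0))
   (pair_pmf (Pi_pmf (K x) 0 (\<lambda>i. pois (\<mu> i))) (Pi_pmf ?U 0 (\<lambda>i. pois (\<mu> i)))))"
  by (simp add: pmf.map_comp comp_def case_prod_unfold)
 also have "\<dots> = map_pmf (\<lambda>(y, h). h(x := y)) (pair_pmf (pois (\<Sum>i\<in>K x. \<mu> i)) (Pi_pmf L 0 (\<lambda>l. pois (\<Sum>i\<in>K l. \<mu> i))))"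
  unfolding map_pair_pmf' using insert fin by (subst pois_sum) auto
 also have "\<dots> = Pi_pmf (insert x L) 0 (\<lambda>l. pois (\<Sum>i\<in>K l. \<mu> i))"
  by (rule Pi_pmf_insert[symmetric]) (use insert in auto)
 finally show ?case unfolding U .
qed

definition pois_law :: "(nat => real) => nat => nat list => real" where
 "pois_law \<mu> m w = (if length w = m then (\<Prod>k<m. \<mu> k ^ (w ! k) / fact (w ! k) * exp (- \<mu> k)) else 0)"

lemma unit_pois_law: "unit_pois_law m w = pois_law (\<lambda>_. 1) m w"
 by (simp add: unit_pois_law_def pois_law_def)

lemma pmf_map_Pi_pois:
 assumes "\<And>k. k < m ==> 0 <= \<mu> k"
 shows "pmf (map_pmf (\<lambda>f. map f [0..<m]) (Pi_pmf {..<m} 0 (\<lambda>k. pois (\<mu> k)))) w = pois_law \<mu> m w"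
proof (cases "length w = m")
 case False
 then have "w \<notin> set_pmf (map_pmf (\<lambda>f. map f [0..<m]) (Pi_pmf {..<m} 0 (\<lambda>k. pois (\<mu> k))))" by auto
 then have "pmf (map_pmf (\<lambda>f. map f [0..<m]) (Pi_pmf {..<m} 0 (\<lambda>k. pois (\<mu> k)))) w = 0"
  by (simp only: pmf_eq_0_set_pmf not_False_eq_True)
 then show ?thesis using False by (simp add: pois_law_def)
next
 case True
 let ?P = "Pi_pmf {..<m} 0 (\<lambda>k. pois (\<mu> k))"
 let ?f = "\<lambda>k. if k < m then w ! k else 0"
 have "pmf (map_pmf (\<lambda>f. map f [0..<m]) ?P) w = measure ?P ((\<lambda>f. map f [0..<m]) -` {w})"
  by (rule pmf_map)
 also have "\<dots> = measure ?P {?f}"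
 proof (rule measure_pmf.finite_measure_eq_AE)
  show "AE f in ?P. (f \<in> (\<lambda>f. map f [0..<m]) -` {w}) = (f \<in> {?f})"
  proof (rule AE_pmfI)
   fix f assume "f \<in> set_pmf ?P"
   then have f: "f k = 0" if "\<not> k < m" for k using set_Pi_pmf_subset[of "{..<m}" 0 "\<lambda>k. pois (\<mu> k)"] that by auto
   show "(f \<in> (\<lambda>f. map f [0..<m]) -` {w}) = (f \<in> {?f})"
    using True f by (auto simp: list_eq_iff_nth_eq fun_eq_iff)
  qed
 qed auto
 also have "\<dots> = pmf ?P ?f" by (simp add: measure_pmf_single)
 also have "\<dots> = (\<Prod>k<m. pmf (pois (\<mu> k)) (w ! k))"
  by (subst pmf_Pi') auto
 also have "\<dots> = pois_law \<mu> m w" using True assms by (simp add: pois_law_def pmf_pois)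
 finally show ?thesis .
qed

text \<open>For a >= 0, the length of [0, a] inside the unit cell [j, j + 1].\<close>

definition frac :: "real => nat => real" where
 "frac a j = min (max (a - real j) 0) 1"

lemma frac_mono: "a <= b ==> frac a j <= frac b j"
 by (auto simp: frac_def)

lemma frac_eq: "a <= real j ==> frac a j = 0" "real j + 1 <= a ==> frac a j = 1"
 by (auto simp: frac_def)

lemma sum_frac: "(\<Sum>j<J. frac a j) = min (max a 0) (real J)"
 by (induction J) (auto simp: frac_def min_def max_def)

text \<open>The real half line carries a unit rate Poisson process; rows cut it at the points of \<open>\<Lambda>\<close>, columns at the integers. Row \<open>n\<close> is the remainder up to \<open>J\<close>.\<close>
definition overlap :: "(nat => real) => nat => nat \<times> nat => real" where
 "overlap \<Lambda> n p = (if fst p < n then frac (\<Lambda> (Suc (fst p))) (snd p) - frac (\<Lambda> (fst p)) (snd p) else 1 - frac (\<Lambda> n) (snd p))"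

text \<open>Independent Poisson counts on the common refinement of the two partitions: by
  superposition the column sums are unit Poisson variables and the row sums have the increments of
  \<open>\<Lambda>\<close> as means, so both families come from one array.\<close>

definition Qpmf :: "(nat => real) => nat => nat => (nat \<times> nat => nat) pmf" where
 "Qpmf \<Lambda> n J = Pi_pmf ({..n} \<times> {..<J}) 0 (\<lambda>p. pois (overlap \<Lambda> n p))"

definition colsums :: "nat => nat => (nat \<times> nat => nat) => nat list" where
 "colsums n J q = map (\<lambda>j. \<Sum>k\<le>n. q (k, j)) [0..<J]"

definition rowsums :: "nat => nat => (nat \<times> nat => nat) => nat list" where
 "rowsums n J q = map (\<lambda>k. \<Sum>j<J. q (k, j)) [0..<n]"

context
 fixes \<Lambda> :: "nat => real" and n J :: nat
 assumes mono: "mono \<Lambda>" and \<Lambda>0: "\<Lambda> 0 = 0" and \<Lambda>n: "\<Lambda> n < real J"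
begin

lemma overlap_nonneg: "0 <= overlap \<Lambda> n p"
 using monoD[OF mono, of "fst p" "Suc (fst p)"] frac_mono by (auto simp: overlap_def) (simp add: frac_def)

lemma overlap_col: "(\<Sum>k\<le>n. overlap \<Lambda> n (k, j)) = 1"
proof -
 have "(\<Sum>k\<le>n. overlap \<Lambda> n (k, j)) = (\<Sum>k<n. overlap \<Lambda> n (k, j)) + overlap \<Lambda> n (n, j)"
  by (simp add: lessThan_Suc_atMost[symmetric])
 also have "(\<Sum>k<n. overlap \<Lambda> n (k, j)) = (\<Sum>k<n. frac (\<Lambda> (Suc k)) j - frac (\<Lambda> k) j)"
  by (rule sum.cong) (auto simp: overlap_def)
 also have "\<dots> = frac (\<Lambda> n) j - frac (\<Lambda> 0) j" by (rule sum_lessThan_telescope)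
 finally show ?thesis by (simp add: overlap_def \<Lambda>0 frac_def)
qed

lemma overlap_row: "k < n ==> (\<Sum>j<J. overlap \<Lambda> n (k, j)) = \<Lambda> (Suc k) - \<Lambda> k"
 using monoD[OF mono, of 0 k] monoD[OF mono, of k "Suc k"] monoD[OF mono, of "Suc k" n] \<Lambda>0 \<Lambda>n
 by (simp add: overlap_def sum_subtractf sum_frac)

lemma colsums_law: "pmf (map_pmf (colsums n J) (Qpmf \<Lambda> n J)) w = unit_pois_law J w"
proof -
 let ?K = "\<lambda>j. {..n} \<times> {j}"
 have I: "{..n} \<times> {..<J} = (\<Union>j\<in>{..<J}. ?K j)" by auto
 have s: "(\<Sum>i\<in>?K j. f i) = (\<Sum>k\<le>n. f (k, j))" for f :: "nat \<times> nat => 'c::comm_monoid_add" and j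
  by (rule sum.reindex_bij_witness[of _ "\<lambda>k. (k, j)" fst]) auto
 have "map_pmf (\<lambda>f. map f [0..<J]) (map_pmf (\<lambda>f l. if l \<in> {..<J} then \<Sum>i\<in>?K l. f i else 0) (Pi_pmf (\<Union>j\<in>{..<J}. ?K j) 0 (\<lambda>i. pois (overlap \<Lambda> n i))))
  = map_pmf (\<lambda>f. map f [0..<J]) (Pi_pmf {..<J} 0 (\<lambda>l. pois (\<Sum>i\<in>?K l. overlap \<Lambda> n i)))"
  by (subst pois_group_sums) (auto simp: overlap_nonneg)
 also have "(\<lambda>l. pois (\<Sum>i\<in>?K l. overlap \<Lambda> n i)) = (\<lambda>_. pois 1)" unfolding s overlap_col ..
 also have "map_pmf (\<lambda>f. map f [0..<J]) (map_pmf (\<lambda>f l. if l \<in> {..<J} then \<Sum>i\<in>?K l. f i else 0) (Pi_pmf (\<Union>j\<in>{..<J}. ?K j) 0 (\<lambda>i. pois (overlap \<Lambda> n i))))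
  = map_pmf (colsums n J) (Qpmf \<Lambda> n J)"
  unfolding Qpmf_def I pmf.map_comp s by (rule map_pmf_cong) (auto simp: colsums_def)
 finally show ?thesis using pmf_map_Pi_pois[of J "\<lambda>_. 1" w] unfolding unit_pois_law by simp
qed

lemma rowsums_law: "pmf (map_pmf (rowsums n J) (Qpmf \<Lambda> n J)) w = pois_law (\<lambda>k. \<Lambda> (Suc k) - \<Lambda> k) n w"
proof -
 let ?K = "\<lambda>k. {k} \<times> {..<J}"
 let ?U = "\<Union>k\<in>{..<n}. ?K k"
 have U: "?U \<subseteq> {..n} \<times> {..<J}" by auto
 have s: "(\<Sum>i\<in>?K k. f i) = (\<Sum>j<J. f (k, j))" for f :: "nat \<times> nat => 'c::comm_monoid_add" and k
  by (rule sum.reindex_bij_witness[of _ "\<lambda>j. (k, j)" snd]) auto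
 have "map_pmf (\<lambda>f. map f [0..<n]) (map_pmf (\<lambda>f l. if l \<in> {..<n} then \<Sum>i\<in>?K l. f i else 0) (Pi_pmf ?U 0 (\<lambda>i. pois (overlap \<Lambda> n i))))
  = map_pmf (\<lambda>f. map f [0..<n]) (Pi_pmf {..<n} 0 (\<lambda>l. pois (\<Sum>i\<in>?K l. overlap \<Lambda> n i)))"
  by (subst pois_group_sums) (auto simp: overlap_nonneg)
 also have "Pi_pmf {..<n} 0 (\<lambda>l. pois (\<Sum>i\<in>?K l. overlap \<Lambda> n i)) = Pi_pmf {..<n} 0 (\<lambda>k. pois (\<Lambda> (Suc k) - \<Lambda> k))"
  unfolding s by (rule Pi_pmf_cong) (auto simp: overlap_row)
 also have "map_pmf (\<lambda>f. map f [0..<n]) (map_pmf (\<lambda>f l. if l \<in> {..<n} then \<Sum>i\<in>?K l. f i else 0) (Pi_pmf ?U 0 (\<lambda>i. pois (overlap \<Lambda> n i))))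
  = map_pmf (rowsums n J) (Qpmf \<Lambda> n J)"
  unfolding Qpmf_def Pi_pmf_subset[OF _ U, simplified] pmf.map_comp s
  by (rule map_pmf_cong) (auto simp: rowsums_def intro!: sum.cong)
 finally show ?thesis using pmf_map_Pi_pois[of n "\<lambda>k. \<Lambda> (Suc k) - \<Lambda> k" w] monoD[OF mono] by simp
qed

text \<open>Both sums weight the same points of the process, once by row and once by column. A point
  can lie in cell (k, j) only if row and column overlap, so its two weights differ by at most C.
  Columns left of \<open>K\<close> lie entirely in the first m rows; only column \<open>K\<close> is
  cut, and it accounts for the extra term.\<close>

lemma rows_vs_cols:
 fixes l a :: "nat => real" and q :: "nat \<times> nat => nat"
 assumes q: "q \<in> set_pmf (Qpmf \<Lambda> n J)" and m: "m <= n"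
  and C: "\<And>k j. k < n ==> j < J ==> real j < \<Lambda> (Suc k) ==> \<Lambda> k < real j + 1 ==> \<bar>l k - a j\<bar> <= C"
  and a: "\<And>j. 0 <= a j" and C0: "0 <= C"
 defines "K \<equiv> nat \<lfloor>\<Lambda> m\<rfloor>"
 shows "\<bar>(\<Sum>k<m. l k * real (rowsums n J q ! k)) - (\<Sum>j<K. a j * real (colsums n J q ! j))\<bar>
  <= C * (\<Sum>k<n. real (rowsums n J q ! k)) + a K * real (colsums n J q ! K)" "K < J"
proof -
 have \<Lambda>m: "0 <= \<Lambda> m" "\<Lambda> m < real J" using monoD[OF mono, of 0 m] monoD[OF mono, of m n] m \<Lambda>0 \<Lambda>n by auto
 have K: "real K <= \<Lambda> m" "\<Lambda> m < real K + 1" using \<Lambda>m by (auto simp: K_def)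
 have "real K < real J" using K \<Lambda>m by linarith
 then show KJ: "K < J" by simp
 \<comment> \<open>An empty intersection has rate 0, where \<open>pois\<close> is the point mass at
   0; on the support of the array its count therefore vanishes.\<close>
 have q0: "q p = 0" if "overlap \<Lambda> n p = 0" for p
 proof -
  have "q \<in> PiE_dflt ({..n} \<times> {..<J}) 0 (set_pmf \<circ> (\<lambda>p. pois (overlap \<Lambda> n p)))"
   using q set_Pi_pmf[of "{..n} \<times> {..<J}" 0 "\<lambda>p. pois (overlap \<Lambda> n p)"] by (simp add: Qpmf_def)
  then have "(p \<in> {..n} \<times> {..<J} \<longrightarrow> q p \<in> set_pmf (pois (overlap \<Lambda> n p))) \<and> (p \<notin> {..n} \<times> {..<J} \<longrightarrow> q p = 0)"
   unfolding PiE_dflt_def mem_Collect_eq comp_def by (rule spec)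
  then have "q p \<in> set_pmf (pois (overlap \<Lambda> n p)) \<or> q p = 0" by meson
  then show ?thesis unfolding that by (auto simp: pois_def)
 qed
 have pos: "real j < \<Lambda> (Suc k) \<and> \<Lambda> k < real j + 1" if "k < n" "q (k, j) ~= 0" for k j
 proof -
  have ne: "frac (\<Lambda> (Suc k)) j ~= frac (\<Lambda> k) j" using q0[of "(k, j)"] that by (auto simp: overlap_def)
  have le: "\<Lambda> k <= \<Lambda> (Suc k)" using monoD[OF mono, of k "Suc k"] by simp
  show ?thesis
  proof (intro conjI; rule ccontr)
   assume "\<not> real j < \<Lambda> (Suc k)"
   then show False using ne le by (simp add: frac_eq)
  next
   assume "\<not> \<Lambda> k < real j + 1"
   then show False using ne le by (simp add: frac_eq)
  qed
 qed
 have row: "rowsums n J q ! k = (\<Sum>j<J. q (k, j))" if "k < n" for k using that by (simp add: rowsums_def)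
 have col: "colsums n J q ! j = (\<Sum>k\<le>n. q (k, j))" if "j < J" for j using that by (simp add: colsums_def)
 have "(\<Sum>k<m. l k * real (rowsums n J q ! k)) = (\<Sum>k<m. \<Sum>j<J. l k * real (q (k, j)))"
  using m by (intro sum.cong) (auto simp: row sum_distrib_left)
 also have "\<dots> = (\<Sum>k<m. \<Sum>j<J. (l k - a j) * real (q (k, j))) + (\<Sum>k<m. \<Sum>j<J. a j * real (q (k, j)))"
 proof -
  have "(\<Sum>k<m. \<Sum>j<J. l k * real (q (k, j))) = (\<Sum>k<m. \<Sum>j<J. (l k - a j) * real (q (k, j)) + a j * real (q (k, j)))"
   by (intro sum.cong refl) (simp add: left_diff_distrib)
  then show ?thesis by (simp only: sum.distrib)
 qed
 finally have split: "(\<Sum>k<m. l k * real (rowsums n J q ! k)) = (\<Sum>k<m. \<Sum>j<J. (l k - a j) * real (q (k, j))) + (\<Sum>k<m. \<Sum>j<J. a j * real (q (k, j)))" .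
 have A: "\<bar>\<Sum>k<m. \<Sum>j<J. (l k - a j) * real (q (k, j))\<bar> <= C * (\<Sum>k<n. real (rowsums n J q ! k))"
 proof -
  have "\<bar>\<Sum>k<m. \<Sum>j<J. (l k - a j) * real (q (k, j))\<bar> <= (\<Sum>k<m. \<Sum>j<J. \<bar>(l k - a j) * real (q (k, j))\<bar>)"
   by (intro order_trans[OF sum_abs] sum_mono sum_abs)
  also have "\<dots> <= (\<Sum>k<m. \<Sum>j<J. C * real (q (k, j)))"
  proof (intro sum_mono)
   fix k j assume "k \<in> {..<m}" "j \<in> {..<J}"
   then show "\<bar>(l k - a j) * real (q (k, j))\<bar> <= C * real (q (k, j))"
    using pos[of k j] C[of k j] m by (cases "q (k, j) = 0") (auto simp: abs_mult intro!: mult_right_mono)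
  qed
  also have "\<dots> = C * (\<Sum>k<m. real (rowsums n J q ! k))"
   unfolding sum_distrib_left using m by (intro sum.cong) (auto simp: row sum_distrib_left)
  also have "\<dots> <= C * (\<Sum>k<n. real (rowsums n J q ! k))"
   using m C0 by (intro mult_left_mono sum_mono2) auto
  finally show ?thesis .
 qed
 define s where "s = (\<lambda>j. \<Sum>k<m. real (q (k, j)))"
 have "(\<Sum>k<m. \<Sum>j<J. a j * real (q (k, j))) = (\<Sum>j<J. a j * s j)"
  unfolding s_def sum_distrib_left by (rule sum.swap)
 also have "\<dots> = (\<Sum>j<Suc K. a j * s j)"
 proof (rule sum.mono_neutral_right)
  show "\<forall>j\<in>{..<J} - {..<Suc K}. a j * s j = 0"
  proof
   fix j assume j: "j \<in> {..<J} - {..<Suc K}"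
   have "q (k, j) = 0" if "k < m" for k
   proof (rule ccontr)
    assume "q (k, j) ~= 0"
    then have "real j < \<Lambda> (Suc k)" using pos[of k j] that m by auto
    also have "\<dots> <= \<Lambda> m" using that by (intro monoD[OF mono]) auto
    finally show False using K j by auto
   qed
   then show "a j * s j = 0" by (simp add: s_def)
  qed
 qed (use KJ in auto)
 also have "\<dots> = (\<Sum>j<K. a j * s j) + a K * s K" by simp
 also have "(\<Sum>j<K. a j * s j) = (\<Sum>j<K. a j * real (colsums n J q ! j))"
 proof (rule sum.cong)
  fix j assume j: "j \<in> {..<K}"
  have "(\<Sum>k\<le>n. real (q (k, j))) = (\<Sum>k<m. real (q (k, j)))"
  proof (rule sum.mono_neutral_right)
   show "\<forall>k\<in>{..n} - {..<m}. real (q (k, j)) = 0"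
   proof
    fix k assume k: "k \<in> {..n} - {..<m}"
    have "\<Lambda> m <= \<Lambda> k" "\<Lambda> m <= \<Lambda> n" "\<Lambda> k <= \<Lambda> (Suc k)" using k m by (auto intro!: monoD[OF mono])
    moreover have "real j + 1 <= \<Lambda> m" using K j by auto
    ultimately have "real j + 1 <= \<Lambda> k" "real j + 1 <= \<Lambda> n" "real j + 1 <= \<Lambda> (Suc k)" by linarith+
    then have "overlap \<Lambda> n (k, j) = 0" by (simp add: overlap_def frac_eq)
    then show "real (q (k, j)) = 0" using q0 by simp
   qed
  qed (use m in auto)
  then show "a j * s j = a j * real (colsums n J q ! j)" using j KJ by (simp add: s_def col)
 qed simp
 finally have B: "(\<Sum>k<m. \<Sum>j<J. a j * real (q (k, j))) = (\<Sum>j<K. a j * real (colsums n J q ! j)) + a K * s K" .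
 have sK: "0 <= s K" "s K <= real (colsums n J q ! K)"
  using m KJ by (auto simp: s_def col intro!: sum_nonneg sum_mono2)
 have "0 <= a K * s K" "a K * s K <= a K * real (colsums n J q ! K)"
  using sK a[of K] by (auto intro: mult_left_mono)
 then show "\<bar>(\<Sum>k<m. l k * real (rowsums n J q ! k)) - (\<Sum>j<K. a j * real (colsums n J q ! j))\<bar>
  <= C * (\<Sum>k<n. real (rowsums n J q ! k)) + a K * real (colsums n J q ! K)"
  using A unfolding split B by linarith
qed

end

section \<open>Cycle counts of permutations\<close>

lemma orbit_closed_subset:
 assumes "x \<in> A" "\<And>y. y \<in> A ==> f y \<in> A" shows "orbit f x \<subseteq> A"
proof
 fix y assume "y \<in> orbit f x"
 then show "y \<in> A" by (induction rule: orbit.induct) (use assms in auto)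
qed

lemma orbit_eq:
 assumes "permutation f" "y \<in> orbit f x" shows "orbit f y = orbit f x"
 using assms by (metis cyclic_on_orbit' orbit_cyclic_eq3)

text \<open>Composing with the transposition of a new point a and a point b inserts a into the cycle
  of b, immediately before b; all other cycles are unchanged.\<close>

lemma insert_orbits:
 assumes q: "q permutes S" and S: "finite S" and a: "a \<notin> S" and b: "b \<in> S"
 defines "s \<equiv> Transposition.transpose a b \<circ> q"
 shows "x \<in> S ==> x \<notin> orbit q b ==> orbit s x = orbit q x"
  and "x \<in> insert a (orbit q b) ==> orbit s x = insert a (orbit q b)"
proof -
 have pq: "permutation q" using S q by (rule permutes_imp_permutation)
 have ps: "permutation s"
 proof (rule permutes_imp_permutation[of "insert a S"])
  have "q permutes insert a S" using q by (rule permutes_subset) auto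
  moreover have "Transposition.transpose a b permutes insert a S" using b by (intro permutes_swap_id) auto
  ultimately show "s permutes insert a S" unfolding s_def by (rule permutes_compose)
 qed (use S in simp)
 have qa: "q a = a" using q a by (rule permutes_not_in)
 have qna: "q y ~= a" if "y ~= a" for y using permutes_inj[OF q] qa that by (metis injD)
 have bO: "b \<in> orbit q b" using pq by (rule permutation_self_in_orbit)
 have OS: "orbit q b \<subseteq> S" using orbit_closed_subset[of b S q] b permutes_in_image[OF q] by auto
 { assume x: "x \<in> S" "x \<notin> orbit q b"
  have xO: "x \<in> orbit q x" using pq by (rule permutation_self_in_orbit)
  have xS: "orbit q x \<subseteq> S" using orbit_closed_subset[of x S q] x permutes_in_image[OF q] by auto
  show "orbit s x = orbit q x"
  proof (rule orbit_cong0[symmetric, of x "orbit q x"])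
   fix y assume y: "y \<in> orbit q x"
   have "q y \<in> orbit q x" using y by (rule orbit.step)
   then have "q y ~= b" using orbit_eq[OF pq, of b x] x(2) xO by auto
   moreover have "q y ~= a" using y xS a by (intro qna) auto
   ultimately show "q y = s y" by (simp add: s_def Transposition.transpose_def)
  qed (use xO in \<open>auto intro: orbit.step\<close>) }
 have sa: "s a = b" by (simp add: s_def qa)
 have sy: "s y = (if q y = b then a else q y)" if "y ~= a" for y
  using qna[OF that] by (simp add: s_def Transposition.transpose_def)
 have sub: "insert a (orbit q b) \<subseteq> orbit s a"
 proof -
  have b_in: "b \<in> orbit s a" using orbit.base[of s a] sa by simp
  have "y \<in> orbit s a" if "y \<in> orbit q b" for y
   using that
  proof (induction rule: orbit.induct)
   case base
   have "b ~= a" using a b by auto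
   then show ?case using b_in sy[of b] orbit.step[OF b_in] by (cases "q b = b") auto
  next
   case (step y)
   then have "y ~= a" using OS a by auto
   then show ?case using b_in sy[of y] orbit.step[OF step(2)] by (cases "q y = b") auto
  qed
  moreover have "a \<in> orbit s a" using ps by (rule permutation_self_in_orbit)
  ultimately show ?thesis by auto
 qed
 have "orbit s a \<subseteq> insert a (orbit q b)"
 proof (rule orbit_closed_subset)
  fix y assume y: "y \<in> insert a (orbit q b)"
  show "s y \<in> insert a (orbit q b)"
  proof (cases "y = a")
   case True
   then show ?thesis using sa bO by simp
  next
   case False
   then show ?thesis using sy[OF False] y orbit.step[of y q b] by auto
  qed
 qed simp
 then have eq: "orbit s a = insert a (orbit q b)" using sub by blast
 assume "x \<in> insert a (orbit q b)"
 then show "orbit s x = insert a (orbit q b)" using orbit_eq[OF ps, of x a] eq by simp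
qed

context
 fixes n :: nat and q :: "nat => nat"
 assumes q: "q permutes {1..n}"
begin

lemma perm_cycles_finite: "finite (perm_cycles n q)"
 by (simp add: perm_cycles_def)

lemma perm_permutation: "permutation q"
 using q by (intro permutes_imp_permutation[of "{1..n}"]) auto

lemma cycle_subset: "c \<in> perm_cycles n q ==> c \<subseteq> {1..n}"
 unfolding perm_cycles_def using orbit_closed_subset[of _ "{1..n}" q] permutes_in_image[OF q] by blast

lemma cycle_fibre: "c \<in> perm_cycles n q ==> {b \<in> {1..n}. orbit q b = c} = c"
proof -
 assume c: "c \<in> perm_cycles n q"
 then obtain x where x: "c = orbit q x" by (auto simp: perm_cycles_def)
 show ?thesis
 proof (intro equalityI subsetI)
  fix b assume "b \<in> {b \<in> {1..n}. orbit q b = c}"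
  then show "b \<in> c" using permutation_self_in_orbit[OF perm_permutation, of b] by auto
 next
  fix b assume b: "b \<in> c"
  have "orbit q b = c" unfolding x by (rule orbit_eq[OF perm_permutation]) (use b x in simp)
  then show "b \<in> {b \<in> {1..n}. orbit q b = c}" using cycle_subset[OF c] b by auto
 qed
qed

lemma cycle_nonempty: "c \<in> perm_cycles n q ==> 1 <= card c \<and> card c <= n"
proof -
 assume c: "c \<in> perm_cycles n q"
 have "finite c" using cycle_subset[OF c] finite_subset by blast
 moreover have "c ~= {}" using c orbit.base by (fastforce simp: perm_cycles_def)
 moreover have "card c <= card {1..n}" using cycle_subset[OF c] by (intro card_mono) auto
 ultimately show ?thesis by (simp add: Suc_le_eq card_gt_0_iff)
qed

lemma sum_over_elements:
 fixes h :: "nat => real"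
 assumes "n < N"
 shows "(\<Sum>b\<in>{1..n}. h (card (orbit q b))) = (\<Sum>k\<in>{1..<N}. real k * real (cycle_count n q k) * h k)"
proof -
 have "(\<Sum>b\<in>{1..n}. h (card (orbit q b))) = (\<Sum>c\<in>perm_cycles n q. \<Sum>b\<in>{b. b \<in> {1..n} \<and> orbit q b = c}. h (card (orbit q b)))"
  unfolding perm_cycles_def by (rule sum.image_gen) simp
 also have "\<dots> = (\<Sum>c\<in>perm_cycles n q. real (card c) * h (card c))"
 proof (rule sum.cong)
  fix c assume c: "c \<in> perm_cycles n q"
  have "(\<Sum>b\<in>{b. b \<in> {1..n} \<and> orbit q b = c}. h (card (orbit q b))) = (\<Sum>b\<in>{b \<in> {1..n}. orbit q b = c}. h (card c))"
   by (rule sum.cong) auto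
  then show "(\<Sum>b\<in>{b. b \<in> {1..n} \<and> orbit q b = c}. h (card (orbit q b))) = real (card c) * h (card c)"
   unfolding cycle_fibre[OF c] by simp
 qed simp
 also have "\<dots> = (\<Sum>k\<in>{1..<N}. \<Sum>c\<in>{c \<in> perm_cycles n q. card c = k}. real (card c) * h (card c))"
  using cycle_nonempty assms by (intro sum.group[symmetric] perm_cycles_finite) force+
 also have "\<dots> = (\<Sum>k\<in>{1..<N}. real k * real (cycle_count n q k) * h k)"
  by (intro sum.cong) (auto simp: cycle_count_def)
 finally show ?thesis .
qed

lemma perm_cycles_fixed:
 "perm_cycles (Suc n) q = insert {Suc n} (perm_cycles n q)" "{Suc n} \<notin> perm_cycles n q"
proof -
 have "q (Suc n) = Suc n" using q by (rule permutes_not_in) simp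
 then have "orbit q (Suc n) = {Suc n}" by (simp add: orbit_eq_singleton_iff)
 moreover have "{1..Suc n} = insert (Suc n) {1..n}" by auto
 ultimately show "perm_cycles (Suc n) q = insert {Suc n} (perm_cycles n q)" by (simp add: perm_cycles_def)
 show "{Suc n} \<notin> perm_cycles n q" using cycle_subset by fastforce
qed

lemma cycle_count_fixed: "cycle_count (Suc n) q = (cycle_count n q)(1 := cycle_count n q 1 + 1)"
proof
 fix k
 have "{c \<in> perm_cycles (Suc n) q. card c = k} = (if k = 1 then insert {Suc n} {c \<in> perm_cycles n q. card c = k} else {c \<in> perm_cycles n q. card c = k})"
  unfolding perm_cycles_fixed by auto
 then show "cycle_count (Suc n) q k = ((cycle_count n q)(1 := cycle_count n q 1 + 1)) k"
  using perm_cycles_fixed(2) perm_cycles_finite by (simp add: cycle_count_def)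
qed

lemma num_cycles_fixed: "num_cycles (Suc n) q = num_cycles n q + 1"
 unfolding num_cycles_def perm_cycles_fixed using perm_cycles_fixed(2) perm_cycles_finite by simp

lemma perm_cycles_insert:
 assumes b: "b \<in> {1..n}"
 shows "perm_cycles (Suc n) (Transposition.transpose (Suc n) b \<circ> q) = insert (insert (Suc n) (orbit q b)) (perm_cycles n q - {orbit q b})"
  "insert (Suc n) (orbit q b) \<notin> perm_cycles n q"
proof -
 let ?s = "Transposition.transpose (Suc n) b \<circ> q"
 have O: "orbit ?s x = orbit q x" if "x \<in> {1..n}" "x \<notin> orbit q b" for x
  using insert_orbits(1)[OF q _ _ b, of "Suc n" x] that by simp
 have O': "orbit ?s x = insert (Suc n) (orbit q b)" if "x \<in> insert (Suc n) (orbit q b)" for x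
  using insert_orbits(2)[OF q _ _ b, of "Suc n" x] that by simp
 have bb: "b \<in> orbit q b" using perm_permutation by (rule permutation_self_in_orbit)
 have neq: "orbit q x ~= orbit q b" if "x \<notin> orbit q b" for x
  using permutation_self_in_orbit[OF perm_permutation, of x] that by auto
 show "perm_cycles (Suc n) ?s = insert (insert (Suc n) (orbit q b)) (perm_cycles n q - {orbit q b})"
 proof (intro equalityI subsetI)
  fix c assume "c \<in> perm_cycles (Suc n) ?s"
  then obtain x where x: "x \<in> {1..Suc n}" "c = orbit ?s x" by (auto simp: perm_cycles_def)
  show "c \<in> insert (insert (Suc n) (orbit q b)) (perm_cycles n q - {orbit q b})"
  proof (cases "x \<in> insert (Suc n) (orbit q b)")
   case True
   then show ?thesis using O'[OF True] x by simp
  next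
   case False
   then have "x \<in> {1..n}" using x(1) by auto
   then show ?thesis using O[of x] False x(2) neq[of x] by (auto simp: perm_cycles_def)
  qed
 next
  fix c assume "c \<in> insert (insert (Suc n) (orbit q b)) (perm_cycles n q - {orbit q b})"
  then consider "c = insert (Suc n) (orbit q b)" | "c \<in> perm_cycles n q" "c ~= orbit q b" by auto
  then show "c \<in> perm_cycles (Suc n) ?s"
  proof cases
   case 1
   then show ?thesis using O'[of b] bb b by (auto simp: perm_cycles_def intro!: image_eqI[of _ _ b])
  next
   case 2
   obtain x where x: "x \<in> {1..n}" "c = orbit q x" using 2(1) by (auto simp: perm_cycles_def)
   have "x \<notin> orbit q b" using orbit_eq[OF perm_permutation, of x b] x 2 by auto
   then show ?thesis using O[of x] x by (auto simp: perm_cycles_def intro!: image_eqI[of _ _ x])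
  qed
 qed
 show "insert (Suc n) (orbit q b) \<notin> perm_cycles n q" using cycle_subset by fastforce
qed

lemma cycle_count_insert:
 assumes b: "b \<in> {1..n}"
 defines "k \<equiv> card (orbit q b)"
 shows "cycle_count (Suc n) (Transposition.transpose (Suc n) b \<circ> q) = (cycle_count n q)(k := cycle_count n q k - 1, Suc k := cycle_count n q (Suc k) + 1)"
  "1 <= cycle_count n q k" "num_cycles (Suc n) (Transposition.transpose (Suc n) b \<circ> q) = num_cycles n q" "1 <= k"
proof -
 let ?O = "orbit q b"
 have Oin: "?O \<in> perm_cycles n q" using b by (auto simp: perm_cycles_def)
 have fO: "finite ?O" using cycle_subset[OF Oin] finite_subset by blast
 have nO: "Suc n \<notin> ?O" using cycle_subset[OF Oin] by auto
 have cI: "card (insert (Suc n) ?O) = Suc k" using fO nO by (simp add: k_def)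
 show "1 <= k" using cycle_nonempty[OF Oin] by (simp add: k_def)
 have fin: "finite {c \<in> perm_cycles n q. P c}" for P using perm_cycles_finite by simp
 show "1 <= cycle_count n q k"
  unfolding cycle_count_def using Oin fin by (auto simp: Suc_le_eq card_gt_0_iff k_def)
 show "cycle_count (Suc n) (Transposition.transpose (Suc n) b \<circ> q) = (cycle_count n q)(k := cycle_count n q k - 1, Suc k := cycle_count n q (Suc k) + 1)"
 proof
  fix j
  consider "j = k" | "j = Suc k" | "j ~= k" "j ~= Suc k" by auto
  then show "cycle_count (Suc n) (Transposition.transpose (Suc n) b \<circ> q) j = ((cycle_count n q)(k := cycle_count n q k - 1, Suc k := cycle_count n q (Suc k) + 1)) j"
  proof cases
   case 1
   have "{c \<in> perm_cycles (Suc n) (Transposition.transpose (Suc n) b \<circ> q). card c = j} = {c \<in> perm_cycles n q. card c = j} - {?O}"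
    unfolding perm_cycles_insert[OF b] using cI 1 by auto
   then show ?thesis using 1 Oin fin by (simp add: cycle_count_def card_Diff_singleton k_def)
  next
   case 2
   have "{c \<in> perm_cycles (Suc n) (Transposition.transpose (Suc n) b \<circ> q). card c = j} = insert (insert (Suc n) ?O) {c \<in> perm_cycles n q. card c = j}"
    unfolding perm_cycles_insert[OF b] using cI 2 by (auto simp: k_def)
   then show ?thesis using 2 perm_cycles_insert(2)[OF b] fin by (simp add: cycle_count_def)
  next
   case 3
   have "{c \<in> perm_cycles (Suc n) (Transposition.transpose (Suc n) b \<circ> q). card c = j} = {c \<in> perm_cycles n q. card c = j}"
    unfolding perm_cycles_insert[OF b] using cI 3 by (auto simp: k_def)
   then show ?thesis using 3 by (simp add: cycle_count_def)
  qed
 qed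
 have "card (perm_cycles n q - {?O}) = card (perm_cycles n q) - 1" using Oin by (simp add: card_Diff_singleton)
 moreover have "card (perm_cycles n q) >= 1" using Oin perm_cycles_finite by (auto simp: Suc_le_eq card_gt_0_iff)
 ultimately show "num_cycles (Suc n) (Transposition.transpose (Suc n) b \<circ> q) = num_cycles n q"
  unfolding num_cycles_def perm_cycles_insert(1)[OF b] using perm_cycles_insert(2)[OF b] perm_cycles_finite by simp
qed

end

text \<open>Cauchy's formula with a factor theta per cycle. The cut-off N is any bound on the cycle
  lengths, independent of n, so that inductions on n keep one range of summation. The condition at 0
  matches cycle counts, which vanish there.\<close>

definition cauchy_weight :: "real => nat => nat => (nat => nat) => real" where
 "cauchy_weight \<theta> N n v = (if v 0 = 0 \<and> (\<forall>k>N. v k = 0) \<and> (\<Sum>k=1..N. k * v k) = n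
  then \<Prod>k=1..N. (\<theta> / real k) ^ v k / fact (v k) else 0)"

lemma if_transfer:
 fixes a b A B :: real
 assumes "P \<longleftrightarrow> Q" "a * A = b * B" shows "a * (if P then A else 0) = b * (if Q then B else 0)"
 using assms by simp

text \<open>The weight recursion for adding the new element as a fixed point, the factor theta
  standing for the new cycle.\<close>

lemma cauchy_weight_new:
 assumes "1 <= N" "1 <= v 1" "\<theta> ~= 0"
 shows "\<theta> * cauchy_weight \<theta> N n (v(1 := v 1 - 1)) = real (v 1) * cauchy_weight \<theta> N (Suc n) v"
proof -
 let ?v = "v(1 := v 1 - 1)"
 let ?R = "{1..N} - {1}"
 have N: "sum f {1..N} = f 1 + sum f ?R" "prod g {1..N} = g 1 * prod g ?R" for f :: "nat => nat" and g :: "nat => real"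
  using assms(1) by (intro sum.remove prod.remove; simp)+
 have s: "(\<Sum>k=1..N. k * v k) = v 1 + (\<Sum>k\<in>?R. k * v k)" unfolding N by (rule arg_cong2[of _ _ _ _ "(+)"]) (auto intro: sum.cong)
 have s': "(\<Sum>k=1..N. k * ?v k) = (v 1 - 1) + (\<Sum>k\<in>?R. k * v k)" unfolding N by (rule arg_cong2[of _ _ _ _ "(+)"]) (auto intro: sum.cong)
 have p: "(\<Prod>k=1..N. (\<theta> / real k) ^ v k / fact (v k)) = (\<theta> ^ v 1 / fact (v 1)) * (\<Prod>k\<in>?R. (\<theta> / real k) ^ v k / fact (v k))"
  unfolding N by (rule arg_cong2[of _ _ _ _ times]) (auto intro: prod.cong)
 have p': "(\<Prod>k=1..N. (\<theta> / real k) ^ ?v k / fact (?v k)) = (\<theta> ^ (v 1 - 1) / fact (v 1 - 1)) * (\<Prod>k\<in>?R. (\<theta> / real k) ^ v k / fact (v k))"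
  unfolding N by (rule arg_cong2[of _ _ _ _ times]) (auto intro: prod.cong)
 obtain m where m: "v 1 = Suc m" using assms(2) by (cases "v 1") auto
 have "(\<Sum>k=1..N. k * ?v k) = n \<longleftrightarrow> (\<Sum>k=1..N. k * v k) = Suc n"
  unfolding s s' using m by linarith
 moreover have "(\<forall>k>N. ?v k = 0) \<longleftrightarrow> (\<forall>k>N. v k = 0)" using assms(1) by auto
 moreover have "?v 0 = v 0" by simp
 moreover have "\<theta> * ((\<theta> ^ (v 1 - 1) / fact (v 1 - 1)) * X) = real (v 1) * ((\<theta> ^ v 1 / fact (v 1)) * X)" for X
  unfolding m by (simp add: field_simps del: of_nat_Suc)
 ultimately show ?thesis unfolding cauchy_weight_def p p' by (intro if_transfer) (simp_all only:)
qed

text \<open>The weight recursion for inserting the new element into a cycle of length k: before the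
  insertion there are v k + 1 such cycles, with k places each.\<close>

lemma cauchy_weight_grow:
 assumes k: "1 <= k" "Suc k <= N" and v: "1 <= v (Suc k)" and \<theta>: "\<theta> ~= 0"
 shows "real k * real (v k + 1) * cauchy_weight \<theta> N n (v(k := v k + 1, Suc k := v (Suc k) - 1))
  = real (Suc k) * real (v (Suc k)) * cauchy_weight \<theta> N (Suc n) v"
proof -
 let ?v = "v(k := v k + 1, Suc k := v (Suc k) - 1)"
 let ?R = "{1..N} - {k, Suc k}"
 have N: "sum f {1..N} = f k + (f (Suc k) + sum f ?R)" "prod g {1..N} = g k * (g (Suc k) * prod g ?R)" for f :: "nat => nat" and g :: "nat => real"
 proof -
  have "sum f {1..N} = f k + sum f ({1..N} - {k})" "prod g {1..N} = g k * prod g ({1..N} - {k})"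
   using k by (intro sum.remove prod.remove; simp)+
  moreover have "sum f ({1..N} - {k}) = f (Suc k) + sum f ({1..N} - {k} - {Suc k})"
   "prod g ({1..N} - {k}) = g (Suc k) * prod g ({1..N} - {k} - {Suc k})"
   using k by (intro sum.remove prod.remove; simp)+
  moreover have "{1..N} - {k} - {Suc k} = ?R" by auto
  ultimately show "sum f {1..N} = f k + (f (Suc k) + sum f ?R)" "prod g {1..N} = g k * (g (Suc k) * prod g ?R)" by simp_all
 qed
 have s: "(\<Sum>k=1..N. k * v k) = k * v k + (Suc k * v (Suc k) + (\<Sum>k\<in>?R. k * v k))" unfolding N ..
 have s': "(\<Sum>k=1..N. k * ?v k) = k * (v k + 1) + (Suc k * (v (Suc k) - 1) + (\<Sum>k\<in>?R. k * v k))"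
  unfolding N by (intro arg_cong2[of _ _ _ _ "(+)"] sum.cong) auto
 have p: "(\<Prod>k=1..N. (\<theta> / real k) ^ v k / fact (v k)) = ((\<theta> / real k) ^ v k / fact (v k)) * (((\<theta> / real (Suc k)) ^ v (Suc k) / fact (v (Suc k))) * (\<Prod>k\<in>?R. (\<theta> / real k) ^ v k / fact (v k)))"
  unfolding N ..
 have p': "(\<Prod>k=1..N. (\<theta> / real k) ^ ?v k / fact (?v k)) = ((\<theta> / real k) ^ (v k + 1) / fact (v k + 1)) * (((\<theta> / real (Suc k)) ^ (v (Suc k) - 1) / fact (v (Suc k) - 1)) * (\<Prod>k\<in>?R. (\<theta> / real k) ^ v k / fact (v k)))"
  unfolding N by (intro arg_cong2[of _ _ _ _ times] prod.cong) auto
 obtain m where m: "v (Suc k) = Suc m" using v by (cases "v (Suc k)") auto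
 have "(\<Sum>k=1..N. k * ?v k) = n \<longleftrightarrow> (\<Sum>k=1..N. k * v k) = Suc n"
  unfolding s s' using m by (simp add: algebra_simps)
 moreover have "(\<forall>k>N. ?v k = 0) \<longleftrightarrow> (\<forall>k>N. v k = 0)" using k by auto
 moreover have "?v 0 = v 0" using k by simp
 moreover have "real k * real (v k + 1) * (((\<theta> / real k) ^ (v k + 1) / fact (v k + 1)) * (((\<theta> / real (Suc k)) ^ (v (Suc k) - 1) / fact (v (Suc k) - 1)) * X))
  = real (Suc k) * real (v (Suc k)) * (((\<theta> / real k) ^ v k / fact (v k)) * (((\<theta> / real (Suc k)) ^ v (Suc k) / fact (v (Suc k))) * X))" for X
 proof -
  have 1: "real k * real (v k + 1) * ((\<theta> / real k) ^ (v k + 1) / fact (v k + 1)) = \<theta> * ((\<theta> / real k) ^ v k / fact (v k))"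
  proof -
   have f: "fact (v k + 1) = real (v k + 1) * fact (v k)" by simp
   show ?thesis unfolding f power_add using k(1) by (simp add: divide_simps del: of_nat_add of_nat_Suc)
  qed
  have 2: "real (Suc k) * real (v (Suc k)) * ((\<theta> / real (Suc k)) ^ v (Suc k) / fact (v (Suc k))) = \<theta> * ((\<theta> / real (Suc k)) ^ (v (Suc k) - 1) / fact (v (Suc k) - 1))"
   unfolding m by (simp add: field_simps del: of_nat_Suc)
  have "real k * real (v k + 1) * (((\<theta> / real k) ^ (v k + 1) / fact (v k + 1)) * (((\<theta> / real (Suc k)) ^ (v (Suc k) - 1) / fact (v (Suc k) - 1)) * X))
   = (real k * real (v k + 1) * ((\<theta> / real k) ^ (v k + 1) / fact (v k + 1))) * (((\<theta> / real (Suc k)) ^ (v (Suc k) - 1) / fact (v (Suc k) - 1)) * X)"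
   by (simp only: mult.assoc)
  also have "\<dots> = (\<theta> * ((\<theta> / real (Suc k)) ^ (v (Suc k) - 1) / fact (v (Suc k) - 1))) * (((\<theta> / real k) ^ v k / fact (v k)) * X)"
   unfolding 1 by (simp only: mult_ac)
  also have "\<dots> = real (Suc k) * real (v (Suc k)) * (((\<theta> / real k) ^ v k / fact (v k)) * (((\<theta> / real (Suc k)) ^ v (Suc k) / fact (v (Suc k))) * X))"
   unfolding 2[symmetric] by (simp only: mult_ac)
  finally show ?thesis .
 qed
 ultimately show ?thesis unfolding cauchy_weight_def p p' by (intro if_transfer) (simp_all only:)
qed

text \<open>The coefficients of the two recursions add up to the sum of k * v k, which is n wherever
  the weight is nonzero.\<close>

lemma cauchy_weight_total:
 assumes "1 <= N"
 shows "(real (v 1) + (\<Sum>k\<in>{1..<N}. real (Suc k) * real (v (Suc k)))) * cauchy_weight \<theta> N n v = real n * cauchy_weight \<theta> N n v"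
proof (cases "(\<Sum>k=1..N. k * v k) = n")
 case True
 have "{1..N} = insert 1 (Suc ` {1..<N})"
 proof (intro equalityI subsetI)
  fix x assume "x \<in> {1..N}"
  then show "x \<in> insert 1 (Suc ` {1..<N})" by (cases x) (auto simp: image_iff)
 qed (use assms in auto)
 then have "(\<Sum>k=1..N. k * v k) = v 1 + (\<Sum>k\<in>{1..<N}. Suc k * v (Suc k))"
 proof -
  assume e: "{1..N} = insert 1 (Suc ` {1..<N})"
  have "sum (\<lambda>k. k * v k) {1..N} = 1 * v 1 + sum (\<lambda>k. k * v k) (Suc ` {1..<N})"
   unfolding e by (intro sum.insert) auto
  then show ?thesis unfolding sum.reindex[OF inj_Suc] o_def by simp
 qed
 then have "real n = real (v 1) + (\<Sum>k\<in>{1..<N}. real (Suc k) * real (v (Suc k)))"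
  using True by (metis (no_types, lifting) of_nat_add of_nat_mult of_nat_sum sum.cong)
 then show ?thesis by simp
qed (simp add: cauchy_weight_def)

lemma cauchy_weight_0: "cauchy_weight \<theta> N 0 v = (if v = (\<lambda>_. 0) then 1 else 0)"
proof (cases "v = (\<lambda>_. 0)")
 case False
 have "cauchy_weight \<theta> N 0 v = 0"
 proof (rule ccontr)
  assume "cauchy_weight \<theta> N 0 v ~= 0"
  then have c: "v 0 = 0" "\<forall>k>N. v k = 0" "(\<Sum>k=1..N. k * v k) = 0" by (auto simp: cauchy_weight_def split: if_splits)
  then have z: "\<forall>k\<in>{1..N}. k * v k = 0" by (subst (asm) sum_eq_0_iff) auto
  have "v k = 0" for k
  proof (cases "k = 0 \<or> k > N")
   case True
   then show ?thesis using c by auto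
  next
   case False
   then have "k \<in> {1..N}" by auto
   then show ?thesis using z by fastforce
  qed
  then show False using False by auto
 qed
 then show ?thesis using False by simp
qed (simp add: cauchy_weight_def)

text \<open>Every permutation of n + 1 points arises once from one of n points, by inserting n + 1
  either as a fixed point or before some b. Grouping the b by the length of their cycle gives the
  two recursions of \<open>cauchy_weight\<close>, and \<open>cauchy_weight_total\<close> supplies
  the factor n + 1.\<close>

lemma cycle_type_weight:
 assumes \<theta>: "\<theta> > 0"
 shows "n <= N ==> 1 <= N ==> (\<Sum>\<sigma>\<in>{\<sigma>. \<sigma> permutes {1..n} \<and> cycle_count n \<sigma> = v}. \<theta> ^ num_cycles n \<sigma>) = fact n * cauchy_weight \<theta> N n v"
proof (induction n arbitrary: v)
 case 0
 have "cycle_count 0 id = (\<lambda>_. 0)" by (auto simp: cycle_count_def perm_cycles_def)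
 moreover have "{\<sigma>. \<sigma> permutes {1..0::nat}} = {id}" by auto
 ultimately have e: "{\<sigma>. \<sigma> permutes {1..0} \<and> cycle_count 0 \<sigma> = v} = (if v = (\<lambda>_. 0) then {id} else {})" by auto
 show ?case
 proof (cases "v = (\<lambda>_. 0)")
  case True
  then show ?thesis unfolding e cauchy_weight_0 by (simp add: num_cycles_def perm_cycles_def)
 next
  case False
  then show ?thesis unfolding e cauchy_weight_0 by simp
 qed
next
 case (Suc n)
 define P where "P = {q::nat => nat. q permutes {1..n}}"
 define w where "w = (\<lambda>m \<sigma>. if cycle_count m \<sigma> = v then \<theta> ^ num_cycles m \<sigma> else 0)"
 have finP: "finite P" unfolding P_def by (rule finite_permutations) simp
 have IH: "(\<Sum>q\<in>P. if cycle_count n q = u then \<theta> ^ num_cycles n q else 0) = fact n * cauchy_weight \<theta> N n u" for u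
 proof -
  have "(\<Sum>q\<in>P. if cycle_count n q = u then \<theta> ^ num_cycles n q else 0) = (\<Sum>q\<in>{q \<in> P. cycle_count n q = u}. \<theta> ^ num_cycles n q)"
   by (rule sum.inter_filter[symmetric, OF finP])
  then show ?thesis using Suc by (simp add: P_def)
 qed
 have "(\<Sum>\<sigma>\<in>{\<sigma>. \<sigma> permutes {1..Suc n} \<and> cycle_count (Suc n) \<sigma> = v}. \<theta> ^ num_cycles (Suc n) \<sigma>)
  = (\<Sum>\<sigma>\<in>{\<sigma> \<in> {\<sigma>. \<sigma> permutes {1..Suc n}}. cycle_count (Suc n) \<sigma> = v}. \<theta> ^ num_cycles (Suc n) \<sigma>)" by simp
 also have "\<dots> = (\<Sum>\<sigma>\<in>{\<sigma>. \<sigma> permutes {1..Suc n}}. w (Suc n) \<sigma>)"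
  unfolding w_def by (rule sum.inter_filter) (rule finite_permutations, simp)
 also have "\<dots>
  = (\<Sum>b\<in>insert (Suc n) {1..n}. \<Sum>q\<in>P. w (Suc n) (Transposition.transpose (Suc n) b \<circ> q))"
 proof -
  have ins: "{1..Suc n} = insert (Suc n) {1..n}" by auto
  show ?thesis unfolding P_def ins by (rule sum_over_permutations_insert) auto
 qed
 also have "\<dots> = (\<Sum>q\<in>P. w (Suc n) q) + (\<Sum>q\<in>P. \<Sum>b\<in>{1..n}. w (Suc n) (Transposition.transpose (Suc n) b \<circ> q))"
 proof -
  have "Suc n \<notin> {1..n}" by simp
  then have "(\<Sum>b\<in>insert (Suc n) {1..n}. \<Sum>q\<in>P. w (Suc n) (Transposition.transpose (Suc n) b \<circ> q))
   = (\<Sum>q\<in>P. w (Suc n) (Transposition.transpose (Suc n) (Suc n) \<circ> q)) + (\<Sum>b\<in>{1..n}. \<Sum>q\<in>P. w (Suc n) (Transposition.transpose (Suc n) b \<circ> q))"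
   by (intro sum.insert) auto
  moreover have "(\<Sum>b\<in>{1..n}. \<Sum>q\<in>P. w (Suc n) (Transposition.transpose (Suc n) b \<circ> q)) = (\<Sum>q\<in>P. \<Sum>b\<in>{1..n}. w (Suc n) (Transposition.transpose (Suc n) b \<circ> q))"
   by (rule sum.swap)
  ultimately show ?thesis by simp
 qed
 also have "(\<Sum>q\<in>P. w (Suc n) q) = real (v 1) * (fact n * cauchy_weight \<theta> N (Suc n) v)"
 proof (cases "1 <= v 1")
  case True
  have "w (Suc n) q = \<theta> * (if cycle_count n q = v(1 := v 1 - 1) then \<theta> ^ num_cycles n q else 0)" if "q \<in> P" for q
  proof -
   have q: "q permutes {1..n}" using that by (simp add: P_def)
   have "(cycle_count n q)(1 := cycle_count n q 1 + 1) = v \<longleftrightarrow> cycle_count n q = v(1 := v 1 - 1)"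
    using True by (auto simp: fun_eq_iff)
   then show ?thesis unfolding w_def cycle_count_fixed[OF q] num_cycles_fixed[OF q] by simp
  qed
  then have "(\<Sum>q\<in>P. w (Suc n) q) = \<theta> * (\<Sum>q\<in>P. if cycle_count n q = v(1 := v 1 - 1) then \<theta> ^ num_cycles n q else 0)"
   by (simp add: sum_distrib_left)
  also have "\<dots> = fact n * (\<theta> * cauchy_weight \<theta> N n (v(1 := v 1 - 1)))" unfolding IH by simp
  also have "\<dots> = real (v 1) * (fact n * cauchy_weight \<theta> N (Suc n) v)"
   using cauchy_weight_new[of N v \<theta> n] True \<theta> Suc.prems by simp
  finally show ?thesis .
 next
  case False
  have "w (Suc n) q = 0" if "q \<in> P" for q
  proof -
   have q: "q permutes {1..n}" using that by (simp add: P_def)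
   show ?thesis unfolding w_def cycle_count_fixed[OF q] using False by (auto simp: fun_eq_iff)
  qed
  then show ?thesis using False by simp
 qed
 also have "(\<Sum>q\<in>P. \<Sum>b\<in>{1..n}. w (Suc n) (Transposition.transpose (Suc n) b \<circ> q))
   = (\<Sum>k\<in>{1..<N}. real (Suc k) * real (v (Suc k)) * (fact n * cauchy_weight \<theta> N (Suc n) v))"
 proof -
  let ?g = "\<lambda>q k. if (cycle_count n q)(k := cycle_count n q k - 1, Suc k := cycle_count n q (Suc k) + 1) = v then \<theta> ^ num_cycles n q else 0"
  have nN: "n < N" using Suc.prems by simp
  have "(\<Sum>b\<in>{1..n}. w (Suc n) (Transposition.transpose (Suc n) b \<circ> q)) = (\<Sum>k\<in>{1..<N}. real k * real (cycle_count n q k) * ?g q k)" if "q \<in> P" for q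
  proof -
   have q: "q permutes {1..n}" using that by (simp add: P_def)
   have "(\<Sum>b\<in>{1..n}. w (Suc n) (Transposition.transpose (Suc n) b \<circ> q)) = (\<Sum>b\<in>{1..n}. ?g q (card (orbit q b)))"
    by (rule sum.cong) (auto simp: w_def cycle_count_insert(1,3)[OF q])
   also have "\<dots> = (\<Sum>k\<in>{1..<N}. real k * real (cycle_count n q k) * ?g q k)"
    by (rule sum_over_elements[OF q nN])
   finally show ?thesis .
  qed
  then have "(\<Sum>q\<in>P. \<Sum>b\<in>{1..n}. w (Suc n) (Transposition.transpose (Suc n) b \<circ> q)) = (\<Sum>q\<in>P. \<Sum>k\<in>{1..<N}. real k * real (cycle_count n q k) * ?g q k)"
   by (rule sum.cong[OF refl])
  also have "\<dots> = (\<Sum>k\<in>{1..<N}. \<Sum>q\<in>P. real k * real (cycle_count n q k) * ?g q k)"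
   by (rule sum.swap)
  also have "\<dots> = (\<Sum>k\<in>{1..<N}. real (Suc k) * real (v (Suc k)) * (fact n * cauchy_weight \<theta> N (Suc n) v))"
  proof (rule sum.cong[OF refl])
   fix k assume k: "k \<in> {1..<N}"
   show "(\<Sum>q\<in>P. real k * real (cycle_count n q k) * ?g q k) = real (Suc k) * real (v (Suc k)) * (fact n * cauchy_weight \<theta> N (Suc n) v)"
   proof (cases "1 <= v (Suc k)")
    case True
    let ?u = "v(k := v k + 1, Suc k := v (Suc k) - 1)"
    have "real k * real (cycle_count n q k) * ?g q k = real k * real (v k + 1) * (if cycle_count n q = ?u then \<theta> ^ num_cycles n q else 0)" for q
    proof (cases "cycle_count n q k = 0")
     case True
     then have "cycle_count n q ~= ?u" by (auto dest: fun_cong[of _ _ k])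
     then show ?thesis using True by simp
    next
     case F: False
     have "(cycle_count n q)(k := cycle_count n q k - 1, Suc k := cycle_count n q (Suc k) + 1) = v \<longleftrightarrow> cycle_count n q = ?u"
     proof
      assume h: "(cycle_count n q)(k := cycle_count n q k - 1, Suc k := cycle_count n q (Suc k) + 1) = v"
      show "cycle_count n q = ?u"
      proof
       have 1: "v k = cycle_count n q k - 1" "v (Suc k) = cycle_count n q (Suc k) + 1"
        unfolding h[symmetric] by simp_all
       have 2: "v j = cycle_count n q j" if "j ~= k" "j ~= Suc k" for j
        unfolding h[symmetric] using that by simp
       fix j
       consider "j = k" | "j = Suc k" | "j ~= k" "j ~= Suc k" by auto
       then show "cycle_count n q j = ?u j" using 1 2[of j] F by cases auto
      qed
     next
      assume h: "cycle_count n q = ?u"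
      show "(cycle_count n q)(k := cycle_count n q k - 1, Suc k := cycle_count n q (Suc k) + 1) = v"
       unfolding h using True by (auto simp: fun_eq_iff)
     qed
     then show ?thesis by auto
    qed
    then have "(\<Sum>q\<in>P. real k * real (cycle_count n q k) * ?g q k) = real k * real (v k + 1) * (\<Sum>q\<in>P. if cycle_count n q = ?u then \<theta> ^ num_cycles n q else 0)"
     by (simp only: sum_distrib_left)
    also have "\<dots> = fact n * (real k * real (v k + 1) * cauchy_weight \<theta> N n ?u)" unfolding IH by simp
    also have "\<dots> = fact n * (real (Suc k) * real (v (Suc k)) * cauchy_weight \<theta> N (Suc n) v)"
     using cauchy_weight_grow[of k N v \<theta> n] True \<theta> k by simp
    finally show ?thesis by (simp only: mult_ac)
   next
    case False
    have "?g q k = 0" for q using False by (auto dest: fun_cong[of _ _ "Suc k"])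
    then show ?thesis using False by simp
   qed
  qed
  finally show ?thesis .
 qed
 also have "real (v 1) * (fact n * cauchy_weight \<theta> N (Suc n) v) + (\<Sum>k\<in>{1..<N}. real (Suc k) * real (v (Suc k)) * (fact n * cauchy_weight \<theta> N (Suc n) v))
  = fact n * ((real (v 1) + (\<Sum>k\<in>{1..<N}. real (Suc k) * real (v (Suc k)))) * cauchy_weight \<theta> N (Suc n) v)"
  by (simp only: distrib_right distrib_left sum_distrib_right sum_distrib_left mult_ac)
 also have "\<dots> = fact (Suc n) * cauchy_weight \<theta> N (Suc n) v"
  unfolding cauchy_weight_total[OF Suc.prems(2)] by simp
 finally show ?case .
qed

section \<open>The Feller coupling\<close>

text \<open>Lists carry the newest step at the head. \<open>True\<close> closes the open block and starts a new one, \<open>False\<close> lengthens the open block; hence prefixes of the same list give the cycle counts for all sizes simultaneously.\<close>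
primrec feller :: "real => nat => bool list pmf" where
 "feller \<theta> 0 = return_pmf []"
| "feller \<theta> (Suc n) = map_pmf (\<lambda>(b, h). b # h) (pair_pmf (bernoulli_pmf (\<theta> / (\<theta> + real n))) (feller \<theta> n))"

primrec open_block :: "bool list => nat" where
 "open_block [] = 0"
| "open_block (b # h) = (if b then 1 else Suc (open_block h))"

primrec closed_blocks :: "bool list => nat => nat" where
 "closed_blocks [] = (\<lambda>_. 0)"
| "closed_blocks (b # h) = (if b then (closed_blocks h)(open_block h := closed_blocks h (open_block h) + 1) else closed_blocks h)"

text \<open>The still open block counts as a cycle. Index 0 is forced to 0 because the very first
  step closes an empty block, which \<open>closed_blocks\<close> records as one of length 0.\<close>

definition blocks :: "bool list => nat => nat" where
 "blocks h k = (if k = 0 then 0 else closed_blocks h k + (if open_block h = k then 1 else 0))"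

lemma blocks_True: "blocks (True # h) = (blocks h)(1 := blocks h 1 + 1)"
 by (auto simp: blocks_def fun_eq_iff)

lemma blocks_False:
 assumes "1 <= open_block h"
 shows "blocks (False # h) = (blocks h)(open_block h := blocks h (open_block h) - 1, Suc (open_block h) := blocks h (Suc (open_block h)) + 1)"
 using assms by (auto simp: blocks_def fun_eq_iff)

lemma blocks_open: "1 <= open_block h ==> 1 <= blocks h (open_block h)"
 by (simp add: blocks_def)

lemma blocks_0: "blocks h 0 = 0"
 by (simp add: blocks_def)

lemma open_block_pos: "h ~= [] ==> 1 <= open_block h"
 by (cases h) auto

lemma open_block_le: "open_block h <= length h"
 by (induction h) auto

lemma blocks_le: "blocks h k <= length h"
proof (induction h)
 case Nil
 then show ?case by (simp add: blocks_def)
next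
 case (Cons b h)
 then show ?case by (cases b) (auto simp: blocks_def split: if_splits)
qed

lemma closed_blocks_append:
 "closed_blocks h k <= closed_blocks (xs @ h) k"
 "finite F ==> (\<Sum>k\<in>F. real (closed_blocks (xs @ h) k) - real (closed_blocks h k)) <= real (count_list xs True)"
proof -
 show "closed_blocks h k <= closed_blocks (xs @ h) k" by (induction xs) auto
 assume F: "finite F"
 show "(\<Sum>k\<in>F. real (closed_blocks (xs @ h) k) - real (closed_blocks h k)) <= real (count_list xs True)"
 proof (induction xs)
  case (Cons b xs)
  have "(\<Sum>k\<in>F. real (closed_blocks ((b # xs) @ h) k) - real (closed_blocks h k))
    = (\<Sum>k\<in>F. (real (closed_blocks (xs @ h) k) - real (closed_blocks h k)) + (if k = open_block (xs @ h) then (if b then 1 else 0) else 0))"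
   by (rule sum.cong) auto
  also have "\<dots> = (\<Sum>k\<in>F. real (closed_blocks (xs @ h) k) - real (closed_blocks h k)) + (if open_block (xs @ h) \<in> F then (if b then 1 else 0) else 0)"
   unfolding sum.distrib sum.delta[OF F] ..
  also have "\<dots> <= real (count_list xs True) + (if b then 1 else 0)"
   by (rule add_mono[OF Cons.IH]) auto
  also have "\<dots> = real (count_list (b # xs) True)" by (cases b) auto
  finally show ?case .
 qed simp
qed

text \<open>Further steps never destroy a closed block and close at most one per
  \<open>True\<close>; beyond that only the two open blocks can differ, which gives the constant
  2.\<close>

lemma blocks_append:
 assumes F: "finite F"
 shows "(\<Sum>k\<in>F. \<bar>real (blocks (xs @ h) k) - real (blocks h k)\<bar>) <= 2 + real (count_list xs True)"
proof -
 let ?o = "\<lambda>h k. if open_block h = k then 1 else 0 :: real"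
 have "(\<Sum>k\<in>F. \<bar>real (blocks (xs @ h) k) - real (blocks h k)\<bar>)
   <= (\<Sum>k\<in>F. (real (closed_blocks (xs @ h) k) - real (closed_blocks h k)) + (?o (xs @ h) k + ?o h k))"
 proof (rule sum_mono)
  fix k
  show "\<bar>real (blocks (xs @ h) k) - real (blocks h k)\<bar> <= (real (closed_blocks (xs @ h) k) - real (closed_blocks h k)) + (?o (xs @ h) k + ?o h k)"
   using closed_blocks_append(1)[of h k xs] by (auto simp: blocks_def)
 qed
 also have "\<dots> = (\<Sum>k\<in>F. real (closed_blocks (xs @ h) k) - real (closed_blocks h k)) + ((\<Sum>k\<in>F. ?o (xs @ h) k) + (\<Sum>k\<in>F. ?o h k))"
  by (simp only: sum.distrib)
 also have "\<dots> <= real (count_list xs True) + (1 + 1)"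
  using closed_blocks_append(2)[OF F, of xs h] by (intro add_mono) (simp_all add: F)
 finally show ?thesis by simp
qed

context
 fixes \<theta> :: real
 assumes \<theta>: "\<theta> > 0"
begin

declare feller.simps(2) [simp del]

lemma nn_integral_feller_Suc:
 "(\<integral>\<^sup>+h. f h \<partial>feller \<theta> (Suc n)) = (\<integral>\<^sup>+h. f (True # h) \<partial>feller \<theta> n) * ennreal (\<theta> / (\<theta> + real n)) + (\<integral>\<^sup>+h. f (False # h) \<partial>feller \<theta> n) * ennreal (real n / (\<theta> + real n))"
proof -
 have p: "0 <= \<theta> / (\<theta> + real n)" "\<theta> / (\<theta> + real n) <= 1" "1 - \<theta> / (\<theta> + real n) = real n / (\<theta> + real n)"
  using \<theta> by (auto simp: field_simps)
 show ?thesis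
  unfolding feller.simps nn_integral_map_pmf nn_integral_pair_pmf' split
  by (subst nn_integral_bernoulli_pmf) (simp_all only: p zero_le)
qed

lemma prob_feller_Suc:
 "measure (feller \<theta> (Suc n)) {h. Q h} = measure (feller \<theta> n) {h. Q (True # h)} * (\<theta> / (\<theta> + real n)) + measure (feller \<theta> n) {h. Q (False # h)} * (real n / (\<theta> + real n))"
proof -
 have e: "(\<integral>\<^sup>+h. indicator {h. P h} h \<partial>measure_pmf p) = ennreal (measure p {h. P h})" for P and p :: "bool list pmf"
  by (simp add: measure_pmf.emeasure_eq_measure)
 have i: "indicator {h. Q h} (b # h) = (indicator {h. Q (b # h)} h :: ennreal)" for b h
  by (simp add: indicator_def)
 have "ennreal (measure (feller \<theta> (Suc n)) {h. Q h}) = ennreal (measure (feller \<theta> n) {h. Q (True # h)}) * ennreal (\<theta> / (\<theta> + real n)) + ennreal (measure (feller \<theta> n) {h. Q (False # h)}) * ennreal (real n / (\<theta> + real n))"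
  unfolding e[symmetric] nn_integral_feller_Suc i ..
 also have "\<dots> = ennreal (measure (feller \<theta> n) {h. Q (True # h)} * (\<theta> / (\<theta> + real n)) + measure (feller \<theta> n) {h. Q (False # h)} * (real n / (\<theta> + real n)))"
  using \<theta> by (simp only: ennreal_plus ennreal_mult mult_nonneg_nonneg measure_nonneg divide_nonneg_nonneg add_nonneg_nonneg of_nat_0_le_iff less_imp_le)
 finally show ?thesis using \<theta> by (subst (asm) ennreal_inj) auto
qed

lemma length_feller: "h \<in> set_pmf (feller \<theta> n) ==> length h = n"
 by (induction n arbitrary: h) (auto simp: feller.simps)

lemma feller_open_0: "real n * measure (feller \<theta> n) {h. P h \<and> open_block h = 0} = 0"
proof (cases n)
 case (Suc m)
 have "measure (feller \<theta> n) {h. P h \<and> open_block h = 0} = 0"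
  unfolding Suc prob_feller_Suc by simp
 then show ?thesis by simp
qed simp

lemma scaled_step:
 fixes a b m q r t F :: real
 assumes "t ~= 0" "b * (m * q) = F * r" shows "a * (m * (b / t)) * (q * t) = (a * F) * r"
proof -
 have "a * (m * (b / t)) * (q * t) = a * (b * (m * q))" using assms(1) by simp
 then show ?thesis unfolding assms(2) by simp
qed

text \<open>A step that extends the open block needs its length, so the induction carries the joint
  law: given the counts v, the open block has length k with probability k * v k / n. With this
  size-biased form the two kinds of step match \<open>cauchy_weight_new\<close> and
  \<open>cauchy_weight_grow\<close>.\<close>

lemma feller_law_aux:
 "n < N ==> (\<forall>k v. 1 <= k \<longrightarrow> real n * measure (feller \<theta> n) {h. blocks h = v \<and> open_block h = k} * pochhammer \<theta> n = fact n * (real k * real (v k) * cauchy_weight \<theta> N n v))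
  \<and> (\<forall>v. measure (feller \<theta> n) {h. blocks h = v} * pochhammer \<theta> n = fact n * cauchy_weight \<theta> N n v)"
proof (induction n)
 case 0
 have b: "blocks [] = (\<lambda>_. 0)" by (auto simp: blocks_def)
 have d: "measure (return_pmf []) {h. blocks h = v} = (if v = (\<lambda>_. 0) then 1 else 0)" for v
  unfolding measure_return_pmf by (simp add: b indicator_def eq_commute)
 show ?case unfolding cauchy_weight_0 feller.simps d by simp
next
 case (Suc n)
 have \<theta>n: "\<theta> + real n > 0" using \<theta> by simp
 have nN: "n < N" "1 <= N" using Suc.prems by auto
 have IH: "1 <= k ==> real n * measure (feller \<theta> n) {h. blocks h = v \<and> open_block h = k} * pochhammer \<theta> n = fact n * (real k * real (v k) * cauchy_weight \<theta> N n v)"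
  "measure (feller \<theta> n) {h. blocks h = v} * pochhammer \<theta> n = fact n * cauchy_weight \<theta> N n v" for k v
  using Suc.IH[OF nN(1)] by blast+
 have joint: "real (Suc n) * measure (feller \<theta> (Suc n)) {h. blocks h = v \<and> open_block h = k} * pochhammer \<theta> (Suc n)
   = fact (Suc n) * (real k * real (v k) * cauchy_weight \<theta> N (Suc n) v)" if k: "1 <= k" "k <= N" for k v
 proof (cases "k = 1")
  case True
  have "measure (feller \<theta> (Suc n)) {h. blocks h = v \<and> open_block h = k}
   = measure (feller \<theta> n) {h. (blocks h)(1 := blocks h 1 + 1) = v} * (\<theta> / (\<theta> + real n)) + measure (feller \<theta> n) {h. blocks (False # h) = v \<and> open_block h = 0} * (real n / (\<theta> + real n))"
   unfolding prob_feller_Suc blocks_True by (simp add: True)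
  also have "measure (feller \<theta> n) {h. blocks (False # h) = v \<and> open_block h = 0} * (real n / (\<theta> + real n)) = 0"
   using feller_open_0[of n "\<lambda>h. blocks (False # h) = v"] by auto
  finally have m: "measure (feller \<theta> (Suc n)) {h. blocks h = v \<and> open_block h = k} = measure (feller \<theta> n) {h. (blocks h)(1 := blocks h 1 + 1) = v} * (\<theta> / (\<theta> + real n))" by (simp only: add_0_right)
  have "\<theta> * (measure (feller \<theta> n) {h. (blocks h)(1 := blocks h 1 + 1) = v} * pochhammer \<theta> n) = fact n * (real (v 1) * cauchy_weight \<theta> N (Suc n) v)"
  proof (cases "1 <= v 1")
   case T: True
   have "{h. (blocks h)(1 := blocks h 1 + 1) = v} = {h. blocks h = v(1 := v 1 - 1)}"
    using T by (auto simp: fun_eq_iff)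
   then have "\<theta> * (measure (feller \<theta> n) {h. (blocks h)(1 := blocks h 1 + 1) = v} * pochhammer \<theta> n) = fact n * (\<theta> * cauchy_weight \<theta> N n (v(1 := v 1 - 1)))"
    unfolding IH(2)[of "v(1 := v 1 - 1)", symmetric] by (simp only: IH(2)[of "v(1 := v 1 - 1)"] mult.left_commute)
   moreover have "\<theta> * cauchy_weight \<theta> N n (v(1 := v 1 - 1)) = real (v 1) * cauchy_weight \<theta> N (Suc n) v"
    by (rule cauchy_weight_new) (use nN T \<theta> in simp_all)
   ultimately show ?thesis by (simp only:)
  next
   case False
   then have "{h. (blocks h)(1 := blocks h 1 + 1) = v} = {}" by (auto simp: fun_eq_iff)
   then show ?thesis using False by simp
  qed
  then have "real (Suc n) * (measure (feller \<theta> n) {h. (blocks h)(1 := blocks h 1 + 1) = v} * (\<theta> / (\<theta> + real n))) * (pochhammer \<theta> n * (\<theta> + real n))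
   = (real (Suc n) * fact n) * (real (v 1) * cauchy_weight \<theta> N (Suc n) v)"
   by (intro scaled_step) (use \<theta>n in simp)
  then show ?thesis unfolding m[symmetric] pochhammer_Suc[symmetric] True by simp
 next
  case False
  then obtain j where j: "k = Suc j" "1 <= j" "Suc j <= N" using k by (cases k) auto
  have m: "measure (feller \<theta> (Suc n)) {h. blocks h = v \<and> open_block h = k}
   = measure (feller \<theta> n) {h. blocks (False # h) = v \<and> open_block h = j} * (real n / (\<theta> + real n))"
   unfolding prob_feller_Suc using j by simp
  have "real n * measure (feller \<theta> n) {h. blocks (False # h) = v \<and> open_block h = j} * pochhammer \<theta> n
   = fact n * (real k * real (v k) * cauchy_weight \<theta> N (Suc n) v)"
  proof (cases "1 <= v (Suc j)")
   case T: True
   let ?u = "v(j := v j + 1, Suc j := v (Suc j) - 1)"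
   have "blocks (False # h) = v \<longleftrightarrow> blocks h = ?u" if "open_block h = j" for h
   proof -
    have b: "blocks (False # h) = (blocks h)(j := blocks h j - 1, Suc j := blocks h (Suc j) + 1)" "1 <= blocks h j"
     using blocks_False[of h] blocks_open[of h] that j by auto
    show ?thesis
    proof
     assume h: "blocks (False # h) = v"
     have 1: "v j = blocks h j - 1" "v (Suc j) = blocks h (Suc j) + 1"
      unfolding h[symmetric] b by simp_all
     have 2: "v i = blocks h i" if "i ~= j" "i ~= Suc j" for i
      unfolding h[symmetric] b using that by simp
     show "blocks h = ?u"
     proof
      fix i
      consider "i = j" | "i = Suc j" | "i ~= j" "i ~= Suc j" by auto
      then show "blocks h i = ?u i" using 1 2[of i] b(2) by cases auto
     qed
    next
     assume h: "blocks h = ?u"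
     show "blocks (False # h) = v" unfolding b h using T by (auto simp: fun_eq_iff)
    qed
   qed
   then have "{h. blocks (False # h) = v \<and> open_block h = j} = {h. blocks h = ?u \<and> open_block h = j}" by blast
   then have "real n * measure (feller \<theta> n) {h. blocks (False # h) = v \<and> open_block h = j} * pochhammer \<theta> n = fact n * (real j * real (v j + 1) * cauchy_weight \<theta> N n ?u)"
    using IH(1)[OF j(2), of ?u] by simp
   moreover have "real j * real (v j + 1) * cauchy_weight \<theta> N n ?u = real (Suc j) * real (v (Suc j)) * cauchy_weight \<theta> N (Suc n) v"
    by (rule cauchy_weight_grow) (use j T \<theta> in simp_all)
   ultimately show ?thesis unfolding j(1) by (simp only:)
  next
   case F: False
   have e: "{h. blocks (False # h) = v \<and> open_block h = j} = {}"
   proof -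
    have "v (Suc j) >= 1" if "blocks (False # h) = v" "open_block h = j" for h
     using blocks_open[of "False # h"] that by auto
    then show ?thesis using F by blast
   qed
   have "v (Suc j) = 0" using F by simp
   then show ?thesis unfolding e j(1) by simp
  qed
  then have "real (Suc n) * (measure (feller \<theta> n) {h. blocks (False # h) = v \<and> open_block h = j} * (real n / (\<theta> + real n))) * (pochhammer \<theta> n * (\<theta> + real n))
   = (real (Suc n) * fact n) * (real k * real (v k) * cauchy_weight \<theta> N (Suc n) v)"
   by (intro scaled_step) (use \<theta>n in \<open>simp_all add: mult.assoc\<close>)
  then show ?thesis unfolding m[symmetric] pochhammer_Suc[symmetric] by simp
 qed
 have zero: "v k * cauchy_weight \<theta> N m v = 0" if "k > N" for k m and v :: "nat => nat"
  using that by (simp add: cauchy_weight_def)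
 have "real (Suc n) * measure (feller \<theta> (Suc n)) {h. blocks h = v \<and> open_block h = k} * pochhammer \<theta> (Suc n)
   = fact (Suc n) * (real k * real (v k) * cauchy_weight \<theta> N (Suc n) v)" if k: "1 <= k" for k v
  proof (cases "k <= N")
   case True
   then show ?thesis using joint k by blast
  next
   case False
   have "measure (feller \<theta> (Suc n)) {h. blocks h = v \<and> open_block h = k} = measure (feller \<theta> (Suc n)) {}"
   proof (rule measure_pmf.finite_measure_eq_AE)
    show "AE h in feller \<theta> (Suc n). (h \<in> {h. blocks h = v \<and> open_block h = k}) = (h \<in> {})"
    proof (rule AE_pmfI)
     fix h assume "h \<in> set_pmf (feller \<theta> (Suc n))"
     then have "length h = Suc n" by (rule length_feller)
     then show "(h \<in> {h. blocks h = v \<and> open_block h = k}) = (h \<in> {})"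
      using open_block_le[of h] False nN by auto
    qed
   qed auto
   then show ?thesis using zero[of k v "Suc n"] False by auto
  qed
 moreover have "measure (feller \<theta> (Suc n)) {h. blocks h = v} * pochhammer \<theta> (Suc n) = fact (Suc n) * cauchy_weight \<theta> N (Suc n) v" for v
 proof -
  have "measure (feller \<theta> (Suc n)) {h. blocks h = v} = measure (feller \<theta> (Suc n)) (\<Union>k\<in>{1..N}. {h. blocks h = v \<and> open_block h = k})"
  proof (rule measure_pmf.finite_measure_eq_AE)
   show "AE h in feller \<theta> (Suc n). (h \<in> {h. blocks h = v}) = (h \<in> (\<Union>k\<in>{1..N}. {h. blocks h = v \<and> open_block h = k}))"
   proof (rule AE_pmfI)
    fix h assume "h \<in> set_pmf (feller \<theta> (Suc n))"
    then have "length h = Suc n" by (rule length_feller)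
    then show "(h \<in> {h. blocks h = v}) = (h \<in> (\<Union>k\<in>{1..N}. {h. blocks h = v \<and> open_block h = k}))"
     using open_block_le[of h] open_block_pos[of h] nN by (cases "h = []") auto
   qed
  qed auto
  also have "\<dots> = (\<Sum>k\<in>{1..N}. measure (feller \<theta> (Suc n)) {h. blocks h = v \<and> open_block h = k})"
   by (rule measure_pmf.finite_measure_finite_Union) (auto simp: disjoint_family_on_def)
  finally have "real (Suc n) * measure (feller \<theta> (Suc n)) {h. blocks h = v} * pochhammer \<theta> (Suc n)
   = (\<Sum>k\<in>{1..N}. real (Suc n) * measure (feller \<theta> (Suc n)) {h. blocks h = v \<and> open_block h = k} * pochhammer \<theta> (Suc n))"
   by (simp only: sum_distrib_left sum_distrib_right)
  also have "\<dots> = (\<Sum>k\<in>{1..N}. fact (Suc n) * (real k * real (v k) * cauchy_weight \<theta> N (Suc n) v))"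
   by (rule sum.cong[OF refl], rule joint) auto
  also have "\<dots> = fact (Suc n) * (real (\<Sum>k=1..N. k * v k) * cauchy_weight \<theta> N (Suc n) v)"
   by (simp add: sum_distrib_left sum_distrib_right)
  also have "real (\<Sum>k=1..N. k * v k) * cauchy_weight \<theta> N (Suc n) v = real (Suc n) * cauchy_weight \<theta> N (Suc n) v"
   by (cases "(\<Sum>k=1..N. k * v k) = Suc n") (simp_all only: cauchy_weight_def if_False simp_thms mult_zero_right)
  finally have "real (Suc n) * (measure (feller \<theta> (Suc n)) {h. blocks h = v} * pochhammer \<theta> (Suc n)) = real (Suc n) * (fact (Suc n) * cauchy_weight \<theta> N (Suc n) v)"
   by (simp only: mult_ac)
  then show ?thesis by (simp only: mult_left_cancel of_nat_eq_0_iff nat.distinct simp_thms)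
 qed
 ultimately show ?case by blast
qed

lemma feller_law:
 "n < N ==> measure (feller \<theta> n) {h. blocks h = v} = fact n * cauchy_weight \<theta> N n v / pochhammer \<theta> n"
 using feller_law_aux[of n N] pochhammer_pos[OF \<theta>, of n] by (simp add: field_simps)

lemma drop_feller: "map_pmf (drop l) (feller \<theta> (m + l)) = feller \<theta> m"
proof (induction l)
 case 0
 then show ?case by (simp add: pmf.map_ident drop_0[abs_def])
next
 case (Suc l)
 have "map_pmf (drop (Suc l)) (feller \<theta> (m + Suc l)) = map_pmf (drop l) (map_pmf snd (pair_pmf (bernoulli_pmf (\<theta> / (\<theta> + real (m + l)))) (feller \<theta> (m + l))))"
  by (simp add: feller.simps pmf.map_comp o_def case_prod_unfold)
 then show ?case using Suc by (simp add: map_snd_pair_pmf)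
qed

end

section \<open>Cycle counts at a negative binomial size\<close>

lemma pochhammer_sums:
 fixes a z :: real
 assumes "\<bar>z\<bar> < 1"
 shows "(\<lambda>m. pochhammer a m / fact m * z ^ m) sums (1 - z) powr (- a)"
proof -
 have "(\<lambda>m. ((- a) gchoose m) * (- z) ^ m) sums (1 + - z) powr (- a)"
  by (rule gen_binomial_real) (use assms in simp)
 moreover have "((- a) gchoose m) * (- z) ^ m = pochhammer a m / fact m * z ^ m" for m
 proof -
  have "(- 1) ^ m * (- z) ^ m = z ^ m" by (simp add: power_mult_distrib[symmetric])
  then show ?thesis by (simp add: gbinomial_pochhammer mult.commute mult.left_commute)
 qed
 ultimately show ?thesis by simp
qed

lemma sum_pochhammer:
 fixes a :: real
 shows "(\<Sum>m\<le>j. pochhammer a m / fact m) = pochhammer (a + 1) j / fact j"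
proof (induction j)
 case (Suc j)
 have "(\<Sum>m\<le>Suc j. pochhammer a m / fact m) = pochhammer (a + 1) j / fact j + a * pochhammer (a + 1) j / fact (Suc j)"
  using Suc by (simp add: pochhammer_rec)
 also have "\<dots> = pochhammer (a + 1) j * (a + 1 + real j) / fact (Suc j)"
 proof -
  have "(fact (Suc j) :: real) = (1 + real j) * fact j" by simp
  then show ?thesis by (simp add: divide_simps del: fact_Suc) (simp add: algebra_simps)
 qed
 finally show ?case by (simp only: pochhammer_Suc)
qed simp

lemma harm_le_ln: "1 <= n ==> harm n <= 1 + ln (real n)"
 using decseq_harm_diff_ln[unfolded decseq_def, rule_format, of 0 "n - 1"] by (simp add: harm_Suc harm_def[of 0])

lemma pochhammer_over_fact_le:
 fixes a :: real
 assumes "a >= 0" "1 <= n"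
 shows "pochhammer (a + 1) (n - 1) / fact (n - 1) <= exp a * real n powr a"
proof -
 have p: "pochhammer (a + 1) j / fact j <= exp (a * harm j)" for j
 proof (induction j)
  case (Suc j)
  have "pochhammer (a + 1) (Suc j) / fact (Suc j) = (pochhammer (a + 1) j / fact j) * (1 + a / real (Suc j))"
   by (simp add: pochhammer_Suc field_simps)
  also have "\<dots> <= exp (a * harm j) * exp (a / real (Suc j))"
   using assms Suc exp_ge_add_one_self[of "a / real (Suc j)"] by (intro mult_mono) auto
  also have "\<dots> = exp (a * harm (Suc j))"
   unfolding exp_add[symmetric] harm_Suc by (simp add: distrib_left divide_inverse)
  finally show ?case .
 qed (simp add: harm_def)
 have "harm (n - 1) <= (harm n :: real)" by (rule harm_mono) simp
 then have "a * harm (n - 1) <= a * (1 + ln (real n))" using harm_le_ln[OF assms(2)] assms(1) by (intro mult_left_mono) auto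
 then have "exp (a * harm (n - 1)) <= exp (a * (1 + ln (real n)))" by simp
 also have "\<dots> = exp a * real n powr a" using assms(2) by (simp add: powr_def distrib_left exp_add)
 finally show ?thesis using p[of "n - 1"] by linarith
qed

text \<open>The marginal of p and the law q are both proportional to A, hence equal since both have
  total mass 1. The sum of B never has to be evaluated.\<close>

lemma pmf_product_form:
 fixes p :: "('a \<times> 'b) pmf" and q :: "'a pmf"
 assumes p: "\<And>x y. pmf p (x, y) = A x * B y" and q: "\<And>x. pmf q x = A x * e"
  and nonneg: "\<And>x. 0 <= A x" "\<And>y. 0 <= B y" "0 < e"
 shows "map_pmf fst p = q"
proof -
 define \<beta> where "\<beta> = (\<integral>\<^sup>+y. ennreal (B y) \<partial>count_space UNIV)"
 have P: "ennreal (pmf (map_pmf fst p) x) = ennreal (A x) * \<beta>" for x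
 proof -
  have "ennreal (pmf (map_pmf fst p) x) = emeasure p (range (Pair x))"
   unfolding pmf_map measure_pmf.emeasure_eq_measure[symmetric] by (rule arg_cong[where f = "emeasure _"]) auto
  also have "\<dots> = (\<integral>\<^sup>+y. ennreal (pmf p (x, y)) \<partial>count_space UNIV)"
   by (rule nn_integral_pmf'[symmetric]) (simp add: inj_on_def)
  also have "\<dots> = (\<integral>\<^sup>+y. ennreal (A x) * ennreal (B y) \<partial>count_space UNIV)"
   unfolding p using nonneg by (simp add: ennreal_mult)
  finally show ?thesis unfolding \<beta>_def by (simp add: nn_integral_cmult)
 qed
 have "ennreal e = (\<integral>\<^sup>+x. ennreal e * ennreal (pmf (map_pmf fst p) x) \<partial>count_space UNIV)"
  by (simp add: nn_integral_cmult nn_integral_pmf)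
 also have "\<dots> = (\<integral>\<^sup>+x. \<beta> * ennreal (pmf q x) \<partial>count_space UNIV)"
  using nonneg by (simp add: P q ennreal_mult mult_ac)
 also have "\<dots> = \<beta>" by (simp add: nn_integral_cmult nn_integral_pmf)
 finally have \<beta>: "\<beta> = ennreal e" by simp
 show ?thesis
 proof (rule pmf_eqI)
  fix x
  have "ennreal (pmf (map_pmf fst p) x) = ennreal (pmf q x)"
   unfolding P \<beta> q using nonneg by (simp add: ennreal_mult)
  then show "pmf (map_pmf fst p) x = pmf q x" by simp
 qed
qed

lemma blocks_beyond: "length h < k ==> blocks h k = 0"
proof (induction h)
 case (Cons b h)
 then show ?case using open_block_le[of h] by (cases b) (auto simp: blocks_def split: if_splits)
qed (simp add: blocks_def)

text \<open>For this random size the cycle counts become independent Poisson variables (Shepp and Lloyd).\<close>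
definition negbin :: "real => real => nat pmf" where
 "negbin \<theta> z = embed_pmf (\<lambda>m. (1 - z) powr \<theta> * (pochhammer \<theta> m / fact m * z ^ m))"

text \<open>One run of length n + m contains both sizes: dropping the m newest steps leaves a run of
  length n, dropping the n newest leaves one of the random length m.\<close>

definition feller_pair :: "real => real => nat => (nat \<times> bool list) pmf" where
 "feller_pair \<theta> z n = bind_pmf (negbin \<theta> z) (\<lambda>m. map_pmf (Pair m) (feller \<theta> (n + m)))"

context
 fixes \<theta> z :: real
 assumes \<theta>: "\<theta> > 0" and z: "0 <= z" "z < 1"
begin

lemma pmf_negbin: "pmf (negbin \<theta> z) m = (1 - z) powr \<theta> * (pochhammer \<theta> m / fact m * z ^ m)"
 unfolding negbin_def
proof (rule pmf_embed_pmf)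
 show nn: "0 <= (1 - z) powr \<theta> * (pochhammer \<theta> m / fact m * z ^ m)" for m
  using pochhammer_pos[OF \<theta>, of m] z by simp
 have "(\<lambda>m. (1 - z) powr \<theta> * (pochhammer \<theta> m / fact m * z ^ m)) sums ((1 - z) powr \<theta> * (1 - z) powr (- \<theta>))"
  by (intro sums_mult pochhammer_sums) (use z in simp)
 then have "(\<lambda>m. (1 - z) powr \<theta> * (pochhammer \<theta> m / fact m * z ^ m)) sums 1"
  using z by (simp add: powr_add[symmetric])
 from suminf_ennreal_eq[OF nn this]
 show "(\<integral>\<^sup>+m. ennreal ((1 - z) powr \<theta> * (pochhammer \<theta> m / fact m * z ^ m)) \<partial>count_space UNIV) = 1"
  by (simp add: nn_integral_count_space_nat)
qed

lemma negbin_mean: "(\<integral>\<^sup>+m. ennreal (real m) \<partial>negbin \<theta> z) = ennreal (\<theta> * z / (1 - z))"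
proof -
 let ?f = "\<lambda>m. pmf (negbin \<theta> z) m * real m"
 have "?f (Suc m) = (1 - z) powr \<theta> * (\<theta> * z) * (pochhammer (\<theta> + 1) m / fact m * z ^ m)" for m
  unfolding pmf_negbin pochhammer_rec by (simp add: field_simps del: of_nat_Suc)
 moreover have "(\<lambda>m. (1 - z) powr \<theta> * (\<theta> * z) * (pochhammer (\<theta> + 1) m / fact m * z ^ m)) sums ((1 - z) powr \<theta> * (\<theta> * z) * (1 - z) powr (- (\<theta> + 1)))"
  by (intro sums_mult pochhammer_sums) (use z in simp)
 ultimately have "(\<lambda>m. ?f (Suc m)) sums ((1 - z) powr \<theta> * (\<theta> * z) * (1 - z) powr (- (\<theta> + 1)))" by simp
 then have "?f sums ((1 - z) powr \<theta> * (\<theta> * z) * (1 - z) powr (- (\<theta> + 1)) + ?f 0)" by (rule sums_Suc)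
 moreover have "(1 - z) powr \<theta> * (\<theta> * z) * (1 - z) powr (- (\<theta> + 1)) = \<theta> * z / (1 - z)"
 proof -
  have "(1 - z) powr \<theta> * (1 - z) powr (- (\<theta> + 1)) = 1 / (1 - z)"
   using z by (simp add: powr_add[symmetric] powr_minus_divide)
  then show ?thesis by (metis (no_types, opaque_lifting) mult.assoc mult.commute mult.right_neutral times_divide_eq_right)
 qed
 ultimately have s: "?f sums (\<theta> * z / (1 - z))" by simp
 have "(\<integral>\<^sup>+m. ennreal (real m) \<partial>negbin \<theta> z) = (\<Sum>m. ennreal (?f m))"
  unfolding nn_integral_pmf_nat by (simp add: ennreal_mult)
 also have "\<dots> = ennreal (\<theta> * z / (1 - z))"
  by (rule suminf_ennreal_eq[OF _ s]) simp
 finally show ?thesis .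
qed

lemma feller_weight:
 assumes "v 0 = 0" "\<And>k. k > N ==> v k = 0"
 shows "measure (feller \<theta> m) {h. blocks h = v} = (if (\<Sum>k=1..N. k * v k) = m then fact m * (\<Prod>k=1..N. (\<theta> / real k) ^ v k / fact (v k)) / pochhammer \<theta> m else 0)"
proof -
 let ?N = "max N (Suc m)"
 have "(\<Sum>k=1..N. k * v k) = (\<Sum>k=1..?N. k * v k)"
  using assms by (intro sum.mono_neutral_left) auto
 moreover have "(\<Prod>k=1..N. (\<theta> / real k) ^ v k / fact (v k)) = (\<Prod>k=1..?N. (\<theta> / real k) ^ v k / fact (v k))"
  using assms by (intro prod.mono_neutral_left) auto
 moreover have "\<forall>k>?N. v k = 0" using assms by auto
 moreover have "m < ?N" by simp
 ultimately show ?thesis using assms feller_law[OF \<theta>, of m ?N v] by (simp only: cauchy_weight_def) auto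
qed

definition "random_blocks = bind_pmf (negbin \<theta> z) (\<lambda>m. map_pmf blocks (feller \<theta> m))"

text \<open>Only the size m equal to the sum of k * v k contributes. There m! and the Pochhammer
  symbol of \<open>feller_law\<close> cancel against the negative binomial weight, and z^m
  distributes over the cycles.\<close>

lemma pmf_random_blocks:
 assumes "v 0 = 0" "\<And>k. k > N ==> v k = 0"
 shows "pmf random_blocks v = (1 - z) powr \<theta> * (\<Prod>k=1..N. (\<theta> * z ^ k / real k) ^ v k / fact (v k))"
proof -
 let ?M = "\<Sum>k=1..N. k * v k"
 let ?P = "\<Prod>k=1..N. (\<theta> / real k) ^ v k / fact (v k)"
 have P: "0 <= ?P" using \<theta> by (intro prod_nonneg) auto
 have pp: "pochhammer \<theta> ?M > 0" using \<theta> by (rule pochhammer_pos)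
 have fw: "measure (feller \<theta> m) {h. blocks h = v} = (if ?M = m then fact m * ?P / pochhammer \<theta> m else 0)" for m
  by (rule feller_weight) (use assms in auto)
 have "ennreal (pmf random_blocks v) = (\<integral>\<^sup>+m. ennreal (measure (feller \<theta> m) {h. blocks h = v}) \<partial>negbin \<theta> z)"
  unfolding random_blocks_def ennreal_pmf_bind pmf_map vimage_singleton_eq vimage_def by simp
 also have "\<dots> = (\<integral>\<^sup>+m. ennreal (fact ?M * ?P / pochhammer \<theta> ?M) * indicator {?M} m \<partial>negbin \<theta> z)"
  by (rule nn_integral_cong) (auto simp: fw indicator_def)
 also have "\<dots> = ennreal (fact ?M * ?P / pochhammer \<theta> ?M) * ennreal (pmf (negbin \<theta> z) ?M)"
  by (simp add: emeasure_pmf_single)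
 also have "\<dots> = ennreal (fact ?M * ?P / pochhammer \<theta> ?M * pmf (negbin \<theta> z) ?M)"
  using P pp by (intro ennreal_mult[symmetric]) auto
 also have "fact ?M * ?P / pochhammer \<theta> ?M * pmf (negbin \<theta> z) ?M = (1 - z) powr \<theta> * (z ^ ?M * ?P)"
  unfolding pmf_negbin using pp by simp
 also have "z ^ ?M * ?P = (\<Prod>k=1..N. (\<theta> * z ^ k / real k) ^ v k / fact (v k))"
  unfolding power_sum prod.distrib[symmetric]
  by (rule prod.cong) (simp_all add: power_mult power_mult_distrib power_divide)
 finally show ?thesis using P z by (subst (asm) ennreal_inj) (auto intro!: mult_nonneg_nonneg prod_nonneg simp: \<theta> less_imp_le)
qed

lemma set_random_blocks: "v \<in> set_pmf random_blocks ==> v 0 = 0 \<and> finite {k. v k ~= 0}"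
proof -
 assume "v \<in> set_pmf random_blocks"
 then obtain h where h: "v = blocks h" by (auto simp: random_blocks_def)
 have "{k. blocks h k ~= 0} \<subseteq> {..length h}" using blocks_beyond[of h] by (force simp: not_less[symmetric])
 then show ?thesis unfolding h using blocks_0 finite_subset by blast
qed

text \<open>The weights factor into the first n counts and all later ones.
  \<open>pmf_product_form\<close> identifies the marginal of the first n without computing the
  infinite product over the remaining lengths; finiteness of the support keeps each single weight a
  finite product.\<close>

lemma shepp_lloyd:
 "pmf (map_pmf (\<lambda>v. map (\<lambda>k. v (Suc k)) [0..<n]) random_blocks) w = pois_law (\<lambda>k. \<theta> * z ^ Suc k / real (Suc k)) n w"
proof -
 define f where "f = (\<lambda>v :: nat => nat. (map (\<lambda>k. v (Suc k)) [0..<n], \<lambda>k. if k <= n then 0 else v k))"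
 define g where "g = (\<lambda>k (c :: nat). (\<theta> * z ^ k / real k) ^ c / fact c)"
 define A where "A = (\<lambda>w. if length w = n then \<Prod>k<n. g (Suc k) (w ! k) else 0)"
 define B where "B = (\<lambda>u :: nat => nat. if (\<forall>k\<le>n. u k = 0) \<and> finite {k. u k ~= 0} then (1 - z) powr \<theta> * (\<Prod>k\<in>{k. u k ~= 0}. g k (u k)) else 0)"
 let ?q = "map_pmf (\<lambda>f. map f [0..<n]) (Pi_pmf {..<n} 0 (\<lambda>k. pois (\<theta> * z ^ Suc k / real (Suc k))))"
 have g0: "g k 0 = 1" for k by (simp add: g_def)
 have gn: "0 <= g k c" for k c using \<theta> z by (simp add: g_def)
 have "map_pmf fst (map_pmf f random_blocks) = ?q"
 proof (rule pmf_product_form)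
  fix w u
  show "pmf (map_pmf f random_blocks) (w, u) = A w * B u"
  proof (cases "length w = n \<and> (\<forall>k\<le>n. u k = 0) \<and> finite {k. u k ~= 0}")
   case False
   have "(w, u) \<notin> f ` set_pmf random_blocks"
   proof
    assume "(w, u) \<in> f ` set_pmf random_blocks"
    then obtain v where v: "v \<in> set_pmf random_blocks" "(w, u) = f v" by auto
    have "{k. u k ~= 0} \<subseteq> {k. v k ~= 0}" using v(2) by (auto simp: f_def)
    then show False using False v(2) set_random_blocks[OF v(1)] finite_subset by (auto simp: f_def)
   qed
   then show ?thesis using False by (auto simp: pmf_map_outside A_def B_def)
  next
   case True
   define v where "v = (\<lambda>k. if k = 0 then 0 else if k <= n then w ! (k - 1) else u k)"
   have fv: "f v = (w, u)" using True by (auto simp: f_def v_def fun_eq_iff list_eq_iff_nth_eq)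
   obtain N0 where N0: "\<And>k. u k ~= 0 ==> k <= N0" using True finite_nat_set_iff_bounded_le[of "{k. u k ~= 0}"] by auto
   define N where "N = max n N0"
   have v0: "v 0 = 0" "\<And>k. k > N ==> v k = 0"
   proof -
    fix k assume k: "k > N"
    then have "u k = 0" using N0[of k] by (cases "u k = 0") (auto simp: N_def)
    then show "v k = 0" using k by (simp add: v_def N_def)
   qed (simp add: v_def)
   have "(\<Prod>k=1..N. (\<theta> * z ^ k / real k) ^ v k / fact (v k)) = (\<Prod>k\<in>{1..n} \<union> {n<..N}. g k (v k))"
    unfolding g_def by (rule prod.cong) (auto simp: N_def)
   also have "\<dots> = (\<Prod>k=1..n. g k (v k)) * (\<Prod>k\<in>{n<..N}. g k (v k))"
    by (rule prod.union_disjoint) auto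
   also have "(\<Prod>k\<in>{n<..N}. g k (v k)) = (\<Prod>k\<in>{k. u k ~= 0}. g k (u k))"
   proof -
    have "(\<Prod>k\<in>{k. u k ~= 0}. g k (u k)) = (\<Prod>k\<in>{n<..N}. g k (u k))"
     
    proof (rule prod.mono_neutral_left)
     show "{k. u k ~= 0} \<subseteq> {n<..N}"
     proof
      fix k assume k: "k \<in> {k. u k ~= 0}"
      then have "k <= N0" "\<not> k <= n" using N0[of k] True by auto
      then show "k \<in> {n<..N}" by (simp add: N_def)
     qed
    qed (use g0 in auto)
    also have "\<dots> = (\<Prod>k\<in>{n<..N}. g k (v k))" by (rule prod.cong) (auto simp: v_def)
    finally show ?thesis ..
   qed
   also have "(\<Prod>k=1..n. g k (v k)) = (\<Prod>k<n. g (Suc k) (w ! k))"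
    by (simp add: prod.atLeast1_atMost_eq v_def)
   finally have pr: "pmf random_blocks v = A w * B u"
    using pmf_random_blocks[of v N, OF v0] True by (simp add: A_def B_def)
   show ?thesis
   proof (cases "v \<in> set_pmf random_blocks")
    case T: True
    have inj: "inj_on f (set_pmf random_blocks)"
    proof (rule inj_onI)
     fix v v' assume v: "v \<in> set_pmf random_blocks" "v' \<in> set_pmf random_blocks" and e: "f v = f v'"
     show "v = v'"
     proof
      fix k
      have z0: "v 0 = 0" "v' 0 = 0" using v set_random_blocks by blast+
      have l: "map (\<lambda>k. v (Suc k)) [0..<n] = map (\<lambda>k. v' (Suc k)) [0..<n]" and t: "(\<lambda>k. if k <= n then 0 else v k) = (\<lambda>k. if k <= n then 0 else v' k)"
       using e by (simp_all only: f_def prod.inject)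
      consider "k = 0" | "0 < k" "k <= n" | "k > n" by linarith
      then show "v k = v' k"
      proof cases
       case 2
       then obtain j where "k = Suc j" "j < n" by (cases k) auto
       then show ?thesis using l by simp
      next
       case 3
       then show ?thesis using fun_cong[OF t, of k] by simp
      qed (use z0 in simp)
     qed
    qed
    show ?thesis using pmf_map_inj[OF inj T] pr unfolding fv by simp
   next
    case F: False
    have "(w, u) \<notin> f ` set_pmf random_blocks"
    proof
     assume "(w, u) \<in> f ` set_pmf random_blocks"
     then obtain v' where v': "v' \<in> set_pmf random_blocks" "(w, u) = f v'" by auto
     have "v' = v"
     proof
      fix k
      have z0: "v' 0 = 0" using v' set_random_blocks by blast
      have l: "w = map (\<lambda>k. v' (Suc k)) [0..<n]" and t: "u = (\<lambda>k. if k <= n then 0 else v' k)"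
       using v'(2) by (simp_all only: f_def prod.inject)
      show "v' k = v k" using z0 unfolding v_def l t by (cases k) auto
     qed
     then show False using F v' by simp
    qed
    moreover have "pmf random_blocks v = 0" using F by (simp only: pmf_eq_0_set_pmf not_False_eq_True)
    ultimately show ?thesis using pr by (simp add: pmf_map_outside)
   qed
  qed
 next
  fix w
  have "pmf ?q w = pois_law (\<lambda>k. \<theta> * z ^ Suc k / real (Suc k)) n w"
   by (rule pmf_map_Pi_pois) (use \<theta> z in simp)
  then show "pmf ?q w = A w * (\<Prod>k<n. exp (- (\<theta> * z ^ Suc k / real (Suc k))))"
   by (simp only: pois_law_def A_def g_def prod.distrib split: if_splits) auto
 next
  show "0 <= A x" for x using gn by (auto simp: A_def intro: prod_nonneg)
  show "0 <= B y" for y using gn by (auto simp: B_def intro!: prod_nonneg mult_nonneg_nonneg)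
 qed (simp add: prod_pos)
 then have "map_pmf (\<lambda>v. map (\<lambda>k. v (Suc k)) [0..<n]) random_blocks = ?q"
  by (simp add: pmf.map_comp o_def f_def)
 then show ?thesis by (simp only:) (rule pmf_map_Pi_pois, use \<theta> z in simp)
qed

lemma feller_pair_n: "map_pmf (\<lambda>(m, h). blocks (drop m h)) (feller_pair \<theta> z n) = map_pmf blocks (feller \<theta> n)"
proof -
 have "map_pmf (\<lambda>(m, h). blocks (drop m h)) (map_pmf (Pair m) (feller \<theta> (n + m))) = map_pmf blocks (map_pmf (drop m) (feller \<theta> (n + m)))" for m
  by (simp add: pmf.map_comp o_def)
 then show ?thesis unfolding feller_pair_def map_bind_pmf by (simp add: drop_feller[OF \<theta>])
qed

lemma feller_pair_N: "map_pmf (\<lambda>(m, h). blocks (drop n h)) (feller_pair \<theta> z n) = random_blocks"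
proof -
 have "map_pmf (\<lambda>(m, h). blocks (drop n h)) (map_pmf (Pair m) (feller \<theta> (n + m))) = map_pmf blocks (map_pmf (drop n) (feller \<theta> (m + n)))" for m
  by (simp add: pmf.map_comp o_def add.commute)
 then show ?thesis unfolding feller_pair_def map_bind_pmf random_blocks_def by (simp add: drop_feller[OF \<theta>])
qed

lemma count_feller: "(\<integral>\<^sup>+h. ennreal (real (count_list (take l h) True)) \<partial>feller \<theta> (b + l)) = ennreal (\<Sum>j\<in>{b..<b + l}. \<theta> / (\<theta> + real j))"
proof (induction l)
 case (Suc l)
 let ?I = "\<integral>\<^sup>+h. ennreal (real (count_list (take l h) True)) \<partial>feller \<theta> (b + l)"
 have p: "ennreal (\<theta> / (\<theta> + real (b + l))) + ennreal (real (b + l) / (\<theta> + real (b + l))) = 1"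
  using \<theta> by (simp flip: ennreal_plus add_divide_distrib)
 have "(\<integral>\<^sup>+h. ennreal (real (count_list (take (Suc l) h) True)) \<partial>feller \<theta> (b + Suc l))
  = (\<integral>\<^sup>+h. 1 + ennreal (real (count_list (take l h) True)) \<partial>feller \<theta> (b + l)) * ennreal (\<theta> / (\<theta> + real (b + l))) + ?I * ennreal (real (b + l) / (\<theta> + real (b + l)))"
 proof -
  have "ennreal (real (count_list (take (Suc l) (True # h)) True)) = 1 + ennreal (real (count_list (take l h) True))" for h
   by (simp add: ennreal_plus)
  moreover have "count_list (take (Suc l) (False # h)) True = count_list (take l h) True" for h
   by simp
  ultimately show ?thesis unfolding add_Suc_right nn_integral_feller_Suc[OF \<theta>] by (simp only:)
 qed
 also have "\<dots> = (1 + ?I) * ennreal (\<theta> / (\<theta> + real (b + l))) + ?I * ennreal (real (b + l) / (\<theta> + real (b + l)))"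
  by (simp add: nn_integral_add)
 also have "\<dots> = ennreal (\<theta> / (\<theta> + real (b + l))) + ?I * (ennreal (\<theta> / (\<theta> + real (b + l))) + ennreal (real (b + l) / (\<theta> + real (b + l))))"
  by (simp only: distrib_left distrib_right mult_1 add.assoc)
 also have "\<dots> = ennreal (\<theta> / (\<theta> + real (b + l))) + ennreal (\<Sum>j\<in>{b..<b + l}. \<theta> / (\<theta> + real j))"
  unfolding p Suc by simp
 also have "\<dots> = ennreal (\<Sum>j\<in>{b..<b + Suc l}. \<theta> / (\<theta> + real j))"
  using \<theta> by (subst ennreal_plus[symmetric]) (auto intro!: sum_nonneg simp: add.commute)
 finally show ?case .
qed simp

end

text \<open>The shorter of the two runs is a tail of the longer one in list order, so
  \<open>blocks_append\<close> applies; the expected number of \<open>True\<close> among the surplus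
  steps is the harmonic-type sum between the two sizes.\<close>

lemma feller_pair_prefix:
 assumes \<theta>: "\<theta> > 0"
 shows "(\<integral>\<^sup>+h. ennreal (\<Sum>k\<in>F. \<bar>real (blocks (drop m h) k) - real (blocks (drop n h) k)\<bar>) \<partial>feller \<theta> (n + m))
  <= ennreal (2 + (\<Sum>j\<in>{min n m..<max n m}. \<theta> / (\<theta> + real j)))"
proof (cases "finite F")
 case F: True
 define a b where "a = min n m" and "b = max n m"
 have ab: "a <= b" "b + a = n + m" "b = a + (b - a)" by (auto simp: a_def b_def)
 have "(\<integral>\<^sup>+h. ennreal (\<Sum>k\<in>F. \<bar>real (blocks (drop m h) k) - real (blocks (drop n h) k)\<bar>) \<partial>feller \<theta> (n + m))
  <= (\<integral>\<^sup>+h. 2 + ennreal (real (count_list (take (b - a) (drop a h)) True)) \<partial>feller \<theta> (n + m))"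
 proof (rule nn_integral_mono)
  fix h :: "bool list"
  have "b - a + a = b" using ab(1) by simp
  then have "drop b h = drop (b - a) (drop a h)" by (simp only: drop_drop)
  then have "drop a h = take (b - a) (drop a h) @ drop b h" by (simp only: append_take_drop_id)
  then have *: "(\<Sum>k\<in>F. \<bar>real (blocks (drop a h) k) - real (blocks (drop b h) k)\<bar>) <= 2 + real (count_list (take (b - a) (drop a h)) True)"
   using blocks_append[OF F, of "take (b - a) (drop a h)" "drop b h"] by simp
  have "(\<Sum>k\<in>F. \<bar>real (blocks (drop m h) k) - real (blocks (drop n h) k)\<bar>) = (\<Sum>k\<in>F. \<bar>real (blocks (drop a h) k) - real (blocks (drop b h) k)\<bar>)"
   by (cases "n <= m") (simp_all add: a_def b_def abs_minus_commute)
  then have "ennreal (\<Sum>k\<in>F. \<bar>real (blocks (drop m h) k) - real (blocks (drop n h) k)\<bar>) <= ennreal (2 + real (count_list (take (b - a) (drop a h)) True))"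
   using * by (intro ennreal_leI) simp
  also have "\<dots> = 2 + ennreal (real (count_list (take (b - a) (drop a h)) True))" by simp
  finally show "ennreal (\<Sum>k\<in>F. \<bar>real (blocks (drop m h) k) - real (blocks (drop n h) k)\<bar>) <= 2 + ennreal (real (count_list (take (b - a) (drop a h)) True))" .
 qed
 also have "\<dots> = 2 + (\<integral>\<^sup>+h. ennreal (real (count_list (take (b - a) (drop a h)) True)) \<partial>feller \<theta> (b + a))"
  by (simp add: nn_integral_add ab(2))
 also have "(\<integral>\<^sup>+h. ennreal (real (count_list (take (b - a) (drop a h)) True)) \<partial>feller \<theta> (b + a)) = (\<integral>\<^sup>+h. ennreal (real (count_list (take (b - a) h) True)) \<partial>map_pmf (drop a) (feller \<theta> (b + a)))"
  by (simp only: nn_integral_map_pmf)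
 also have "\<dots> = ennreal (\<Sum>j\<in>{a..<b}. \<theta> / (\<theta> + real j))"
  unfolding drop_feller[OF \<theta>] using count_feller[OF \<theta>, of 0 a "b - a", unfolded ab(3)[symmetric]] by simp
 also have "2 + \<dots> = ennreal (2 + (\<Sum>j\<in>{a..<b}. \<theta> / (\<theta> + real j)))"
  using \<theta> by (subst ennreal_plus) (auto intro!: sum_nonneg)
 finally show ?thesis unfolding a_def b_def .
qed simp

text \<open>With z = 1 - 1 / n the random size m has mean theta * (n - 1), comparable to n. If m >
  n, each surplus step closes a block with probability at most theta / n, which costs theta^2 in
  mean. If m < n, exchanging the sums gives theta / (theta + j) times P(m <= j), whose total over j
  < n is at most exp theta.\<close>

lemma feller_pair_close:
 assumes \<theta>: "\<theta> > 0" and n: "n >= 1"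
 defines "z \<equiv> 1 - 1 / real n"
 shows "(\<integral>\<^sup>+(m, h). ennreal (\<Sum>k\<in>F. \<bar>real (blocks (drop m h) k) - real (blocks (drop n h) k)\<bar>) \<partial>feller_pair \<theta> z n) <= ennreal (2 + exp \<theta> + \<theta>\<^sup>2)"
proof -
 have z: "0 <= z" "z < 1" "1 - z = 1 / real n" using n by (auto simp: z_def)
 have hs: "(\<Sum>j\<in>{min n m..<max n m}. \<theta> / (\<theta> + real j)) <= (\<Sum>j<n. if m <= j then \<theta> / (\<theta> + real j) else 0) + \<theta> / real n * real m" for m
 proof (cases "m <= n")
  case True
  have "(\<Sum>j\<in>{min n m..<max n m}. \<theta> / (\<theta> + real j)) = (\<Sum>j\<in>{j \<in> {..<n}. m <= j}. \<theta> / (\<theta> + real j))"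
   using True by (intro sum.cong) auto
  also have "\<dots> = (\<Sum>j<n. if m <= j then \<theta> / (\<theta> + real j) else 0)"
   by (rule sum.inter_filter) simp
  finally show ?thesis using \<theta> by simp
 next
  case False
  have "(\<Sum>j\<in>{min n m..<max n m}. \<theta> / (\<theta> + real j)) <= (\<Sum>j\<in>{min n m..<max n m}. \<theta> / real n)"
   using False n \<theta> by (intro sum_mono divide_left_mono mult_pos_pos) auto
  also have "\<dots> = \<theta> / real n * (real m - real n)" using False by (simp add: of_nat_diff max_def min_def mult.commute)
  also have "\<dots> <= \<theta> / real n * real m" using \<theta> by (intro mult_left_mono) auto
  finally show ?thesis using \<theta> by (intro add_increasing sum_nonneg) auto
 qed
 \<comment> \<open>Bound on P(m <= j): the powers of z are dropped, and the Pochhammer sum has a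
   closed form.\<close>
 have cdf: "(\<integral>\<^sup>+m. ennreal (if m <= j then c else 0) \<partial>negbin \<theta> z) <= ennreal (c * (real n powr (- \<theta>) * (pochhammer (\<theta> + 1) j / fact j)))" if c: "0 <= c" for c :: real and j :: nat
 proof -
  have "(\<integral>\<^sup>+m. ennreal (if m <= j then c else 0) \<partial>negbin \<theta> z) = (\<integral>\<^sup>+m. ennreal c * indicator {..j} m \<partial>negbin \<theta> z)"
   by (rule nn_integral_cong) (simp add: indicator_def)
  also have "\<dots> = ennreal c * ennreal (measure (negbin \<theta> z) {..j})"
   by (subst nn_integral_cmult_indicator) (simp_all only: measure_pmf.emeasure_eq_measure sets_measure_pmf UNIV_I)
  also have "\<dots> = ennreal (c * measure (negbin \<theta> z) {..j})"
   using c by (simp add: ennreal_mult)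
  also have "\<dots> <= ennreal (c * (real n powr (- \<theta>) * (pochhammer (\<theta> + 1) j / fact j)))"
  proof (intro ennreal_leI mult_left_mono[OF _ c])
   have "measure (negbin \<theta> z) {..j} = (\<Sum>m\<le>j. (1 - z) powr \<theta> * (pochhammer \<theta> m / fact m * z ^ m))"
    by (simp add: measure_measure_pmf_finite pmf_negbin[OF \<theta> z(1,2)])
   also have "\<dots> <= (\<Sum>m\<le>j. (1 - z) powr \<theta> * (pochhammer \<theta> m / fact m * 1))"
    using z pochhammer_pos[OF \<theta>] by (intro sum_mono mult_left_mono power_le_one) (auto intro: less_imp_le)
   also have "\<dots> = (1 - z) powr \<theta> * (\<Sum>m\<le>j. pochhammer \<theta> m / fact m)"
    by (simp add: sum_distrib_left)
   also have "\<dots> = real n powr (- \<theta>) * (pochhammer (\<theta> + 1) j / fact j)"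
    unfolding sum_pochhammer z(3) using n by (simp add: powr_divide powr_minus_divide)
   finally show "measure (negbin \<theta> z) {..j} <= real n powr (- \<theta>) * (pochhammer (\<theta> + 1) j / fact j)" .
  qed
  finally show ?thesis .
 qed
 \<comment> \<open>The factor theta / (theta + j) lowers the parameter from theta + 1 back to theta,
   so that the sum over j is again closed; its growth n^theta cancels against n^(- theta).\<close>
 have ph: "\<theta> / (\<theta> + real j) * (real n powr (- \<theta>) * (pochhammer (\<theta> + 1) j / fact j)) = real n powr (- \<theta>) * (pochhammer \<theta> j / fact j)" for j
 proof -
  have "\<theta> * pochhammer (\<theta> + 1) j = (\<theta> + real j) * pochhammer \<theta> j"
   unfolding pochhammer_rec[symmetric] pochhammer_rec' by simp
  then have "\<theta> / (\<theta> + real j) * pochhammer (\<theta> + 1) j = pochhammer \<theta> j" using \<theta> by (simp add: divide_simps add_eq_0_iff)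
  then show ?thesis by (metis (no_types, lifting) mult.left_commute times_divide_eq_right)
 qed
 have "(\<integral>\<^sup>+(m, h). ennreal (\<Sum>k\<in>F. \<bar>real (blocks (drop m h) k) - real (blocks (drop n h) k)\<bar>) \<partial>feller_pair \<theta> z n)
  = (\<integral>\<^sup>+m. (\<integral>\<^sup>+h. ennreal (\<Sum>k\<in>F. \<bar>real (blocks (drop m h) k) - real (blocks (drop n h) k)\<bar>) \<partial>feller \<theta> (n + m)) \<partial>negbin \<theta> z)"
  by (simp add: feller_pair_def nn_integral_bind_pmf nn_integral_map_pmf)
 also have "\<dots> <= (\<integral>\<^sup>+m. ennreal (2 + (\<Sum>j\<in>{min n m..<max n m}. \<theta> / (\<theta> + real j))) \<partial>negbin \<theta> z)"
  by (intro nn_integral_mono feller_pair_prefix[OF \<theta>])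
 also have "\<dots> <= (\<integral>\<^sup>+m. 2 + ((\<Sum>j<n. ennreal (if m <= j then \<theta> / (\<theta> + real j) else 0)) + ennreal (\<theta> / real n) * ennreal (real m)) \<partial>negbin \<theta> z)"
 proof (rule nn_integral_mono)
  fix m
  have "ennreal (2 + (\<Sum>j\<in>{min n m..<max n m}. \<theta> / (\<theta> + real j))) <= ennreal (2 + ((\<Sum>j<n. if m <= j then \<theta> / (\<theta> + real j) else 0) + \<theta> / real n * real m))"
   using hs[of m] by (intro ennreal_leI) simp
  also have "\<dots> = 2 + (ennreal (\<Sum>j<n. if m <= j then \<theta> / (\<theta> + real j) else 0) + ennreal (\<theta> / real n) * ennreal (real m))"
  proof -
   have "ennreal (\<theta> / real n) * ennreal (real m) = ennreal (\<theta> / real n * real m)"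
    by (rule ennreal_mult[symmetric]) (use \<theta> in auto)
   moreover have "ennreal (2 + (A + B)) = 2 + (ennreal A + ennreal B)" if "0 <= A" "0 <= B" for A B :: real
    using that by (simp add: ennreal_plus)
   ultimately show ?thesis using \<theta> by (simp only:) (simp add: sum_nonneg)
  qed
  also have "ennreal (\<Sum>j<n. if m <= j then \<theta> / (\<theta> + real j) else 0) = (\<Sum>j<n. ennreal (if m <= j then \<theta> / (\<theta> + real j) else 0))"
   using \<theta> by (intro sum_ennreal[symmetric]) auto
  finally show "ennreal (2 + (\<Sum>j\<in>{min n m..<max n m}. \<theta> / (\<theta> + real j))) <= 2 + ((\<Sum>j<n. ennreal (if m <= j then \<theta> / (\<theta> + real j) else 0)) + ennreal (\<theta> / real n) * ennreal (real m))" .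
 qed
 also have "\<dots> = 2 + ((\<Sum>j<n. (\<integral>\<^sup>+m. ennreal (if m <= j then \<theta> / (\<theta> + real j) else 0) \<partial>negbin \<theta> z)) + ennreal (\<theta> / real n) * (\<integral>\<^sup>+m. ennreal (real m) \<partial>negbin \<theta> z))"
  by (simp add: nn_integral_add nn_integral_sum nn_integral_cmult del: sum_ennreal)
 also have "\<dots> <= 2 + ((\<Sum>j<n. ennreal (real n powr (- \<theta>) * (pochhammer \<theta> j / fact j))) + ennreal (\<theta> / real n) * ennreal (\<theta> * real n))"
 proof (intro add_mono sum_mono mult_left_mono order_refl)
  fix j
  show "(\<integral>\<^sup>+m. ennreal (if m <= j then \<theta> / (\<theta> + real j) else 0) \<partial>negbin \<theta> z) <= ennreal (real n powr (- \<theta>) * (pochhammer \<theta> j / fact j))"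
   unfolding ph[symmetric] by (rule cdf) (use \<theta> in simp)
 next
  show "(\<integral>\<^sup>+m. ennreal (real m) \<partial>negbin \<theta> z) <= ennreal (\<theta> * real n)"
   unfolding negbin_mean[OF \<theta> z(1,2)] z(3) using \<theta> z n by (intro ennreal_leI) (simp add: mult_le_one mult_left_le_one_le)
 qed simp
 also have "(\<Sum>j<n. ennreal (real n powr (- \<theta>) * (pochhammer \<theta> j / fact j))) = ennreal (real n powr (- \<theta>) * (\<Sum>j<n. pochhammer \<theta> j / fact j))"
  unfolding sum_distrib_left using pochhammer_pos[OF \<theta>] by (intro sum_ennreal) (simp add: less_imp_le)
 also have "(\<Sum>j<n. pochhammer \<theta> j / fact j) = pochhammer (\<theta> + 1) (n - 1) / fact (n - 1)"
 proof -
  have "{..<n} = {..n - 1}" using n by auto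
  then show ?thesis by (simp only: sum_pochhammer)
 qed
 also have "2 + (ennreal (real n powr (- \<theta>) * (pochhammer (\<theta> + 1) (n - 1) / fact (n - 1))) + ennreal (\<theta> / real n) * ennreal (\<theta> * real n)) <= 2 + (ennreal (exp \<theta>) + ennreal (\<theta>\<^sup>2))"
 proof (intro add_mono order_refl)
  have "real n powr (- \<theta>) * (pochhammer (\<theta> + 1) (n - 1) / fact (n - 1)) <= real n powr (- \<theta>) * (exp \<theta> * real n powr \<theta>)"
   using pochhammer_over_fact_le[of \<theta> n] \<theta> n by (intro mult_left_mono) auto
  also have "\<dots> = exp \<theta>" using n by (simp add: powr_minus field_simps)
  finally show "ennreal (real n powr (- \<theta>) * (pochhammer (\<theta> + 1) (n - 1) / fact (n - 1))) <= ennreal (exp \<theta>)" by (rule ennreal_leI)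
  show "ennreal (\<theta> / real n) * ennreal (\<theta> * real n) <= ennreal (\<theta>\<^sup>2)"
   using \<theta> n by (simp add: ennreal_mult[symmetric] power2_eq_square)
 qed
 also have "\<dots> = ennreal (2 + exp \<theta> + \<theta>\<^sup>2)" by (simp add: ennreal_plus add.assoc)
 finally show ?thesis .
qed

lemma esf_coupling:
 fixes \<theta> :: real
 assumes \<theta>: "\<theta> > 0" and n: "n >= 1"
 obtains S :: "(nat \<times> bool list) pmf" and C :: "nat \<times> bool list => nat => nat" and Z :: "nat \<times> bool list => nat list"
 where "\<And>v. measure S {\<omega>. C \<omega> = v} = (\<Sum>\<sigma>\<in>{\<sigma>. \<sigma> permutes {1..n} \<and> cycle_count n \<sigma> = v}. esf_weight \<theta> n \<sigma>)"
  "\<And>w. pmf (map_pmf Z S) w = pois_law (\<lambda>k. \<theta> * (1 - 1 / real n) ^ Suc k / real (Suc k)) n w"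
  "\<And>\<omega>. length (Z \<omega>) = n"
  "(\<integral>\<^sup>+\<omega>. ennreal (\<Sum>k<n. \<bar>real (C \<omega> (Suc k)) - real (Z \<omega> ! k)\<bar>) \<partial>S) <= ennreal (2 + exp \<theta> + \<theta>\<^sup>2)"
  "\<And>\<omega> k. \<omega> \<in> set_pmf S ==> C \<omega> k <= n"
proof
 let ?z = "1 - 1 / real n"
 let ?S = "feller_pair \<theta> ?z n"
 let ?C = "\<lambda>(m, h). blocks (drop m h)"
 let ?V = "\<lambda>(m, h). blocks (drop n h)"
 let ?Z = "\<lambda>\<omega> :: nat \<times> bool list. map (\<lambda>k. ?V \<omega> (Suc k)) [0..<n]"
 have z: "0 <= ?z" "?z < 1" using n by auto
 fix v
 have "measure ?S {\<omega>. ?C \<omega> = v} = pmf (map_pmf ?C ?S) v"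
  unfolding pmf_map by (rule arg_cong[where f = "measure _"]) auto
 also have "\<dots> = measure (feller \<theta> n) {h. blocks h = v}"
  unfolding feller_pair_n[OF \<theta> z] pmf_map by (rule arg_cong[where f = "measure _"]) auto
 also have "\<dots> = fact n * cauchy_weight \<theta> (Suc n) n v / pochhammer \<theta> n"
  by (rule feller_law[OF \<theta>]) simp
 also have "\<dots> = (\<Sum>\<sigma>\<in>{\<sigma>. \<sigma> permutes {1..n} \<and> cycle_count n \<sigma> = v}. esf_weight \<theta> n \<sigma>)"
  unfolding esf_weight_def sum_divide_distrib[symmetric] by (subst cycle_type_weight[OF \<theta>, of n "Suc n"]) auto
 finally show "measure ?S {\<omega>. ?C \<omega> = v} = (\<Sum>\<sigma>\<in>{\<sigma>. \<sigma> permutes {1..n} \<and> cycle_count n \<sigma> = v}. esf_weight \<theta> n \<sigma>)" .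
next
 let ?z = "1 - 1 / real n"
 let ?S = "feller_pair \<theta> ?z n"
 have z: "0 <= ?z" "?z < 1" using n by auto
 fix w
 have "map_pmf (\<lambda>\<omega>. map (\<lambda>k. (case \<omega> of (m, h) => blocks (drop n h)) (Suc k)) [0..<n]) ?S
  = map_pmf (\<lambda>v. map (\<lambda>k. v (Suc k)) [0..<n]) (map_pmf (\<lambda>(m, h). blocks (drop n h)) ?S)"
  by (simp only: pmf.map_comp o_def)
 then show "pmf (map_pmf (\<lambda>\<omega>. map (\<lambda>k. (case \<omega> of (m, h) => blocks (drop n h)) (Suc k)) [0..<n]) ?S) w = pois_law (\<lambda>k. \<theta> * ?z ^ Suc k / real (Suc k)) n w"
  unfolding feller_pair_N[OF \<theta> z] by (simp only: shepp_lloyd[OF \<theta> z])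
next
 have "(\<Sum>k<n. \<bar>real ((case \<omega> of (m, h) => blocks (drop m h)) (Suc k)) - real (map (\<lambda>k. (case \<omega> of (m, h) => blocks (drop n h)) (Suc k)) [0..<n] ! k)\<bar>)
  = (case \<omega> of (m, h) => \<Sum>k\<in>Suc ` {..<n}. \<bar>real (blocks (drop m h) k) - real (blocks (drop n h) k)\<bar>)" for \<omega> :: "nat \<times> bool list"
  by (simp add: sum.reindex case_prod_unfold)
 then show "(\<integral>\<^sup>+\<omega>. ennreal (\<Sum>k<n. \<bar>real ((case \<omega> of (m, h) => blocks (drop m h)) (Suc k)) - real (map (\<lambda>k. (case \<omega> of (m, h) => blocks (drop n h)) (Suc k)) [0..<n] ! k)\<bar>) \<partial>feller_pair \<theta> (1 - 1 / real n) n) <= ennreal (2 + exp \<theta> + \<theta>\<^sup>2)"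
  using feller_pair_close[OF \<theta> n, of "Suc ` {..<n}"] by (simp add: case_prod_unfold)
next
 fix \<omega> k assume "\<omega> \<in> set_pmf (feller_pair \<theta> (1 - 1 / real n) n)"
 then obtain m h where h: "\<omega> = (m, h)" "h \<in> set_pmf (feller \<theta> (n + m))" by (auto simp: feller_pair_def)
 then show "(case \<omega> of (m, h) => blocks (drop m h)) k <= n"
  using blocks_le[of "drop m h" k] length_feller[OF \<theta> h(2)] by simp
qed simp

section \<open>The involution factors\<close>

definition invol_factor :: "nat => nat => real" where
 "invol_factor k c = (\<Sum>j=0..c div 2. falling c (2 * j) / ((2 * real k) ^ j * fact j))"

lemma falling_nonneg: "r <= c ==> 0 <= falling c r"
 unfolding falling_def by (rule prod_nonneg) auto

lemma falling_beyond: "c < r ==> falling c r = 0"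
 unfolding falling_def by (rule prod_zero) auto

lemma falling_Suc: "falling c (Suc r) = falling c r * (real c - real r)"
 by (simp add: falling_def)

lemma falling_double_le: "2 * j <= c ==> falling c (2 * j) <= (real c * (real c - 1)) ^ j"
proof (induction j)
 case (Suc j)
 have "falling c (2 * Suc j) = falling c (2 * j) * ((real c - real (2 * j)) * (real c - 1 - real (2 * j)))"
  by (simp add: falling_Suc)
 also have "\<dots> <= (real c * (real c - 1)) ^ j * (real c * (real c - 1))"
  using Suc by (intro mult_mono Suc.IH mult_nonneg_nonneg zero_le_power) auto
 finally show ?case by (simp add: mult.commute)
qed (simp add: falling_def)

lemma falling_shift: "falling (Suc c) (Suc r) = (real c + 1) * falling c r"
proof (induction r)
 case (Suc r)
 have "falling (Suc c) (Suc (Suc r)) = falling (Suc c) (Suc r) * (real (Suc c) - real (Suc r))"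
  by (rule falling_Suc)
 then show ?case unfolding Suc falling_Suc[of c r] by simp
qed (simp add: falling_def)

lemma invol_factor_ge_1: "1 <= invol_factor k c"
proof -
 have "falling c (2 * 0) / ((2 * real k) ^ 0 * fact 0) <= invol_factor k c"
  unfolding invol_factor_def by (rule member_le_sum) (auto intro!: divide_nonneg_nonneg falling_nonneg)
 then show ?thesis by (simp add: falling_def)
qed

lemma exp_partial_sum:
 fixes x :: real
 assumes "0 <= x" shows "(\<Sum>j=0..m. x ^ j / fact j) <= exp x"
proof -
 have e: "x ^ j / fact j = x ^ j /\<^sub>R fact j" for j by (simp add: divide_inverse_commute)
 show ?thesis unfolding e exp_def
  by (rule sum_le_suminf[OF summable_exp_generic]) (use assms in simp_all)
qed

lemma invol_factor_le_exp:
 assumes "1 <= k"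
 shows "invol_factor k c <= exp (real c * (real c - 1) / (2 * real k))"
proof -
 let ?x = "real c * (real c - 1) / (2 * real k)"
 have cc: "0 <= real c * (real c - 1)" by (cases c) auto
 then have x: "0 <= ?x" by simp
 have "invol_factor k c <= (\<Sum>j=0..c div 2. ?x ^ j / fact j)"
  unfolding invol_factor_def
 proof (rule sum_mono)
  fix j assume j: "j \<in> {0..c div 2}"
  have "falling c (2 * j) / ((2 * real k) ^ j * fact j) <= (real c * (real c - 1)) ^ j / ((2 * real k) ^ j * fact j)"
   using j assms by (intro divide_right_mono falling_double_le) auto
  then show "falling c (2 * j) / ((2 * real k) ^ j * fact j) <= ?x ^ j / fact j"
   by (simp add: power_divide)
 qed
 also have "\<dots> <= exp ?x" by (rule exp_partial_sum[OF x])
 finally show ?thesis .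
qed

text \<open>One more cycle of length k raises the logarithm of the factor by at most ln (c + 2),
  hence by ln (n + 1) while the counts stay at most n. This Lipschitz property makes the L1 coupling
  of the counts sufficient.\<close>

lemma invol_factor_Suc:
 assumes k: "1 <= k"
 shows "invol_factor k (Suc c) <= (real c + 2) * invol_factor k c"
proof -
 let ?t = "\<lambda>c j. falling c (2 * j) / ((2 * real k) ^ j * fact j)"
 have t0: "0 <= ?t c j" for j using falling_nonneg[of "2 * j" c] falling_beyond[of c "2 * j"] by (cases "2 * j <= c") auto
 have le: "?t (Suc c) j <= (real c + 1) * ?t c j" if "2 * j <= c" for j
 proof -
  have "falling (Suc c) (2 * j) <= (real c + 1) * falling c (2 * j)"
  proof (cases j)
   case 0
   then show ?thesis by (simp add: falling_def)
  next
   case (Suc i)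
   have "falling (Suc c) (2 * j) = (real c + 1) * falling c (2 * i + 1)"
    using falling_shift[of c "2 * i + 1"] Suc by simp
   also have "\<dots> <= (real c + 1) * (falling c (2 * i + 1) * (real c - real (2 * i + 1)))"
    using that Suc falling_nonneg[of "2 * i + 1" c] by (intro mult_left_mono) (auto simp: mult_le_cancel_left1 le_diff_eq)
   also have "\<dots> = (real c + 1) * falling c (2 * j)"
    using falling_Suc[of c "2 * i + 1"] Suc by simp
   finally show ?thesis .
  qed
  then have "?t (Suc c) j <= (real c + 1) * falling c (2 * j) / ((2 * real k) ^ j * fact j)"
   by (rule divide_right_mono) simp
  then show ?thesis by simp
 qed
 have s: "(\<Sum>j=0..c div 2. ?t (Suc c) j) <= (real c + 1) * invol_factor k c"
  unfolding invol_factor_def sum_distrib_left by (rule sum_mono) (rule le, auto)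
 show ?thesis
 proof (cases "even c")
  case True
  then have "invol_factor k (Suc c) = (\<Sum>j=0..c div 2. ?t (Suc c) j)" by (simp add: invol_factor_def)
  then show ?thesis using s invol_factor_ge_1[of k c] by (simp add: distrib_right)
 next
  case False
  \<comment> \<open>For odd c the sum for c + 1 has one additional top term; it equals the i-th term
    for c divided by k, and so is covered by one more copy of the factor.\<close>
  then obtain i where i: "c = Suc (2 * i)" by (auto elim: oddE)
  have "invol_factor k (Suc c) = (\<Sum>j=0..c div 2. ?t (Suc c) j) + ?t (Suc c) (Suc i)"
   by (simp add: invol_factor_def i)
  also have "?t (Suc c) (Suc i) <= ?t c i"
  proof -
   have f: "falling (Suc c) (2 * Suc i) = (real c + 1) * falling c (2 * i)"
    using falling_shift[of c "Suc (2 * i)"] falling_Suc[of c "2 * i"] by (simp add: i)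
   have "?t (Suc c) (Suc i) = ?t c i / real k"
    unfolding f using k by (simp add: i divide_simps)
   also have "\<dots> <= ?t c i / 1" using k t0[of i] by (intro divide_left_mono) auto
   finally show ?thesis by simp
  qed
  also have "?t c i <= invol_factor k c"
   unfolding invol_factor_def
  proof (rule member_le_sum)
   show "i \<in> {0..c div 2}" by (simp add: i)
   show "0 <= ?t c j" for j by (rule t0)
  qed simp
  finally show ?thesis using s by (simp add: distrib_right)
 qed
qed

lemma ln_invol_factor_add:
 assumes k: "1 <= k" and n: "c + d <= n"
 shows "ln (invol_factor k (c + d)) <= ln (invol_factor k c) + real d * ln (real n + 1)"
 using n
proof (induction d)
 case (Suc d)
 have "invol_factor k (c + Suc d) <= (real (c + d) + 2) * invol_factor k (c + d)"
  using invol_factor_Suc[OF k, of "c + d"] by simp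
 also have "\<dots> <= (real n + 1) * invol_factor k (c + d)"
  using Suc.prems invol_factor_ge_1[of k "c + d"] by (intro mult_right_mono) auto
 finally have "ln (invol_factor k (c + Suc d)) <= ln ((real n + 1) * invol_factor k (c + d))"
  using invol_factor_ge_1[of k "c + Suc d"] by (subst ln_le_cancel_iff) linarith+
 also have "\<dots> = ln (real n + 1) + ln (invol_factor k (c + d))"
  using invol_factor_ge_1[of k "c + d"] by (subst ln_mult) auto
 also have "\<dots> <= ln (real n + 1) + (ln (invol_factor k c) + real d * ln (real n + 1))"
  using Suc by simp
 finally show ?case by (simp add: distrib_right)
qed simp

lemma ln_invol:
 "ln (invol m c) = (\<Sum>k=1..m. real (c k) * ln (real k) + ln (invol_factor k (c k)))"
proof -
 have pos: "0 < invol_factor k (c k)" for k using invol_factor_ge_1[of k "c k"] by linarith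
 have "invol m c = (\<Prod>k=1..m. real k ^ c k * invol_factor k (c k))"
  by (simp add: invol_def B_m_def invol_factor_def prod.distrib)
 then have "ln (invol m c) = (\<Sum>k=1..m. ln (real k ^ c k * invol_factor k (c k)))"
 proof (simp only:, intro ln_prod)
  fix k assume "k \<in> {1..m}"
  then show "real k ^ c k * invol_factor k (c k) ~= 0" using pos[of k] by auto
 qed simp
 also have "\<dots> = (\<Sum>k=1..m. real (c k) * ln (real k) + ln (invol_factor k (c k)))"
 proof (rule sum.cong)
  fix k assume k: "k \<in> {1..m}"
  have "ln (real k ^ c k * invol_factor k (c k)) = ln (real k ^ c k) + ln (invol_factor k (c k))"
   by (rule ln_mult_pos) (use k pos[of k] in auto)
  then show "ln (real k ^ c k * invol_factor k (c k)) = real (c k) * ln (real k) + ln (invol_factor k (c k))"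
   using k by (simp add: ln_realpow)
 qed simp
 finally show ?thesis .
qed

text \<open>The linear term and the involution factor each lose at most ln (n + 1) per unit of
  difference between the counts, hence the 2. If C is the smaller count, the exponential bound for C
  is dominated by the one for Z; otherwise the factor is increased step by step from Z to C. Squares
  of the Feller counts therefore never have to be controlled.\<close>

lemma ln_invol_close:
 assumes m: "m <= n" and C: "\<And>k. C k <= n"
 shows "\<bar>ln (invol m C) - (\<Sum>k<m. ln (real (Suc k)) * real (Z k))\<bar>
  <= 2 * ln (real n + 1) * (\<Sum>k<n. \<bar>real (C (Suc k)) - real (Z k)\<bar>) + (\<Sum>k<n. real (Z k) * (real (Z k) - 1) / real (Suc k))"
proof -
 let ?b = "\<lambda>k. 2 * ln (real n + 1) * \<bar>real (C (Suc k)) - real (Z k)\<bar> + real (Z k) * (real (Z k) - 1) / real (Suc k)"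
 have zz: "0 <= real (Z k) * (real (Z k) - 1)" for k by (cases "Z k") auto
 have b0: "0 <= ?b k" for k
 proof (rule add_nonneg_nonneg)
  show "0 <= real (Z k) * (real (Z k) - 1) / real (Suc k)" by (rule divide_nonneg_nonneg[OF zz]) simp
 qed (intro mult_nonneg_nonneg, auto)
 have "ln (invol m C) - (\<Sum>k<m. ln (real (Suc k)) * real (Z k))
  = (\<Sum>k<m. (real (C (Suc k)) * ln (real (Suc k)) + ln (invol_factor (Suc k) (C (Suc k)))) - ln (real (Suc k)) * real (Z k))"
  unfolding ln_invol sum_subtractf by (simp add: sum.atLeast1_atMost_eq)
 also have "\<bar>\<dots>\<bar> <= (\<Sum>k<m. ?b k)"
 proof (rule order_trans[OF sum_abs sum_mono])
  fix k assume "k \<in> {..<m}"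
  then have kn: "Suc k <= n" using m by auto
  define c where "c = C (Suc k)"
  define y where "y = Z k"
  define l where "l = ln (real n + 1)"
  define d where "d = \<bar>real c - real y\<bar>"
  have lk: "0 <= ln (real (Suc k))" "ln (real (Suc k)) <= l" using kn by (auto simp: l_def)
  have l0: "0 <= l" by (simp add: l_def)
  have d0: "0 <= d" by (simp add: d_def)
  have g0: "0 <= ln (invol_factor (Suc k) c)" using invol_factor_ge_1[of "Suc k" c] by simp
  have ge: "ln (invol_factor (Suc k) j) <= real j * (real j - 1) / real (Suc k)" for j
  proof -
   have jj: "0 <= real j * (real j - 1)" by (cases j) auto
   have "invol_factor (Suc k) j <= exp (real j * (real j - 1) / (2 * real (Suc k)))"
    by (rule invol_factor_le_exp) simp
   then have "ln (invol_factor (Suc k) j) <= ln (exp (real j * (real j - 1) / (2 * real (Suc k))))"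
    by (rule ln_mono) (rule less_le_trans[OF zero_less_one invol_factor_ge_1])
   then have "ln (invol_factor (Suc k) j) <= real j * (real j - 1) / (2 * real (Suc k))"
    unfolding ln_exp .
   also have "\<dots> <= real j * (real j - 1) / real (Suc k)"
    using jj by (intro divide_left_mono) auto
   finally show ?thesis .
  qed
  have g1: "ln (invol_factor (Suc k) c) <= l * d + real y * (real y - 1) / real (Suc k)"
  proof (cases "c <= y")
   case True
   have "real c * (real c - 1) <= real y * (real y - 1)"
    using True by (cases c; cases y) (auto intro!: mult_mono)
   then have "real c * (real c - 1) / real (Suc k) <= real y * (real y - 1) / real (Suc k)"
    by (rule divide_right_mono) simp
   then show ?thesis using ge[of c] mult_nonneg_nonneg[OF l0 d0] by linarith
  next
   case False
   have "ln (invol_factor (Suc k) (y + (c - y))) <= ln (invol_factor (Suc k) y) + real (c - y) * ln (real n + 1)"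
    by (rule ln_invol_factor_add) (use C[of "Suc k"] False in \<open>auto simp: c_def\<close>)
   then show ?thesis using ge[of y] False by (simp add: l_def d_def of_nat_diff mult.commute)
  qed
  have "\<bar>real c * ln (real (Suc k)) - ln (real (Suc k)) * real y\<bar> = ln (real (Suc k)) * d"
  proof -
   have "real c * ln (real (Suc k)) - ln (real (Suc k)) * real y = ln (real (Suc k)) * (real c - real y)"
    by (simp add: algebra_simps)
   then show ?thesis using lk(1) by (simp only: abs_mult d_def abs_of_nonneg)
  qed
  also have "\<dots> <= l * d" using lk d0 by (intro mult_right_mono)
  finally have "\<bar>real c * ln (real (Suc k)) - ln (real (Suc k)) * real y\<bar> <= l * d" .
  then have "\<bar>(real c * ln (real (Suc k)) + ln (invol_factor (Suc k) c)) - ln (real (Suc k)) * real y\<bar> <= l * d + (l * d + real y * (real y - 1) / real (Suc k))"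
   using g0 g1 by linarith
  then show "\<bar>(real (C (Suc k)) * ln (real (Suc k)) + ln (invol_factor (Suc k) (C (Suc k)))) - ln (real (Suc k)) * real (Z k)\<bar> <= ?b k"
   unfolding c_def[symmetric] y_def[symmetric] l_def[symmetric] d_def[symmetric] by (simp only: mult_2 distrib_right add.assoc)
 qed
 also have "\<dots> <= (\<Sum>k<n. ?b k)" using m b0 by (intro sum_mono2) auto
 also have "\<dots> = 2 * ln (real n + 1) * (\<Sum>k<n. \<bar>real (C (Suc k)) - real (Z k)\<bar>) + (\<Sum>k<n. real (Z k) * (real (Z k) - 1) / real (Suc k))"
  by (simp only: sum.distrib sum_distrib_left)
 finally show ?thesis .
qed

lemma nn_integral_pois_list:
 fixes p :: "'a pmf" and Y :: "'a => nat list" and g :: "nat => nat => ennreal"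
 assumes Y: "\<And>w. pmf (map_pmf Y p) w = pois_law \<mu> n w" and \<mu>: "\<And>k. k < n ==> 0 <= \<mu> k"
 shows "(\<integral>\<^sup>+\<omega>. (\<Sum>k<n. g k (Y \<omega> ! k)) \<partial>p) = (\<Sum>k<n. \<integral>\<^sup>+c. g k c \<partial>pois (\<mu> k))"
proof -
 let ?P = "Pi_pmf {..<n} 0 (\<lambda>k. pois (\<mu> k))"
 have eq: "map_pmf Y p = map_pmf (\<lambda>f. map f [0..<n]) ?P"
  by (rule pmf_eqI) (simp only: Y pmf_map_Pi_pois[OF \<mu>])
 have "(\<integral>\<^sup>+\<omega>. (\<Sum>k<n. g k (Y \<omega> ! k)) \<partial>p) = (\<integral>\<^sup>+w. (\<Sum>k<n. g k (w ! k)) \<partial>map_pmf Y p)"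
  by (simp only: nn_integral_map_pmf)
 also have "\<dots> = (\<integral>\<^sup>+f. (\<Sum>k<n. g k (f k)) \<partial>?P)"
  unfolding eq nn_integral_map_pmf by (intro nn_integral_cong sum.cong) auto
 also have "\<dots> = (\<Sum>k<n. \<integral>\<^sup>+f. g k (f k) \<partial>?P)" by (rule nn_integral_sum) simp
 also have "\<dots> = (\<Sum>k<n. \<integral>\<^sup>+c. g k c \<partial>map_pmf (\<lambda>f. f k) ?P)" by (simp only: nn_integral_map_pmf)
 also have "\<dots> = (\<Sum>k<n. \<integral>\<^sup>+c. g k c \<partial>pois (\<mu> k))"
  by (rule sum.cong) (simp_all add: Pi_pmf_component)
 finally show ?thesis .
qed

text \<open>The remainder of the summation by parts is bounded by the increments of the monotone
  weights, which together with a 0 add up to a K; the boundary term costs another a K * D.\<close>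

lemma abel_bound:
 fixes a e :: "nat => real"
 assumes a: "mono a" "0 <= a 0" and D: "\<And>k. k <= K ==> \<bar>\<Sum>j<k. e j\<bar> <= D"
 shows "\<bar>\<Sum>j<K. a j * e j\<bar> <= 2 * a K * D"
proof -
 have D0: "0 <= D" using D[of 0] by simp
 have a0: "0 <= a j" for j using a monoD[OF a(1), of 0 j] by simp
 have "\<bar>(\<Sum>j<k. a j * e j) - a k * (\<Sum>j<k. e j)\<bar> <= a k * D" if "k <= K" for k
  using that
 proof (induction k)
  case 0
  then show ?case using a D0 by simp
 next
  case (Suc k)
  let ?E = "\<Sum>j<Suc k. e j"
  have "(\<Sum>j<Suc k. a j * e j) - a (Suc k) * ?E = ((\<Sum>j<k. a j * e j) - a k * (\<Sum>j<k. e j)) - (a (Suc k) - a k) * ?E"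
   by (simp add: algebra_simps)
  moreover have "\<bar>(a (Suc k) - a k) * ?E\<bar> <= (a (Suc k) - a k) * D"
   using D[OF Suc.prems] monoD[OF a(1), of k "Suc k"] unfolding abs_mult by (intro mult_mono) auto
  moreover have "(a (Suc k) - a k) * D = a (Suc k) * D - a k * D" by (simp add: left_diff_distrib)
  ultimately show ?case using Suc by linarith
 qed
 from this[of K] have "\<bar>(\<Sum>j<K. a j * e j) - a K * (\<Sum>j<K. e j)\<bar> <= a K * D" by simp
 moreover have "\<bar>a K * (\<Sum>j<K. e j)\<bar> <= a K * D" using D[of K] a0[of K] by (simp add: abs_mult mult_left_mono)
 ultimately show ?thesis by linarith
qed

section \<open>The coupling\<close>

text \<open>Bundles measurability, nonnegativity and the mean bound, so that the final error
  estimate can be assembled by sums, scalings and pullbacks alone. The condition 0 <= a prevents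
  \<open>ennreal\<close> from truncating a negative bound.\<close>

definition mean_le :: "'a measure => ('a => real) => real => bool" where
 "mean_le M f a \<longleftrightarrow> f \<in> borel_measurable M \<and> (\<forall>\<omega>. 0 <= f \<omega>) \<and> 0 <= a \<and> (\<integral>\<^sup>+\<omega>. ennreal (f \<omega>) \<partial>M) <= ennreal a"

lemma mean_le_add:
 assumes "mean_le M f a" "mean_le M g b"
 shows "mean_le M (\<lambda>\<omega>. f \<omega> + g \<omega>) (a + b)"
proof -
 have m[measurable]: "f \<in> borel_measurable M" "g \<in> borel_measurable M" and nn: "\<And>\<omega>. 0 <= f \<omega>" "\<And>\<omega>. 0 <= g \<omega>" "0 <= a" "0 <= b"
  and i: "(\<integral>\<^sup>+\<omega>. ennreal (f \<omega>) \<partial>M) <= ennreal a" "(\<integral>\<^sup>+\<omega>. ennreal (g \<omega>) \<partial>M) <= ennreal b"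
  using assms by (auto simp: mean_le_def)
 have "(\<integral>\<^sup>+\<omega>. ennreal (f \<omega> + g \<omega>) \<partial>M) = (\<integral>\<^sup>+\<omega>. ennreal (f \<omega>) + ennreal (g \<omega>) \<partial>M)"
  by (rule nn_integral_cong) (rule ennreal_plus[OF nn(1,2)])
 also have "\<dots> = (\<integral>\<^sup>+\<omega>. ennreal (f \<omega>) \<partial>M) + (\<integral>\<^sup>+\<omega>. ennreal (g \<omega>) \<partial>M)"
  by (rule nn_integral_add) auto
 also have "\<dots> <= ennreal a + ennreal b" by (rule add_mono[OF i])
 also have "\<dots> = ennreal (a + b)" by (rule ennreal_plus[OF nn(3,4), symmetric])
 finally show ?thesis unfolding mean_le_def using nn by auto
qed

lemma mean_le_cmult:
 assumes "mean_le M f a" "0 <= c"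
 shows "mean_le M (\<lambda>\<omega>. c * f \<omega>) (c * a)"
proof -
 have m[measurable]: "f \<in> borel_measurable M" and nn: "\<And>\<omega>. 0 <= f \<omega>" "0 <= a"
  and i: "(\<integral>\<^sup>+\<omega>. ennreal (f \<omega>) \<partial>M) <= ennreal a"
  using assms by (auto simp: mean_le_def)
 have "(\<integral>\<^sup>+\<omega>. ennreal (c * f \<omega>) \<partial>M) = (\<integral>\<^sup>+\<omega>. ennreal c * ennreal (f \<omega>) \<partial>M)"
  by (rule nn_integral_cong) (rule ennreal_mult[OF assms(2) nn(1)])
 also have "\<dots> = ennreal c * (\<integral>\<^sup>+\<omega>. ennreal (f \<omega>) \<partial>M)"
  by (rule nn_integral_cmult) auto
 also have "\<dots> <= ennreal c * ennreal a" by (rule mult_left_mono[OF i]) simp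
 also have "\<dots> = ennreal (c * a)" by (rule ennreal_mult[OF assms(2) nn(2), symmetric])
 finally show ?thesis unfolding mean_le_def using nn assms(2) by auto
qed

lemma mean_le_const: "prob_space M ==> 0 <= c ==> mean_le M (\<lambda>_. c) c"
 by (simp add: mean_le_def prob_space.emeasure_space_1)

lemma mean_le_mpres:
 assumes "mean_le M f a" "mpres M' M h"
 shows "mean_le M' (\<lambda>\<omega>. f (h \<omega>)) a"
proof -
 have m[measurable]: "f \<in> borel_measurable M" using assms by (auto simp: mean_le_def)
 have h: "h \<in> measurable M' M" "distr M' M h = M" using assms(2) by (auto simp: mpres_def)
 have "(\<integral>\<^sup>+\<omega>. ennreal (f (h \<omega>)) \<partial>M') = (\<integral>\<^sup>+\<omega>. ennreal (f \<omega>) \<partial>distr M' M h)"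
  by (rule nn_integral_distr[symmetric]) (use h in auto)
 then show ?thesis using assms(1) measurable_compose[OF h(1) m] unfolding mean_le_def h by auto
qed

text \<open>Cells are numbered from 0: cell \<open>k\<close> holds the cycles of length \<open>k + 1\<close>.\<close>
definition cell_mean :: "real => nat => nat => real" where
 "cell_mean \<theta> n k = \<theta> * (1 - 1 / real n) ^ Suc k / real (Suc k)"

definition cum_mean :: "real => nat => nat => real" where
 "cum_mean \<theta> n k = (\<Sum>i<k. cell_mean \<theta> n i)"

text \<open>Chosen so that the weighted sum of normalised increments of \<open>W\<close> over the grid \<open>grid_time\<close> telescopes exactly; up to a bounded error it is the logarithm of the cycle lengths counted in block \<open>j\<close>.\<close>
definition block_log :: "real => nat => real" where
 "block_log \<theta> j = sqrt (real j * real j + real j + 1 / 3) / \<theta>"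

text \<open>The share of the variance used by the first j blocks: the squares of
  \<open>block_log\<close> sum to exactly j^3 / (3 theta^2), and division by theta l^3 / 3, the
  square of the normalisation, gives this cube.\<close>

definition grid_time :: "real => real => nat => real" where
 "grid_time \<theta> l j = (real j / (\<theta> * l)) ^ 3"

lemma sum_inverse_Suc: "(\<Sum>i<k. 1 / real (Suc i)) = harm k"
 unfolding harm_def by (simp add: sum.atLeast1_atMost_eq divide_inverse)

context
 fixes \<theta> :: real
 assumes \<theta>: "\<theta> > 0"
begin

lemma block_log_bounds: "real j / \<theta> <= block_log \<theta> j" "block_log \<theta> j <= (real j + 1) / \<theta>" "0 < block_log \<theta> j"
proof -
 have p: "0 <= real j * real j" by simp
 have "sqrt (real j * real j) <= sqrt (real j * real j + real j + 1 / 3)" by (rule real_sqrt_le_mono) simp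
 then show "real j / \<theta> <= block_log \<theta> j" unfolding block_log_def using \<theta> by (intro divide_right_mono) simp_all
 have "(real j + 1) * (real j + 1) = real j * real j + 2 * real j + 1" by (simp add: algebra_simps)
 then have "sqrt (real j * real j + real j + 1 / 3) <= sqrt ((real j + 1) * (real j + 1))" by (intro real_sqrt_le_mono) simp
 then show "block_log \<theta> j <= (real j + 1) / \<theta>" unfolding block_log_def using \<theta> by (intro divide_right_mono) simp_all
 have "0 < real j * real j + real j + 1 / 3" using p by linarith
 then show "0 < block_log \<theta> j" unfolding block_log_def using \<theta> by simp
qed

lemma block_log_mono: "mono (block_log \<theta>)"
proof (rule monoI)
 fix i j :: nat assume "i <= j"
 then have "real i * real i <= real j * real j" "real i <= real j" by (auto intro!: mult_mono)
 then show "block_log \<theta> i <= block_log \<theta> j"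
  unfolding block_log_def using \<theta> by (intro divide_right_mono real_sqrt_le_mono) auto
qed

lemma grid_time_strict_mono: "0 < l ==> strict_mono (grid_time \<theta> l)"
 unfolding grid_time_def using \<theta> by (intro strict_monoI power_strict_mono divide_strict_right_mono) auto

lemma grid_time_0: "grid_time \<theta> l 0 = 0"
 by (simp add: grid_time_def)

lemma brownian_sum:
 assumes l: "0 < l"
 shows "(\<Sum>j<K. block_log \<theta> j * incr (grid_time \<theta> l) w j) = sqrt (\<theta> / 3 * l ^ 3) * (w (grid_time \<theta> l K) - w 0)"
proof -
 let ?s = "sqrt (\<theta> / 3 * l ^ 3)"
 have s: "0 < ?s" "?s\<^sup>2 = \<theta> / 3 * l ^ 3" using \<theta> l by auto
 have "block_log \<theta> j * incr (grid_time \<theta> l) w j = ?s * (w (grid_time \<theta> l (Suc j)) - w (grid_time \<theta> l j))" for j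
 proof -
  have b: "(block_log \<theta> j)\<^sup>2 = (real j * real j + real j + 1 / 3) / \<theta>\<^sup>2"
   by (simp add: block_log_def power_divide)
  have "sqrt (grid_time \<theta> l (Suc j) - grid_time \<theta> l j) = block_log \<theta> j / ?s"
  proof (rule real_sqrt_unique)
   have "(block_log \<theta> j / ?s)\<^sup>2 = ((real j * real j + real j + 1 / 3) / \<theta>\<^sup>2) / (\<theta> / 3 * l ^ 3)"
    unfolding power_divide b s(2) ..
   also have "\<dots> = (3 * (real j * real j) + 3 * real j + 1) / (\<theta> * l) ^ 3"
    using \<theta> l by (simp add: field_simps power2_eq_square power3_eq_cube)
   also have "3 * (real j * real j) + 3 * real j + 1 = real (Suc j) ^ 3 - real j ^ 3"
    by (simp add: power3_eq_cube algebra_simps)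
   finally show "(block_log \<theta> j / ?s)\<^sup>2 = grid_time \<theta> l (Suc j) - grid_time \<theta> l j"
    by (simp only: grid_time_def power_divide diff_divide_distrib)
   show "0 <= block_log \<theta> j / ?s" using block_log_bounds(3)[of j] s by simp
  qed
  then show ?thesis unfolding incr_def using block_log_bounds(3)[of j] s(1) by simp
 qed
 then have "(\<Sum>j<K. block_log \<theta> j * incr (grid_time \<theta> l) w j) = ?s * (\<Sum>j<K. w (grid_time \<theta> l (Suc j)) - w (grid_time \<theta> l j))"
  by (simp only: sum_distrib_left)
 then show ?thesis using sum_lessThan_telescope[of "\<lambda>j. w (grid_time \<theta> l j)" K] by (simp only: grid_time_0)
qed

lemma sum_block_log: "\<bar>(\<Sum>j<K. block_log \<theta> j) - (real K)\<^sup>2 / (2 * \<theta>)\<bar> <= real K / (2 * \<theta>)"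
proof -
 have s: "(\<Sum>j<K. real j) = ((real K)\<^sup>2 - real K) / 2"
  by (induction K) (simp_all add: power2_eq_square field_simps)
 have "(\<Sum>j<K. real j / \<theta>) <= (\<Sum>j<K. block_log \<theta> j)" by (rule sum_mono) (rule block_log_bounds)
 then have 1: "((real K)\<^sup>2 - real K) / 2 / \<theta> <= (\<Sum>j<K. block_log \<theta> j)" by (simp only: sum_divide_distrib[symmetric] s)
 have "(\<Sum>j<K. block_log \<theta> j) <= (\<Sum>j<K. (real j + 1) / \<theta>)" by (rule sum_mono) (rule block_log_bounds)
 also have "\<dots> = (((real K)\<^sup>2 - real K) / 2 + real K) / \<theta>" by (simp only: sum_divide_distrib[symmetric] sum.distrib s) simp
 finally have 2: "(\<Sum>j<K. block_log \<theta> j) <= (((real K)\<^sup>2 - real K) / 2 + real K) / \<theta>" .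
 have "((real K)\<^sup>2 - real K) / 2 / \<theta> = (real K)\<^sup>2 / (2 * \<theta>) - real K / (2 * \<theta>)"
  "(((real K)\<^sup>2 - real K) / 2 + real K) / \<theta> = (real K)\<^sup>2 / (2 * \<theta>) + real K / (2 * \<theta>)"
  using \<theta> by (simp_all add: field_simps)
 then show ?thesis using 1 2 by linarith
qed

context
 fixes n :: nat
 assumes n: "1 <= n"
begin

lemma cell_mean_bounds: "0 <= cell_mean \<theta> n k" "cell_mean \<theta> n k <= \<theta> * (1 / real (Suc k))" "\<theta> * (1 / real (Suc k)) - \<theta> / real n <= cell_mean \<theta> n k"
proof -
 let ?z = "1 - 1 / real n"
 have z: "0 <= ?z" "?z <= 1" using n by auto
 show "0 <= cell_mean \<theta> n k" unfolding cell_mean_def using z \<theta> by (intro divide_nonneg_nonneg mult_nonneg_nonneg zero_le_power) auto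
 have "?z ^ Suc k <= 1" using z by (rule power_le_one)
 then have "\<theta> * ?z ^ Suc k / real (Suc k) <= \<theta> * 1 / real (Suc k)" using \<theta> by (intro divide_right_mono mult_left_mono) auto
 then show "cell_mean \<theta> n k <= \<theta> * (1 / real (Suc k))" unfolding cell_mean_def by simp
 have "1 + real (Suc k) * (- (1 / real n)) <= (1 + - (1 / real n)) ^ Suc k"
  by (rule Bernoulli_inequality) (use n in auto)
 then have "\<theta> * (1 + real (Suc k) * (- (1 / real n))) / real (Suc k) <= \<theta> * ?z ^ Suc k / real (Suc k)"
  using \<theta> by (intro divide_right_mono mult_left_mono) auto
 moreover have "\<theta> * (1 + real (Suc k) * (- (1 / real n))) / real (Suc k) = \<theta> * (1 / real (Suc k)) - \<theta> / real n"
  using n by (simp add: field_simps del: of_nat_Suc)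
 ultimately show "\<theta> * (1 / real (Suc k)) - \<theta> / real n <= cell_mean \<theta> n k" unfolding cell_mean_def by linarith
qed

lemma cum_mean_mono: "mono (cum_mean \<theta> n)"
 by (rule mono_iff_le_Suc[THEN iffD2]) (simp add: cum_mean_def cell_mean_bounds)

text \<open>By Bernoulli's inequality the powers of 1 - 1 / n lower each cell mean by at most theta
  / n, in total by at most theta; what remains is theta times a harmonic number.\<close>

lemma cum_mean_bounds:
 assumes k: "1 <= k" "k <= n"
 shows "\<bar>cum_mean \<theta> n k - \<theta> * ln (real k)\<bar> <= \<theta>"
proof -
 have "cum_mean \<theta> n k <= (\<Sum>i<k. \<theta> * (1 / real (Suc i)))"
  unfolding cum_mean_def by (rule sum_mono) (rule cell_mean_bounds)
 also have "\<dots> = \<theta> * harm k" by (simp only: sum_distrib_left[symmetric] sum_inverse_Suc)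
 also have "\<dots> <= \<theta> * (1 + ln (real k))" using harm_le_ln[OF k(1)] \<theta> by (intro mult_left_mono) auto
 finally have 1: "cum_mean \<theta> n k <= \<theta> + \<theta> * ln (real k)" by (simp add: distrib_left)
 have "ln (real k) <= harm k" using euler_mascheroni_sequence_nonneg[of k] k by simp
 then have "\<theta> * ln (real k) <= \<theta> * harm k" using \<theta> by (intro mult_left_mono) auto
 moreover have "(\<Sum>i<k. \<theta> * (1 / real (Suc i)) - \<theta> / real n) <= cum_mean \<theta> n k"
  unfolding cum_mean_def by (rule sum_mono) (rule cell_mean_bounds)
 moreover have "(\<Sum>i<k. \<theta> * (1 / real (Suc i)) - \<theta> / real n) = \<theta> * harm k - real k * (\<theta> / real n)"
  by (simp only: sum_subtractf sum_distrib_left[symmetric] sum_inverse_Suc) simp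
 moreover have "real k * (\<theta> / real n) <= \<theta>"
 proof -
  have "real k * (\<theta> / real n) <= real n * (\<theta> / real n)" using k \<theta> by (intro mult_right_mono) auto
  then show ?thesis using n by simp
 qed
 ultimately show ?thesis using 1 by linarith
qed

lemma cum_mean_top: "cum_mean \<theta> n n <= \<theta> * (ln (real n) + 1)"
 using cum_mean_bounds[of n] n by (simp add: distrib_left)

text \<open>If row k meets block j, then j is within O(1) of theta * ln (k + 1), and
  \<open>block_log\<close> lies between j / theta and (j + 1) / theta.\<close>

lemma cell_vs_block:
 assumes k: "k < n" and j: "real j < cum_mean \<theta> n (Suc k)" "cum_mean \<theta> n k < real j + 1"
 shows "\<bar>ln (real (Suc k)) - block_log \<theta> j\<bar> <= 2 + 1 / \<theta>"
proof -
 have b: "\<bar>cum_mean \<theta> n (Suc k) - \<theta> * ln (real (Suc k))\<bar> <= \<theta>" by (rule cum_mean_bounds) (use k in auto)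
 have s: "cum_mean \<theta> n (Suc k) = cum_mean \<theta> n k + cell_mean \<theta> n k" by (simp add: cum_mean_def)
 have "\<theta> * (1 / real (Suc k)) <= \<theta> * 1" using \<theta> by (intro mult_left_mono) auto
 then have "cell_mean \<theta> n k <= \<theta>" using cell_mean_bounds(2)[of k] by linarith
 then have "real j <= \<theta> * ln (real (Suc k)) + \<theta>" "\<theta> * ln (real (Suc k)) - 2 * \<theta> <= real j + 1"
  using b s j by linarith+
 then have "real j / \<theta> <= (\<theta> * ln (real (Suc k)) + \<theta>) / \<theta>" "(\<theta> * ln (real (Suc k)) - 2 * \<theta>) / \<theta> <= (real j + 1) / \<theta>"
  using \<theta> by (intro divide_right_mono; simp)+
 moreover have "(\<theta> * ln (real (Suc k)) + \<theta>) / \<theta> = ln (real (Suc k)) + 1" "(\<theta> * ln (real (Suc k)) - 2 * \<theta>) / \<theta> = ln (real (Suc k)) - 2"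
  "(real j + 1) / \<theta> = real j / \<theta> + 1 / \<theta>"
  using \<theta> by (simp_all add: add_divide_distrib diff_divide_distrib)
 moreover have "0 <= 1 / \<theta>" using \<theta> by simp
 ultimately show ?thesis using block_log_bounds(1,2)[of j] by linarith
qed

context
 fixes t :: real
 assumes t: "0 <= t" "t <= 1" and ln_n: "2 <= ln (real n)"
begin

definition "prefix_len = nat \<lfloor>real n powr t\<rfloor>"
definition "prefix_blocks = nat \<lfloor>cum_mean \<theta> n prefix_len\<rfloor>"

lemma prefix_len: "1 <= prefix_len" "prefix_len <= n" "\<bar>ln (real prefix_len) - t * ln (real n)\<bar> <= 1"
proof -
 have n1: "1 <= real n" using n by simp
 have p: "1 <= real n powr t" using t n1 ge_one_powr_ge_zero by blast
 then show m: "1 <= prefix_len" unfolding prefix_len_def by (simp add: le_nat_iff)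
 have "real n powr t <= real n powr 1" using n1 t by (intro powr_mono) auto
 then have "real n powr t <= real n" using n1 by simp
 then show "prefix_len <= n" unfolding prefix_len_def by linarith
 have f: "real prefix_len <= real n powr t" "real n powr t < real prefix_len + 1" unfolding prefix_len_def using p by linarith+
 have rm: "1 <= real prefix_len" using m by simp
 have lp: "ln (real n powr t) = t * ln (real n)" using n1 by (simp add: ln_powr)
 have "ln (real prefix_len) <= ln (real n powr t)" using f m by (intro ln_mono) auto
 moreover have "ln (real n powr t) <= ln (2 * real prefix_len)" using f rm p by (intro ln_mono) linarith+
 moreover have "ln (2 * real prefix_len) = ln 2 + ln (real prefix_len)" using m by (intro ln_mult_pos) auto
 moreover have "ln (2::real) <= 1" using ln_2_less_1 by simp
 ultimately show "\<bar>ln (real prefix_len) - t * ln (real n)\<bar> <= 1" unfolding lp by linarith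
qed

lemma prefix_blocks:
 "real prefix_blocks <= \<theta> * (ln (real n) + 1)" "\<bar>real prefix_blocks - \<theta> * (t * ln (real n))\<bar> <= 2 * \<theta> + 1"
proof -
 let ?m = prefix_len
 have b: "\<bar>cum_mean \<theta> n ?m - \<theta> * ln (real ?m)\<bar> <= \<theta>" by (rule cum_mean_bounds[OF prefix_len(1,2)])
 have c0: "0 <= cum_mean \<theta> n ?m" unfolding cum_mean_def by (intro sum_nonneg cell_mean_bounds)
 have K: "real prefix_blocks <= cum_mean \<theta> n ?m" "cum_mean \<theta> n ?m < real prefix_blocks + 1"
  unfolding prefix_blocks_def using c0 by linarith+
 have "cum_mean \<theta> n ?m <= cum_mean \<theta> n n" by (rule monoD[OF cum_mean_mono prefix_len(2)])
 then show "real prefix_blocks <= \<theta> * (ln (real n) + 1)" using K cum_mean_top by linarith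
 have "\<bar>\<theta> * ln (real ?m) - \<theta> * (t * ln (real n))\<bar> = \<theta> * \<bar>ln (real ?m) - t * ln (real n)\<bar>"
  using \<theta> by (simp add: right_diff_distrib[symmetric] abs_mult)
 also have "\<dots> <= \<theta> * 1" using prefix_len(3) \<theta> by (intro mult_left_mono) auto
 finally show "\<bar>real prefix_blocks - \<theta> * (t * ln (real n))\<bar> <= 2 * \<theta> + 1" using b K by linarith
qed

text \<open>The centring: the block weights sum to K^2 / (2 theta) up to O(K), and K is within O(1)
  of theta * t * ln n, which reproduces the quadratic term of \<open>Wn\<close> up to O(ln
  n).\<close>

lemma prefix_mean: "\<bar>(\<Sum>j<prefix_blocks. block_log \<theta> j) - \<theta> * t\<^sup>2 / 2 * (ln (real n))\<^sup>2\<bar> <= (2 * \<theta> + 2) * (ln (real n) + 1)"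
proof -
 define K where "K = real prefix_blocks"
 define L where "L = ln (real n)"
 define s where "s = \<theta> * (t * L)"
 have K: "0 <= K" "K <= \<theta> * (L + 1)" "\<bar>K - s\<bar> <= 2 * \<theta> + 1" using prefix_blocks by (auto simp: K_def L_def s_def)
 have L: "2 <= L" using ln_n by (simp add: L_def)
 have s: "0 <= s" "s <= \<theta> * (L + 1)"
 proof -
  show "0 <= s" using \<theta> t L by (simp add: s_def)
  have "t * L <= 1 * L" using t L by (intro mult_right_mono) auto
  then show "s <= \<theta> * (L + 1)" unfolding s_def using \<theta> by (intro mult_left_mono) auto
 qed
 have e: "\<theta> * t\<^sup>2 / 2 * L\<^sup>2 = s\<^sup>2 / (2 * \<theta>)" using \<theta> by (simp add: s_def power2_eq_square)
 have "K\<^sup>2 - s\<^sup>2 = (K - s) * (K + s)" by (simp add: power2_eq_square algebra_simps)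
 then have "\<bar>K\<^sup>2 - s\<^sup>2\<bar> = \<bar>K - s\<bar> * (K + s)" using K s by (simp add: abs_mult)
 also have "\<dots> <= (2 * \<theta> + 1) * (\<theta> * (L + 1) + \<theta> * (L + 1))"
  using K s \<theta> by (intro mult_mono add_mono) auto
 finally have d: "\<bar>K\<^sup>2 - s\<^sup>2\<bar> / (2 * \<theta>) <= (2 * \<theta> + 1) * (\<theta> * (L + 1) + \<theta> * (L + 1)) / (2 * \<theta>)"
  using \<theta> by (intro divide_right_mono) auto
 have d': "(2 * \<theta> + 1) * (\<theta> * (L + 1) + \<theta> * (L + 1)) / (2 * \<theta>) = (2 * \<theta> + 1) * (L + 1)"
  using \<theta> by (simp add: field_simps)
 have "K / (2 * \<theta>) <= \<theta> * (L + 1) / (2 * \<theta>)" using K \<theta> by (intro divide_right_mono) auto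
 then have k: "K / (2 * \<theta>) <= (L + 1) / 2" using \<theta> by simp
 have dd: "\<bar>K\<^sup>2 - s\<^sup>2\<bar> / (2 * \<theta>) = \<bar>K\<^sup>2 / (2 * \<theta>) - s\<^sup>2 / (2 * \<theta>)\<bar>"
  using \<theta> by (simp add: diff_divide_distrib[symmetric])
 define P where "P = (2 * \<theta> + 1) * (L + 1)"
 have P: "(2 * \<theta> + 2) * (L + 1) = P + (L + 1)" by (simp add: P_def algebra_simps)
 have "(L + 1) / 2 <= L + 1" using L by simp
 then have k': "K / (2 * \<theta>) <= L + 1" using k by linarith
 show ?thesis using sum_block_log[of prefix_blocks] d k'
  unfolding K_def[symmetric] L_def[symmetric] e d' dd P P_def[symmetric] by linarith
qed

text \<open>The cube root of the grid time is below 1 + 1 / ln n, hence below 2. So 8 is a safe time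
  horizon for the Brownian path, and 12 bounds x^2 + x t + t^2 in the difference of cubes.\<close>

lemma prefix_time:
 "0 <= grid_time \<theta> (ln (real n)) prefix_blocks" "grid_time \<theta> (ln (real n)) prefix_blocks < 8"
 "\<bar>grid_time \<theta> (ln (real n)) prefix_blocks - t ^ 3\<bar> <= 12 * ((2 * \<theta> + 1) / (\<theta> * ln (real n)))"
proof -
 define L where "L = ln (real n)"
 define x where "x = real prefix_blocks / (\<theta> * L)"
 have L: "2 <= L" using ln_n by (simp add: L_def)
 have \<theta>L: "0 < \<theta> * L" using \<theta> L by simp
 have x0: "0 <= x" using \<theta>L by (simp add: x_def)
 have "x <= \<theta> * (L + 1) / (\<theta> * L)" unfolding x_def using prefix_blocks(1) \<theta>L by (intro divide_right_mono) (auto simp: L_def)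
 also have "\<dots> = 1 + 1 / L" using \<theta> L by (simp add: field_simps)
 also have "\<dots> < 2" using L by simp
 finally have x2: "x < 2" .
 have "x - t = (real prefix_blocks - \<theta> * (t * L)) / (\<theta> * L)" using \<theta> L by (simp add: x_def field_simps)
 then have "\<bar>x - t\<bar> = \<bar>real prefix_blocks - \<theta> * (t * L)\<bar> / (\<theta> * L)" using \<theta>L by simp
 also have "\<dots> <= (2 * \<theta> + 1) / (\<theta> * L)" using prefix_blocks(2) \<theta>L by (intro divide_right_mono) (auto simp: L_def)
 finally have d: "\<bar>x - t\<bar> <= (2 * \<theta> + 1) / (\<theta> * L)" .
 have "x ^ 3 - t ^ 3 = (x * x + x * t + t * t) * (x - t)" by (simp add: power3_eq_cube algebra_simps)
 then have "\<bar>x ^ 3 - t ^ 3\<bar> = (x * x + x * t + t * t) * \<bar>x - t\<bar>"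
  using x0 t by (simp only: abs_mult) simp
 also have "\<dots> <= 12 * ((2 * \<theta> + 1) / (\<theta> * L))"
 proof (rule mult_mono[OF _ d])
  have "x * x <= 2 * 2" by (rule mult_mono) (use x0 x2 in auto)
  moreover have "x * t <= 2 * 2" by (rule mult_mono) (use x0 x2 t in auto)
  moreover have "t * t <= 2 * 2" by (rule mult_mono) (use t in auto)
  ultimately show "x * x + x * t + t * t <= 12" by linarith
 qed auto
 finally show "\<bar>grid_time \<theta> (ln (real n)) prefix_blocks - t ^ 3\<bar> <= 12 * ((2 * \<theta> + 1) / (\<theta> * ln (real n)))"
  by (simp only: grid_time_def x_def L_def)
 have "x ^ 3 < 2 ^ 3" using x0 x2 by (intro power_strict_mono) auto
 then show "grid_time \<theta> (ln (real n)) prefix_blocks < 8" by (simp add: grid_time_def x_def L_def)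
 show "0 <= grid_time \<theta> (ln (real n)) prefix_blocks" using x0 by (simp add: grid_time_def x_def L_def)
qed

text \<open>The deterministic core, for one path and one t: four replacements with their errors,
  namely involutions by weighted Poisson counts, rows by blocks, blocks by Brownian increments, and
  grid time by t^3. Of the factor 3 in front of d, two parts are from the Abel summation and one
  from the block cut by the prefix.\<close>

lemma path_bound:
 fixes w :: "real => real" and Z N :: "nat => nat"
 assumes w0: "w 0 = 0"
  and osc: "\<bar>w (t ^ 3) - w (grid_time \<theta> (ln (real n)) prefix_blocks)\<bar> <= b"
  and I: "\<bar>ln (invol prefix_len c) - (\<Sum>k<prefix_len. ln (real (Suc k)) * real (Z k))\<bar> <= e1"
  and R: "\<bar>(\<Sum>k<prefix_len. ln (real (Suc k)) * real (Z k)) - (\<Sum>j<prefix_blocks. block_log \<theta> j * real (N j))\<bar> <= e2 + block_log \<theta> prefix_blocks * real (N prefix_blocks)"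
  and NP: "real (N prefix_blocks) <= d"
  and G: "\<And>k. k <= prefix_blocks ==> \<bar>(\<Sum>j<k. real (N j) - 1) - (\<Sum>j<k. incr (grid_time \<theta> (ln (real n))) w j)\<bar> <= d"
 shows "\<bar>Wn \<theta> n c t - w (t ^ 3)\<bar> <= (e1 + (e2 + (3 * (ln (real n) + 1 + 1 / \<theta>) * d + (2 * \<theta> + 2) * (ln (real n) + 1)))) / sqrt (\<theta> / 3 * (ln (real n)) ^ 3) + b"
proof -
 define L where "L = ln (real n)"
 define \<sigma> where "\<sigma> = sqrt (\<theta> / 3 * L ^ 3)"
 define K where "K = prefix_blocks"
 let ?a = "block_log \<theta>" and ?g = "incr (grid_time \<theta> L) w"
 have L: "2 <= L" using ln_n by (simp add: L_def)
 have \<sigma>: "0 < \<sigma>" unfolding \<sigma>_def using \<theta> L by simp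
 have d0: "0 <= d" using G[of 0] by simp
 have aK: "?a K <= L + 1 + 1 / \<theta>"
 proof -
  have "?a K <= (real K + 1) / \<theta>" by (rule block_log_bounds)
  also have "\<dots> <= (\<theta> * (L + 1) + 1) / \<theta>" using prefix_blocks(1) \<theta> by (intro divide_right_mono) (auto simp: K_def L_def)
  also have "\<dots> = L + 1 + 1 / \<theta>" using \<theta> by (simp add: add_divide_distrib)
  finally show ?thesis .
 qed
 have "\<bar>\<Sum>j<K. ?a j * ((real (N j) - 1) - ?g j)\<bar> <= 2 * ?a K * d"
 proof (rule abel_bound[OF block_log_mono])
  show "0 <= ?a 0" using block_log_bounds(3)[of 0] by simp
  fix k assume "k <= K"
  then show "\<bar>\<Sum>j<k. (real (N j) - 1) - ?g j\<bar> <= d" using G[of k] by (simp only: sum_subtractf K_def L_def)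
 qed
 moreover have "(\<Sum>j<K. ?a j * ((real (N j) - 1) - ?g j)) = (\<Sum>j<K. ?a j * real (N j)) - (\<Sum>j<K. ?a j) - (\<Sum>j<K. ?a j * ?g j)"
  by (simp only: sum_subtractf right_diff_distrib mult_1_right)
 moreover have "(\<Sum>j<K. ?a j * ?g j) = \<sigma> * w (grid_time \<theta> L K)"
  unfolding \<sigma>_def by (subst brownian_sum) (use L w0 in auto)
 moreover have "?a K * real (N K) <= ?a K * d" using NP block_log_bounds(3)[of K] by (intro mult_left_mono) (auto simp: K_def)
 moreover have "2 * ?a K * d + ?a K * d <= 3 * (L + 1 + 1 / \<theta>) * d"
 proof -
  have "2 * ?a K * d + ?a K * d = 3 * (?a K * d)" by simp
  also have "\<dots> <= 3 * ((L + 1 + 1 / \<theta>) * d)" using aK d0 by (intro mult_left_mono mult_right_mono) auto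
  finally show ?thesis by (simp only: mult.assoc)
 qed
 moreover note I R[folded K_def] prefix_mean[folded K_def L_def]
 ultimately have main: "\<bar>ln (invol prefix_len c) - \<theta> * t\<^sup>2 / 2 * L\<^sup>2 - \<sigma> * w (grid_time \<theta> L K)\<bar>
  <= e1 + (e2 + (3 * (L + 1 + 1 / \<theta>) * d + (2 * \<theta> + 2) * (L + 1)))" by linarith
 have "Wn \<theta> n c t = (ln (invol prefix_len c) - \<theta> * t\<^sup>2 / 2 * L\<^sup>2) / \<sigma>"
  unfolding Wn_def prefix_len_def L_def \<sigma>_def ..
 then have "Wn \<theta> n c t - w (grid_time \<theta> L K) = (ln (invol prefix_len c) - \<theta> * t\<^sup>2 / 2 * L\<^sup>2 - \<sigma> * w (grid_time \<theta> L K)) / \<sigma>"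
  using \<sigma> by (simp add: diff_divide_distrib)
 then have "\<bar>Wn \<theta> n c t - w (grid_time \<theta> L K)\<bar> = \<bar>ln (invol prefix_len c) - \<theta> * t\<^sup>2 / 2 * L\<^sup>2 - \<sigma> * w (grid_time \<theta> L K)\<bar> / \<sigma>"
  using \<sigma> by simp
 also have "\<dots> <= (e1 + (e2 + (3 * (L + 1 + 1 / \<theta>) * d + (2 * \<theta> + 2) * (L + 1)))) / \<sigma>"
  using main \<sigma> by (intro divide_right_mono) auto
 finally show ?thesis using osc unfolding L_def \<sigma>_def K_def by linarith
qed

end

end

end

text \<open>Countably many reals and one countable item have the cardinality of the continuum: each
  real becomes a set of naturals, all these sets are placed side by side in one set of triples
  (first entry 0 marks the countable item), and that set is coded by a real.\<close>

lemma inj_into_reals: "\<exists>f :: (nat \<times> (nat \<times> nat => real)) \<times> ('c :: countable) => real. inj f"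
proof -
 have "(UNIV :: real set) \<approx> (UNIV :: nat set set)" by (rule eqpoll_sym[OF nat_sets_eqpoll_reals])
 then obtain e :: "real => nat set" where e: "inj e" by (auto simp: eqpoll_def bij_betw_def)
 obtain d :: "nat set => real" where d: "inj d" using nat_sets_eqpoll_reals by (auto simp: eqpoll_def bij_betw_def)
 define S where "S = (\<lambda>x :: (nat \<times> (nat \<times> nat => real)) \<times> 'c. {p :: nat \<times> (nat \<times> nat) \<times> nat.
  (fst p = 0 \<and> snd (snd p) = to_nat (fst (fst x), snd x)) \<or> (fst p = 1 \<and> snd (snd p) \<in> e (snd (fst x) (fst (snd p))))})"
 have "inj S"
 proof (rule injI)
  fix x y assume xy: "S x = S y"
  obtain k g c where x: "x = ((k, g), c)" by (metis surj_pair)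
  obtain k' g' c' where y: "y = ((k', g'), c')" by (metis surj_pair)
  have "(0, (0, 0), to_nat (k, c)) \<in> S x" by (simp add: S_def x)
  then have "(0, (0, 0), to_nat (k, c)) \<in> S y" using xy by simp
  then have 1: "(k, c) = (k', c')" by (simp add: S_def y)
  have "e (g i) = e (g' i)" for i
  proof (rule set_eqI)
   fix m
   have "(1, i, m) \<in> S x \<longleftrightarrow> (1, i, m) \<in> S y" using xy by simp
   then show "m \<in> e (g i) \<longleftrightarrow> m \<in> e (g' i)" by (simp add: S_def x y)
  qed
  then have "g = g'" by (intro ext) (rule injD[OF e])
  then show "x = y" using 1 by (simp add: x y)
 qed
 moreover have "inj (\<lambda>A :: (nat \<times> (nat \<times> nat) \<times> nat) set. to_nat ` A)" by (rule injI) (simp add: inj_image_eq_iff)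
 ultimately have "inj (d \<circ> ((\<lambda>A. to_nat ` A) \<circ> S))" using d by (intro inj_compose)
 then show ?thesis by blast
qed

lemma measure_pmf_level: "measure (measure_pmf p) {x. f x = w} = pmf (map_pmf f p) w"
 unfolding pmf_map by (rule arg_cong[where f = "measure _"]) auto

text \<open>Makes the supremum measurable. A value above the countable supremum would persist on an
  interval to the right of t, which contains a rational; t = 1 has no room on its right inside the
  interval and belongs to the countable set itself.\<close>

lemma SUP_right_continuous:
 fixes \<phi> :: "real => real"
 assumes "\<And>t. 0 <= t ==> t < 1 ==> (\<phi> \<longlongrightarrow> \<phi> t) (at_right t)"
 shows "(SUP t\<in>{0..1}. ennreal (\<phi> t)) = (SUP t\<in>insert 1 ({0..1} \<inter> \<rat>). ennreal (\<phi> t))"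
proof (rule antisym)
 let ?B = "SUP t\<in>insert 1 ({0..1} \<inter> \<rat>). ennreal (\<phi> t)"
 show "?B <= (SUP t\<in>{0..1}. ennreal (\<phi> t))" by (rule SUP_subset_mono) auto
 show "(SUP t\<in>{0..1}. ennreal (\<phi> t)) <= ?B"
 proof (rule SUP_least)
  fix t :: real assume t: "t \<in> {0..1}"
  show "ennreal (\<phi> t) <= ?B"
  proof (cases "t = 1")
   case True
   then show ?thesis by (intro SUP_upper) simp
  next
   case False
   then have t1: "0 <= t" "t < 1" using t by auto
   show ?thesis
   proof (rule ccontr)
    assume "\<not> ennreal (\<phi> t) <= ?B"
    then have "?B < ennreal (\<phi> t)" by simp
    moreover have "((\<lambda>s. ennreal (\<phi> s)) \<longlongrightarrow> ennreal (\<phi> t)) (at_right t)"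
     by (rule tendsto_ennrealI[OF assms[OF t1]])
    ultimately have "eventually (\<lambda>s. ?B < ennreal (\<phi> s)) (at_right t)" by (rule order_tendstoD(1)[rotated])
    then obtain b where b: "b > t" "\<And>s. t < s ==> s < b ==> ?B < ennreal (\<phi> s)"
     by (auto simp: eventually_at_right_field)
    have "t < min b 1" using b t1 by simp
    then obtain q where q: "q \<in> \<rat>" "t < q" "q < min b 1" using Rats_dense_in_real by blast
    then have "ennreal (\<phi> q) <= ?B" using t1 by (intro SUP_upper) auto
    then show False using b(2)[of q] q by auto
   qed
  qed
 qed
qed

text \<open>The only jumps come from the floor of n^t, which is constant on a short interval to the
  right of every t.\<close>

lemma Wn_right_continuous:
 assumes n: "1 <= n" and w: "continuous_on {0..} w" and t: "0 <= t"
 shows "((\<lambda>s. \<bar>Wn \<theta> n c s - w (s ^ 3)\<bar>) \<longlongrightarrow> \<bar>Wn \<theta> n c t - w (t ^ 3)\<bar>) (at_right t)"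
proof -
 let ?I = "ln (invol (nat \<lfloor>real n powr t\<rfloor>) c)"
 let ?f = "\<lambda>s. \<bar>(?I - \<theta> * s\<^sup>2 / 2 * (ln (real n))\<^sup>2) / sqrt (\<theta> / 3 * (ln (real n)) ^ 3) - w (s ^ 3)\<bar>"
 have p: "((\<lambda>s. real n powr s) \<longlongrightarrow> real n powr t) (at_right t)" using n by (intro tendsto_intros) auto
 have "real n powr t < real_of_int \<lfloor>real n powr t\<rfloor> + 1" by linarith
 then have "eventually (\<lambda>s. real n powr s < real_of_int \<lfloor>real n powr t\<rfloor> + 1) (at_right t)" by (rule order_tendstoD(2)[OF p])
 moreover have "eventually (\<lambda>s. t < s) (at_right t)" by (rule eventually_at_right_less)
 ultimately have "eventually (\<lambda>s. \<bar>Wn \<theta> n c s - w (s ^ 3)\<bar> = ?f s) (at_right t)"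
 proof eventually_elim
  case (elim s)
  have "real n powr t <= real n powr s" using elim n by (intro powr_mono) auto
  then have "\<lfloor>real n powr s\<rfloor> = \<lfloor>real n powr t\<rfloor>" using elim by linarith
  then show ?case by (simp add: Wn_def)
 qed
 moreover have "(?f \<longlongrightarrow> ?f t) (at_right t)"
 proof -
  have "continuous_on {0..} (\<lambda>s. w (s ^ 3))"
   by (rule continuous_on_compose2[OF w]) (auto intro!: continuous_intros)
  then have "continuous_on {0..} ?f" unfolding divide_inverse by (intro continuous_intros)
  then have "(?f \<longlongrightarrow> ?f t) (at t within {0..})" using t by (auto simp: continuous_on_def)
  then show ?thesis by (rule tendsto_within_subset) (use t in auto)
 qed
 ultimately show ?thesis by (subst tendsto_cong) (auto simp: Wn_def)
qed

section \<open>Choice of the dyadic scales and assembly of the coupling\<close>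

lemma choose_scale:
 fixes x :: real
 assumes "1 <= x"
 obtains r where "x <= 2 ^ r" "real r <= 2 * ln x + 1"
proof
 have lx: "0 <= ln x" using assms by simp
 have l2: "2 / 3 <= ln (2::real)" by (rule ln2_ge_two_thirds)
 have l: "0 <= log 2 x" using assms by simp
 have "log 2 x = ln x / ln 2" by (simp add: log_def)
 also have "\<dots> <= ln x / (1 / 2)" using lx l2 by (intro divide_left_mono) auto
 finally have b: "log 2 x <= 2 * ln x" by simp
 let ?r = "nat \<lceil>log 2 x\<rceil>"
 have r: "log 2 x <= real ?r" "real ?r < log 2 x + 1" using l by linarith+
 show "real ?r <= 2 * ln x + 1" using r b by linarith
 have "x <= 2 powr real ?r" using r(1) assms by (subst (asm) log_le_iff) auto
 then show "x <= 2 ^ ?r" by (simp add: powr_realpow)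
qed

context
 fixes \<theta> K1 :: real and n r i :: nat
 assumes \<theta>: "\<theta> > 0" and ln_n: "2 <= ln (real n)"
  and r: "1 <= r" "\<theta> * (ln (real n) + 1) + 2 <= 2 ^ r"
  and i: "12 * ((2 * \<theta> + 1) / (\<theta> * ln (real n))) <= 1 / 2 ^ i"
  and K1: "1 <= K1" "\<And>v r. strict_mono v ==> 0 <= v 0 ==> 1 <= r ==>
  \<exists>D. D \<in> borel_measurable (S1 (2 * r)) \<and> (\<integral>\<^sup>+\<omega>. ennreal (D \<omega>) \<partial>S1 (2 * r)) <= ennreal (K1 * real r) \<and>
   (\<forall>\<omega>. 0 <= D \<omega> \<and> (\<forall>k\<le>2 ^ r. \<bar>(\<Sum>j<k. real (S1N v (2 * r) \<omega> ! j) - 1) - (\<Sum>j<k. incr v (S1W \<omega>) j)\<bar> <= D \<omega>)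
     \<and> (\<forall>j<2 ^ r. real (S1N v (2 * r) \<omega> ! j) <= D \<omega>))"
begin

lemma n_pos: "1 <= n"
proof (rule ccontr)
 assume "\<not> 1 <= n"
 then have "n = 0" by simp
 then show False using ln_n by simp
qed

text \<open>Two gluings: the Brownian space meets the Poisson array along the column sums (unit
  Poisson), and the result meets the Feller coupling along the row sums, which have the law of the
  Poisson counts there. The parameter r provides at least as many coupled cells as blocks are used;
  i is the scale of the time error in \<open>prefix_time\<close>.\<close>

lemma coupling_at:
 defines "L \<equiv> ln (real n)"
 shows "\<exists>(M :: real measure) (C :: real => nat => nat) (W :: real => real => real).
   prob_space M \<and> esf_cycle_counts M \<theta> n C \<and> std_brownian_motion M W \<and>
   (\<lambda>\<omega>. SUP t\<in>{0..1}. ennreal \<bar>Wn \<theta> n (C \<omega>) t - W \<omega> (t^3)\<bar>) \<in> borel_measurable M \<and>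
   (\<integral>\<^sup>+ \<omega>. (SUP t\<in>{0..1}. ennreal \<bar>Wn \<theta> n (C \<omega>) t - W \<omega> (t^3)\<bar>) \<partial>M)
    <= ennreal (1 / sqrt (\<theta> / 3 * L ^ 3) * ((2 * ln (real n + 1) * (2 + exp \<theta> + \<theta>\<^sup>2) + \<theta>\<^sup>2 * (1 + L))
       + ((2 + 1 / \<theta>) * (\<theta> * (L + 1)) + (3 * (L + 1 + 1 / \<theta>) * (K1 * real r) + (2 * \<theta> + 2) * (L + 1))))
      + 2 * (ln (real 8) + 4) / (1 - 1 / sqrt 2)\<^sup>2 * (real i + 1) / sqrt 2 ^ i)"
proof -
 have L: "2 <= L" using ln_n by (simp add: L_def)
 let ?v = "grid_time \<theta> L"
 let ?R = "2 * r"
 let ?J = "2 ^ (2 * r) :: nat"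
 let ?\<Lambda> = "cum_mean \<theta> n"
 let ?\<mu> = "\<lambda>k. \<theta> * (1 - 1 / real n) ^ Suc k / real (Suc k)"
 have v: "strict_mono ?v" "0 <= ?v 0" using grid_time_strict_mono[OF \<theta>, of L] L by (auto simp: grid_time_0[OF \<theta>])
 obtain D where D: "D \<in> borel_measurable (S1 ?R)" "(\<integral>\<^sup>+\<omega>. ennreal (D \<omega>) \<partial>S1 ?R) <= ennreal (K1 * real r)"
  "\<And>\<omega>. 0 <= D \<omega>" "\<And>\<omega> k. k <= 2 ^ r ==> \<bar>(\<Sum>j<k. real (S1N ?v ?R \<omega> ! j) - 1) - (\<Sum>j<k. incr ?v (S1W \<omega>) j)\<bar> <= D \<omega>"
  "\<And>\<omega> j. j < 2 ^ r ==> real (S1N ?v ?R \<omega> ! j) <= D \<omega>"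
  using K1(2)[OF v r(1)] by blast
 obtain S :: "(nat \<times> bool list) pmf" and C :: "nat \<times> bool list => nat => nat" and Z :: "nat \<times> bool list => nat list" where S: "\<And>v. measure (measure_pmf S) {\<omega>. C \<omega> = v} = (\<Sum>\<sigma>\<in>{\<sigma>. \<sigma> permutes {1..n} \<and> cycle_count n \<sigma> = v}. esf_weight \<theta> n \<sigma>)"
  "\<And>w. pmf (map_pmf Z S) w = pois_law ?\<mu> n w"
  "\<And>\<omega>. length (Z \<omega>) = n"
  "(\<integral>\<^sup>+\<omega>. ennreal (\<Sum>k<n. \<bar>real (C \<omega> (Suc k)) - real (Z \<omega> ! k)\<bar>) \<partial>S) <= ennreal (2 + exp \<theta> + \<theta>\<^sup>2)"
  "\<And>\<omega> k. \<omega> \<in> set_pmf S ==> C \<omega> k <= n"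
  by (rule esf_coupling[OF \<theta> n_pos], rule that)
 have \<Lambda>J: "?\<Lambda> n < real ?J"
 proof -
  have "?\<Lambda> n <= \<theta> * (L + 1)" unfolding L_def by (rule cum_mean_top[OF \<theta> n_pos])
  also have "\<dots> < 2 ^ r" using r(2) by (simp add: L_def)
  also have "(2::real) ^ r <= 2 ^ (2 * r)" by (rule power_increasing) auto
  finally show ?thesis by simp
 qed
 have \<Lambda>0: "?\<Lambda> 0 = 0" by (simp add: cum_mean_def)
 note \<Lambda> = cum_mean_mono[OF \<theta> n_pos] \<Lambda>0 \<Lambda>J
 define Q where "Q = map_pmf (\<lambda>q. (colsums n ?J q, rowsums n ?J q)) (Qpmf ?\<Lambda> n ?J)"
 have Q: "\<exists>q\<in>set_pmf (Qpmf ?\<Lambda> n ?J). x = (colsums n ?J q, rowsums n ?J q)" if "x \<in> set_pmf Q" for x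
  using that by (auto simp: Q_def)
 note pm = measure_pmf_level
 have Qf: "map_pmf fst Q = map_pmf (colsums n ?J) (Qpmf ?\<Lambda> n ?J)" "map_pmf snd Q = map_pmf (rowsums n ?J) (Qpmf ?\<Lambda> n ?J)"
  by (simp_all add: Q_def pmf.map_comp o_def)
 have c\<mu>: "(\<lambda>k. ?\<Lambda> (Suc k) - ?\<Lambda> k) = ?\<mu>" by (simp add: cum_mean_def cell_mean_def fun_eq_iff)
 have law1: "measure (S1 ?R) {\<omega> \<in> space (S1 ?R). S1N ?v ?R \<omega> = w} = measure (measure_pmf Q) {\<omega> \<in> space (measure_pmf Q). fst \<omega> = w}" for w
  unfolding S1N_law(2)[OF v] using pm[where p = Q and f = fst and w = w] Qf(1) colsums_law[OF \<Lambda>, of w] by simp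
 have fQ: "fst \<in> measurable (measure_pmf Q) (count_space UNIV)" by simp
 obtain M1 :: "((nat \<times> (nat \<times> nat => real)) \<times> (nat list \<times> nat list)) measure"
  where M1: "prob_space M1" "mpres M1 (S1 ?R) fst" "mpres M1 (measure_pmf Q) snd"
   "AE \<omega> in M1. S1N ?v ?R (fst \<omega>) = fst (snd \<omega>)"
  by (rule glue[where ?X1.0 = "S1N ?v ?R" and ?X2.0 = "fst" and ?M1.0 = "S1 ?R" and ?M2.0 = "measure_pmf Q",
     OF prob_space_S1 measure_pmf.prob_space_axioms S1N_measurable[OF v] fQ law1], rule that)
 note M1m[measurable] = mpres_measurable[OF M1(2)] mpres_measurable[OF M1(3)]
 have X1: "(\<lambda>\<omega>. snd (snd \<omega>)) \<in> measurable M1 (count_space UNIV)"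
  by (rule measurable_compose[OF M1m(2)]) simp
 have law2: "measure M1 {\<omega> \<in> space M1. snd (snd \<omega>) = w} = measure (measure_pmf S) {\<omega> \<in> space (measure_pmf S). Z \<omega> = w}" for w
 proof -
  have "measure M1 {\<omega> \<in> space M1. snd (snd \<omega>) = w} = measure (measure_pmf Q) {x. snd x = w}"
   using mpres_measure[OF M1(3), of "{x. snd x = w}"] by (simp add: vimage_def Int_def conj_commute)
  also have "\<dots> = pois_law ?\<mu> n w"
   using pm[where p = Q and f = snd and w = w] Qf(2) rowsums_law[OF \<Lambda>, of w] unfolding c\<mu> by simp
  also have "\<dots> = measure (measure_pmf S) {x. Z x = w}" using pm[where p = S and f = Z and w = w] S(2)[of w] by simp
  finally show ?thesis by simp
 qed
 have ZS: "Z \<in> measurable (measure_pmf S) (count_space UNIV)" by simp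
 obtain M2 :: "(((nat \<times> (nat \<times> nat => real)) \<times> (nat list \<times> nat list)) \<times> (nat \<times> bool list)) measure"
  where M2: "prob_space M2" "mpres M2 M1 fst" "mpres M2 (measure_pmf S) snd"
   "AE \<omega> in M2. snd (snd (fst \<omega>)) = Z (snd \<omega>)"
  by (rule glue[where ?X1.0 = "\<lambda>\<omega>. snd (snd \<omega>)" and ?X2.0 = Z and ?M1.0 = M1 and ?M2.0 = "measure_pmf S",
     OF M1(1) measure_pmf.prob_space_axioms X1 ZS law2], rule that)
 obtain f :: "(nat \<times> (nat \<times> nat => real)) \<times> ((nat list \<times> nat list) \<times> (nat \<times> bool list)) => real" where f: "inj f"
  using inj_into_reals by blast
 \<comment> \<open>Regrouping so that the two lists, the random size and the Feller run form the
   countable component in \<open>inj_into_reals\<close>.\<close>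
 define g where "g = (\<lambda>\<omega> :: ((nat \<times> (nat \<times> nat => real)) \<times> (nat list \<times> nat list)) \<times> (nat \<times> bool list). f (fst (fst \<omega>), (snd (fst \<omega>), snd \<omega>)))"
 have "inj g" using f by (auto simp: g_def inj_def)
 then obtain M :: "real measure" and h where M: "prob_space M" "mpres M M2 h"
  using embed_into[OF _ M2(1)] by blast
 interpret M: prob_space M by (rule M(1))
 define a where "a = (\<lambda>\<omega>. fst (fst (h \<omega>)))"
 define b where "b = (\<lambda>\<omega>. snd (fst (h \<omega>)))"
 define s where "s = (\<lambda>\<omega>. snd (h \<omega>))"
 have mh: "mpres M M1 (\<lambda>\<omega>. fst (h \<omega>))" by (rule mpres_comp[OF M(2) M2(2)])
 have ma: "mpres M (S1 ?R) a" unfolding a_def by (rule mpres_comp[OF mh M1(2)])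
 have mb: "mpres M (measure_pmf Q) b" unfolding b_def by (rule mpres_comp[OF mh M1(3)])
 have ms: "mpres M (measure_pmf S) s" unfolding s_def by (rule mpres_comp[OF M(2) M2(3)])
 have mz: "mpres M BMsp (\<lambda>\<omega>. snd (a \<omega>))" by (rule mpres_comp[OF ma mpres_S1(2)])
 define C' where "C' = (\<lambda>\<omega>. C (s \<omega>))"
 define W where "W = (\<lambda>\<omega>. S1W (a \<omega>))"
 have Cm: "C' \<in> measurable M (count_space UNIV)"
  unfolding C'_def by (rule measurable_compose[OF mpres_measurable[OF ms]]) simp
 have esf: "esf_cycle_counts M \<theta> n C'"
  unfolding esf_cycle_counts_def
 proof (intro conjI allI Cm)
  fix v
  have "measure M {\<omega> \<in> space M. C' \<omega> = v} = measure (measure_pmf S) {x. C x = v}"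
   using mpres_measure[OF ms, of "{x. C x = v}"] by (simp add: C'_def vimage_def Int_def conj_commute)
  then show "measure M {\<omega> \<in> space M. C' \<omega> = v} = (\<Sum>\<sigma>\<in>{\<sigma>. \<sigma> permutes {1..n} \<and> cycle_count n \<sigma> = v}. esf_weight \<theta> n \<sigma>)"
   by (simp only: S(1))
 qed
 have bm: "std_brownian_motion M W"
  unfolding W_def by (rule mpres_std_brownian_motion[OF ma prob_space_S1 M(1) brownian_S1])
 have Wc: "continuous_on {0..} (W \<omega>)" for \<omega> unfolding W_def S1W_def by (rule bmW_continuous)
 have sup: "(SUP t\<in>{0..1}. ennreal \<bar>Wn \<theta> n (C' \<omega>) t - W \<omega> (t^3)\<bar>) = (SUP t\<in>insert 1 ({0..1} \<inter> \<rat>). ennreal \<bar>Wn \<theta> n (C' \<omega>) t - W \<omega> (t^3)\<bar>)" for \<omega>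
  by (rule SUP_right_continuous) (rule Wn_right_continuous[OF n_pos Wc])
 have meas: "(\<lambda>\<omega>. SUP t\<in>{0..1}. ennreal \<bar>Wn \<theta> n (C' \<omega>) t - W \<omega> (t^3)\<bar>) \<in> borel_measurable M"
  unfolding sup
 proof (rule borel_measurable_SUP)
  show "countable (insert 1 ({0..1} \<inter> \<rat>) :: real set)" by (intro countable_insert countable_Int2 countable_rat)
  fix t :: real assume "t \<in> insert 1 ({0..1} \<inter> \<rat>)"
  then have t: "0 <= t ^ 3" by auto
  have [measurable]: "(\<lambda>\<omega>. W \<omega> (t ^ 3)) \<in> borel_measurable M"
   using bm t unfolding std_brownian_motion_def by blast
  have [measurable]: "(\<lambda>\<omega>. Wn \<theta> n (C' \<omega>) t) \<in> borel_measurable M"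
   by (rule measurable_compose[OF Cm]) simp
  show "(\<lambda>\<omega>. ennreal \<bar>Wn \<theta> n (C' \<omega>) t - W \<omega> (t ^ 3)\<bar>) \<in> borel_measurable M" by measurable
 qed
 define \<Delta> where "\<Delta> = (\<lambda>x. \<Sum>k<n. \<bar>real (C x (Suc k)) - real (Z x ! k)\<bar>)"
 define Z2 where "Z2 = (\<lambda>x. \<Sum>k<n. real (Z x ! k) * (real (Z x ! k) - 1) / real (Suc k))"
 define Z1 where "Z1 = (\<lambda>x. \<Sum>k<n. real (Z x ! k))"
 have \<mu>: "0 <= ?\<mu> k" "?\<mu> k <= \<theta> * (1 / real (Suc k))" for k
  using cell_mean_bounds(1,2)[OF \<theta> n_pos, of k] unfolding cell_mean_def by auto
 have zz: "0 <= real c * (real c - 1)" for c by (cases c) auto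
 have m\<Delta>: "mean_le (measure_pmf S) \<Delta> (2 + exp \<theta> + \<theta>\<^sup>2)"
  unfolding mean_le_def \<Delta>_def using S(4) by (auto intro!: sum_nonneg add_nonneg_nonneg)
 have mZ1: "mean_le (measure_pmf S) Z1 (\<theta> * (L + 1))"
 proof -
  have "(\<integral>\<^sup>+x. ennreal (Z1 x) \<partial>S) = (\<integral>\<^sup>+x. (\<Sum>k<n. ennreal (real (Z x ! k))) \<partial>S)"
   by (rule nn_integral_cong) (simp add: Z1_def sum_ennreal)
  also have "\<dots> = (\<Sum>k<n. \<integral>\<^sup>+c. ennreal (real c) \<partial>pois (?\<mu> k))"
   by (rule nn_integral_pois_list[where g = "\<lambda>k c. ennreal (real c)", OF S(2) \<mu>(1)])
  also have "\<dots> = (\<Sum>k<n. ennreal (?\<mu> k))" by (rule sum.cong[OF refl]) (rule nn_integral_pois_1[OF \<mu>(1)])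
  also have "\<dots> = ennreal (?\<Lambda> n)" unfolding cum_mean_def cell_mean_def by (rule sum_ennreal) (rule \<mu>(1))
  also have "\<dots> <= ennreal (\<theta> * (L + 1))" unfolding L_def by (intro ennreal_leI cum_mean_top[OF \<theta> n_pos])
  finally show ?thesis unfolding mean_le_def Z1_def using \<theta> L by (auto intro: sum_nonneg)
 qed
 have mZ2: "mean_le (measure_pmf S) Z2 (\<theta>\<^sup>2 * (1 + L))"
 proof -
  have "(\<integral>\<^sup>+x. ennreal (Z2 x) \<partial>S) = (\<integral>\<^sup>+x. (\<Sum>k<n. ennreal (1 / real (Suc k)) * ennreal (real (Z x ! k) * (real (Z x ! k) - 1))) \<partial>S)"
  proof (rule nn_integral_cong)
   fix x
   have "Z2 x = (\<Sum>k<n. 1 / real (Suc k) * (real (Z x ! k) * (real (Z x ! k) - 1)))" by (simp add: Z2_def)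
   also have "ennreal \<dots> = (\<Sum>k<n. ennreal (1 / real (Suc k) * (real (Z x ! k) * (real (Z x ! k) - 1))))"
    by (intro sum_ennreal[symmetric] mult_nonneg_nonneg zz) simp
   also have "\<dots> = (\<Sum>k<n. ennreal (1 / real (Suc k)) * ennreal (real (Z x ! k) * (real (Z x ! k) - 1)))"
    by (intro sum.cong refl ennreal_mult zz) simp
   finally show "ennreal (Z2 x) = (\<Sum>k<n. ennreal (1 / real (Suc k)) * ennreal (real (Z x ! k) * (real (Z x ! k) - 1)))" .
  qed
  also have "\<dots> = (\<Sum>k<n. \<integral>\<^sup>+c. ennreal (1 / real (Suc k)) * ennreal (real c * (real c - 1)) \<partial>pois (?\<mu> k))"
   by (rule nn_integral_pois_list[where g = "\<lambda>k c. ennreal (1 / real (Suc k)) * ennreal (real c * (real c - 1))", OF S(2) \<mu>(1)])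
  also have "\<dots> = (\<Sum>k<n. ennreal (1 / real (Suc k)) * ennreal ((?\<mu> k)\<^sup>2))"
   by (rule sum.cong[OF refl]) (simp add: nn_integral_cmult nn_integral_pois_2[OF \<mu>(1)] del: of_nat_Suc power_Suc)
  also have "\<dots> <= (\<Sum>k<n. ennreal (\<theta>\<^sup>2 * (1 / real (Suc k))))"
  proof (rule sum_mono)
   fix k
   have "\<theta> * (1 / real (Suc k)) <= \<theta> * 1" by (rule mult_left_mono) (use \<theta> in auto)
   then have "?\<mu> k <= \<theta>" using order_trans[OF \<mu>(2)[of k]] by simp
   then have "(?\<mu> k)\<^sup>2 <= \<theta>\<^sup>2" using \<mu>(1)[of k] by (intro power_mono) auto
   then have "1 / real (Suc k) * (?\<mu> k)\<^sup>2 <= \<theta>\<^sup>2 * (1 / real (Suc k))" by (subst mult.commute) (intro mult_right_mono, auto)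
   then have "ennreal (1 / real (Suc k) * (?\<mu> k)\<^sup>2) <= ennreal (\<theta>\<^sup>2 * (1 / real (Suc k)))" by (rule ennreal_leI)
   moreover have "ennreal (1 / real (Suc k) * (?\<mu> k)\<^sup>2) = ennreal (1 / real (Suc k)) * ennreal ((?\<mu> k)\<^sup>2)"
    by (rule ennreal_mult) (simp_all only: zero_le_power2 zero_le_divide_1_iff of_nat_0_le_iff)
   ultimately show "ennreal (1 / real (Suc k)) * ennreal ((?\<mu> k)\<^sup>2) <= ennreal (\<theta>\<^sup>2 * (1 / real (Suc k)))" by (simp only:)
  qed
  also have "\<dots> = ennreal (\<Sum>k<n. \<theta>\<^sup>2 * (1 / real (Suc k)))" by (rule sum_ennreal) simp
  also have "(\<Sum>k<n. \<theta>\<^sup>2 * (1 / real (Suc k))) = \<theta>\<^sup>2 * harm n" by (simp only: sum_distrib_left[symmetric] sum_inverse_Suc)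
  also have "ennreal (\<theta>\<^sup>2 * harm n) <= ennreal (\<theta>\<^sup>2 * (1 + L))"
   unfolding L_def by (intro ennreal_leI mult_left_mono harm_le_ln[OF n_pos]) simp
  finally have "(\<integral>\<^sup>+x. ennreal (Z2 x) \<partial>S) <= ennreal (\<theta>\<^sup>2 * (1 + L))" .
  moreover have "0 <= Z2 x" for x unfolding Z2_def by (intro sum_nonneg divide_nonneg_nonneg zz) simp
  moreover have "0 <= \<theta>\<^sup>2 * (1 + L)" using L by simp
  ultimately show ?thesis unfolding mean_le_def by simp
 qed
 have mD: "mean_le (S1 ?R) D (K1 * real r)" unfolding mean_le_def using D K1(1) by auto
 have mO: "mean_le BMsp (osc 8 i) (2 * (ln (real 8) + 4) / (1 - 1 / sqrt 2)\<^sup>2 * (real i + 1) / sqrt 2 ^ i)"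
 proof -
  have "0 <= osc 8 i z" for z using bmW_osc[of 0 0 8 i z] by simp
  moreover have "(\<integral>\<^sup>+z. ennreal (osc 8 i z) \<partial>BMsp) <= ennreal (2 * (ln (real 8) + 4) / (1 - 1 / sqrt 2)\<^sup>2 * (real i + 1) / sqrt 2 ^ i)"
   by (rule nn_integral_osc) simp
  moreover have "0 <= 2 * (ln (real 8) + 4) / (1 - 1 / sqrt 2)\<^sup>2 * (real i + 1) / sqrt 2 ^ i"
   by (intro divide_nonneg_nonneg mult_nonneg_nonneg add_nonneg_nonneg) auto
  ultimately show ?thesis unfolding mean_le_def using osc_measurable by blast
 qed
 define \<sigma> where "\<sigma> = sqrt (\<theta> / 3 * L ^ 3)"
 \<comment> \<open>A majorant of the whole supremum, free of t: passage to Poisson counts,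
   regrouping of rows into columns, Abel summation with centring, and finally the Brownian
   oscillation between grid time and t^3.\<close>
 define X where "X = (\<lambda>\<omega>. 1 / \<sigma> * ((2 * ln (real n + 1) * \<Delta> (s \<omega>) + Z2 (s \<omega>)) + ((2 + 1 / \<theta>) * Z1 (s \<omega>) + (3 * (L + 1 + 1 / \<theta>) * D (a \<omega>) + (2 * \<theta> + 2) * (L + 1)))) + osc 8 i (snd (a \<omega>)))"
 have mX: "mean_le M X (1 / \<sigma> * ((2 * ln (real n + 1) * (2 + exp \<theta> + \<theta>\<^sup>2) + \<theta>\<^sup>2 * (1 + L))
       + ((2 + 1 / \<theta>) * (\<theta> * (L + 1)) + (3 * (L + 1 + 1 / \<theta>) * (K1 * real r) + (2 * \<theta> + 2) * (L + 1))))
      + 2 * (ln (real 8) + 4) / (1 - 1 / sqrt 2)\<^sup>2 * (real i + 1) / sqrt 2 ^ i)"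
  unfolding X_def
  by (intro mean_le_add mean_le_cmult mean_le_const[OF M(1)] mean_le_mpres[OF m\<Delta> ms] mean_le_mpres[OF mZ1 ms] mean_le_mpres[OF mZ2 ms]
    mean_le_mpres[OF mD ma] mean_le_mpres[OF mO mz]) (use \<theta> L in \<open>auto simp: \<sigma>_def intro!: mult_nonneg_nonneg\<close>)
 have ae: "AE \<omega> in M. (SUP t\<in>{0..1}. ennreal \<bar>Wn \<theta> n (C' \<omega>) t - W \<omega> (t^3)\<bar>) <= ennreal (X \<omega>)"
 proof -
  have 1: "AE \<omega> in M. S1N ?v ?R (a \<omega>) = fst (b \<omega>)" unfolding a_def b_def by (rule mpres_AE[OF mh M1(4)])
  have 2: "AE \<omega> in M. snd (b \<omega>) = Z (s \<omega>)" unfolding b_def s_def by (rule mpres_AE[OF M(2) M2(4)])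
  have 3: "AE \<omega> in M. b \<omega> \<in> set_pmf Q" by (rule mpres_AE[OF mb]) (rule AE_measure_pmf)
  have 4: "AE \<omega> in M. s \<omega> \<in> set_pmf S" by (rule mpres_AE[OF ms]) (rule AE_measure_pmf)
  from 1 2 3 4 show ?thesis
  proof eventually_elim
   case (elim \<omega>)
   obtain q where q: "q \<in> set_pmf (Qpmf ?\<Lambda> n ?J)" "b \<omega> = (colsums n ?J q, rowsums n ?J q)" using Q[OF elim(3)] by blast
   have cq: "colsums n ?J q = S1N ?v ?R (a \<omega>)" and rq: "rowsums n ?J q = Z (s \<omega>)" using elim q by auto
   show ?case
   proof (intro SUP_least ennreal_leI)
    fix t :: real assume "t \<in> {0..1}"
    then have t: "0 <= t" "t <= 1" by auto
    note pt = \<theta> n_pos t ln_n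
    let ?m = "prefix_len n t" and ?K = "prefix_blocks \<theta> n t"
    have K: "real ?K < 2 ^ r" using prefix_blocks(1)[OF pt] r(2) by linarith
    then have K2: "?K < 2 ^ r" by simp
    have "\<bar>Wn \<theta> n (C' \<omega>) t - W \<omega> (t ^ 3)\<bar> <= ((2 * ln (real n + 1) * \<Delta> (s \<omega>) + Z2 (s \<omega>)) + ((2 + 1 / \<theta>) * Z1 (s \<omega>) + (3 * (ln (real n) + 1 + 1 / \<theta>) * D (a \<omega>) + (2 * \<theta> + 2) * (ln (real n) + 1)))) / sqrt (\<theta> / 3 * (ln (real n)) ^ 3) + osc 8 i (snd (a \<omega>))"
    proof (rule path_bound[OF pt, where Z = "\<lambda>k. Z (s \<omega>) ! k" and N = "\<lambda>j. S1N ?v ?R (a \<omega>) ! j"])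
     show "W \<omega> 0 = 0" by (simp add: W_def S1W_def bmW_0)
     show "\<bar>W \<omega> (t ^ 3) - W \<omega> (grid_time \<theta> (ln (real n)) ?K)\<bar> <= osc 8 i (snd (a \<omega>))"
      unfolding W_def S1W_def
     proof (rule bmW_osc)
      show "0 <= grid_time \<theta> (ln (real n)) ?K" "grid_time \<theta> (ln (real n)) ?K < real 8" using prefix_time(1,2)[OF pt] by simp_all
      show "0 <= t ^ 3" using t by simp
      have "t ^ 3 <= 1" using t by (intro power_le_one)
      then show "t ^ 3 < real 8" by simp
      show "\<bar>t ^ 3 - grid_time \<theta> (ln (real n)) ?K\<bar> <= 1 / 2 ^ i" using prefix_time(3)[OF pt] i by linarith
     qed
     show "\<bar>ln (invol ?m (C' \<omega>)) - (\<Sum>k<?m. ln (real (Suc k)) * real (Z (s \<omega>) ! k))\<bar> <= 2 * ln (real n + 1) * \<Delta> (s \<omega>) + Z2 (s \<omega>)"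
      unfolding \<Delta>_def Z2_def C'_def by (rule ln_invol_close[OF prefix_len(2)[OF pt] S(5)[OF elim(4)]])
     show "\<bar>(\<Sum>k<?m. ln (real (Suc k)) * real (Z (s \<omega>) ! k)) - (\<Sum>j<?K. block_log \<theta> j * real (S1N ?v ?R (a \<omega>) ! j))\<bar>
      <= (2 + 1 / \<theta>) * Z1 (s \<omega>) + block_log \<theta> ?K * real (S1N ?v ?R (a \<omega>) ! ?K)"
      unfolding Z1_def rq[symmetric] cq[symmetric] prefix_blocks_def[OF pt]
     proof (rule rows_vs_cols(1)[OF \<Lambda> q(1) prefix_len(2)[OF pt]])
      show "\<bar>ln (real (Suc k)) - block_log \<theta> j\<bar> <= 2 + 1 / \<theta>" if "k < n" "real j < ?\<Lambda> (Suc k)" "?\<Lambda> k < real j + 1" for k j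
       by (rule cell_vs_block[OF \<theta> n_pos that])
      show "0 <= block_log \<theta> j" for j using block_log_bounds(3)[OF \<theta>, of j] by simp
      show "0 <= 2 + 1 / \<theta>" using \<theta> by simp
     qed
     show "real (S1N ?v ?R (a \<omega>) ! ?K) <= D (a \<omega>)" by (rule D(5)[OF K2])
     show "\<bar>(\<Sum>j<k. real (S1N ?v ?R (a \<omega>) ! j) - 1) - (\<Sum>j<k. incr (grid_time \<theta> (ln (real n))) (W \<omega>) j)\<bar> <= D (a \<omega>)" if "k <= ?K" for k
      using D(4)[of k "a \<omega>"] that K2 unfolding W_def L_def by simp
    qed
    then show "\<bar>Wn \<theta> n (C' \<omega>) t - W \<omega> (t ^ 3)\<bar> <= X \<omega>"
     unfolding X_def \<sigma>_def L_def by simp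
   qed
  qed
 qed
 have "(\<integral>\<^sup>+ \<omega>. (SUP t\<in>{0..1}. ennreal \<bar>Wn \<theta> n (C' \<omega>) t - W \<omega> (t^3)\<bar>) \<partial>M) <= (\<integral>\<^sup>+ \<omega>. ennreal (X \<omega>) \<partial>M)"
  by (rule nn_integral_mono_AE[OF ae])
 also have "\<dots> <= ennreal (1 / \<sigma> * ((2 * ln (real n + 1) * (2 + exp \<theta> + \<theta>\<^sup>2) + \<theta>\<^sup>2 * (1 + L))
       + ((2 + 1 / \<theta>) * (\<theta> * (L + 1)) + (3 * (L + 1 + 1 / \<theta>) * (K1 * real r) + (2 * \<theta> + 2) * (L + 1))))
      + 2 * (ln (real 8) + 4) / (1 - 1 / sqrt 2)\<^sup>2 * (real i + 1) / sqrt 2 ^ i)"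
  using mX by (simp only: mean_le_def)
 finally show ?thesis unfolding \<sigma>_def using M(1) esf bm meas by blast
qed

end

lemma choose_floor_scale:
 fixes x :: real
 assumes "1 <= x"
 obtains i where "2 ^ i <= x" "x <= 2 * 2 ^ i" "real i <= 2 * ln x"
proof
 have lx: "0 <= ln x" using assms by simp
 have l: "0 <= log 2 x" using assms by simp
 have "log 2 x = ln x / ln 2" by (simp add: log_def)
 also have "\<dots> <= ln x / (1 / 2)" using lx ln2_ge_two_thirds by (intro divide_left_mono) auto
 finally have b: "log 2 x <= 2 * ln x" by simp
 let ?i = "nat \<lfloor>log 2 x\<rfloor>"
 have i: "real ?i <= log 2 x" "log 2 x <= real (Suc ?i)" using l by linarith+
 show "real ?i <= 2 * ln x" using i b by linarith
 have "2 powr real ?i <= x" using i(1) assms by (subst (asm) le_log_iff) auto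
 then show "2 ^ ?i <= x" by (simp add: powr_realpow)
 have "x <= 2 powr real (Suc ?i)" using i(2) assms by (subst (asm) log_le_iff) auto
 then have "x <= 2 ^ Suc ?i" by (simp only: powr_realpow zero_less_numeral)
 then show "x <= 2 * 2 ^ ?i" by simp
qed

text \<open>Every term of the bracket is at most a constant times L * ln L, the critical one being L
  * r with r of order ln L; the normalisation is of order L * sqrt L. The oscillation is of order i
  / sqrt (2^i), with 2^i of order L and i of order ln L, and so has the same rate.\<close>

lemma rate_bound:
 fixes \<theta> K1 L c :: real
 assumes \<theta>: "\<theta> > 0" and K1: "1 <= K1" and L: "3 <= L" "1 <= ln L" and c: "0 <= c" and n: "2 <= n" "L = ln (real n)"
  and r: "real r <= 5 * ln L" and i: "\<theta> * L / (12 * (2 * \<theta> + 1)) <= 2 * 2 ^ i" "real i <= 2 * ln L"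
 shows "1 / sqrt (\<theta> / 3 * L ^ 3) * ((2 * ln (real n + 1) * (2 + exp \<theta> + \<theta>\<^sup>2) + \<theta>\<^sup>2 * (1 + L))
       + ((2 + 1 / \<theta>) * (\<theta> * (L + 1)) + (3 * (L + 1 + 1 / \<theta>) * (K1 * real r) + (2 * \<theta> + 2) * (L + 1))))
      + c * (real i + 1) / sqrt 2 ^ i
  <= ((4 * (2 + exp \<theta> + \<theta>\<^sup>2) + \<theta>\<^sup>2 * 2 + ((2 + 1 / \<theta>) * \<theta> * 2 + ((2 + 1 / \<theta>) * K1 * 15 + (2 * \<theta> + 2) * 2))) / sqrt (\<theta> / 3) + 3 * c / sqrt (\<theta> / (24 * (2 * \<theta> + 1)))) * ln L / sqrt L"
proof -
 define l where "l = ln L"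
 define P where "P = L * l"
 define c0 where "c0 = 2 + exp \<theta> + \<theta>\<^sup>2"
 define q where "q = 2 + 1 / \<theta>"
 have l: "1 <= l" using L by (simp add: l_def)
 have c0: "0 <= c0" by (simp add: c0_def add_nonneg_nonneg)
 have q: "0 <= q" using \<theta> by (simp add: q_def)
 have LP: "L <= P" using mult_left_mono[OF l, of L] L by (simp add: P_def)
 have "real n + 1 <= real n * real n"
 proof -
  have "2 * real n <= real n * real n" using n(1) by (intro mult_right_mono) auto
  then show ?thesis using n(1) by linarith
 qed
 then have "ln (real n + 1) <= ln (real n * real n)" using n(1) by (intro ln_mono) auto
 also have "\<dots> = 2 * L" using n by (simp add: ln_mult)
 finally have ln1: "ln (real n + 1) <= 2 * P" using LP by linarith
 have t1: "2 * ln (real n + 1) * c0 <= 4 * c0 * P"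
 proof -
  have "2 * ln (real n + 1) * c0 <= 2 * (2 * P) * c0" using ln1 c0 by (intro mult_right_mono mult_left_mono) auto
  then show ?thesis by (simp add: mult_ac)
 qed
 have L1: "1 + L <= 2 * P" "L + 1 <= 2 * P" using LP L by linarith+
 have t2: "\<theta>\<^sup>2 * (1 + L) <= \<theta>\<^sup>2 * 2 * P" using mult_left_mono[OF L1(1), of "\<theta>\<^sup>2"] by (simp add: mult_ac)
 have t3: "q * (\<theta> * (L + 1)) <= q * \<theta> * 2 * P"
  using mult_left_mono[OF L1(2), of "q * \<theta>"] q \<theta> by (simp add: mult_ac)
 have t5: "(2 * \<theta> + 2) * (L + 1) <= (2 * \<theta> + 2) * 2 * P"
  using mult_left_mono[OF L1(2), of "2 * \<theta> + 2"] \<theta> by (simp only: mult.assoc)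
 have t4: "3 * (L + 1 + 1 / \<theta>) * (K1 * real r) <= q * K1 * 15 * P"
 proof -
  have "1 / \<theta> * 1 <= 1 / \<theta> * L" using L \<theta> by (intro mult_left_mono) auto
  moreover have "q * L = 2 * L + 1 / \<theta> * L" by (simp add: q_def distrib_right)
  ultimately have a: "L + 1 + 1 / \<theta> <= q * L" using L by linarith
  have b: "K1 * real r <= K1 * (5 * l)" using r K1 by (intro mult_left_mono) (auto simp: l_def)
  have "3 * (L + 1 + 1 / \<theta>) * (K1 * real r) <= 3 * (q * L) * (K1 * (5 * l))"
   using a b q L K1 by (intro mult_mono mult_left_mono mult_nonneg_nonneg) auto
  then show ?thesis by (simp add: P_def mult_ac)
 qed
 define T where "T = (2 * ln (real n + 1) * c0 + \<theta>\<^sup>2 * (1 + L)) + (q * (\<theta> * (L + 1)) + (3 * (L + 1 + 1 / \<theta>) * (K1 * real r) + (2 * \<theta> + 2) * (L + 1)))"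
 define A where "A = 4 * c0 + \<theta>\<^sup>2 * 2 + (q * \<theta> * 2 + (q * K1 * 15 + (2 * \<theta> + 2) * 2))"
 have T: "T <= A * P" unfolding T_def A_def distrib_right[of _ _ P] by (intro add_mono t1 t2 t3 t4 t5)
 have s3: "sqrt (\<theta> / 3 * L ^ 3) = sqrt (\<theta> / 3) * (L * sqrt L)"
 proof -
  have "L ^ 3 = L * L * L" by (simp add: power3_eq_cube)
  then have "sqrt (L ^ 3) = L * sqrt L" using L by (simp add: real_sqrt_mult)
  then show ?thesis by (simp only: real_sqrt_mult)
 qed
 have "1 / sqrt (\<theta> / 3 * L ^ 3) * T <= 1 / sqrt (\<theta> / 3 * L ^ 3) * (A * P)"
  using T \<theta> L by (intro mult_left_mono) auto
 also have "\<dots> = A / sqrt (\<theta> / 3) * (l / sqrt L)" unfolding s3 P_def using L by simp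
 finally have m: "1 / sqrt (\<theta> / 3 * L ^ 3) * T <= A / sqrt (\<theta> / 3) * (l / sqrt L)" .
 \<comment> \<open>Half of the constant in the hypothesis on i: rounding the scale down to a power
   of 2 loses at most a factor 2.\<close>
 define \<kappa> where "\<kappa> = \<theta> / (24 * (2 * \<theta> + 1))"
 have \<kappa>: "0 < \<kappa>" using \<theta> by (simp add: \<kappa>_def)
 have "\<kappa> * L <= 2 ^ i"
 proof -
  have "\<kappa> * L = \<theta> * L / (12 * (2 * \<theta> + 1)) / 2" by (simp add: \<kappa>_def)
  moreover have "a <= b" if "a = y / 2" "y <= 2 * b" for a b y :: real using that by linarith
  ultimately show ?thesis using i(1) by blast
 qed
 then have "sqrt (\<kappa> * L) <= sqrt (2 ^ i)" by (rule real_sqrt_le_mono)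
 then have s2: "sqrt \<kappa> * sqrt L <= sqrt 2 ^ i" by (simp only: real_sqrt_mult real_sqrt_power)
 have "c * (real i + 1) / sqrt 2 ^ i <= c * (3 * l) / (sqrt \<kappa> * sqrt L)"
 proof (rule frac_le)
  have "real i + 1 <= 3 * l" using i(2) l by (simp add: l_def)
  then show "c * (real i + 1) <= c * (3 * l)" using c by (rule mult_left_mono)
 qed (use c l \<kappa> L s2 in auto)
 also have "\<dots> = 3 * c / sqrt \<kappa> * (l / sqrt L)" by simp
 finally have o: "c * (real i + 1) / sqrt 2 ^ i <= 3 * c / sqrt \<kappa> * (l / sqrt L)" .
 have "(A / sqrt (\<theta> / 3) + 3 * c / sqrt \<kappa>) * ln L / sqrt L = A / sqrt (\<theta> / 3) * (l / sqrt L) + 3 * c / sqrt \<kappa> * (l / sqrt L)"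
  by (simp only: l_def distrib_right times_divide_eq_right)
   (simp add: add_divide_distrib)
 then show ?thesis using add_mono[OF m o] unfolding A_def T_def c0_def q_def \<kappa>_def by simp
qed

theorem theorem5p1:
  fixes \<theta> :: real
  assumes "\<theta> > 0"
  shows "\<exists>K. \<forall>\<^sub>F n in sequentially.
    \<exists>(M :: real measure) (C :: real \<Rightarrow> nat \<Rightarrow> nat) (W :: real \<Rightarrow> real \<Rightarrow> real).
      prob_space M \<and> esf_cycle_counts M \<theta> n C \<and> std_brownian_motion M W \<and>
      (\<lambda>\<omega>. SUP t\<in>{0..1}. ennreal \<bar>Wn \<theta> n (C \<omega>) t - W \<omega> (t^3)\<bar>) \<in> borel_measurable M \<and>
      (\<integral>\<^sup>+ \<omega>. (SUP t\<in>{0..1}. ennreal \<bar>Wn \<theta> n (C \<omega>) t - W \<omega> (t^3)\<bar>) \<partial>M)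
        \<le> ennreal (K * ln (ln (real n)) / sqrt (ln (real n)))"
proof -
 note \<theta> = assms
 obtain K1 where K1: "1 <= K1" "\<And>v r. strict_mono v ==> 0 <= v 0 ==> 1 <= r ==>
  \<exists>D. D \<in> borel_measurable (S1 (2 * r)) \<and> (\<integral>\<^sup>+\<omega>. ennreal (D \<omega>) \<partial>S1 (2 * r)) <= ennreal (K1 * real r) \<and>
   (\<forall>\<omega>. 0 <= D \<omega> \<and> (\<forall>k\<le>2 ^ r. \<bar>(\<Sum>j<k. real (S1N v (2 * r) \<omega> ! j) - 1) - (\<Sum>j<k. incr v (S1W \<omega>) j)\<bar> <= D \<omega>)
     \<and> (\<forall>j<2 ^ r. real (S1N v (2 * r) \<omega> ! j) <= D \<omega>))"
  by (rule S1_coupling, rule that)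
 define c where "c = 2 * (ln (real 8) + 4) / (1 - 1 / sqrt 2)\<^sup>2"
 have c: "0 <= c" unfolding c_def by (intro divide_nonneg_nonneg mult_nonneg_nonneg add_nonneg_nonneg) auto
 \<comment> \<open>3 exceeds e, so that ln L >= 1; 2 * \<open>\<theta>\<close> + 2 makes theta * (L
   + 1) + 2 at most L * L; the last term makes \<open>Y\<close> >= 1 below.\<close>
 define L0 where "L0 = max 3 (max (2 * \<theta> + 2) (12 * (2 * \<theta> + 1) / \<theta>))"
 have "filterlim (\<lambda>n. ln (real n)) at_top sequentially"
  by (rule filterlim_compose[OF ln_at_top filterlim_real_sequentially])
 then have ev: "\<forall>\<^sub>F n in sequentially. L0 <= ln (real n)" by (simp add: filterlim_at_top)
 show ?thesis
 proof (rule exI, rule eventually_mono[OF ev])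
  fix n :: nat assume n: "L0 <= ln (real n)"
  define L where "L = ln (real n)"
  have L: "3 <= L" "2 * \<theta> + 2 <= L" "12 * (2 * \<theta> + 1) / \<theta> <= L" using n by (simp_all add: L0_def L_def)
  have n2: "2 <= n"
  proof (rule ccontr)
   assume "\<not> 2 <= n"
   then have "n = 0 \<or> n = 1" by auto
   then show False using L(1) by (auto simp: L_def)
  qed
  have "ln (exp 1) <= ln L" using L(1) exp_le by (intro ln_mono) auto
  then have l: "1 <= ln L" by simp
  have "1 <= L * L" using mult_mono[of 1 L 1 L] L(1) by simp
  \<comment> \<open>L * L in place of a multiple of L keeps the bound 5 * ln L on r free of theta;
    2^r still exceeds the number of blocks, which is only O(L).\<close>
  then obtain r where r: "L * L <= 2 ^ r" "real r <= 2 * ln (L * L) + 1" by (rule choose_scale)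
  have "ln (L * L) = 2 * ln L" using L(1) by (simp add: ln_mult)
  then have r5: "real r <= 5 * ln L" using r(2) l by linarith
  have r1: "1 <= r"
  proof (rule ccontr)
   assume "\<not> 1 <= r"
   then have "r = 0" by simp
   then have "L * L <= 1" using r(1) by simp
   moreover have "3 * 3 <= L * L" using L(1) by (intro mult_mono) auto
   ultimately show False by linarith
  qed
  have r2: "\<theta> * (L + 1) + 2 <= 2 ^ r"
  proof -
   have "\<theta> * (L + 1) + 2 <= \<theta> * (2 * L) + 2 * L" using \<theta> L(1) by (intro add_mono mult_left_mono) auto
   also have "\<dots> = (2 * \<theta> + 2) * L" by (simp add: algebra_simps)
   also have "\<dots> <= L * L" using L by (intro mult_right_mono) auto
   finally show ?thesis using r(1) by linarith
  qed
  \<comment> \<open>The reciprocal of the time error in \<open>prefix_time\<close>, rounded down to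
    a power of 2 to obtain the scale of the modulus of continuity.\<close>
  define Y where "Y = \<theta> * L / (12 * (2 * \<theta> + 1))"
  have pos: "0 < 12 * (2 * \<theta> + 1)" using \<theta> by simp
  have "12 * (2 * \<theta> + 1) <= L * \<theta>" using L(3) \<theta> by (simp only: pos_divide_le_eq)
  then have Y1: "1 <= Y" unfolding Y_def using pos by (simp add: pos_le_divide_eq mult.commute)
  have YL: "Y <= L"
  proof -
   have "\<theta> * L <= (12 * (2 * \<theta> + 1)) * L" using \<theta> L(1) by (intro mult_right_mono) auto
   then show ?thesis unfolding Y_def using pos by (simp only: pos_divide_le_eq mult.commute)
  qed
  obtain i where i: "2 ^ i <= Y" "Y <= 2 * 2 ^ i" "real i <= 2 * ln Y" using Y1 by (rule choose_floor_scale)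
  have "ln Y <= ln L" using Y1 YL by (intro ln_mono) auto
  then have i2: "real i <= 2 * ln L" using i(3) by linarith
  have i1: "12 * ((2 * \<theta> + 1) / (\<theta> * L)) <= 1 / 2 ^ i"
  proof -
   have "12 * ((2 * \<theta> + 1) / (\<theta> * L)) = 1 / Y" by (simp add: Y_def)
   also have "\<dots> <= 1 / 2 ^ i" using i(1) Y1 by (intro divide_left_mono) auto
   finally show ?thesis .
  qed
  have L2: "2 <= ln (real n)" using L(1) by (simp add: L_def)
  note coupling_at[OF \<theta> L2 r1 r2[unfolded L_def] i1[unfolded L_def] K1, folded L_def c_def]
  moreover note rate_bound[OF \<theta> K1(1) L(1) l c n2 L_def r5 i(2)[unfolded Y_def] i2, THEN ennreal_leI]
  ultimately show "\<exists>(M :: real measure) (C :: real => nat => nat) (W :: real => real => real).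
   prob_space M \<and> esf_cycle_counts M \<theta> n C \<and> std_brownian_motion M W \<and>
   (\<lambda>\<omega>. SUP t\<in>{0..1}. ennreal \<bar>Wn \<theta> n (C \<omega>) t - W \<omega> (t^3)\<bar>) \<in> borel_measurable M \<and>
   (\<integral>\<^sup>+ \<omega>. (SUP t\<in>{0..1}. ennreal \<bar>Wn \<theta> n (C \<omega>) t - W \<omega> (t^3)\<bar>) \<partial>M)
    <= ennreal (((4 * (2 + exp \<theta> + \<theta>\<^sup>2) + \<theta>\<^sup>2 * 2 + ((2 + 1 / \<theta>) * \<theta> * 2 + ((2 + 1 / \<theta>) * K1 * 15 + (2 * \<theta> + 2) * 2))) / sqrt (\<theta> / 3) + 3 * c / sqrt (\<theta> / (24 * (2 * \<theta> + 1)))) * ln (ln (real n)) / sqrt (ln (real n)))"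
   unfolding L_def[symmetric] by (blast intro: order_trans)
 qed
qed

end
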